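(* Let $\mathcal{A}$ be a hyperarithmetical structure (for a computable language). Then there is a computable structure $\mathcal{A}^*$, with a copy of $\mathcal{A}$ definable in $\mathcal{A}^*$ by computable infinitary formulas, such that: (1) if $SR(\mathcal{A})<\omega_1^{CK}$, then $SR(\mathcal{A}^* )<\omega_1^{CK}$; (2) if $SR(\mathcal{A})=\omega_1^{CK}$, then $SR(\mathcal{A}^* )=\omega_1^{CK}$; (3) if $SR(\mathcal{A})=\omega_1^{CK}+1$, then $SR(\mathcal{A}^* )=\omega_1^{CK}+1$.
   Context: Structures are countable and identified with their atomic diagrams; a structure is hyperarithmetical (resp. computable) if its atomic diagram is. Computable infinitary formulas are formulas of $L_{\omega_1,\omega}$ in which all infinite conjunctions and disjunctions are over c.e. sets (of indices). For a countable structure, define $\overline{a}\equiv^0\overline{b}$ iff the tuples satisfy the same quantifier-free formulas, and for $\beta>0$, $\overline{a}\equiv^\beta\overline{b}$ iff for every $\gamma<\beta$, for every $c$ there is $d$ and for every $d$ there is $c$ with $\overline{a},c\equiv^\gamma\overline{b},d$. $SR(\overline{a})$ is the least $\beta$ such that all $\overline{b}$ with $\overline{a}\equiv^\beta\overline{b}$ are in the automorphism orbit of $\overline{a}$; $SR(\mathcal{A})$ is the least $\alpha$ with $SR(\overline{a})<\alpha$ for all tuples $\overline{a}$. *)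

theory Defs
  imports Complex_Main "HOL-Library.Nat_Bijection" "HOL-Library.Countable_Set_Type"
begin

section \<open>Computability relative to an oracle\<close>

text \<open>Unary partial recursive functions; several arguments are coded by \<^const>\<open>prod_encode\<close>.
  \<open>PPrec p q\<close> is primitive recursion and \<open>PMu p\<close> is unbounded search.\<close>

datatype prog =
    PZero | PSucc | PFst | PSnd | POracle
  | PPair prog prog | PComp prog prog | PPrec prog prog | PMu prog

inductive eval :: "nat set \<Rightarrow> prog \<Rightarrow> nat \<Rightarrow> nat \<Rightarrow> bool" for X :: "nat set" where
  eval_zero: "eval X PZero x 0"
| eval_succ: "eval X PSucc x (Suc x)"
| eval_fst: "eval X PFst x (fst (prod_decode x))"
| eval_snd: "eval X PSnd x (snd (prod_decode x))"
| eval_oracle: "eval X POracle x (if x \<in> X then 1 else 0)"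
| eval_pair: "eval X p x y \<Longrightarrow> eval X q x z \<Longrightarrow> eval X (PPair p q) x (prod_encode (y, z))"
| eval_comp: "eval X q x y \<Longrightarrow> eval X p y z \<Longrightarrow> eval X (PComp p q) x z"
| eval_prec_0: "eval X p a y \<Longrightarrow> eval X (PPrec p q) (prod_encode (a, 0)) y"
| eval_prec_Suc:
    "eval X (PPrec p q) (prod_encode (a, n)) y \<Longrightarrow>
     eval X q (prod_encode (a, prod_encode (n, y))) z \<Longrightarrow>
     eval X (PPrec p q) (prod_encode (a, Suc n)) z"
| eval_mu:
    "eval X p (prod_encode (a, n)) 0 \<Longrightarrow>
     (\<forall>m<n. \<exists>y. 0 < y \<and> eval X p (prod_encode (a, m)) y) \<Longrightarrow>
     eval X (PMu p) a n"

primrec code_prog :: "prog \<Rightarrow> nat" where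
  "code_prog PZero = prod_encode (0, 0)"
| "code_prog PSucc = prod_encode (1, 0)"
| "code_prog PFst = prod_encode (2, 0)"
| "code_prog PSnd = prod_encode (3, 0)"
| "code_prog POracle = prod_encode (4, 0)"
| "code_prog (PPair p q) = prod_encode (5, prod_encode (code_prog p, code_prog q))"
| "code_prog (PComp p q) = prod_encode (6, prod_encode (code_prog p, code_prog q))"
| "code_prog (PPrec p q) = prod_encode (7, prod_encode (code_prog p, code_prog q))"
| "code_prog (PMu p) = prod_encode (8, code_prog p)"

text \<open>\<open>phi X e x y\<close>: the \<open>e\<close>-th partial function computable from \<open>X\<close> has value \<open>y\<close> at \<open>x\<close>.
  Numbers that code no program index the nowhere defined function.\<close>

definition phi :: "nat set \<Rightarrow> nat \<Rightarrow> nat \<Rightarrow> nat \<Rightarrow> bool" where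
  "phi X e x y \<longleftrightarrow> (\<exists>p. code_prog p = e \<and> eval X p x y)"

definition ce_set :: "nat \<Rightarrow> nat set" where
  "ce_set e = {x. \<exists>y. phi {} e x y}"

definition turing_le :: "nat set \<Rightarrow> nat set \<Rightarrow> bool" where
  "turing_le Y X \<longleftrightarrow> (\<exists>p. \<forall>x. eval X p x (if x \<in> Y then 1 else 0))"

definition computable_set :: "nat set \<Rightarrow> bool" where
  "computable_set Y \<longleftrightarrow> turing_le Y {}"

definition computable_fun_on :: "nat set \<Rightarrow> (nat \<Rightarrow> nat) \<Rightarrow> bool" where
  "computable_fun_on D f \<longleftrightarrow> (\<exists>p. \<forall>x\<in>D. eval {} p x (f x))"

definition jump :: "nat set \<Rightarrow> nat set" where
  "jump X = {e. \<exists>y. phi X e e y}"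


section \<open>Hyperarithmetical sets\<close>

text \<open>Kleene's system \<open>O\<close> of ordinal notations with its ordering: \<open>1\<close> denotes \<open>0\<close>, \<open>2 ^ a\<close> the
  successor of what \<open>a\<close> denotes, and \<open>3 * 5 ^ e\<close> the limit of the increasing sequence of notations
  enumerated by the \<open>e\<close>-th partial computable function.\<close>

inductive kleene_O :: "nat \<Rightarrow> bool" and less_O :: "nat \<Rightarrow> nat \<Rightarrow> bool" where
  kleene_O_zero: "kleene_O 1"
| kleene_O_succ: "kleene_O a \<Longrightarrow> kleene_O (2 ^ a)"
| kleene_O_lim:
    "\<forall>n. phi {} e n (f n) \<Longrightarrow> \<forall>n. kleene_O (f n) \<Longrightarrow> \<forall>n. less_O (f n) (f (Suc n)) \<Longrightarrow>
     kleene_O (3 * 5 ^ e)"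
| less_O_succ: "kleene_O a \<Longrightarrow> less_O a (2 ^ a)"
| less_O_lim:
    "\<forall>n. phi {} e n (f n) \<Longrightarrow> \<forall>n. kleene_O (f n) \<Longrightarrow> \<forall>n. less_O (f n) (f (Suc n)) \<Longrightarrow>
     less_O (f n) (3 * 5 ^ e)"
| less_O_trans: "less_O a b \<Longrightarrow> less_O b c \<Longrightarrow> less_O a c"

text \<open>\<open>H_set a X\<close>: \<open>X\<close> is the set \<open>H(a)\<close> of the jump hierarchy along \<open>O\<close>
  (meaningful for \<open>a\<close> in \<open>O\<close>).\<close>

inductive H_set :: "nat \<Rightarrow> nat set \<Rightarrow> bool" where
  H_zero: "H_set 1 {}"
| H_succ: "H_set a X \<Longrightarrow> H_set (2 ^ a) (jump X)"
| H_lim: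
    "\<forall>n. phi {} e n (f n) \<Longrightarrow> \<forall>n. H_set (f n) (Y n) \<Longrightarrow>
     H_set (3 * 5 ^ e) {prod_encode (x, n) | x n. x \<in> Y n}"

definition hyperarithmetical_set :: "nat set \<Rightarrow> bool" where
  "hyperarithmetical_set Y \<longleftrightarrow> (\<exists>a X. kleene_O a \<and> H_set a X \<and> turing_le Y X)"


section \<open>Countable ordinals\<close>

text \<open>Isomorphism types of well-orders whose field is a set of natural numbers.  Well-orders in
  the library are reflexive relations, and \<open>ordIso\<close> relates well-orders only.\<close>

quotient_type cord = "nat rel" / partial: "\<lambda>r s. (r, s) \<in> ordIso"
proof (rule part_equivpI)
  have "({}::nat rel, {}::nat rel) \<in> ordIso"
    by (intro ordIso_reflexive) (simp add: well_order_on_def linear_order_on_def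
      partial_order_on_def preorder_on_def refl_on_def trans_def antisym_def total_on_def)
  then show "\<exists>r::nat rel. (r, r) \<in> ordIso" by blast
  show "symp (\<lambda>r s::nat rel. (r, s) \<in> ordIso)"
    by (auto intro: sympI ordIso_symmetric)
  show "transp (\<lambda>r s::nat rel. (r, s) \<in> ordIso)"
    by (auto intro: transpI ordIso_transitive)
qed

lemma ordIso_refl_Well_order: "(r, r) \<in> ordIso \<Longrightarrow> Well_order r"
  unfolding ordIso_def by blast

lemma cord_abs_exhaust: "\<exists>r. (r, r) \<in> ordIso \<and> \<alpha> = abs_cord r"
  using Quotient3_rep_reflp[OF Quotient3_cord, of \<alpha>] Quotient3_abs_rep[OF Quotient3_cord, of \<alpha>]
  by (intro exI[of _ "rep_cord \<alpha>"]) simp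

instantiation cord :: linorder
begin

lift_definition less_eq_cord :: "cord \<Rightarrow> cord \<Rightarrow> bool" is "\<lambda>r s. (r, s) \<in> ordLeq"
  by (meson ordIso_ordLeq_trans ordIso_symmetric ordLeq_ordIso_trans)

lift_definition less_cord :: "cord \<Rightarrow> cord \<Rightarrow> bool" is "\<lambda>r s. (r, s) \<in> ordLess"
  by (meson ordIso_ordLess_trans ordIso_symmetric ordLess_ordIso_trans)

instance
proof
  fix a b c :: cord
  show "a < b \<longleftrightarrow> a \<le> b \<and> \<not> b \<le> a"
  proof transfer
    fix r s :: "nat rel"
    assume "(r, r) \<in> ordIso" "(s, s) \<in> ordIso"
    then have wo: "Well_order r" "Well_order s" by (blast dest: ordIso_refl_Well_order)+
    show "(r, s) \<in> ordLess \<longleftrightarrow> (r, s) \<in> ordLeq \<and> (s, r) \<notin> ordLeq"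
      using not_ordLeq_iff_ordLess[OF wo] ordLess_imp_ordLeq by blast
  qed
  show "a \<le> a"
    by transfer (rule ordIso_imp_ordLeq)
  show "a \<le> b \<Longrightarrow> b \<le> c \<Longrightarrow> a \<le> c"
    by transfer (rule ordLeq_transitive)
  show "a \<le> b \<Longrightarrow> b \<le> a \<Longrightarrow> a = b"
    by transfer (blast intro: iffD2[OF ordIso_iff_ordLeq])
  show "a \<le> b \<or> b \<le> a"
    by transfer (rule ordLeq_total[OF ordIso_refl_Well_order ordIso_refl_Well_order])
qed

end

instance cord :: wellorder
proof
  fix P :: "cord \<Rightarrow> bool" and a :: cord
  assume step: "\<And>x. (\<And>y. y < x \<Longrightarrow> P y) \<Longrightarrow> P x"
  have less: "(r, s) \<in> ordLess"
    if "(r, r) \<in> ordIso" "(s, s) \<in> ordIso" "abs_cord r < abs_cord s" for r s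
    using that by (simp add: less_cord.abs_eq)
  have "(r, r) \<in> ordIso \<Longrightarrow> P (abs_cord r)" for r
  proof (induction r rule: wf_induct_rule[OF wf_ordLess])
    case (1 s)
    show ?case
    proof (rule step)
      fix y assume y: "y < abs_cord s"
      obtain r where r: "(r, r) \<in> ordIso" "y = abs_cord r"
        using cord_abs_exhaust by blast
      then show "P y" using 1 less y by blast
    qed
  qed
  moreover obtain r where "(r, r) \<in> ordIso" "a = abs_cord r"
    using cord_abs_exhaust by blast
  ultimately show "P a" by simp
qed

instantiation cord :: zero
begin

lift_definition zero_cord :: cord is "{}"
  by (intro ordIso_reflexive) (simp add: well_order_on_def linear_order_on_def
    partial_order_on_def preorder_on_def refl_on_def trans_def antisym_def total_on_def)

instance ..

end

definition succ_cord :: "cord \<Rightarrow> cord" where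
  "succ_cord \<alpha> = (LEAST \<beta>. \<alpha> < \<beta>)"

definition computable_ordinal :: "cord \<Rightarrow> bool" where
  "computable_ordinal \<alpha> \<longleftrightarrow>
     (\<exists>r :: nat rel. Well_order r \<and> computable_set (prod_encode ` r) \<and> \<alpha> = abs_cord r)"

definition omega1CK :: cord where
  "omega1CK = (LEAST \<alpha>. \<not> computable_ordinal \<alpha>)"


section \<open>Languages and structures\<close>

record lang =
  rels :: "nat set"
  rel_arity :: "nat \<Rightarrow> nat"
  funs :: "nat set"
  fun_arity :: "nat \<Rightarrow> nat"

definition computable_language :: "lang \<Rightarrow> bool" where
  "computable_language L \<longleftrightarrow>
     computable_set (rels L) \<and> computable_fun_on (rels L) (rel_arity L) \<and>
     computable_set (funs L) \<and> computable_fun_on (funs L) (fun_arity L)"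

record struct =
  univ :: "nat set"
  rel_in :: "nat \<Rightarrow> nat list \<Rightarrow> bool"
  fun_in :: "nat \<Rightarrow> nat list \<Rightarrow> nat"

definition tuples :: "struct \<Rightarrow> nat \<Rightarrow> nat list set" where
  "tuples A n = {xs. length xs = n \<and> set xs \<subseteq> univ A}"

definition is_structure :: "lang \<Rightarrow> struct \<Rightarrow> bool" where
  "is_structure L A \<longleftrightarrow> univ A \<noteq> {} \<and>
     (\<forall>f\<in>funs L. \<forall>xs\<in>tuples A (fun_arity L f). fun_in A f xs \<in> univ A)"

definition isomorphism :: "lang \<Rightarrow> struct \<Rightarrow> struct \<Rightarrow> (nat \<Rightarrow> nat) \<Rightarrow> bool" where
  "isomorphism L A B h \<longleftrightarrow> bij_betw h (univ A) (univ B) \<and>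
     (\<forall>r\<in>rels L. \<forall>xs\<in>tuples A (rel_arity L r). rel_in A r xs \<longleftrightarrow> rel_in B r (map h xs)) \<and>
     (\<forall>f\<in>funs L. \<forall>xs\<in>tuples A (fun_arity L f). h (fun_in A f xs) = fun_in B f (map h xs))"


section \<open>Infinitary formulas\<close>

datatype trm = Var nat | Fun nat "trm list"

datatype atom = Eq trm trm | Rel nat "trm list"

datatype fm =
    Atom atom
  | Neg fm
  | Ex nat fm
  | All nat fm
  | Conj "fm cset"
  | Disj "fm cset"

primrec trm_val :: "struct \<Rightarrow> (nat \<Rightarrow> nat) \<Rightarrow> trm \<Rightarrow> nat" where
  "trm_val A v (Var x) = v x"
| "trm_val A v (Fun f ts) = fun_in A f (map (trm_val A v) ts)"

primrec sat_atom :: "struct \<Rightarrow> atom \<Rightarrow> (nat \<Rightarrow> nat) \<Rightarrow> bool" where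
  "sat_atom A (Eq s t) v \<longleftrightarrow> trm_val A v s = trm_val A v t"
| "sat_atom A (Rel r ts) v \<longleftrightarrow> rel_in A r (map (trm_val A v) ts)"

primrec sat :: "struct \<Rightarrow> fm \<Rightarrow> (nat \<Rightarrow> nat) \<Rightarrow> bool" where
  "sat A (Atom a) = sat_atom A a"
| "sat A (Neg \<phi>) = (\<lambda>v. \<not> sat A \<phi> v)"
| "sat A (Ex x \<phi>) = (\<lambda>v. \<exists>c\<in>univ A. sat A \<phi> (v(x := c)))"
| "sat A (All x \<phi>) = (\<lambda>v. \<forall>c\<in>univ A. sat A \<phi> (v(x := c)))"
| "sat A (Conj S) = (\<lambda>v. \<forall>P\<in>rcset (cimage (sat A) S). P v)"
| "sat A (Disj S) = (\<lambda>v. \<exists>P\<in>rcset (cimage (sat A) S). P v)"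

primrec trm_vars :: "trm \<Rightarrow> nat set" where
  "trm_vars (Var x) = {x}"
| "trm_vars (Fun f ts) = \<Union> (set (map trm_vars ts))"

primrec atom_vars :: "atom \<Rightarrow> nat set" where
  "atom_vars (Eq s t) = trm_vars s \<union> trm_vars t"
| "atom_vars (Rel r ts) = \<Union> (set (map trm_vars ts))"

primrec free_vars :: "fm \<Rightarrow> nat set" where
  "free_vars (Atom a) = atom_vars a"
| "free_vars (Neg \<phi>) = free_vars \<phi>"
| "free_vars (Ex x \<phi>) = free_vars \<phi> - {x}"
| "free_vars (All x \<phi>) = free_vars \<phi> - {x}"
| "free_vars (Conj S) = \<Union> (rcset (cimage free_vars S))"
| "free_vars (Disj S) = \<Union> (rcset (cimage free_vars S))"

inductive L_trm :: "lang \<Rightarrow> trm \<Rightarrow> bool" for L :: lang where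
  L_trm_Var: "L_trm L (Var x)"
| L_trm_Fun: "f \<in> funs L \<Longrightarrow> length ts = fun_arity L f \<Longrightarrow> \<forall>t\<in>set ts. L_trm L t \<Longrightarrow> L_trm L (Fun f ts)"

primrec L_atom :: "lang \<Rightarrow> atom \<Rightarrow> bool" where
  "L_atom L (Eq s t) \<longleftrightarrow> L_trm L s \<and> L_trm L t"
| "L_atom L (Rel r ts) \<longleftrightarrow>
     r \<in> rels L \<and> length ts = rel_arity L r \<and> (\<forall>t\<in>set ts. L_trm L t)"

inductive L_fm :: "lang \<Rightarrow> fm \<Rightarrow> bool" for L :: lang where
  L_fm_Atom: "L_atom L a \<Longrightarrow> L_fm L (Atom a)"
| L_fm_Neg: "L_fm L \<phi> \<Longrightarrow> L_fm L (Neg \<phi>)"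
| L_fm_Ex: "L_fm L \<phi> \<Longrightarrow> L_fm L (Ex x \<phi>)"
| L_fm_All: "L_fm L \<phi> \<Longrightarrow> L_fm L (All x \<phi>)"
| L_fm_Conj: "\<forall>\<phi>\<in>rcset S. L_fm L \<phi> \<Longrightarrow> L_fm L (Conj S)"
| L_fm_Disj: "\<forall>\<phi>\<in>rcset S. L_fm L \<phi> \<Longrightarrow> L_fm L (Disj S)"

text \<open>Quantifier-free formulas are finitary.\<close>

inductive quantifier_free :: "fm \<Rightarrow> bool" where
  qf_Atom: "quantifier_free (Atom a)"
| qf_Neg: "quantifier_free \<phi> \<Longrightarrow> quantifier_free (Neg \<phi>)"
| qf_Conj: "finite (rcset S) \<Longrightarrow> \<forall>\<phi>\<in>rcset S. quantifier_free \<phi> \<Longrightarrow> quantifier_free (Conj S)"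
| qf_Disj: "finite (rcset S) \<Longrightarrow> \<forall>\<phi>\<in>rcset S. quantifier_free \<phi> \<Longrightarrow> quantifier_free (Disj S)"

text \<open>The formula \<open>\<phi>(x\<^sub>0, \<dots>, x\<^sub>n\<^sub>-\<^sub>1)\<close> at the tuple \<open>as\<close> of length \<open>n\<close>.  The value \<open>0\<close> for the other
  variables is immaterial, since they are never free in the formulas considered.\<close>

definition sat_at :: "struct \<Rightarrow> fm \<Rightarrow> nat list \<Rightarrow> bool" where
  "sat_at A \<phi> as \<longleftrightarrow> sat A \<phi> (\<lambda>i. if i < length as then as ! i else 0)"


section \<open>Atomic diagrams\<close>

primrec code_trm :: "trm \<Rightarrow> nat" where
  "code_trm (Var x) = prod_encode (0, x)"
| "code_trm (Fun f ts) = prod_encode (1, prod_encode (f, list_encode (map code_trm ts)))"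

primrec code_atom :: "atom \<Rightarrow> nat" where
  "code_atom (Eq s t) = prod_encode (0, prod_encode (code_trm s, code_trm t))"
| "code_atom (Rel r ts) = prod_encode (1, prod_encode (r, list_encode (map code_trm ts)))"

text \<open>The set of codes of the atomic sentences and negations of atomic sentences, in the language
  with names for the elements, that are true in the structure.  The name of the element \<open>a\<close>
  is \<open>Var a\<close>, hence the valuation \<open>\<lambda>a. a\<close>.\<close>

definition atomic_diagram :: "lang \<Rightarrow> struct \<Rightarrow> nat set" where
  "atomic_diagram L A =
     {prod_encode (1, code_atom a) | a. L_atom L a \<and> atom_vars a \<subseteq> univ A \<and> sat_atom A a (\<lambda>a. a)} \<union>
     {prod_encode (0, code_atom a) | a. L_atom L a \<and> atom_vars a \<subseteq> univ A \<and> \<not> sat_atom A a (\<lambda>a. a)}"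

definition computable_structure :: "lang \<Rightarrow> struct \<Rightarrow> bool" where
  "computable_structure L A \<longleftrightarrow> is_structure L A \<and> computable_set (atomic_diagram L A)"

definition hyperarithmetical_structure :: "lang \<Rightarrow> struct \<Rightarrow> bool" where
  "hyperarithmetical_structure L A \<longleftrightarrow>
     is_structure L A \<and> hyperarithmetical_set (atomic_diagram L A)"


section \<open>Computable infinitary formulas and definability\<close>

text \<open>\<open>fm_index i \<phi>\<close>: \<open>i\<close> is an index of the computable infinitary formula \<open>\<phi>\<close>.  Conjunctions and
  disjunctions are taken over a c.e. set, all of whose members are indices.\<close>

inductive fm_index :: "nat \<Rightarrow> fm \<Rightarrow> bool" where
  fm_index_Atom: "fm_index (prod_encode (0, code_atom a)) (Atom a)"
| fm_index_Neg: "fm_index i \<phi> \<Longrightarrow> fm_index (prod_encode (1, i)) (Neg \<phi>)"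
| fm_index_Ex: "fm_index i \<phi> \<Longrightarrow> fm_index (prod_encode (2, prod_encode (x, i))) (Ex x \<phi>)"
| fm_index_All: "fm_index i \<phi> \<Longrightarrow> fm_index (prod_encode (3, prod_encode (x, i))) (All x \<phi>)"
| fm_index_Conj:
    "\<forall>i\<in>ce_set e. fm_index i (F i) \<Longrightarrow>
     fm_index (prod_encode (4, e)) (Conj (acset (F ` ce_set e)))"
| fm_index_Disj:
    "\<forall>i\<in>ce_set e. fm_index i (F i) \<Longrightarrow>
     fm_index (prod_encode (5, e)) (Disj (acset (F ` ce_set e)))"

definition computable_infinitary :: "lang \<Rightarrow> fm \<Rightarrow> bool" where
  "computable_infinitary L \<phi> \<longleftrightarrow> L_fm L \<phi> \<and> (\<exists>i. fm_index i \<phi>)"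

definition ci_definable :: "lang \<Rightarrow> struct \<Rightarrow> nat \<Rightarrow> nat list set \<Rightarrow> bool" where
  "ci_definable L A n R \<longleftrightarrow>
     (\<exists>\<phi>. computable_infinitary L \<phi> \<and> free_vars \<phi> \<subseteq> {..<n} \<and>
          R = {xs \<in> tuples A n. sat_at A \<phi> xs})"

text \<open>The universe of the copy, its basic relations and the graphs of its basic functions are all
  definable, without parameters, in the structure \<open>A'\<close>.\<close>

definition ci_definable_copy :: "lang \<Rightarrow> struct \<Rightarrow> lang \<Rightarrow> struct \<Rightarrow> bool" where
  "ci_definable_copy L A L' A' \<longleftrightarrow>
     (\<exists>B h. is_structure L B \<and> isomorphism L A B h \<and> univ B \<subseteq> univ A' \<and>
        ci_definable L' A' 1 (tuples B 1) \<and>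
        (\<forall>r\<in>rels L. ci_definable L' A' (rel_arity L r)
           {xs \<in> tuples B (rel_arity L r). rel_in B r xs}) \<and>
        (\<forall>f\<in>funs L. ci_definable L' A' (Suc (fun_arity L f))
           {xs @ [fun_in B f xs] | xs. xs \<in> tuples B (fun_arity L f)}))"


section \<open>Scott rank\<close>

function back_forth :: "lang \<Rightarrow> struct \<Rightarrow> cord \<Rightarrow> nat list \<Rightarrow> nat list \<Rightarrow> bool" where
  "back_forth L A \<beta> as bs \<longleftrightarrow>
     (if \<beta> = 0 then
        (\<forall>\<phi>. L_fm L \<phi> \<and> quantifier_free \<phi> \<and> free_vars \<phi> \<subseteq> {..<length as} \<longrightarrow>
             (sat_at A \<phi> as \<longleftrightarrow> sat_at A \<phi> bs))
      else
        (\<forall>\<gamma>. \<gamma> < \<beta> \<longrightarrow>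
           (\<forall>c\<in>univ A. \<exists>d\<in>univ A. back_forth L A \<gamma> (as @ [c]) (bs @ [d])) \<and>
           (\<forall>d\<in>univ A. \<exists>c\<in>univ A. back_forth L A \<gamma> (as @ [c]) (bs @ [d]))))"
  by pat_completeness auto
termination
  by (relation "inv_image {(\<gamma>, \<beta>). \<gamma> < \<beta>} (\<lambda>(L, A, \<beta>, as, bs). \<beta>)")
    (auto intro!: wf_inv_image simp: wf)

declare back_forth.simps [simp del]

definition same_orbit :: "lang \<Rightarrow> struct \<Rightarrow> nat list \<Rightarrow> nat list \<Rightarrow> bool" where
  "same_orbit L A as bs \<longleftrightarrow> (\<exists>h. isomorphism L A A h \<and> map h as = bs)"

definition SR_tuple :: "lang \<Rightarrow> struct \<Rightarrow> nat list \<Rightarrow> cord" where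
  "SR_tuple L A as =
     (LEAST \<beta>. \<forall>bs\<in>tuples A (length as). back_forth L A \<beta> as bs \<longrightarrow> same_orbit L A as bs)"

definition SR :: "lang \<Rightarrow> struct \<Rightarrow> cord" where
  "SR L A = (LEAST \<alpha>. \<forall>n. \<forall>as\<in>tuples A n. SR_tuple L A as < \<alpha>)"

end

theory Submission
  imports Defs "HOL-Library.Product_Lexorder"
begin

text \<open>To every atomic formula \<open>\<alpha>\<close> and every tuple \<open>xs\<close> of (names of) elements of \<open>A\<close> a computable
  well-founded tree \<open>T\<^sub>\<alpha>\<^sub>,\<^sub>x\<^sub>s\<close> is attached, whose rank is \<open>\<beta> + 1\<close> if \<open>xs\<close> satisfies \<open>\<alpha>\<close> and \<open>\<beta>\<close>
  otherwise, for one computable ordinal \<open>\<beta>\<close>.  The trees are fat: every rank below the rank of a node is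
  the rank of infinitely many children, so that finite partial maps preserving ranks extend, and an
  isomorphism between parts of \<open>A\<close> extends to the trees above them.  Hence orbits of \<open>A\<^sup>*\<close> are
  determined by those of \<open>A\<close> and by ranks, and the back-and-forth relations of the two structures can
  be compared up to a shift of the form \<open>\<beta>' + \<omega> \<cdot> \<gamma>\<close> with \<open>\<beta>'\<close> computable.  This shift preserves
  \<open>\<omega>\<^sub>1\<^sup>C\<^sup>K\<close>, which gives the three statements on Scott ranks.  Since "the rank of \<open>y\<close> is at
  least \<open>\<gamma>\<close>" is a computable infinitary formula for every computable \<open>\<gamma>\<close>, satisfaction of \<open>\<alpha>\<close> in \<open>A\<close> is definable in \<open>A\<^sup>*\<close>.

  For the trees, the truth of the facts of \<open>A\<close> is described by a computable infinitary conjunctive normal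
  form: it axiomatises evaluation of programs, the jump hierarchy up to the given notation and the
  reduction of the diagram to it.  All its models agree on the facts of \<open>A\<close>, although they may differ
  elsewhere.  A fact \<open>n\<close> is true iff the tree of partial solutions in which \<open>n\<close> holds has an infinite path.
  The joint tree of pairs of partial solutions that disagree on some fact is well-founded; its
  Kleene-Brouwer order \<open>W\<close> caps the solution trees and makes them well-founded of the required ranks.\<close>

section \<open>Countable ordinals\<close>

text \<open>A plain tree of attempts to verify a fact is ill-founded if the fact is true and has
  some rank below \<open>\<omega>\<^sub>1\<^sup>C\<^sup>K\<close> otherwise, and no bound on these
  ranks is visible; telling such trees apart could take back-and-forth levels arbitrarily high below
  \<open>\<omega>\<^sub>1\<^sup>C\<^sup>K\<close>, and Scott ranks would get out of control. Hence
  one computable ordinal has to bound the ranks for all false facts at once. It exists since the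
  clauses settle every fact both ways: an attempt to verify a false fact, paired with the choices of
  a genuine model, is a node of the joint tree. This makes the boundedness principle for
  well-founded computable trees explicit. Cutting the trees off at that bound leaves two possible
  root ranks, and one computable back-and-forth level tells them apart. The factor
  \<open>\<omega>\<close> in the shift is there because a tree node mentions a tuple of any finite
  length, so that one move in the new structure can cost any finite number of moves in
  \<open>A\<close>. The elements of \<open>A\<close> are renumbered by an initial segment of the
  natural numbers because the universe of \<open>A\<close> need not be decidable.\<close>

definition seg :: "nat rel \<Rightarrow> nat \<Rightarrow> cord" where
  "seg r x = abs_cord (Restr r (underS r x))"

lemma ordIso_self_iff: "(r, r) \<in> ordIso \<longleftrightarrow> Well_order r"
  using ordIso_reflexive ordIso_refl_Well_order by blast

lemma cord_obtain:
  obtains r :: "nat rel" where "Well_order r" "\<alpha> = abs_cord r"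
  using cord_abs_exhaust ordIso_self_iff by metis

lemma abs_cord_less_iff:
  "Well_order r \<Longrightarrow> Well_order s \<Longrightarrow> abs_cord r < abs_cord s \<longleftrightarrow> (r, s) \<in> ordLess"
  by (simp add: less_cord.abs_eq ordIso_self_iff)

lemma abs_cord_eq: "(r, s) \<in> ordIso \<Longrightarrow> abs_cord r = abs_cord s"
  using Quotient3_rel[OF Quotient3_cord, of r s] by simp

lemma Well_order_seg: "Well_order r \<Longrightarrow> Well_order (Restr r (underS r x))"
  by (rule Well_order_Restr)

lemma seg_less: "Well_order r \<Longrightarrow> x \<in> Field r \<Longrightarrow> seg r x < abs_cord r"
  unfolding seg_def by (auto simp: abs_cord_less_iff Well_order_seg intro: underS_Restr_ordLess)

lemma seg_surj:
  assumes "Well_order r" "\<alpha> < abs_cord r"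
  obtains x where "x \<in> Field r" "\<alpha> = seg r x"
proof -
  obtain s where s: "Well_order s" "\<alpha> = abs_cord s" by (rule cord_obtain)
  then have "(s, r) \<in> ordLess" using assms by (simp add: abs_cord_less_iff)
  then obtain a where "a \<in> Field r" "(s, Restr r (underS r a)) \<in> ordIso"
    using ordLess_iff_ordIso_Restr[OF assms(1) s(1)] by blast
  then show thesis using that s(2) abs_cord_eq unfolding seg_def by blast
qed

lemma seg_strict:
  assumes wo: "Well_order r" and xy: "(x, y) \<in> r" "x \<noteq> y"
  shows "seg r x < seg r y"
proof -
  let ?s = "Restr r (underS r y)"
  have tr: "trans r" "antisym r"
    using wo by (auto simp: well_order_on_def linear_order_on_def partial_order_on_def preorder_on_def)
  have xu: "x \<in> underS r y" using xy by (simp add: underS_def)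
  have sub: "underS r x \<subseteq> underS r y"
    using tr xy unfolding underS_def by (auto dest: transD antisymD)
  have "underS ?s x = underS r x"
    using sub xu unfolding underS_def by blast
  then have eq: "Restr ?s (underS ?s x) = Restr r (underS r x)" using sub by auto
  have "x \<in> Field ?s"
  proof -
    have "(x, x) \<in> r" using wo xy by (auto simp: well_order_on_def linear_order_on_def
      partial_order_on_def preorder_on_def refl_on_def Field_def)
    then show ?thesis using xu by (auto simp: Field_def)
  qed
  then have "seg ?s x < abs_cord ?s" by (intro seg_less Well_order_seg wo)
  then show ?thesis using eq by (simp add: seg_def)
qed

lemma Well_order_total:
  "Well_order r \<Longrightarrow> x \<in> Field r \<Longrightarrow> y \<in> Field r \<Longrightarrow> (x, y) \<in> r \<or> (y, x) \<in> r"
  unfolding well_order_on_def linear_order_on_def total_on_def partial_order_on_def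
    preorder_on_def refl_on_def by metis

lemma seg_le_iff:
  assumes "Well_order r" "x \<in> Field r" "y \<in> Field r"
  shows "seg r x \<le> seg r y \<longleftrightarrow> (x, y) \<in> r"
  using Well_order_total[OF assms] seg_strict[OF assms(1), of x y] seg_strict[OF assms(1), of y x]
  by (metis leD less_imp_le order_refl)

lemma seg_less_iff:
  assumes "Well_order r" "x \<in> Field r" "y \<in> Field r"
  shows "seg r x < seg r y \<longleftrightarrow> (x, y) \<in> r \<and> x \<noteq> y"
  by (metis assms seg_le_iff linorder_not_less order_less_irrefl seg_strict less_imp_le)

lemma inj_on_seg: "Well_order r \<Longrightarrow> inj_on (seg r) (Field r)"
  by (rule inj_onI) (metis order_less_irrefl order_refl seg_le_iff seg_strict)

text \<open>By induction \<open>seg r x\<close> is a strict bound of the values of \<open>t\<close>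
  below \<open>x\<close>, and slowness says that \<open>t x\<close> is at most every such bound.
  This bounds a function by positions in an order; the next two lemmas give the opposite
  bound.\<close>

lemma slow_le_seg:
  fixes t :: "nat \<Rightarrow> cord"
  assumes wo: "Well_order r"
    and slow: "\<And>x c. x \<in> Field r \<Longrightarrow> (\<And>y. (y, x) \<in> r \<Longrightarrow> y \<noteq> x \<Longrightarrow> t y < c) \<Longrightarrow> t x \<le> c"
    and x: "x \<in> Field r"
  shows "t x \<le> seg r x"
proof -
  have "x \<in> Field r \<longrightarrow> seg r x = \<alpha> \<longrightarrow> t x \<le> seg r x" for \<alpha>
  proof (induction \<alpha> arbitrary: x rule: less_induct)
    case (less \<alpha>)
    show ?case
    proof (intro impI, rule slow)
      fix y assume "x \<in> Field r" "seg r x = \<alpha>" and y: "(y, x) \<in> r" "y \<noteq> x"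
      then have "seg r y < seg r x" "y \<in> Field r" using seg_strict[OF wo] by (auto simp: Field_def)
      then show "t y < seg r x" using less \<open>seg r x = \<alpha>\<close> by fastforce
    qed
  qed
  then show ?thesis using x by blast
qed

text \<open>At a least counterexample \<open>t x\<close> is itself \<open>seg r y\<close> for some
  \<open>y\<close> below \<open>x\<close>, and then
  \<open>seg r y \<le> t y < t x = seg r y\<close>.\<close>

lemma strict_mono_seg_le:
  fixes t :: "nat \<Rightarrow> cord"
  assumes wo: "Well_order r" and mono: "\<And>x y. (x, y) \<in> r \<Longrightarrow> x \<noteq> y \<Longrightarrow> t x < t y"
    and x: "x \<in> Field r"
  shows "seg r x \<le> t x"
proof -
  have "x \<in> Field r \<longrightarrow> seg r x = \<alpha> \<longrightarrow> \<alpha> \<le> t x" for \<alpha>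
  proof (induction \<alpha> arbitrary: x rule: less_induct)
    case (less \<alpha>)
    show ?case
    proof (intro impI leI notI)
      assume x: "x \<in> Field r" "seg r x = \<alpha>" "t x < \<alpha>"
      then obtain y where y: "y \<in> Field r" "t x = seg r y"
        using seg_surj[OF wo] seg_less[OF wo] by (metis order_less_trans)
      then have "(y, x) \<in> r" "y \<noteq> x" using x seg_less_iff[OF wo] by auto
      then show False using less[of "seg r y" y] y x mono by fastforce
    qed
  qed
  then show ?thesis using x by blast
qed

text \<open>Order types are compared through any strictly monotone ordinal-valued map, so that no
  order embedding has to be built.\<close>

lemma strict_mono_abs_cord_le:
  fixes t :: "nat \<Rightarrow> cord"
  assumes wo: "Well_order r" and mono: "\<And>x y. (x, y) \<in> r \<Longrightarrow> x \<noteq> y \<Longrightarrow> t x < t y"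
    and bd: "\<And>x. x \<in> Field r \<Longrightarrow> t x < c"
  shows "abs_cord r \<le> c"
proof (rule leI, rule notI)
  assume "c < abs_cord r"
  then obtain x where "x \<in> Field r" "c = seg r x" using seg_surj[OF wo] by blast
  then show False using strict_mono_seg_le[of r t x, OF wo mono] bd by fastforce
qed

text \<open>The key may take values in any well-ordered type, in particular in lexicographic
  products; this is how sums and products of orders are realised on natural numbers.\<close>

lemma Well_order_key:
  fixes m :: "nat \<Rightarrow> 'a::wellorder"
  assumes inj: "inj_on m F" and r: "r = {(x, y). x \<in> F \<and> y \<in> F \<and> m x \<le> m y}"
  shows "Well_order r" and "Field r = F"
proof -
  show F: "Field r = F" unfolding r Field_def by auto
  have "r - Id \<subseteq> inv_image {(x, y). x < y} m"
    using inj unfolding r by (auto simp: inj_on_def le_less)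
  then have "wf (r - Id)" using wf wf_inv_image wf_subset by blast
  then show "Well_order r"
    unfolding well_order_on_def linear_order_on_def partial_order_on_def preorder_on_def F
    using inj unfolding r refl_on_def trans_def antisym_def total_on_def inj_on_def by fastforce
qed

text \<open>Countably many well-orders are placed one after the other in a lexicographic order on
  coded pairs, and a new top element makes the bound strict.\<close>

lemma countable_cords_bounded:
  assumes "countable (X :: cord set)"
  obtains c where "\<And>x. x \<in> X \<Longrightarrow> x < c"
proof (cases "X = {}")
  case False
  then obtain f :: "nat \<Rightarrow> cord" where f: "X = range f"
    using assms range_from_nat_into by metis
  define rr where "rr n = (SOME r. Well_order r \<and> f n = abs_cord r)" for n
  have rr: "Well_order (rr n) \<and> f n = abs_cord (rr n)" for n
    unfolding rr_def by (rule someI_ex) (metis cord_obtain)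
  define F where "F = {prod_encode (n, x) | n x. x \<in> Field (rr n)}"
  define m where "m z = (fst (prod_decode z), seg (rr (fst (prod_decode z))) (snd (prod_decode z)))" for z
  have inj: "inj_on m F"
    unfolding inj_on_def F_def m_def using inj_on_seg[OF conjunct1[OF rr]] by (auto simp: inj_on_def)
  define s where "s = {(x, y). x \<in> F \<and> y \<in> F \<and> m x \<le> m y}"
  note wo = Well_order_key[OF inj s_def]
  have le: "f n \<le> abs_cord s" for n
  proof -
    have "abs_cord (rr n) \<le> abs_cord s"
    proof (rule strict_mono_abs_cord_le[of _ "\<lambda>x. seg s (prod_encode (n, x))"])
      show "Well_order (rr n)" using rr by blast
      show "seg s (prod_encode (n, x)) < seg s (prod_encode (n, y))"
        if "(x, y) \<in> rr n" "x \<noteq> y" for x y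
      proof (rule seg_strict[OF wo(1)])
        show "(prod_encode (n, x), prod_encode (n, y)) \<in> s"
          using that seg_strict[OF conjunct1[OF rr] that]
          unfolding s_def F_def m_def by (auto simp: Field_def)
      qed (use that in simp)
      show "seg s (prod_encode (n, x)) < abs_cord s" if "x \<in> Field (rr n)" for x
        using that by (intro seg_less wo) (auto simp: wo F_def)
    qed
    then show ?thesis using rr by simp
  qed
  have "\<exists>c. abs_cord s < c"
  proof -
    \<comment> \<open>The number 0 is the new greatest element and \<open>Suc x\<close> the copy of
      \<open>x\<close>.\<close>
    let ?F = "insert 0 (Suc ` Field s)"
    let ?m = "\<lambda>x. case x of 0 \<Rightarrow> (1::nat, 0) | Suc x \<Rightarrow> (0, seg s x)"
    let ?t = "{(x, y). x \<in> ?F \<and> y \<in> ?F \<and> ?m x \<le> ?m y}"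
    have "inj_on ?m ?F" using inj_on_seg[OF wo(1)] by (auto simp: inj_on_def split: nat.splits)
    note wot = Well_order_key[OF this refl]
    have "abs_cord s \<le> seg ?t 0"
    proof (rule strict_mono_abs_cord_le[OF wo(1), of "\<lambda>x. seg ?t (Suc x)"])
      show "seg ?t (Suc x) < seg ?t (Suc y)" if "(x, y) \<in> s" "x \<noteq> y" for x y
        using that seg_strict[OF wo(1) that] by (intro seg_strict wot) (auto simp: Field_def)
      show "seg ?t (Suc x) < seg ?t 0" if "x \<in> Field s" for x
        using that by (intro seg_strict wot) auto
    qed
    also have "\<dots> < abs_cord ?t" using wot by (intro seg_less) auto
    finally show ?thesis by blast
  qed
  then obtain c where "abs_cord s < c" by blast
  then show thesis using le f that by (metis imageE le_less_trans)
qed (use that in blast)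

definition strict_sup :: "cord set \<Rightarrow> cord" where
  "strict_sup X = (LEAST c. \<forall>x\<in>X. x < c)"

lemma strict_sup_upper: "countable X \<Longrightarrow> x \<in> X \<Longrightarrow> x < strict_sup X"
  unfolding strict_sup_def using countable_cords_bounded[of X] LeastI[of "\<lambda>c. \<forall>x\<in>X. x < c"] by metis

lemma strict_sup_least: "(\<And>x. x \<in> X \<Longrightarrow> x < c) \<Longrightarrow> strict_sup X \<le> c"
  unfolding strict_sup_def by (rule Least_le) blast

lemma less_strict_supD: "a < strict_sup X \<Longrightarrow> \<exists>x\<in>X. a \<le> x"
  using strict_sup_least[of X a] by (meson leD leI)

lemma countable_below: "countable {x :: cord. x < c}"
proof -
  obtain r where r: "Well_order r" "c = abs_cord r" by (rule cord_obtain)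
  have "{x. x < c} \<subseteq> seg r ` Field r" using seg_surj[OF r(1)] r(2) by blast
  then show ?thesis by (rule countable_subset) simp
qed

lemma zero_cord_least: "0 \<le> (\<alpha> :: cord)"
proof -
  have z: "Well_order ({} :: nat rel)" using zero_cord.rsp ordIso_self_iff by (simp add: eq_onp_def)
  have "\<not> \<alpha> < 0"
  proof
    assume "\<alpha> < 0"
    then have "\<alpha> < abs_cord {}" by (simp add: zero_cord_def)
    then show False using seg_surj[OF z] by (metis Field_empty empty_iff)
  qed
  then show ?thesis by simp
qed

lemma succ_cord_eq: "succ_cord \<alpha> = strict_sup {\<alpha>}"
  by (simp add: succ_cord_def strict_sup_def)

lemma less_succ_cord [simp]: "\<alpha> < succ_cord \<alpha>"
  unfolding succ_cord_eq by (rule strict_sup_upper) auto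

lemma succ_cord_le_iff: "succ_cord \<alpha> \<le> \<beta> \<longleftrightarrow> \<alpha> < \<beta>"
  using less_succ_cord[of \<alpha>] strict_sup_least[of "{\<alpha>}" \<beta>] unfolding succ_cord_eq
  by (metis le_less_trans less_le_trans singletonD)

lemma less_succ_cord_iff: "\<beta> < succ_cord \<alpha> \<longleftrightarrow> \<beta> \<le> \<alpha>"
  by (metis linorder_not_less succ_cord_le_iff)

text \<open>\<open>Zf \<beta> \<gamma>\<close> is the ordinal \<open>\<beta> + \<omega> \<cdot> \<gamma>\<close>.\<close>

function Zf :: "cord \<Rightarrow> cord \<Rightarrow> cord" where
  "Zf \<beta> \<gamma> = strict_sup ({..<\<beta>} \<union> (\<Union>\<gamma>'\<in>{..<\<gamma>}. range (\<lambda>n. (succ_cord ^^ n) (Zf \<beta> \<gamma>'))))"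
  by pat_completeness auto
termination
  by (relation "inv_image {(\<gamma>, \<beta>). \<gamma> < \<beta>} snd") (auto intro!: wf_inv_image simp: wf)

declare Zf.simps [simp del]

lemma countable_Zf_set:
  "countable ({..<\<beta>} \<union> (\<Union>\<gamma>'\<in>{..<\<gamma>}. range (\<lambda>n. (succ_cord ^^ n) (Zf \<beta> \<gamma>'))))"
  using countable_below by (auto simp: lessThan_def)

text \<open>Between two values of \<open>Zf \<beta>\<close> there is room for any finite number of
  successors. These pay for the extra moves that one move in the tree structure can cost.\<close>

lemma Zf_upper: "\<gamma>' < \<gamma> \<Longrightarrow> (succ_cord ^^ n) (Zf \<beta> \<gamma>') < Zf \<beta> \<gamma>"
  by (subst (2) Zf.simps) (rule strict_sup_upper[OF countable_Zf_set], blast)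

lemma Zf_mono: "\<gamma>' < \<gamma> \<Longrightarrow> Zf \<beta> \<gamma>' < Zf \<beta> \<gamma>"
  using Zf_upper[of \<gamma>' \<gamma> 0] by simp

lemma Zf_ge: "\<beta> \<le> Zf \<beta> \<gamma>"
proof -
  have "\<not> Zf \<beta> \<gamma> < \<beta>"
  proof
    assume "Zf \<beta> \<gamma> < \<beta>"
    then have "Zf \<beta> \<gamma> \<in> {..<\<beta>} \<union> (\<Union>\<gamma>'\<in>{..<\<gamma>}. range (\<lambda>n. (succ_cord ^^ n) (Zf \<beta> \<gamma>')))"
      by simp
    from strict_sup_upper[OF countable_Zf_set this] show False
      unfolding Zf.simps[of \<beta> \<gamma>, symmetric] by (rule less_irrefl[THEN notE])
  qed
  then show ?thesis by (rule leI)
qed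

lemma Zf_least:
  assumes "\<beta> \<le> c" "\<And>\<gamma>' n. \<gamma>' < \<gamma> \<Longrightarrow> (succ_cord ^^ n) (Zf \<beta> \<gamma>') < c"
  shows "Zf \<beta> \<gamma> \<le> c"
  unfolding Zf.simps[of \<beta> \<gamma>]
proof (rule strict_sup_least)
  fix x assume "x \<in> {..<\<beta>} \<union> (\<Union>\<gamma>'\<in>{..<\<gamma>}. range (\<lambda>n. (succ_cord ^^ n) (Zf \<beta> \<gamma>')))"
  then consider "x < \<beta>" | \<gamma>' n where "\<gamma>' < \<gamma>" "x = (succ_cord ^^ n) (Zf \<beta> \<gamma>')" by blast
  then show "x < c" using assms less_le_trans by cases blast+
qed

section \<open>Scott analysis of a countable structure\<close>

abbreviation vl :: "nat list \<Rightarrow> nat \<Rightarrow> nat" where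
  "vl as \<equiv> (\<lambda>i. if i < length as then as ! i else 0)"

lemma trm_val_cong: "(\<And>x. x \<in> trm_vars t \<Longrightarrow> v x = w x) \<Longrightarrow> trm_val A v t = trm_val A w t"
proof (induction t)
  case (Fun f ts)
  then have "map (trm_val A v) ts = map (trm_val A w) ts" by auto
  then show ?case by (simp only: trm_val.simps)
qed simp

lemma sat_atom_cong:
  assumes "\<And>x. x \<in> atom_vars a \<Longrightarrow> v x = w x" shows "sat_atom A a v \<longleftrightarrow> sat_atom A a w"
proof (cases a)
  case (Eq s t)
  then have "trm_val A v s = trm_val A w s" "trm_val A v t = trm_val A w t"
    using assms by (auto intro: trm_val_cong)
  then show ?thesis using Eq by simp
next
  case (Rel r ts)
  then have "map (trm_val A v) ts = map (trm_val A w) ts"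
    using assms by (auto intro!: trm_val_cong)
  then show ?thesis unfolding Rel by (simp only: sat_atom.simps)
qed

definition same_atoms :: "lang \<Rightarrow> struct \<Rightarrow> nat list \<Rightarrow> nat list \<Rightarrow> bool" where
  "same_atoms L A as bs \<longleftrightarrow> (\<forall>a. L_atom L a \<and> atom_vars a \<subseteq> {..<length as} \<longrightarrow>
     (sat_atom A a (vl as) \<longleftrightarrow> sat_atom A a (vl bs)))"

lemma rcset_cimage [simp]: "rcset (cimage f S) = f ` rcset S"
  by (rule cimage.rep_eq)

lemma back_forth_0_iff: "back_forth L A 0 as bs \<longleftrightarrow> same_atoms L A as bs"
proof
  assume bf: "back_forth L A 0 as bs"
  show "same_atoms L A as bs"
    unfolding same_atoms_def
  proof (intro allI impI)
    fix a assume "L_atom L a \<and> atom_vars a \<subseteq> {..<length as}"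
    then show "sat_atom A a (vl as) \<longleftrightarrow> sat_atom A a (vl bs)"
      using bf unfolding back_forth.simps[of L A 0]
      by (auto dest!: spec[of _ "Atom a"] simp: sat_at_def intro: L_fm.intros quantifier_free.intros)
  qed
next
  assume at: "same_atoms L A as bs"
  have "quantifier_free \<phi> \<Longrightarrow> L_fm L \<phi> \<Longrightarrow> free_vars \<phi> \<subseteq> {..<length as} \<Longrightarrow>
    sat A \<phi> (vl as) \<longleftrightarrow> sat A \<phi> (vl bs)" for \<phi>
  proof (induction \<phi> rule: quantifier_free.induct)
    case (qf_Atom a)
    from qf_Atom(1) have "L_atom L a" by cases auto
    then show ?case using at qf_Atom(2) unfolding same_atoms_def by simp
  next
    case (qf_Neg \<phi>)
    from qf_Neg(3) have "L_fm L \<phi>" by cases auto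
    then show ?case using qf_Neg by simp
  next
    case (qf_Conj S)
    from qf_Conj(3) have "\<forall>\<phi>\<in>rcset S. L_fm L \<phi>" by cases auto
    then show ?case using qf_Conj by (simp add: UN_subset_iff)
  next
    case (qf_Disj S)
    from qf_Disj(3) have "\<forall>\<phi>\<in>rcset S. L_fm L \<phi>" by cases auto
    then show ?case using qf_Disj by (simp add: UN_subset_iff)
  qed
  then show "back_forth L A 0 as bs"
    unfolding back_forth.simps[of L A 0] by (simp add: sat_at_def)
qed

lemma back_forth_pos:
  "\<beta> \<noteq> 0 \<Longrightarrow> back_forth L A \<beta> as bs \<longleftrightarrow>
     (\<forall>\<gamma><\<beta>. (\<forall>c\<in>univ A. \<exists>d\<in>univ A. back_forth L A \<gamma> (as @ [c]) (bs @ [d])) \<and>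
             (\<forall>d\<in>univ A. \<exists>c\<in>univ A. back_forth L A \<gamma> (as @ [c]) (bs @ [d])))"
  by (subst back_forth.simps) simp

lemma cord_pos: "\<gamma> < (\<beta> :: cord) \<Longrightarrow> \<beta> \<noteq> 0"
  using zero_cord_least[of \<gamma>] by auto

lemma back_forth_forth:
  "back_forth L A \<beta> as bs \<Longrightarrow> \<gamma> < \<beta> \<Longrightarrow> c \<in> univ A \<Longrightarrow>
    \<exists>d\<in>univ A. back_forth L A \<gamma> (as @ [c]) (bs @ [d])"
  using back_forth_pos[of \<beta>] cord_pos by blast

lemma back_forth_back:
  "back_forth L A \<beta> as bs \<Longrightarrow> \<gamma> < \<beta> \<Longrightarrow> d \<in> univ A \<Longrightarrow>
    \<exists>c\<in>univ A. back_forth L A \<gamma> (as @ [c]) (bs @ [d])"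
  using back_forth_pos[of \<beta>] cord_pos by blast

lemma same_atoms_prefix:
  assumes "same_atoms L A (as @ cs) (bs @ ds)" "length as = length bs"
  shows "same_atoms L A as bs"
  unfolding same_atoms_def
proof (intro allI impI)
  fix a assume a: "L_atom L a \<and> atom_vars a \<subseteq> {..<length as}"
  then have "atom_vars a \<subseteq> {..<length (as @ cs)}" by auto
  then have "sat_atom A a (vl (as @ cs)) \<longleftrightarrow> sat_atom A a (vl (bs @ ds))"
    using assms(1) a unfolding same_atoms_def by blast
  moreover have "sat_atom A a (vl (as @ cs)) \<longleftrightarrow> sat_atom A a (vl as)"
    by (rule sat_atom_cong) (use a in \<open>auto simp: nth_append\<close>)
  moreover have "sat_atom A a (vl (bs @ ds)) \<longleftrightarrow> sat_atom A a (vl bs)"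
    by (rule sat_atom_cong) (use a assms(2) in \<open>auto simp: nth_append\<close>)
  ultimately show "sat_atom A a (vl as) \<longleftrightarrow> sat_atom A a (vl bs)" by simp
qed

lemma back_forth_mono:
  assumes "univ A \<noteq> {}" "length as = length bs" "back_forth L A \<delta> as bs" "\<gamma> \<le> \<delta>"
  shows "back_forth L A \<gamma> as bs"
proof (cases "\<gamma> = \<delta>")
  case False
  then have less: "\<gamma> < \<delta>" using assms(4) by simp
  show ?thesis
  proof (cases "\<gamma> = 0")
    case True
    \<comment> \<open>A positive level says nothing about atoms directly: one arbitrary element is
      played, and it is forgotten again together with its answer.\<close>
    obtain c where "c \<in> univ A" using assms(1) by blast
    then obtain d where "back_forth L A 0 (as @ [c]) (bs @ [d])"
      using back_forth_forth[OF assms(3)] less True by blast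
    then show ?thesis using same_atoms_prefix assms(2) True by (simp add: back_forth_0_iff)
  next
    case False
    have "\<gamma>' < \<delta>" if "\<gamma>' < \<gamma>" for \<gamma>' using that less by (rule order_less_trans)
    then show ?thesis unfolding back_forth_pos[OF False]
      using back_forth_forth[OF assms(3)] back_forth_back[OF assms(3)] by blast
  qed
qed (use assms in simp)

lemma back_forth_same_atoms:
  "univ A \<noteq> {} \<Longrightarrow> length as = length bs \<Longrightarrow> back_forth L A \<delta> as bs \<Longrightarrow> same_atoms L A as bs"
  using back_forth_mono[of A as bs L \<delta> 0] zero_cord_least by (simp add: back_forth_0_iff)

text \<open>Moves at level \<open>\<gamma> < \<mu>\<close> are taken from level
  \<open>succ_cord \<gamma>\<close>, which is still below a limit. This settles tuples whose rank is
  exactly \<open>\<omega>\<^sub>1\<^sup>C\<^sup>K\<close>.\<close>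

lemma back_forth_limit:
  assumes "univ A \<noteq> {}" "length as = length bs" "\<mu> \<noteq> 0"
    and lim: "\<And>\<gamma>. \<gamma> < \<mu> \<Longrightarrow> succ_cord \<gamma> < \<mu>"
    and bf: "\<And>\<gamma>. \<gamma> < \<mu> \<Longrightarrow> back_forth L A \<gamma> as bs"
  shows "back_forth L A \<mu> as bs"
proof -
  have "(\<forall>c\<in>univ A. \<exists>d\<in>univ A. back_forth L A \<gamma> (as @ [c]) (bs @ [d])) \<and>
        (\<forall>d\<in>univ A. \<exists>c\<in>univ A. back_forth L A \<gamma> (as @ [c]) (bs @ [d]))" if "\<gamma> < \<mu>" for \<gamma>
    using back_forth_forth[OF bf[OF lim[OF that]]] back_forth_back[OF bf[OF lim[OF that]]] by simp
  then show ?thesis using back_forth_pos assms(3) by blast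
qed

section \<open>Back-and-forth systems and automorphisms of countable structures\<close>

lemma same_atoms_Rel:
  assumes "same_atoms L A as bs" "length as = length bs" "r \<in> rels L" "length is = rel_arity L r"
    and "set is \<subseteq> {..<length as}"
  shows "rel_in A r (map ((!) as) is) \<longleftrightarrow> rel_in A r (map ((!) bs) is)"
proof -
  have "atom_vars (Rel r (map Var is)) \<subseteq> {..<length as}" "L_atom L (Rel r (map Var is))"
    using assms by (auto intro: L_trm.intros)
  then have "sat_atom A (Rel r (map Var is)) (vl as) \<longleftrightarrow> sat_atom A (Rel r (map Var is)) (vl bs)"
    using assms(1) unfolding same_atoms_def by blast
  moreover have "map (trm_val A (vl as)) (map Var is) = map ((!) as) is"
    "map (trm_val A (vl bs)) (map Var is) = map ((!) bs) is"
    using assms(2,5) by auto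
  ultimately show ?thesis by (simp only: sat_atom.simps)
qed

lemma same_atoms_eq:
  assumes "same_atoms L A as bs" "length as = length bs" "i < length as" "j < length as"
  shows "as ! i = as ! j \<longleftrightarrow> bs ! i = bs ! j"
proof -
  have "L_atom L (Eq (Var i) (Var j))" "atom_vars (Eq (Var i) (Var j)) \<subseteq> {..<length as}"
    using assms by (auto intro: L_trm.intros)
  then show ?thesis using assms unfolding same_atoms_def by fastforce
qed

lemma same_atoms_Fun:
  assumes "same_atoms L A as bs" "length as = length bs" "f \<in> funs L" "length is = fun_arity L f"
    and "set is \<subseteq> {..<length as}" "j < length as"
  shows "fun_in A f (map ((!) as) is) = as ! j \<longleftrightarrow> fun_in A f (map ((!) bs) is) = bs ! j"
proof -
  let ?a = "Eq (Fun f (map Var is)) (Var j)"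
  have "atom_vars ?a \<subseteq> {..<length as}" "L_atom L ?a"
    using assms by (auto intro!: L_trm.intros)
  then have "sat_atom A ?a (vl as) \<longleftrightarrow> sat_atom A ?a (vl bs)"
    using assms(1) unfolding same_atoms_def by blast
  moreover have "map (trm_val A (vl as)) (map Var is) = map ((!) as) is"
    "map (trm_val A (vl bs)) (map Var is) = map ((!) bs) is"
    using assms(2,5) by auto
  ultimately show ?thesis using assms(2,6) by (simp only: sat_atom.simps trm_val.simps) simp
qed

text \<open>Karp's argument for countable structures: elements are numbers, so stage
  \<open>n\<close> can put \<open>n\<close> into both tuples, and the union of the increasing tuples
  is an automorphism.\<close>

lemma back_forth_system_same_orbit:
  assumes str: "is_structure L A"
    and I: "\<And>as bs. I as bs \<Longrightarrow>
      length as = length bs \<and> set as \<subseteq> univ A \<and> set bs \<subseteq> univ A \<and> same_atoms L A as bs"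
    and forth: "\<And>as bs c. I as bs \<Longrightarrow> c \<in> univ A \<Longrightarrow> \<exists>d\<in>univ A. I (as @ [c]) (bs @ [d])"
    and bk: "\<And>as bs d. I as bs \<Longrightarrow> d \<in> univ A \<Longrightarrow> \<exists>c\<in>univ A. I (as @ [c]) (bs @ [d])"
    and start: "I as0 bs0"
  shows "same_orbit L A as0 bs0"
proof -
  let ?P = "\<lambda>(n::nat) p. I (fst p) (snd p) \<and> (n = 0 \<longrightarrow> p = (as0, bs0))"
  let ?Q = "\<lambda>(n::nat) p q. (\<exists>cs ds. fst q = fst p @ cs \<and> snd q = snd p @ ds) \<and>
     (n \<in> univ A \<longrightarrow> n \<in> set (fst q) \<and> n \<in> set (snd q))"
  have "\<exists>f. \<forall>n. ?P n (f n) \<and> ?Q n (f n) (f (Suc n))"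
  proof (rule dependent_nat_choice[of ?P ?Q])
    show "\<exists>p. ?P 0 p" using start by auto
    fix p n assume p: "?P n p"
    show "\<exists>q. ?P (Suc n) q \<and> ?Q n p q"
    proof (cases "n \<in> univ A")
      case True
      then obtain d where d: "I (fst p @ [n]) (snd p @ [d])" using forth p by blast
      then obtain c where "I ((fst p @ [n]) @ [c]) ((snd p @ [d]) @ [n])" using bk True by blast
      then show ?thesis by (intro exI[of _ "((fst p @ [n]) @ [c], (snd p @ [d]) @ [n])"]) simp
    next
      case False
      then show ?thesis using p by (intro exI[of _ p]) simp
    qed
  qed
  then obtain F where F: "\<And>n. ?P n (F n)" "\<And>n. ?Q n (F n) (F (Suc n))" by blast
  define X where "X n = fst (F n)" for n
  define Y where "Y n = snd (F n)" for n
  have XY: "length (X n) = length (Y n)" "set (X n) \<subseteq> univ A" "set (Y n) \<subseteq> univ A"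
    "same_atoms L A (X n) (Y n)" for n
    using I[of "fst (F n)" "snd (F n)"] F(1)[of n] unfolding X_def Y_def by auto
  have ext1: "\<exists>cs ds. X (Suc n) = X n @ cs \<and> Y (Suc n) = Y n @ ds" for n
    using F(2)[of n] unfolding X_def Y_def by auto
  have ext: "n \<le> m \<Longrightarrow> \<exists>cs ds. X m = X n @ cs \<and> Y m = Y n @ ds" for n m
  proof (induction rule: dec_induct)
    case (step k)
    then show ?case using ext1[of k] by (metis append_assoc)
  qed simp
  have cover: "n \<in> univ A \<Longrightarrow> n \<in> set (X (Suc n)) \<and> n \<in> set (Y (Suc n))" for n
    using F(2)[of n] unfolding X_def Y_def by auto
  have coverX: "set xs \<subseteq> univ A \<Longrightarrow> \<exists>n. set xs \<subseteq> set (X n)" for xs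
  proof (induction xs)
    case (Cons x xs)
    then obtain n where n: "set xs \<subseteq> set (X n)" by auto
    let ?m = "max n (Suc x)"
    have "set (X n) \<subseteq> set (X ?m)" "set (X (Suc x)) \<subseteq> set (X ?m)"
      using ext[of n ?m] ext[of "Suc x" ?m] by (metis max.cobounded1 max.cobounded2 set_append Un_upper1)+
    then have "set (x # xs) \<subseteq> set (X ?m)" using n cover[of x] Cons.prems by auto
    then show ?case by blast
  qed simp
  \<comment> \<open>Graph of the automorphism. It is only a relation at first because an element may
    occur at several positions and stages; \<open>G_eq\<close> shows that it is functional and
    injective.\<close>
  define G where "G x y \<longleftrightarrow> (\<exists>n i. i < length (X n) \<and> x = X n ! i \<and> y = Y n ! i)" for x y
  have G_eq: "x = x' \<longleftrightarrow> y = y'" if "G x y" "G x' y'" for x y x' y'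
  proof -
    from that obtain n i n' i' where i: "i < length (X n)" "x = X n ! i" "y = Y n ! i"
      "i' < length (X n')" "x' = X n' ! i'" "y' = Y n' ! i'" unfolding G_def by blast
    let ?m = "max n n'"
    obtain cs ds cs' ds' where e: "X ?m = X n @ cs" "Y ?m = Y n @ ds" "X ?m = X n' @ cs'" "Y ?m = Y n' @ ds'"
      using ext[of n ?m] ext[of n' ?m] by auto
    have "x = X ?m ! i" "y = Y ?m ! i" using i e(1,2) XY(1)[of n] by (simp_all only: nth_append) auto
    moreover have "x' = X ?m ! i'" "y' = Y ?m ! i'"
      using i e(3,4) XY(1)[of n'] by (simp_all only: nth_append) auto
    moreover have "i < length (X ?m)" using i(1) e(1) by simp
    moreover have "i' < length (X ?m)" using i(4) e(3) by simp
    ultimately show ?thesis using same_atoms_eq[OF XY(4) XY(1), of i ?m i'] by simp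
  qed
  have G_dom: "\<exists>y. G x y" if "x \<in> univ A" for x
    using cover[OF that] unfolding G_def by (metis in_set_conv_nth)
  have G_ran: "\<exists>x. G x y" if "y \<in> univ A" for y
    using cover[OF that] XY(1) unfolding G_def by (metis in_set_conv_nth)
  have G_in: "x \<in> univ A \<and> y \<in> univ A" if "G x y" for x y
    using that XY(1,2,3) unfolding G_def by (metis nth_mem subsetD)
  define h where "h x = (SOME y. G x y)" for x
  have h: "G x (h x)" if "x \<in> univ A" for x
    unfolding h_def using someI_ex[OF G_dom[OF that]] .
  have hX: "h (X n ! i) = Y n ! i" if "i < length (X n)" for n i
    using G_eq[of "X n ! i" "h (X n ! i)" "X n ! i" "Y n ! i"] h that XY(2)
    unfolding G_def by (metis nth_mem subsetD)
  have idx: "\<exists>n is. set is \<subseteq> {..<length (X n)} \<and> xs = map ((!) (X n)) is \<and> map h xs = map ((!) (Y n)) is"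
    if xs: "set xs \<subseteq> univ A" for xs
  proof -
    obtain n where n: "set xs \<subseteq> set (X n)" using coverX[OF xs] by blast
    let ?j = "\<lambda>x. SOME i. i < length (X n) \<and> X n ! i = x"
    have j: "?j x < length (X n) \<and> X n ! ?j x = x" if "x \<in> set xs" for x
      by (rule someI_ex) (use n that in \<open>auto simp: in_set_conv_nth dest!: subsetD\<close>)
    have "map ((!) (X n)) (map ?j xs) = xs"
      unfolding map_map by (rule map_idI) (use j in auto)
    moreover have "Y n ! ?j x = h x" if "x \<in> set xs" for x
      using j[OF that] hX[of "?j x" n] by simp
    then have "map ((!) (Y n)) (map ?j xs) = map h xs" by (simp del: some_eq_ex)
    moreover have "set (map ?j xs) \<subseteq> {..<length (X n)}" using j by auto
    ultimately show ?thesis by (intro exI[of _ n] exI[of _ "map ?j xs"]) simp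
  qed
  have bij: "bij_betw h (univ A) (univ A)"
    unfolding bij_betw_def inj_on_def
  proof (intro conjI ballI impI set_eqI iffI)
    fix x y assume "x \<in> univ A" "y \<in> univ A" "h x = h y"
    then show "x = y" using G_eq[OF h[of x] h[of y]] by simp
  next
    fix y assume "y \<in> h ` univ A" then show "y \<in> univ A" using h G_in by blast
  next
    fix y assume "y \<in> univ A"
    then obtain x where "G x y" using G_ran by blast
    then have "x \<in> univ A" "h x = y" using G_in[of x y] h[of x] G_eq[of x "h x" x y] by simp_all
    then show "y \<in> h ` univ A" by blast
  qed
  have "rel_in A r xs \<longleftrightarrow> rel_in A r (map h xs)"
    if "r \<in> rels L" "xs \<in> tuples A (rel_arity L r)" for r xs
  proof -
    obtain n "is" where n: "set is \<subseteq> {..<length (X n)}" "xs = map ((!) (X n)) is"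
      "map h xs = map ((!) (Y n)) is" using idx[of xs] \<open>xs \<in> _\<close> by (auto simp: tuples_def)
    then have "length is = rel_arity L r" using that(2) by (auto simp: tuples_def)
    then show ?thesis
      unfolding n(3) using same_atoms_Rel[OF XY(4) XY(1) that(1) _ n(1)] n(2) by simp
  qed
  moreover have "h (fun_in A f xs) = fun_in A f (map h xs)"
    if "f \<in> funs L" "xs \<in> tuples A (fun_arity L f)" for f xs
  proof -
    have "fun_in A f xs \<in> univ A" using str that unfolding is_structure_def by blast
    \<comment> \<open>The value is listed together with the arguments so that a single stage
      contains all of them.\<close>
    then have "set (fun_in A f xs # xs) \<subseteq> univ A" using that by (auto simp: tuples_def)
    from idx[OF this] obtain n js where js: "set js \<subseteq> {..<length (X n)}"
      "fun_in A f xs # xs = map ((!) (X n)) js" "map h (fun_in A f xs # xs) = map ((!) (Y n)) js" by (elim exE conjE) (rule that)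
    have "length js = Suc (length xs)" using arg_cong[OF js(2), of length] by simp
    then obtain j "is" where i: "js = j # is" by (auto simp: length_Suc_conv)
    have e: "fun_in A f xs = X n ! j" "xs = map ((!) (X n)) is" "h (fun_in A f xs) = Y n ! j"
      "map h xs = map ((!) (Y n)) is" using js(2,3) unfolding i list.map list.inject by blast+
    have "length xs = fun_arity L f" using that(2) by (simp add: tuples_def)
    then have "length is = fun_arity L f" using arg_cong[OF e(2), of length] by simp
    then have "fun_in A f (map ((!) (X n)) is) = X n ! j \<longleftrightarrow> fun_in A f (map ((!) (Y n)) is) = Y n ! j"
      using js(1) i by (intro same_atoms_Fun[OF XY(4) XY(1) that(1)]) auto
    then show ?thesis unfolding e(3) e(4) using e(1) unfolding e(2)[symmetric] by simp
  qed
  ultimately have "isomorphism L A A h" unfolding isomorphism_def using bij by blast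
  moreover have "map h as0 = bs0"
  proof -
    have "X 0 = as0" "Y 0 = bs0" using F(1)[of 0] unfolding X_def Y_def by auto
    then show ?thesis using hX[of _ 0] XY(1)[of 0] by (auto intro: nth_equalityI)
  qed
  ultimately show ?thesis unfolding same_orbit_def by blast
qed

lemma isomorphism_trm_val:
  assumes str: "is_structure L A" and h: "isomorphism L A B h"
  shows "L_trm L t \<Longrightarrow> (\<And>x. x \<in> trm_vars t \<Longrightarrow> v x \<in> univ A) \<Longrightarrow>
    trm_val A v t \<in> univ A \<and> trm_val B (\<lambda>x. h (v x)) t = h (trm_val A v t)"
proof (induction t rule: L_trm.induct)
  case (L_trm_Fun f ts)
  then have ts: "\<And>t. t \<in> set ts \<Longrightarrow> trm_val A v t \<in> univ A \<and> trm_val B (\<lambda>x. h (v x)) t = h (trm_val A v t)"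
    by auto
  then have "map (trm_val A v) ts \<in> tuples A (fun_arity L f)"
    using L_trm_Fun(2) by (auto simp: tuples_def)
  moreover have "map (trm_val B (\<lambda>x. h (v x))) ts = map h (map (trm_val A v) ts)" using ts by auto
  ultimately show ?case using str h L_trm_Fun(1) unfolding is_structure_def isomorphism_def trm_val.simps by metis
qed simp

lemma isomorphism_sat_atom:
  assumes str: "is_structure L A" and h: "isomorphism L A B h"
    and a: "L_atom L a" "\<And>x. x \<in> atom_vars a \<Longrightarrow> v x \<in> univ A"
  shows "sat_atom B a (\<lambda>x. h (v x)) \<longleftrightarrow> sat_atom A a v"
proof (cases a)
  case (Eq s t)
  then have "trm_val A v s \<in> univ A \<and> trm_val B (\<lambda>x. h (v x)) s = h (trm_val A v s)"
    "trm_val A v t \<in> univ A \<and> trm_val B (\<lambda>x. h (v x)) t = h (trm_val A v t)"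
    using a by (auto intro!: isomorphism_trm_val[OF str h])
  moreover have "inj_on h (univ A)" using h unfolding isomorphism_def bij_betw_def by blast
  ultimately show ?thesis using Eq by (auto simp: inj_on_def)
next
  case (Rel r ts)
  have ts: "trm_val A v t \<in> univ A \<and> trm_val B (\<lambda>x. h (v x)) t = h (trm_val A v t)" if "t \<in> set ts" for t
    using a Rel that by (intro isomorphism_trm_val[OF str h]) auto
  then have "map (trm_val A v) ts \<in> tuples A (rel_arity L r)" using a Rel by (auto simp: tuples_def)
  moreover have "map (trm_val B (\<lambda>x. h (v x))) ts = map h (map (trm_val A v) ts)" using ts by auto
  ultimately show ?thesis using a(1) h unfolding Rel isomorphism_def sat_atom.simps L_atom.simps by metis
qed

lemma same_orbit_back_forth:
  assumes str: "is_structure L A" and orb: "same_orbit L A as bs" and as: "set as \<subseteq> univ A"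
  shows "back_forth L A \<gamma> as bs"
proof -
  obtain h where h: "isomorphism L A A h" "map h as = bs" using orb unfolding same_orbit_def by blast
  have surj: "h ` univ A = univ A" using h unfolding isomorphism_def bij_betw_def by blast
  have "set as \<subseteq> univ A \<Longrightarrow> back_forth L A \<gamma> as (map h as)" for as
  proof (induction \<gamma> arbitrary: as rule: less_induct)
    case (less \<gamma>)
    show ?case
    proof (cases "\<gamma> = 0")
      case True
      have "sat_atom A a (vl as) \<longleftrightarrow> sat_atom A a (vl (map h as))"
        if "L_atom L a" "atom_vars a \<subseteq> {..<length as}" for a
      proof -
        have "sat_atom A a (\<lambda>x. h (vl as x)) \<longleftrightarrow> sat_atom A a (vl as)"
          using that less.prems by (intro isomorphism_sat_atom[OF str h(1)]) (auto dest!: subsetD)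
        moreover have "sat_atom A a (\<lambda>x. h (vl as x)) \<longleftrightarrow> sat_atom A a (vl (map h as))"
          by (rule sat_atom_cong) (use that in auto)
        ultimately show ?thesis by blast
      qed
      then show ?thesis unfolding True back_forth_0_iff same_atoms_def by blast
    next
      case False
      have *: "back_forth L A \<gamma>' (as @ [c]) (map h as @ [h c])" if "\<gamma>' < \<gamma>" "c \<in> univ A" for c \<gamma>'
        using less.IH[OF that(1), of "as @ [c]"] that less.prems by simp
      show ?thesis unfolding back_forth_pos[OF False] using * surj by (metis image_iff)
    qed
  qed
  then show ?thesis using as h(2) by blast
qed

text \<open>If every answer \<open>d\<close> failed at some level \<open>g d\<close>, then, as there
  are countably many answers, all would fail at one common level; but agreement at the next level
  provides an answer there.\<close>

lemma back_forth_all_same_orbit: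
  assumes str: "is_structure L A" and len: "length as = length bs" "set as \<subseteq> univ A" "set bs \<subseteq> univ A"
    and bf: "\<And>\<gamma>. back_forth L A \<gamma> as bs"
  shows "same_orbit L A as bs"
proof -
  have ne: "univ A \<noteq> {}" using str unfolding is_structure_def by blast
  let ?I = "\<lambda>as bs. length as = length bs \<and> set as \<subseteq> univ A \<and> set bs \<subseteq> univ A \<and> (\<forall>\<gamma>. back_forth L A \<gamma> as bs)"
  show ?thesis
  proof (rule back_forth_system_same_orbit[OF str, of ?I])
    fix as bs assume I: "?I as bs"
    then show "length as = length bs \<and> set as \<subseteq> univ A \<and> set bs \<subseteq> univ A \<and> same_atoms L A as bs"
      using back_forth_0_iff by blast
    fix c assume c: "c \<in> univ A"
    have "\<exists>d\<in>univ A. \<forall>\<gamma>. back_forth L A \<gamma> (as @ [c]) (bs @ [d])"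
    proof (rule ccontr)
      assume "\<not> ?thesis"
      then obtain g where g: "\<And>d. d \<in> univ A \<Longrightarrow> \<not> back_forth L A (g d) (as @ [c]) (bs @ [d])" by metis
      obtain d where d: "d \<in> univ A" "back_forth L A (strict_sup (g ` univ A)) (as @ [c]) (bs @ [d])"
        using back_forth_forth[of L A _ as bs] I c less_succ_cord by blast
      moreover have "g d \<le> strict_sup (g ` univ A)" using d(1) by (intro less_imp_le strict_sup_upper) auto
      ultimately have "back_forth L A (g d) (as @ [c]) (bs @ [d])"
        using I by (intro back_forth_mono[OF ne _ d(2)]) auto
      then show False using g d(1) by blast
    qed
    then show "\<exists>d\<in>univ A. ?I (as @ [c]) (bs @ [d])" using I c by auto
    have "\<exists>d\<in>univ A. \<forall>\<gamma>. back_forth L A \<gamma> (as @ [d]) (bs @ [c])"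
    proof (rule ccontr)
      assume "\<not> ?thesis"
      then obtain g where g: "\<And>d. d \<in> univ A \<Longrightarrow> \<not> back_forth L A (g d) (as @ [d]) (bs @ [c])" by metis
      obtain d where d: "d \<in> univ A" "back_forth L A (strict_sup (g ` univ A)) (as @ [d]) (bs @ [c])"
        using back_forth_back[of L A _ as bs] I c less_succ_cord by blast
      moreover have "g d \<le> strict_sup (g ` univ A)" using d(1) by (intro less_imp_le strict_sup_upper) auto
      ultimately have "back_forth L A (g d) (as @ [d]) (bs @ [c])"
        using I by (intro back_forth_mono[OF ne _ d(2)]) auto
      then show False using g d(1) by blast
    qed
    then show "\<exists>d\<in>univ A. ?I (as @ [d]) (bs @ [c])" using I c by auto
  qed (use len bf in blast)
qed

section \<open>Scott ranks of tuples and of the structure\<close>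

lemma countable_tuples: "countable (tuples A n)"
  by (rule countable_subset[OF subset_UNIV]) simp

text \<open>The least level in the definition exists by the same bounding argument, applied to the
  countably many tuples outside the orbit, and the levels that work are closed upwards by
  \<open>back_forth_mono\<close>.\<close>

lemma SR_tuple_le_iff:
  assumes str: "is_structure L A" and as: "set as \<subseteq> univ A"
  shows "SR_tuple L A as \<le> \<gamma> \<longleftrightarrow>
    (\<forall>bs\<in>tuples A (length as). back_forth L A \<gamma> as bs \<longrightarrow> same_orbit L A as bs)"
proof -
  let ?P = "\<lambda>\<gamma>. \<forall>bs\<in>tuples A (length as). back_forth L A \<gamma> as bs \<longrightarrow> same_orbit L A as bs"
  have ne: "univ A \<noteq> {}" using str unfolding is_structure_def by blast
  have mono: "?P \<gamma> \<Longrightarrow> \<gamma> \<le> \<delta> \<Longrightarrow> ?P \<delta>" for \<gamma> \<delta>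
    using back_forth_mono[OF ne, of as _ L \<delta> \<gamma>] by (auto simp: tuples_def)
  have "\<exists>\<gamma>. ?P \<gamma>"
  proof -
    define g where "g bs = (SOME \<gamma>. \<not> back_forth L A \<gamma> as bs)" for bs
    have g: "\<not> back_forth L A (g bs) as bs" if "bs \<in> tuples A (length as)" "\<not> same_orbit L A as bs" for bs
      unfolding g_def
      by (rule someI_ex) (use that back_forth_all_same_orbit[OF str _ as, of bs] in \<open>fastforce simp: tuples_def\<close>)
    have "?P (strict_sup (g ` tuples A (length as)))"
    proof (intro ballI impI, rule ccontr)
      fix bs assume bs: "bs \<in> tuples A (length as)"
        and bf: "back_forth L A (strict_sup (g ` tuples A (length as))) as bs" and "\<not> same_orbit L A as bs"
      moreover have "g bs \<le> strict_sup (g ` tuples A (length as))"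
        using bs countable_tuples by (intro less_imp_le strict_sup_upper) auto
      ultimately show False using g back_forth_mono[OF ne, of as bs L _ "g bs"] by (auto simp: tuples_def)
    qed
    then show ?thesis by blast
  qed
  then have "?P (SR_tuple L A as)" unfolding SR_tuple_def by (rule LeastI_ex)
  then show ?thesis using mono Least_le[of ?P \<gamma>] unfolding SR_tuple_def by blast
qed

lemma back_forth_sym:
  "length as = length bs \<Longrightarrow> back_forth L A \<gamma> as bs \<Longrightarrow> back_forth L A \<gamma> bs as"
proof (induction \<gamma> arbitrary: as bs rule: less_induct)
  case (less \<gamma>)
  show ?case
  proof (cases "\<gamma> = 0")
    case True
    then show ?thesis using less.prems by (auto simp: back_forth_0_iff same_atoms_def)
  next
    case False
    have "back_forth L A \<gamma>' (bs @ [d]) (as @ [c])"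
      if "back_forth L A \<gamma>' (as @ [c]) (bs @ [d])" "\<gamma>' < \<gamma>" for \<gamma>' c d
      using less.IH[OF that(2) _ that(1)] less.prems(1) by simp
    then show ?thesis using less.prems(2) unfolding back_forth_pos[OF False] by metis
  qed
qed

lemma SR_eq: "SR L A = strict_sup (SR_tuple L A ` {as. set as \<subseteq> univ A})"
proof -
  have "(\<forall>n. \<forall>as\<in>tuples A n. SR_tuple L A as < \<alpha>) \<longleftrightarrow> (\<forall>as. set as \<subseteq> univ A \<longrightarrow> SR_tuple L A as < \<alpha>)" for \<alpha>
    by (auto simp: tuples_def)
  then show ?thesis unfolding SR_def strict_sup_def by simp
qed

lemma SR_tuple_less_SR: "set as \<subseteq> univ A \<Longrightarrow> SR_tuple L A as < SR L A"
  unfolding SR_eq by (rule strict_sup_upper) auto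

lemma SR_le: "(\<And>as. set as \<subseteq> univ A \<Longrightarrow> SR_tuple L A as < \<alpha>) \<Longrightarrow> SR L A \<le> \<alpha>"
  unfolding SR_eq by (rule strict_sup_least) auto

section \<open>The structure of gadget trees over a structure\<close>

declare list_encode_eq [simp]

lemma code_trm_inj: "code_trm t = code_trm t' \<Longrightarrow> t = t'"
proof (induction t arbitrary: t')
  case (Var x)
  then show ?case by (cases t') auto
next
  case (Fun f ts)
  then obtain ts' where t': "t' = Fun f ts'" "map code_trm ts = map code_trm ts'" by (cases t') auto
  then have "ts = ts'"
    using Fun.IH by (intro nth_equalityI) (auto dest: map_eq_imp_length_eq simp: list_eq_iff_nth_eq)
  then show ?case using t' by simp
qed

lemma code_atom_inj: "code_atom a = code_atom a' \<Longrightarrow> a = a'"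
proof -
  have inj: "inj code_trm" using code_trm_inj by (auto intro: injI)
  show "code_atom a = code_atom a' \<Longrightarrow> a = a'"
    by (cases a; cases a') (auto dest: code_trm_inj map_injective[OF _ inj])
qed

primrec ren_trm :: "(nat \<Rightarrow> nat) \<Rightarrow> trm \<Rightarrow> trm" where
  "ren_trm f (Var x) = Var (f x)"
| "ren_trm f (Fun g ts) = Fun g (map (ren_trm f) ts)"

primrec ren_atom :: "(nat \<Rightarrow> nat) \<Rightarrow> atom \<Rightarrow> atom" where
  "ren_atom f (Eq s t) = Eq (ren_trm f s) (ren_trm f t)"
| "ren_atom f (Rel r ts) = Rel r (map (ren_trm f) ts)"

lemma trm_val_ren: "trm_val A v (ren_trm f t) = trm_val A (\<lambda>x. v (f x)) t"
proof (induction t)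
  case (Fun g ts)
  then have "map (trm_val A v \<circ> ren_trm f) ts = map (trm_val A (\<lambda>x. v (f x))) ts" by auto
  then show ?case by (simp del: map_eq_conv)
qed simp

lemma sat_atom_ren: "sat_atom A (ren_atom f a) v \<longleftrightarrow> sat_atom A a (\<lambda>x. v (f x))"
proof (cases a)
  case (Rel r ts)
  have "map (trm_val A v \<circ> ren_trm f) ts = map (trm_val A (\<lambda>x. v (f x))) ts"
    by (auto simp: trm_val_ren)
  then show ?thesis using Rel by (simp del: map_eq_conv)
qed (simp add: trm_val_ren)

lemma trm_vars_ren: "trm_vars (ren_trm f t) = f ` trm_vars t"
  by (induction t) auto

lemma atom_vars_ren: "atom_vars (ren_atom f a) = f ` atom_vars a"
  by (cases a) (auto simp: trm_vars_ren)

lemma L_trm_ren: "L_trm L t \<Longrightarrow> L_trm L (ren_trm f t)"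
  by (induction t rule: L_trm.induct) (auto intro!: L_trm.intros)

lemma L_trm_ren_iff: "L_trm L (ren_trm f t) \<longleftrightarrow> L_trm L t"
proof
  show "L_trm L (ren_trm f t) \<Longrightarrow> L_trm L t"
  proof (induction t)
    case (Fun g ts)
    from Fun.prems show ?case by cases (use Fun.IH in \<open>auto intro!: L_trm.intros\<close>)
  qed (rule L_trm.intros)
qed (rule L_trm_ren)

lemma L_atom_ren: "L_atom L (ren_atom f a) \<longleftrightarrow> L_atom L a"
  by (cases a) (auto simp: L_trm_ren_iff)

text \<open>Variables of the atom are positions in \<open>xs\<close>. Codes of no
  \<open>L\<close>-atom, and atoms with a variable outside the tuple, count as false, so that every
  pair \<open>a\<close>, \<open>xs\<close> can be given a tree.\<close>

definition fact_holds :: "lang \<Rightarrow> struct \<Rightarrow> (nat \<Rightarrow> nat) \<Rightarrow> nat \<Rightarrow> nat list \<Rightarrow> bool" where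
  "fact_holds L A h a xs \<longleftrightarrow> (\<exists>b. code_atom b = a \<and> L_atom L b \<and>
     atom_vars b \<subseteq> {..<length xs} \<and> sat_atom A b (\<lambda>i. h (xs ! i)))"

definition base :: "nat \<Rightarrow> nat" where
  "base i = prod_encode (0, i)"

text \<open>Nodes of the tree attached to the atom with code \<open>a\<close> and the tuple \<open>xs\<close>.  The branch \<open>s\<close>
  leading to the node is listed from the node down to the root, so that the parent is a tail.\<close>

definition nd :: "nat \<Rightarrow> nat list \<Rightarrow> nat list \<Rightarrow> nat" where
  "nd a xs s = prod_encode (1, prod_encode (a, prod_encode (list_encode xs, list_encode s)))"

lemma base_nd_simps [simp]:
  "base i = base j \<longleftrightarrow> i = j" "base i \<noteq> nd a xs s" "nd a xs s \<noteq> base i"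
  "nd a xs s = nd a' xs' s' \<longleftrightarrow> a = a' \<and> xs = xs' \<and> s = s'"
  by (auto simp: base_def nd_def)

text \<open>The invariant of an element that the unary relations of the new language will name; the
  two lengths in it fix the number of components.\<close>

definition ety :: "nat \<Rightarrow> nat" where
  "ety x = (case prod_decode x of (k, y) \<Rightarrow> if k = 0 then 0 else
     case prod_decode y of (a, z) \<Rightarrow> case prod_decode z of (u, v) \<Rightarrow>
       Suc (prod_encode (a, prod_encode (length (list_decode u), length (list_decode v)))))"

text \<open>The base elements named by the tuple, then the ancestors from the parent to the root.
  Siblings have the same components, since the last entry of the branch does not show in them; this
  keeps siblings of equal rank interchangeable.\<close>

definition comps :: "nat \<Rightarrow> nat list" where
  "comps x = (case prod_decode x of (k, y) \<Rightarrow> if k = 0 then [] else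
     case prod_decode y of (a, z) \<Rightarrow> case prod_decode z of (u, v) \<Rightarrow>
       map base (list_decode u) @
       map (\<lambda>i. nd a (list_decode u) (drop (Suc i) (list_decode v))) [0..<length (list_decode v)])"

lemma ety_simps [simp]:
  "ety (base i) = 0" "ety (nd a xs s) = Suc (prod_encode (a, prod_encode (length xs, length s)))"
  by (simp_all add: ety_def base_def nd_def)

lemma comps_simps [simp]:
  "comps (base i) = []"
  "comps (nd a xs s) = map base xs @ map (\<lambda>i. nd a xs (drop (Suc i) s)) [0..<length s]"
  by (simp_all add: comps_def base_def nd_def)

definition child :: "nat \<Rightarrow> nat \<Rightarrow> bool" where
  "child g g' \<longleftrightarrow> (\<exists>a xs d s. g = nd a xs s \<and> g' = nd a xs (d # s))"

text \<open>Components are given by relations and not by functions, so that atoms contain no nested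
  terms. Passing to components therefore costs moves, which \<open>back_forth_adjoin\<close>
  counts.\<close>

definition lang_star :: lang where
  "lang_star = \<lparr>rels = UNIV, rel_arity = (\<lambda>r. if fst (prod_decode r) = 0 then 1 else 2),
     funs = {}, fun_arity = (\<lambda>_. 0)\<rparr>"

definition rel_star :: "nat \<Rightarrow> nat list \<Rightarrow> bool" where
  "rel_star r xs = (case prod_decode r of (k, j) \<Rightarrow>
     if k = 0 then ety (xs ! 0) = j
     else if k = 1 then j < length (comps (xs ! 0)) \<and> comps (xs ! 0) ! j = xs ! 1
     else child (xs ! 0) (xs ! 1))"

definition univ_star :: "nat set \<Rightarrow> (nat \<Rightarrow> nat list \<Rightarrow> nat list \<Rightarrow> bool) \<Rightarrow> nat set" where
  "univ_star UB valid = base ` UB \<union> {nd a xs s | a xs s. set xs \<subseteq> UB \<and> valid a xs s}"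

definition struct_star :: "nat set \<Rightarrow> (nat \<Rightarrow> nat list \<Rightarrow> nat list \<Rightarrow> bool) \<Rightarrow> struct" where
  "struct_star UB valid = \<lparr>univ = univ_star UB valid, rel_in = rel_star, fun_in = (\<lambda>_ _. 0)\<rparr>"

lemma L_trm_star: "L_trm lang_star t \<longleftrightarrow> (\<exists>x. t = Var x)"
  by (auto simp: lang_star_def elim: L_trm.cases intro: L_trm.intros)

lemma length_comps: "ety x = ety y \<Longrightarrow> length (comps x) = length (comps y)"
  by (auto simp: ety_def comps_def split: prod.splits if_splits)

text \<open>Only these properties of the trees enter the comparison of Scott ranks. The map
  \<open>h\<close> names the elements of \<open>A\<close> by numbers from \<open>UB\<close>, a set
  that can be decidable although the universe of \<open>A\<close> need not be; \<open>rk_inf\<close>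
  is fatness.\<close>

locale gadget =
  fixes L :: lang and A :: struct and h :: "nat \<Rightarrow> nat" and UB :: "nat set"
    and valid :: "nat \<Rightarrow> nat list \<Rightarrow> nat list \<Rightarrow> bool"
    and rk :: "nat \<Rightarrow> nat list \<Rightarrow> nat list \<Rightarrow> cord" and \<beta>0 \<beta>1 :: cord
  assumes strA: "is_structure L A" and h: "bij_betw h UB (univ A)"
    and valid_Nil [simp]: "valid a xs []"
    and valid_Cons: "valid a xs (d # s) \<Longrightarrow> valid a xs s"
    and rk_less: "valid a xs (d # s) \<Longrightarrow> rk a xs (d # s) < rk a xs s"
    and rk_inf: "valid a xs s \<Longrightarrow> \<gamma> < rk a xs s \<Longrightarrow> infinite {d. valid a xs (d # s) \<and> rk a xs (d # s) = \<gamma>}"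
    and rk_Nil: "set xs \<subseteq> UB \<Longrightarrow> rk a xs [] = (if fact_holds L A h a xs then \<beta>1 else \<beta>0)"
    and \<beta>01: "\<beta>0 < \<beta>1"
begin

abbreviation "V \<equiv> univ_star UB valid"
abbreviation "A' \<equiv> struct_star UB valid"

definition rkE :: "nat \<Rightarrow> cord" where
  "rkE x = (case prod_decode x of (k, y) \<Rightarrow> if k = 0 then 0 else
     case prod_decode y of (a, z) \<Rightarrow> case prod_decode z of (u, v) \<Rightarrow> rk a (list_decode u) (list_decode v))"

lemma rkE_simps [simp]: "rkE (base i) = 0" "rkE (nd a xs s) = rk a xs s"
  by (simp_all add: rkE_def base_def nd_def)

lemma univ_A' [simp]: "univ A' = V"
  by (simp add: struct_star_def)

lemma V_cases:
  assumes "x \<in> V"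
  obtains i where "i \<in> UB" "x = base i" | a xs s where "set xs \<subseteq> UB" "valid a xs s" "x = nd a xs s"
  using assms unfolding univ_star_def by blast

lemma V_simps [simp]: "base i \<in> V \<longleftrightarrow> i \<in> UB" "nd a xs s \<in> V \<longleftrightarrow> set xs \<subseteq> UB \<and> valid a xs s"
  unfolding univ_star_def by auto

lemma UB_ne: "UB \<noteq> {}"
  using strA h unfolding is_structure_def bij_betw_def by blast

lemma V_ne: "V \<noteq> {}"
  using UB_ne unfolding univ_star_def by blast

lemma ne: "univ A \<noteq> {}"
  using strA unfolding is_structure_def by blast

lemma str_A': "is_structure lang_star A'"
  using V_ne by (simp add: is_structure_def lang_star_def)

lemma h_in: "i \<in> UB \<Longrightarrow> h i \<in> univ A"
  using h unfolding bij_betw_def by blast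

lemma h_surj: "c \<in> univ A \<Longrightarrow> \<exists>i\<in>UB. c = h i"
  using h unfolding bij_betw_def by blast

lemma h_inj: "i \<in> UB \<Longrightarrow> j \<in> UB \<Longrightarrow> h i = h j \<longleftrightarrow> i = j"
  using h unfolding bij_betw_def inj_on_def by blast

lemma valid_drop: "valid a xs s \<Longrightarrow> valid a xs (drop n s)"
proof (induction n)
  case (Suc n)
  have d: "drop (Suc n) s = tl (drop n s)" by (simp add: drop_Suc tl_drop)
  show ?case
  proof (cases "drop n s")
    case (Cons x t)
    then show ?thesis using Suc valid_Cons[of a xs x t] d by simp
  qed (use d in simp)
qed simp

lemma comps_in_V: "x \<in> V \<Longrightarrow> set (comps x) \<subseteq> V"
  by (erule V_cases) (auto dest: valid_drop)

text \<open>Tails of tails are tails. Hence closing a tuple under components once already closes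
  it.\<close>

lemma comps_comps:
  assumes "x \<in> V" "y \<in> set (comps x)" shows "set (comps y) \<subseteq> set (comps x)"
  using assms(1)
proof (cases rule: V_cases)
  case (2 a xs s)
  have "nd a xs (drop (Suc j) (drop (Suc i) s)) \<in> set (comps x)" if "j < length s - Suc i" for i j
  proof -
    have "drop (Suc j) (drop (Suc i) s) = drop (Suc (Suc i + j)) s" by (simp add: add.commute)
    then show ?thesis using 2 that by (auto simp: image_iff intro!: bexI[of _ "Suc i + j"])
  qed
  then show ?thesis using assms(2) 2 by auto
qed (use assms(2) in auto)

lemma rk_le_Nil: "valid a xs s \<Longrightarrow> rk a xs s \<le> rk a xs []"
proof (induction s)
  case (Cons d s)
  then show ?case using rk_less[OF Cons.prems] valid_Cons[OF Cons.prems] by simp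
qed simp

lemma rkE_le:
  assumes "x \<in> V" shows "rkE x \<le> \<beta>1"
  using assms
proof (cases rule: V_cases)
  case (2 a xs s)
  then have "rk a xs s \<le> rk a xs []" by (intro rk_le_Nil)
  also have "\<dots> \<le> \<beta>1" using rk_Nil[OF 2(1)] less_imp_le[OF \<beta>01] by simp
  finally show ?thesis using 2 by simp
qed (simp add: zero_cord_least)

lemma child_rkE: "child g g' \<Longrightarrow> g' \<in> V \<Longrightarrow> rkE g' < rkE g"
  unfolding child_def using rk_less by auto

section \<open>Finite partial maps respecting types, components and ranks\<close>

lemma same_atoms_typ:
  assumes "same_atoms lang_star A' as bs" "length as = length bs" "(x, x') \<in> set (zip as bs)"
  shows "ety x = ety x'"
proof -
  obtain i where i: "i < length as" "x = as ! i" "x' = bs ! i" using assms(2,3) by (auto simp: in_set_zip)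
  have "rel_in A' (prod_encode (0, ety x)) (map ((!) as) [i]) \<longleftrightarrow> rel_in A' (prod_encode (0, ety x)) (map ((!) bs) [i])"
    by (rule same_atoms_Rel[OF assms(1,2)]) (use i in \<open>auto simp: lang_star_def\<close>)
  then show ?thesis using i by (simp add: struct_star_def rel_star_def)
qed

lemma same_atoms_comps:
  assumes "same_atoms lang_star A' as bs" "length as = length bs" "(x, x') \<in> set (zip as bs)"
    "(y, y') \<in> set (zip as bs)" "j < length (comps x)"
  shows "comps x ! j = y \<longleftrightarrow> comps x' ! j = y'"
proof -
  obtain i where i: "i < length as" "x = as ! i" "x' = bs ! i" using assms(2,3) by (auto simp: in_set_zip)
  obtain k where k: "k < length as" "y = as ! k" "y' = bs ! k" using assms(2,4) by (auto simp: in_set_zip)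
  have "rel_in A' (prod_encode (1, j)) (map ((!) as) [i, k]) \<longleftrightarrow> rel_in A' (prod_encode (1, j)) (map ((!) bs) [i, k])"
    by (rule same_atoms_Rel[OF assms(1,2)]) (use i k in \<open>auto simp: lang_star_def\<close>)
  moreover have "length (comps x) = length (comps x')"
    by (rule length_comps) (rule same_atoms_typ[OF assms(1-3)])
  ultimately show ?thesis using i k assms(5) by (simp add: struct_star_def rel_star_def)
qed

lemma same_atoms_child:
  assumes "same_atoms lang_star A' as bs" "length as = length bs" "(x, x') \<in> set (zip as bs)"
    "(y, y') \<in> set (zip as bs)"
  shows "child x y \<longleftrightarrow> child x' y'"
proof -
  obtain i where i: "i < length as" "x = as ! i" "x' = bs ! i" using assms(2,3) by (auto simp: in_set_zip)
  obtain k where k: "k < length as" "y = as ! k" "y' = bs ! k" using assms(2,4) by (auto simp: in_set_zip)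
  have "rel_in A' (prod_encode (2, 0)) (map ((!) as) [i, k]) \<longleftrightarrow> rel_in A' (prod_encode (2, 0)) (map ((!) bs) [i, k])"
    by (rule same_atoms_Rel[OF assms(1,2)]) (use i k in \<open>auto simp: lang_star_def\<close>)
  then show ?thesis using i k by (simp add: struct_star_def rel_star_def)
qed

lemma same_atoms_zip_eq:
  assumes "same_atoms L0 B as bs" "length as = length bs" "(x, x') \<in> set (zip as bs)" "(y, y') \<in> set (zip as bs)"
  shows "x = y \<longleftrightarrow> x' = y'"
  using assms(2-4) same_atoms_eq[OF assms(1,2)] by (auto simp: in_set_zip)

text \<open>Truth of facts in \<open>A\<close> does not occur here; the lists of
  \<open>base_in\<close> carry that information. Closure under components makes \<open>child\<close>
  preserved automatically, since the parent is a component.\<close>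

definition good :: "(nat \<times> nat) set \<Rightarrow> bool" where
  "good p \<longleftrightarrow> finite p \<and>
     (\<forall>x x'. (x, x') \<in> p \<longrightarrow> x \<in> V \<and> x' \<in> V \<and> ety x = ety x' \<and> rkE x = rkE x') \<and>
     (\<forall>x x' y y'. (x, x') \<in> p \<longrightarrow> (y, y') \<in> p \<longrightarrow> (x = y \<longleftrightarrow> x' = y')) \<and>
     (\<forall>x x'. (x, x') \<in> p \<longrightarrow> (\<forall>j<length (comps x). (comps x ! j, comps x' ! j) \<in> p))"

lemma goodD:
  assumes "good p"
  shows "finite p" "(x, x') \<in> p \<Longrightarrow> x \<in> V" "(x, x') \<in> p \<Longrightarrow> x' \<in> V" "(x, x') \<in> p \<Longrightarrow> ety x = ety x'"
    "(x, x') \<in> p \<Longrightarrow> rkE x = rkE x'" "(x, x') \<in> p \<Longrightarrow> (y, y') \<in> p \<Longrightarrow> x = y \<longleftrightarrow> x' = y'"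
    "(x, x') \<in> p \<Longrightarrow> j < length (comps x) \<Longrightarrow> (comps x ! j, comps x' ! j) \<in> p"
    "(x, x') \<in> p \<Longrightarrow> length (comps x) = length (comps x')"
  using assms length_comps unfolding good_def by blast+

lemma good_converse:
  assumes g: "good p" shows "good (p\<inverse>)"
  unfolding good_def[of "p\<inverse>"] converse_iff
proof (intro conjI allI impI)
  fix x x' y y' assume xx: "(x', x) \<in> p"
  show "x \<in> V" "x' \<in> V" "ety x = ety x'" "rkE x = rkE x'"
    using goodD(2-5)[OF g xx] by simp_all
  show "(comps x' ! j, comps x ! j) \<in> p" if "j < length (comps x)" for j
    using goodD(7)[OF g xx, of j] goodD(8)[OF g xx] that by simp
  assume "(y', y) \<in> p"
  then show "x = y \<longleftrightarrow> x' = y'" using goodD(6)[OF g xx] by blast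
qed (use goodD(1)[OF g] in simp)

lemma ety_base_cases:
  assumes "y \<in> V" "ety y = 0" obtains i where "i \<in> UB" "y = base i"
  using assms(1) by (cases rule: V_cases) (use assms(2) that in auto)

lemma ety_nd_cases:
  assumes "y \<in> V" "ety (nd a xs s) = ety y"
  obtains xs' s' where "set xs' \<subseteq> UB" "valid a xs' s'" "y = nd a xs' s'" "length xs' = length xs" "length s' = length s"
  using assms(1) by (cases rule: V_cases) (use assms(2) that in auto)

lemma good_base: "good p \<Longrightarrow> (base i, x') \<in> p \<Longrightarrow> \<exists>i'\<in>UB. x' = base i'"
  using goodD(3,4)[of p "base i" x'] ety_base_cases[of x'] by auto

lemma good_nd:
  assumes g: "good p" "(nd a xs s, x') \<in> p"
  obtains xs' s' where "x' = nd a xs' s'" "length s' = length s"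
    "list_all2 (\<lambda>x y. (base x, base y) \<in> p) xs xs'"
    "\<And>i. i < length s \<Longrightarrow> (nd a xs (drop (Suc i) s), nd a xs' (drop (Suc i) s')) \<in> p"
proof -
  obtain xs' s' where x': "x' = nd a xs' s'" "length xs' = length xs" "length s' = length s"
    using ety_nd_cases[OF goodD(3)[OF g] goodD(4)[OF g]] by metis
  have c: "j < length xs + length s \<Longrightarrow> (comps (nd a xs s) ! j, comps (nd a xs' s') ! j) \<in> p" for j
    using goodD(7)[OF g, of j] x'(1) by simp
  have "(base (xs ! i), base (xs' ! i)) \<in> p" if "i < length xs" for i
    using c[of i] that x' by (simp add: nth_append)
  then have "list_all2 (\<lambda>x y. (base x, base y) \<in> p) xs xs'"
    unfolding list_all2_conv_all_nth using x' by simp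
  moreover have "(nd a xs (drop (Suc i) s), nd a xs' (drop (Suc i) s')) \<in> p" if "i < length s" for i
    using c[of "length xs + i"] that x' by (simp add: nth_append)
  ultimately show thesis using that x' by blast
qed

lemma good_child_imp:
  assumes g: "good p" "(x, x') \<in> p" "(y, y') \<in> p" and c: "child x y"
  shows "child x' y'"
proof -
  obtain a xs d s where xy: "x = nd a xs s" "y = nd a xs (d # s)" using c unfolding child_def by blast
  obtain xs' s' where y': "y' = nd a xs' s'" "length s' = length (d # s)"
    "\<And>i. i < length (d # s) \<Longrightarrow> (nd a xs (drop (Suc i) (d # s)), nd a xs' (drop (Suc i) s')) \<in> p"
    using good_nd g xy by metis
  obtain d' s'' where s': "s' = d' # s''" using y'(2) by (cases s') auto
  have "(x, nd a xs' s'') \<in> p" using y'(3)[of 0] s' xy by simp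
  then have "x' = nd a xs' s''" using goodD(6)[OF g(1,2)] by metis
  then show ?thesis unfolding child_def using y' s' by blast
qed

lemma good_same_atoms:
  assumes g: "good p" and ab: "list_all2 (\<lambda>x y. (x, y) \<in> p) as bs"
  shows "same_atoms lang_star A' as bs"
  unfolding same_atoms_def
proof (intro allI impI)
  fix a assume a: "L_atom lang_star a \<and> atom_vars a \<subseteq> {..<length as}"
  have p: "(as ! i, bs ! i) \<in> p" if "i < length as" for i
    using ab that by (auto simp: list_all2_conv_all_nth)
  have len: "length as = length bs" using ab by (rule list_all2_lengthD)
  show "sat_atom A' a (vl as) \<longleftrightarrow> sat_atom A' a (vl bs)"
  proof (cases a)
    case (Eq s t)
    then obtain i j where "s = Var i" "t = Var j" "i < length as" "j < length as"
      using a by (auto simp: L_trm_star)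
    then show ?thesis using Eq len goodD(6)[OF g p p, of i j] by simp
  next
    case (Rel r ts)
    obtain k j where r: "r = prod_encode (k, j)" by (metis prod_decode_inverse prod.exhaust)
    have len_ts: "length ts = (if k = 0 then 1 else 2)" using a Rel r by (simp add: lang_star_def)
    show ?thesis
    proof (cases "k = 0")
      case True
      then obtain t where "ts = [t]" using len_ts by (auto simp: length_Suc_conv)
      then obtain i where "ts = [Var i]" "i < length as" using a Rel by (auto simp: L_trm_star)
      then show ?thesis using Rel True r len goodD(4)[OF g p, of i] by (simp add: struct_star_def rel_star_def)
    next
      case False
      then obtain t t' where "ts = [t, t']" using len_ts by (auto simp: length_Suc_conv numeral_2_eq_2)
      then obtain i i' where ts: "ts = [Var i, Var i']" "i < length as" "i' < length as"
        using a Rel by (auto simp: L_trm_star)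
      have c: "j < length (comps (as ! i)) \<Longrightarrow>
          comps (as ! i) ! j = as ! i' \<longleftrightarrow> comps (bs ! i) ! j = bs ! i'"
        using goodD(6)[OF g goodD(7)[OF g p] p, of i j i'] ts by blast
      have ch: "child (as ! i) (as ! i') \<longleftrightarrow> child (bs ! i) (bs ! i')"
        using good_child_imp[OF g p p] good_child_imp[OF good_converse[OF g], of "bs ! i" "as ! i"] p ts by blast
      show ?thesis using Rel False r ts len c ch goodD(8)[OF g p, of i]
        by (auto simp: struct_star_def rel_star_def)
    qed
  qed
qed

lemma good_insert:
  assumes g: "good p" and V: "x \<in> V" "x' \<in> V" "ety x = ety x'" "rkE x = rkE x'"
    and new: "\<And>y. (x, y) \<notin> p" "\<And>y. (y, x') \<notin> p"
    and comps: "\<And>j. j < length (comps x) \<Longrightarrow> (comps x ! j, comps x' ! j) \<in> p"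
  shows "good (insert (x, x') p)"
  unfolding good_def
proof (intro conjI allI impI)
  show "finite (insert (x, x') p)" using goodD(1)[OF g] by simp
next
  fix y y' z z' assume "(y, y') \<in> insert (x, x') p" "(z, z') \<in> insert (x, x') p"
  then show "y = z \<longleftrightarrow> y' = z'" using new goodD(6)[OF g, of y y' z z'] by auto
qed (use V comps goodD[OF g] in auto)

text \<open>The tuples of \<open>A\<close> underlying a map: the lists fix an order of the base
  elements for use with \<open>back_forth\<close>, and they may contain more pairs than occur in
  \<open>p\<close>.\<close>

definition base_in :: "(nat \<times> nat) set \<Rightarrow> nat list \<Rightarrow> nat list \<Rightarrow> bool" where
  "base_in p us us' \<longleftrightarrow> length us = length us' \<and> set us \<subseteq> UB \<and> set us' \<subseteq> UB \<and>
     (\<forall>i i'. (base i, base i') \<in> p \<longrightarrow> (i, i') \<in> set (zip us us'))"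

lemma base_in_converse: "base_in p us us' \<Longrightarrow> base_in (p\<inverse>) us' us"
  unfolding base_in_def by (simp add: in_set_zip) metis

lemma fact_transfer_imp:
  assumes at: "same_atoms L A (map h us) (map h us')" "length us = length us'"
    and xs: "list_all2 (\<lambda>x y. (x, y) \<in> set (zip us us')) xs xs'" and f: "fact_holds L A h a xs"
  shows "fact_holds L A h a xs'"
proof -
  \<comment> \<open>The tuple \<open>xs\<close> selects entries of \<open>us\<close> in any order
    and with repetitions; renaming variables along \<open>f\<close> turns a fact about
    \<open>xs\<close> into one about \<open>us\<close>.\<close>
  obtain f where f: "\<And>k. k < length xs \<Longrightarrow> f k < length us \<and> xs ! k = us ! f k \<and> xs' ! k = us' ! f k"
  proof -
    have "\<forall>k. k < length xs \<longrightarrow> (\<exists>i. i < length us \<and> xs ! k = us ! i \<and> xs' ! k = us' ! i)"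
      using xs by (auto simp: list_all2_conv_all_nth in_set_zip) metis
    then show thesis using that by metis
  qed
  obtain b where b: "code_atom b = a" "L_atom L b" "atom_vars b \<subseteq> {..<length xs}"
    "sat_atom A b (\<lambda>i. h (xs ! i))" using assms(4) unfolding fact_holds_def by blast
  have len: "length xs = length xs'" using xs by (rule list_all2_lengthD)
  have "atom_vars (ren_atom f b) \<subseteq> {..<length (map h us)}"
    using b(3) f by (auto simp: atom_vars_ren)
  then have "sat_atom A (ren_atom f b) (vl (map h us)) \<longleftrightarrow> sat_atom A (ren_atom f b) (vl (map h us'))"
    using at b(2) unfolding same_atoms_def by (simp add: L_atom_ren)
  moreover have "sat_atom A (ren_atom f b) (vl (map h us)) \<longleftrightarrow> sat_atom A b (\<lambda>i. h (xs ! i))"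
    unfolding sat_atom_ren by (rule sat_atom_cong) (use b(3) f in auto)
  moreover have "sat_atom A (ren_atom f b) (vl (map h us')) \<longleftrightarrow> sat_atom A b (\<lambda>i. h (xs' ! i))"
    unfolding sat_atom_ren by (rule sat_atom_cong) (use b(3) f at(2) in auto)
  ultimately show ?thesis using b len unfolding fact_holds_def by auto
qed

lemma same_atoms_sym: "same_atoms L0 B as bs \<Longrightarrow> length as = length bs \<Longrightarrow> same_atoms L0 B bs as"
  by (simp add: same_atoms_def)

lemma fact_transfer:
  assumes at: "same_atoms L A (map h us) (map h us')" "length us = length us'"
    and xs: "list_all2 (\<lambda>x y. (x, y) \<in> set (zip us us')) xs xs'"
  shows "fact_holds L A h a xs \<longleftrightarrow> fact_holds L A h a xs'"
proof
  have "list_all2 (\<lambda>x y. (x, y) \<in> set (zip us' us)) xs' xs"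
    using xs at(2) by (auto simp: list_all2_conv_all_nth in_set_zip)
  then show "fact_holds L A h a xs' \<Longrightarrow> fact_holds L A h a xs"
    using fact_transfer_imp[OF same_atoms_sym[OF at(1)] at(2)[symmetric]] at(2) by simp
qed (rule fact_transfer_imp[OF assms])

text \<open>Equal truth values give the roots equal ranks, and a root is determined by its atom and
  its components, so no clash with earlier pairs can occur.\<close>

lemma extend_root:
  assumes g: "good p" and xs: "list_all2 (\<lambda>x y. (base x, base y) \<in> p) xs xs'"
    and f: "fact_holds L A h a xs \<longleftrightarrow> fact_holds L A h a xs'"
  shows "good (insert (nd a xs [], nd a xs' []) p)"
proof (cases "(nd a xs [], nd a xs' []) \<in> p")
  case True
  then show ?thesis using g by (simp add: insert_absorb)
next
  case False
  have len: "length xs = length xs'" using xs by (rule list_all2_lengthD)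
  have p: "(base (xs ! k), base (xs' ! k)) \<in> p" if "k < length xs" for k
    using xs that by (auto simp: list_all2_conv_all_nth)
  have UB: "set xs \<subseteq> UB" "set xs' \<subseteq> UB"
    using goodD(2,3)[OF g p] len by (auto simp: in_set_conv_nth)
  have eq: "ys = xs \<longleftrightarrow> ys' = xs'" if "list_all2 (\<lambda>x y. (base x, base y) \<in> p) ys ys'" for ys ys'
  proof -
    have "length ys = length ys'" using that by (rule list_all2_lengthD)
    moreover have "ys ! k = xs ! k \<longleftrightarrow> ys' ! k = xs' ! k" if "k < length xs" "k < length ys" for k
      using goodD(6)[OF g, of "base (ys ! k)" "base (ys' ! k)" "base (xs ! k)" "base (xs' ! k)"] that p
        \<open>list_all2 _ ys ys'\<close> by (auto simp: list_all2_conv_all_nth)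
    ultimately show ?thesis using len by (auto simp: list_eq_iff_nth_eq)
  qed
  show ?thesis
  proof (rule good_insert[OF g])
    fix y show "(nd a xs [], y) \<notin> p"
    proof
      assume y: "(nd a xs [], y) \<in> p"
      then obtain ys' where "y = nd a ys' []" "list_all2 (\<lambda>x y. (base x, base y) \<in> p) xs ys'"
        using good_nd[OF g y] by (metis length_0_conv list.size(3))
      then show False using eq y False by blast
    qed
    show "(y, nd a xs' []) \<notin> p"
    proof
      assume y: "(y, nd a xs' []) \<in> p"
      then have "ety (nd a xs' []) = ety y" "y \<in> V" using goodD(2,4)[OF g y] by simp_all
      then obtain ys where ys: "y = nd a ys []" using ety_nd_cases by (metis length_0_conv list.size(3))
      then obtain ys' s' where "nd a xs' [] = nd a ys' s'" "list_all2 (\<lambda>x y. (base x, base y) \<in> p) ys ys'"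
        using good_nd[OF g] y by metis
      then show False using eq y ys False by auto
    qed
  qed (use UB len f p in \<open>auto simp: rk_Nil\<close>)
qed

text \<open>This is the use of fatness: infinitely many children of the image parent have the
  required rank, and the finite map occupies only finitely many of them. If the child is already in
  the domain, then its image lies below the right parent, because the parent is a component.\<close>

lemma extend_child:
  assumes g: "good p" and par: "(nd a xs s, nd a xs' s') \<in> p" and v: "valid a xs (d # s)"
  shows "\<exists>d'. valid a xs' (d' # s') \<and> good (insert (nd a xs (d # s), nd a xs' (d' # s')) p)"
proof (cases "\<exists>y. (nd a xs (d # s), y) \<in> p")
  case True
  then obtain y where y: "(nd a xs (d # s), y) \<in> p" by blast
  obtain ys t where t: "y = nd a ys t" "length t = length (d # s)"
    "\<And>i. i < length (d # s) \<Longrightarrow> (nd a xs (drop (Suc i) (d # s)), nd a ys (drop (Suc i) t)) \<in> p"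
    using good_nd[OF g y] by metis
  obtain d' s'' where dt: "t = d' # s''" using t(2) by (cases t) auto
  have "(nd a xs s, nd a ys s'') \<in> p" using t(3)[of 0] dt by simp
  then have "nd a ys s'' = nd a xs' s'" using goodD(6)[OF g _ par] by blast
  then have "y = nd a xs' (d' # s')" using t dt by simp
  then show ?thesis using y g goodD(3)[OF g y] by (auto simp: insert_absorb)
next
  case False
  have V: "nd a xs s \<in> V" "nd a xs' s' \<in> V" "ety (nd a xs s) = ety (nd a xs' s')"
    "rk a xs s = rk a xs' s'"
    using goodD(2-5)[OF g par] by simp_all
  let ?D = "{d'. valid a xs' (d' # s') \<and> rk a xs' (d' # s') = rk a xs (d # s)}"
  have "infinite ?D" using rk_inf[of a xs' s'] V rk_less[OF v] by simp
  moreover have "finite {d'. nd a xs' (d' # s') \<in> Range p}"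
  proof -
    have "finite ((\<lambda>d'. nd a xs' (d' # s')) -` Range p)"
      by (rule finite_vimageI) (use goodD(1)[OF g] in \<open>auto intro: injI finite_Range\<close>)
    then show ?thesis by (simp add: vimage_def)
  qed
  ultimately obtain d' where d': "d' \<in> ?D" "nd a xs' (d' # s') \<notin> Range p"
    by (metis (no_types, lifting) finite_subset mem_Collect_eq subsetI)
  have "good (insert (nd a xs (d # s), nd a xs' (d' # s')) p)"
  proof (rule good_insert[OF g])
    fix j assume j: "j < length (comps (nd a xs (d # s)))"
    have len: "length xs = length xs'" "length s = length s'" using V(3) by auto
    have "j < length xs \<or> j = length xs \<or> (\<exists>i. j = Suc (length xs + i) \<and> i < length s)"
      using j by (auto simp: not_less_iff_gr_or_eq dest!: less_imp_Suc_add)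
    then consider "j < length xs" | "j = length xs" | i where "j = Suc (length xs + i)" "i < length s" by blast
    then show "(comps (nd a xs (d # s)) ! j, comps (nd a xs' (d' # s')) ! j) \<in> p"
    proof cases
      case 1
      then show ?thesis using goodD(7)[OF g par, of j] len by (simp add: nth_append)
    next
      case 2
      then show ?thesis using par len by (simp add: nth_append del: upt_Suc)
    next
      case 3
      then show ?thesis using goodD(7)[OF g par, of "length xs + i"] len by (simp add: nth_append del: upt_Suc)
    qed
  qed (use V v d' False in auto)
  then show ?thesis using d' by blast
qed

lemma extend_node:
  assumes g: "good p" and xs: "list_all2 (\<lambda>x y. (base x, base y) \<in> p) xs xs'"
    and f: "fact_holds L A h a xs \<longleftrightarrow> fact_holds L A h a xs'" and v: "valid a xs s"
  shows "\<exists>p' s'. good p' \<and> p \<subseteq> p' \<and> (nd a xs s, nd a xs' s') \<in> p' \<and>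
    (\<forall>i y. (base i, y) \<in> p' \<longrightarrow> (base i, y) \<in> p)"
  using v
proof (induction s)
  case Nil
  show ?case using extend_root[OF g xs f]
    by (intro exI[of _ "insert (nd a xs [], nd a xs' []) p"] exI[of _ "[]"]) auto
next
  case (Cons d s)
  then obtain p' s' where p': "good p'" "p \<subseteq> p'" "(nd a xs s, nd a xs' s') \<in> p'"
    "\<forall>i y. (base i, y) \<in> p' \<longrightarrow> (base i, y) \<in> p" using valid_Cons by blast
  obtain d' where "good (insert (nd a xs (d # s), nd a xs' (d' # s')) p')"
    using extend_child[OF p'(1,3) Cons.prems] by blast
  then show ?case using p'
    by (intro exI[of _ "insert (nd a xs (d # s), nd a xs' (d' # s')) p'"] exI[of _ "d' # s'"]) auto
qed

lemma extend_base:
  assumes g: "good p" and b: "base_in p us us'" and c: "c \<in> UB" "d \<in> UB"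
    and at: "same_atoms L A (map h (us @ [c])) (map h (us' @ [d]))"
  shows "good (insert (base c, base d) p)" "base_in (insert (base c, base d) p) (us @ [c]) (us' @ [d])"
proof -
  have len: "length us = length us'" using b unfolding base_in_def by simp
  have UB: "set (us @ [c]) \<subseteq> UB" "set (us' @ [d]) \<subseteq> UB" using b c unfolding base_in_def by auto
  have eq: "i = j \<longleftrightarrow> i' = j'"
    if "(i, i') \<in> set (zip (us @ [c]) (us' @ [d]))" "(j, j') \<in> set (zip (us @ [c]) (us' @ [d]))" for i i' j j'
  proof -
    have z: "(h i, h i') \<in> set (zip (map h (us @ [c])) (map h (us' @ [d])))"
      "(h j, h j') \<in> set (zip (map h (us @ [c])) (map h (us' @ [d])))"
      using that by (auto simp: zip_map_map simp del: map_append)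
    have "h i = h j \<longleftrightarrow> h i' = h j'" by (rule same_atoms_zip_eq[OF at _ z]) (simp add: len)
    moreover have "i \<in> UB" "j \<in> UB" "i' \<in> UB" "j' \<in> UB"
      using that UB by (meson set_zip_leftD set_zip_rightD subsetD)+
    ultimately show ?thesis using h_inj by simp
  qed
  have old: "(i, i') \<in> set (zip (us @ [c]) (us' @ [d]))" if "(base i, base i') \<in> p" for i i'
    using that b len unfolding base_in_def by auto
  have new: "(c, d) \<in> set (zip (us @ [c]) (us' @ [d]))" using len by simp
  show "good (insert (base c, base d) p)"
  proof (cases "(base c, base d) \<in> p")
    case True
    then show ?thesis using g by (simp add: insert_absorb)
  next
    case False
    show ?thesis
    proof (rule good_insert[OF g])
      fix y show "(base c, y) \<notin> p"
        using good_base[OF g, of c y] old[of c] eq[OF _ new] False by blast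
      show "(y, base d) \<notin> p"
        using good_base[OF good_converse[OF g], of d y] old[of _ d] eq[OF _ new] False by blast
    qed (use c in auto)
  qed
  show "base_in (insert (base c, base d) p) (us @ [c]) (us' @ [d])"
    using UB len old new unfolding base_in_def by auto
qed

text \<open>\<open>J n us us'\<close> stands for the ability to answer \<open>n\<close> further
  moves in \<open>A\<close>; every base element uses up one of them. Keeping \<open>J\<close>
  abstract lets one lemma serve both directions of the game.\<close>

lemma extend_bases:
  assumes J: "\<And>n us us'. J n us us' \<Longrightarrow> same_atoms L A (map h us) (map h us')"
    and forth: "\<And>n us us' c. J (Suc n) us us' \<Longrightarrow> length us = length us' \<Longrightarrow> c \<in> UB \<Longrightarrow>
      \<exists>d\<in>UB. J n (us @ [c]) (us' @ [d])"
  shows "good p \<Longrightarrow> base_in p us us' \<Longrightarrow> J (length xs + n) us us' \<Longrightarrow> set xs \<subseteq> UB \<Longrightarrow>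
    \<exists>p' vs vs' xs'. good p' \<and> p \<subseteq> p' \<and> base_in p' vs vs' \<and> J n vs vs' \<and>
      list_all2 (\<lambda>x y. (base x, base y) \<in> p') xs xs'"
proof (induction xs arbitrary: p us us')
  case Nil
  then show ?case by auto
next
  case (Cons c xs)
  have len: "length us = length us'" using Cons.prems(2) unfolding base_in_def by simp
  obtain d where d: "d \<in> UB" "J (length xs + n) (us @ [c]) (us' @ [d])"
    using forth[of "length xs + n" us us' c] Cons.prems len by auto
  note e = extend_base[OF Cons.prems(1,2) _ d(1) J[OF d(2)]]
  obtain p' vs vs' xs' where p': "good p'" "insert (base c, base d) p \<subseteq> p'" "base_in p' vs vs'" "J n vs vs'"
    "list_all2 (\<lambda>x y. (base x, base y) \<in> p') xs xs'"
    using Cons.IH[OF e d(2)] Cons.prems(4) by auto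
  then show ?case by (intro exI[of _ p'] exI[of _ vs] exI[of _ vs'] exI[of _ "d # xs'"]) auto
qed

text \<open>\<open>J n\<close> is required for all \<open>n\<close> because the tuple of the node
  \<open>c\<close> may have any length. Its base elements are matched first, then the nodes along
  its branch.\<close>

lemma extend_any:
  assumes J: "\<And>n us us'. J n us us' \<Longrightarrow> same_atoms L A (map h us) (map h us')"
    and forth: "\<And>n us us' c. J (Suc n) us us' \<Longrightarrow> length us = length us' \<Longrightarrow> c \<in> UB \<Longrightarrow>
      \<exists>d\<in>UB. J n (us @ [c]) (us' @ [d])"
    and g: "good p" "base_in p us us'" "\<And>n. J n us us'" and c: "c \<in> V"
  shows "\<exists>p' vs vs' d. good p' \<and> p \<subseteq> p' \<and> base_in p' vs vs' \<and> J 0 vs vs' \<and> (c, d) \<in> p'"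
proof -
  have B: "\<exists>p' vs vs' xs'. good p' \<and> p \<subseteq> p' \<and> base_in p' vs vs' \<and> J 0 vs vs' \<and>
      list_all2 (\<lambda>x y. (base x, base y) \<in> p') xs xs'" if "set xs \<subseteq> UB" for xs
    by (rule extend_bases[where J = J and n = 0 and us = us and us' = us'])
      (erule J, erule forth, assumption, assumption, rule g(1), rule g(2), rule g(3), rule that)
  from c show ?thesis
proof (cases rule: V_cases)
  case (1 i)
  then obtain p' vs vs' xs' where "good p'" "p \<subseteq> p'" "base_in p' vs vs'" "J 0 vs vs'"
    "list_all2 (\<lambda>x y. (base x, base y) \<in> p') [i] xs'"
    using B[of "[i]"] by auto
  then show ?thesis using 1 by (auto simp: list_all2_Cons1)
next
  case (2 a xs s)
  then obtain p' vs vs' xs' where p': "good p'" "p \<subseteq> p'" "base_in p' vs vs'" "J 0 vs vs'"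
    "list_all2 (\<lambda>x y. (base x, base y) \<in> p') xs xs'"
    using B[of xs] by auto
  have "list_all2 (\<lambda>x y. (x, y) \<in> set (zip vs vs')) xs xs'"
    using p'(5) by (rule list_all2_mono) (use p'(3) in \<open>auto simp: base_in_def\<close>)
  then have "fact_holds L A h a xs \<longleftrightarrow> fact_holds L A h a xs'"
    using fact_transfer J[OF p'(4)] p'(3) by (simp add: base_in_def)
  from extend_node[OF p'(1,5) this 2(2)] obtain p'' s' where p'': "good p''" "p' \<subseteq> p''"
    "(nd a xs s, nd a xs' s') \<in> p''" "\<forall>i y. (base i, y) \<in> p'' \<longrightarrow> (base i, y) \<in> p'" by blast
  then have "base_in p'' vs vs'" using p'(3) unfolding base_in_def by blast
  then show ?thesis using p' p'' 2 by blast
qed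
qed

end

context gadget
begin

text \<open>A move at level \<open>\<gamma>' < \<gamma>\<close> in \<open>A'\<close> starts from
  agreement in \<open>A\<close> at every finite successor of \<open>Zf \<beta> \<gamma>'\<close>,
  spends one successor per new base element, and ends at
  \<open>Zf \<beta> \<gamma>'\<close>.\<close>

theorem back_forth_star:
  "back_forth L A (Zf \<beta> \<gamma>) (map h us) (map h us') \<Longrightarrow> good p \<Longrightarrow> base_in p us us' \<Longrightarrow>
    list_all2 (\<lambda>x y. (x, y) \<in> p) as bs \<Longrightarrow> back_forth lang_star A' \<gamma> as bs"
proof (induction \<gamma> arbitrary: us us' p as bs rule: less_induct)
  case (less \<gamma>)
  show ?case
  proof (cases "\<gamma> = 0")
    case True
    then show ?thesis using good_same_atoms[OF less.prems(2,4)] by (simp add: back_forth_0_iff)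
  next
    case False
    have len: "length us = length us'" using less.prems(3) unfolding base_in_def by simp
    have bf: "back_forth L A ((succ_cord ^^ n) (Zf \<beta> \<gamma>')) (map h us) (map h us')" if "\<gamma>' < \<gamma>" for \<gamma>' n
      using back_forth_mono[OF ne _ less.prems(1)] Zf_upper[OF that] len by (simp add: less_imp_le)
    have step: "\<exists>d\<in>V. back_forth lang_star A' \<gamma>' (as @ [c]) (bs @ [d])" if \<gamma>': "\<gamma>' < \<gamma>" and c: "c \<in> V" for \<gamma>' c
    proof -
      let ?J = "\<lambda>n vs vs'. length vs = length vs' \<and> back_forth L A ((succ_cord ^^ n) (Zf \<beta> \<gamma>')) (map h vs) (map h vs')"
      have "\<exists>p' vs vs' d. good p' \<and> p \<subseteq> p' \<and> base_in p' vs vs' \<and> ?J 0 vs vs' \<and> (c, d) \<in> p'"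
      proof (rule extend_any[OF _ _ less.prems(2,3) _ c, of ?J])
        show "same_atoms L A (map h vs) (map h vs')" if "?J n vs vs'" for n vs vs'
          using back_forth_same_atoms[OF ne] that by auto
        show "\<exists>d\<in>UB. ?J n (vs @ [e]) (vs' @ [d])" if J: "?J (Suc n) vs vs'" and e: "e \<in> UB" for n vs vs' e
        proof -
          obtain d where "d \<in> univ A" "back_forth L A ((succ_cord ^^ n) (Zf \<beta> \<gamma>')) (map h vs @ [h e]) (map h vs' @ [d])"
            using back_forth_forth[OF conjunct2[OF J] _ h_in[OF e], of "(succ_cord ^^ n) (Zf \<beta> \<gamma>')"] by auto
          then show ?thesis using h_surj[of d] J by auto
        qed
        show "?J n us us'" for n using bf[OF \<gamma>'] len by blast
      qed
      then obtain p' vs vs' d where p': "good p'" "p \<subseteq> p'" "base_in p' vs vs'" "?J 0 vs vs'" "(c, d) \<in> p'" by blast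
      have "list_all2 (\<lambda>x y. (x, y) \<in> p') (as @ [c]) (bs @ [d])"
        using less.prems(4) p'(2,5) by (auto intro!: list_all2_appendI elim!: list_all2_mono)
      then have "back_forth lang_star A' \<gamma>' (as @ [c]) (bs @ [d])"
        using less.IH[OF \<gamma>' _ p'(1,3)] p'(4) by simp
      then show ?thesis using goodD(3)[OF p'(1,5)] by blast
    qed
    have step': "\<exists>c\<in>V. back_forth lang_star A' \<gamma>' (as @ [c]) (bs @ [d])" if \<gamma>': "\<gamma>' < \<gamma>" and d: "d \<in> V" for \<gamma>' d
    proof -
      \<comment> \<open>The other direction applies the same extension lemma to the inverse map, so
        \<open>J\<close> takes its tuples in reverse order.\<close>
      let ?J = "\<lambda>n vs' vs. length vs' = length vs \<and> back_forth L A ((succ_cord ^^ n) (Zf \<beta> \<gamma>')) (map h vs) (map h vs')"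
      have "\<exists>p' vs vs' c. good p' \<and> p\<inverse> \<subseteq> p' \<and> base_in p' vs vs' \<and> ?J 0 vs vs' \<and> (d, c) \<in> p'"
      proof (rule extend_any[OF _ _ good_converse[OF less.prems(2)] base_in_converse[OF less.prems(3)] _ d, of ?J])
        show "same_atoms L A (map h vs) (map h vs')" if "?J n vs vs'" for n vs vs'
          using same_atoms_sym[OF back_forth_same_atoms[OF ne _ conjunct2[OF that]]] that by simp
        show "\<exists>d\<in>UB. ?J n (vs @ [e]) (vs' @ [d])" if J: "?J (Suc n) vs vs'" and e: "e \<in> UB" for n vs vs' e
        proof -
          obtain d where "d \<in> univ A" "back_forth L A ((succ_cord ^^ n) (Zf \<beta> \<gamma>')) (map h vs' @ [d]) (map h vs @ [h e])"
            using back_forth_back[OF conjunct2[OF J] _ h_in[OF e], of "(succ_cord ^^ n) (Zf \<beta> \<gamma>')"] by auto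
          then show ?thesis using h_surj[of d] J by auto
        qed
        show "?J n us' us" for n using bf[OF \<gamma>'] len by simp
      qed
      then obtain p' vs vs' c where p': "good p'" "p\<inverse> \<subseteq> p'" "base_in p' vs vs'" "?J 0 vs vs'" "(d, c) \<in> p'" by blast
      have "list_all2 (\<lambda>x y. (x, y) \<in> p'\<inverse>) as bs"
        using less.prems(4) by (rule list_all2_mono) (use p'(2) in blast)
      then have "list_all2 (\<lambda>x y. (x, y) \<in> p'\<inverse>) (as @ [c]) (bs @ [d])"
        using p'(5) by (auto intro!: list_all2_appendI)
      then have "back_forth lang_star A' \<gamma>' (as @ [c]) (bs @ [d])"
        using less.IH[OF \<gamma>' _ good_converse[OF p'(1)] base_in_converse[OF p'(3)]] p'(4) by simp
      then show ?thesis using goodD(3)[OF p'(1,5)] by blast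
    qed
    show ?thesis unfolding back_forth_pos[OF False] univ_A' using step step' by blast
  qed
qed

lemma same_orbit_star:
  assumes p: "good p" "base_in p us us'" and orb: "same_orbit L A (map h us) (map h us')"
    and ab: "list_all2 (\<lambda>x y. (x, y) \<in> p) as bs"
  shows "same_orbit lang_star A' as bs"
proof -
  have sub: "set (map h us) \<subseteq> univ A" using p(2) h_in unfolding base_in_def by auto
  have bf: "back_forth L A \<delta> (map h us) (map h us')" for \<delta>
    by (rule same_orbit_back_forth[OF strA orb sub])
  have "as ! i \<in> V \<and> bs ! i \<in> V" if "i < length as" for i
    using ab that goodD(2,3)[OF p(1), of "as ! i" "bs ! i"] by (simp add: list_all2_conv_all_nth)
  then have "set as \<subseteq> V" "set bs \<subseteq> V"
    using list_all2_lengthD[OF ab] by (auto simp: in_set_conv_nth)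
  then show ?thesis
    using back_forth_star[OF bf p ab] list_all2_lengthD[OF ab]
    by (intro back_forth_all_same_orbit[OF str_A']) auto
qed

text \<open>If \<open>rkE x' < \<gamma> \<le> rkE x\<close>, play a child of \<open>x\<close> of
  rank exactly \<open>rkE x'\<close>, which fatness provides. The answer is a child of
  \<open>x'\<close>, and by induction its rank is at least \<open>rkE x'\<close>, which is
  impossible.\<close>

lemma rank_back_forth_le:
  "back_forth lang_star A' \<gamma> as bs \<Longrightarrow> length as = length bs \<Longrightarrow> set as \<subseteq> V \<Longrightarrow>
    (x, x') \<in> set (zip as bs) \<Longrightarrow> \<gamma> \<le> rkE x \<Longrightarrow> \<gamma> \<le> rkE x'"
proof (induction \<gamma> arbitrary: as bs x x' rule: less_induct)
  case (less \<gamma>)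
  show ?case
  proof (rule leI, rule notI)
    assume lt: "rkE x' < \<gamma>"
    have "x \<in> V" using less.prems(3,4) by (meson set_zip_leftD subsetD)
    moreover have "rkE x' < rkE x" using lt less.prems(5) by simp
    ultimately obtain a xs s where x: "x = nd a xs s" "set xs \<subseteq> UB" "valid a xs s"
      using zero_cord_least by (metis V_cases rkE_simps(1) leD)
    then have "infinite {d. valid a xs (d # s) \<and> rk a xs (d # s) = rkE x'}"
      using rk_inf \<open>rkE x' < rkE x\<close> by simp
    then obtain d where d: "valid a xs (d # s)" "rk a xs (d # s) = rkE x'"
      using infinite_imp_nonempty by blast
    then have "nd a xs (d # s) \<in> univ A'" using x by simp
    from back_forth_forth[OF less.prems(1) lt this] obtain y
      where y: "y \<in> V" "back_forth lang_star A' (rkE x') (as @ [nd a xs (d # s)]) (bs @ [y])" by auto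
    have z: "(nd a xs (d # s), y) \<in> set (zip (as @ [nd a xs (d # s)]) (bs @ [y]))"
      "(x, x') \<in> set (zip (as @ [nd a xs (d # s)]) (bs @ [y]))"
      using less.prems(2,4) by simp_all
    have len: "length (as @ [nd a xs (d # s)]) = length (bs @ [y])" using less.prems(2) by simp
    have "rkE x' \<le> rkE y"
      using less.IH[OF lt y(2) len _ z(1)] less.prems(3) d x by simp
    moreover have "same_atoms lang_star A' (as @ [nd a xs (d # s)]) (bs @ [y])"
      using back_forth_same_atoms[OF _ len y(2)] V_ne by simp
    then have "child x' y"
      using same_atoms_child[OF _ len z(2,1)] x(1) unfolding child_def by blast
    then have "rkE y < rkE x'" using child_rkE y(1) by blast
    ultimately show False by simp
  qed
qed

lemma rank_back_forth:
  assumes bf: "back_forth lang_star A' \<delta> as bs" and \<delta>: "\<beta>1 < \<delta>" and len: "length as = length bs"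
    and V: "set as \<subseteq> V" "set bs \<subseteq> V" and x: "(x, x') \<in> set (zip as bs)"
  shows "rkE x = rkE x'"
proof (rule antisym)
  have xV: "x \<in> V" "x' \<in> V" using x V by (meson set_zip_leftD set_zip_rightD subsetD)+
  have x': "(x', x) \<in> set (zip bs as)" using x len by (auto simp: in_set_zip)
  have mono: "back_forth lang_star A' \<gamma> as bs" if "\<gamma> \<le> \<beta>1" for \<gamma>
    using back_forth_mono[OF _ len bf] V_ne that \<delta> by simp
  show "rkE x \<le> rkE x'"
    by (rule rank_back_forth_le[OF mono[OF rkE_le[OF xV(1)]] len V(1) x order_refl])
  show "rkE x' \<le> rkE x"
    by (rule rank_back_forth_le[OF back_forth_sym[OF len mono[OF rkE_le[OF xV(2)]]] len[symmetric] V(2) x' order_refl])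
qed

text \<open>Two levels above \<open>\<beta>1\<close>: one move plays the root that belongs to a
  fact, and the level that remains still exceeds all ranks.\<close>

definition \<beta>2 :: cord where
  "\<beta>2 = succ_cord (succ_cord \<beta>1)"

text \<open>Truth of an atom at \<open>us\<close> is coded by the rank of a root. The answer to that
  root must be the root of the same atom at \<open>us'\<close>, by type and components, and it has
  the same rank; as \<open>\<beta>0 < \<beta>1\<close>, the truth values agree.\<close>

lemma same_atoms_base:
  assumes bf: "back_forth lang_star A' \<beta>2 as bs" and len: "length as = length bs"
    and V: "set as \<subseteq> V" "set bs \<subseteq> V"
    and us: "list_all2 (\<lambda>i i'. (base i, base i') \<in> set (zip as bs)) us us'"
  shows "same_atoms L A (map h us) (map h us')"
  unfolding same_atoms_def
proof (intro allI impI)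
  fix b assume b: "L_atom L b \<and> atom_vars b \<subseteq> {..<length (map h us)}"
  have p: "(base (us ! k), base (us' ! k)) \<in> set (zip as bs)" if "k < length us" for k
    using us that by (auto simp: list_all2_conv_all_nth)
  have len_us: "length us = length us'" using us by (rule list_all2_lengthD)
  have "base (us ! k) \<in> V \<and> base (us' ! k) \<in> V" if "k < length us" for k
    using set_zip_leftD[OF p[OF that]] set_zip_rightD[OF p[OF that]] V by blast
  then have UB: "set us \<subseteq> UB" "set us' \<subseteq> UB" using len_us by (auto simp: in_set_conv_nth)
  let ?r = "nd (code_atom b) us []"
  have "?r \<in> univ A'" using UB by simp
  from back_forth_forth[OF bf _ this, of "succ_cord \<beta>1"] obtain r'
    where r': "r' \<in> V" "back_forth lang_star A' (succ_cord \<beta>1) (as @ [?r]) (bs @ [r'])"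
    unfolding \<beta>2_def by auto
  have len': "length (as @ [?r]) = length (bs @ [r'])" using len by simp
  have at: "same_atoms lang_star A' (as @ [?r]) (bs @ [r'])"
    using back_forth_same_atoms[OF _ len' r'(2)] V_ne by simp
  have z: "(?r, r') \<in> set (zip (as @ [?r]) (bs @ [r']))" using len by simp
  obtain ys where ys: "r' = nd (code_atom b) ys []" "length ys = length us" "set ys \<subseteq> UB"
    using ety_nd_cases[OF r'(1) same_atoms_typ[OF at len' z]] by (metis length_0_conv list.size(3))
  have "ys = us'"
  proof (rule nth_equalityI)
    fix k assume k: "k < length ys"
    then have "(base (us ! k), base (us' ! k)) \<in> set (zip (as @ [?r]) (bs @ [r']))"
      using p[of k] ys(2) len by simp
    from same_atoms_comps[OF at len' z this, of k] show "ys ! k = us' ! k"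
      using k ys by (simp add: nth_append)
  qed (use ys(2) len_us in simp)
  moreover have "rkE ?r = rkE r'"
    using V UB r' by (intro rank_back_forth[OF r'(2) _ len' _ _ z]) auto
  ultimately have "fact_holds L A h (code_atom b) us \<longleftrightarrow> fact_holds L A h (code_atom b) us'"
    using ys(1) UB \<beta>01 by (auto simp: rk_Nil split: if_splits)
  moreover have "fact_holds L A h (code_atom b) vs \<longleftrightarrow> sat_atom A b (vl (map h vs))" if "length vs = length us" for vs
  proof -
    have "fact_holds L A h (code_atom b) vs \<longleftrightarrow> sat_atom A b (\<lambda>i. h (vs ! i))"
      using b that unfolding fact_holds_def by (auto dest: code_atom_inj)
    also have "\<dots> \<longleftrightarrow> sat_atom A b (vl (map h vs))"
      by (rule sat_atom_cong) (use b that in auto)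
    finally show ?thesis .
  qed
  ultimately show "sat_atom A b (vl (map h us)) \<longleftrightarrow> sat_atom A b (vl (map h us'))"
    using len_us by simp
qed

text \<open>A move in \<open>A\<close> is simulated by a single base element, so strict monotonicity
  of \<open>Zf\<close> is enough for the moves; starting the scale at \<open>\<beta>2\<close>
  settles the atoms.\<close>

theorem back_forth_unstar:
  "back_forth lang_star A' (Zf \<beta>2 \<gamma>) as bs \<Longrightarrow> length as = length bs \<Longrightarrow> set as \<subseteq> V \<Longrightarrow> set bs \<subseteq> V \<Longrightarrow>
    list_all2 (\<lambda>i i'. (base i, base i') \<in> set (zip as bs)) us us' \<Longrightarrow>
    back_forth L A \<gamma> (map h us) (map h us')"
proof (induction \<gamma> arbitrary: us us' as bs rule: less_induct)
  case (less \<gamma>)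
  show ?case
  proof (cases "\<gamma> = 0")
    case True
    have "back_forth lang_star A' \<beta>2 as bs"
      using back_forth_mono[OF _ less.prems(2,1) Zf_ge] V_ne by simp
    then show ?thesis using same_atoms_base less.prems True by (simp add: back_forth_0_iff)
  next
    case False
    have base_same: "\<exists>j\<in>UB. y = base j"
      if "same_atoms lang_star A' (as @ [x]) (bs @ [y])" "y \<in> V" "x = base i" for x y i
    proof -
      have "ety x = ety y"
        by (rule same_atoms_typ[OF that(1)]) (use less.prems(2) in auto)
      then show ?thesis using that by (auto elim: ety_base_cases)
    qed
    have base_same': "\<exists>j\<in>UB. x = base j"
      if "same_atoms lang_star A' (as @ [x]) (bs @ [y])" "x \<in> V" "y = base i" for x y i
    proof -
      have "ety x = ety y"
        by (rule same_atoms_typ[OF that(1)]) (use less.prems(2) in auto)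
      then show ?thesis using that by (auto elim: ety_base_cases)
    qed
    have IH: "back_forth L A \<gamma>' (map h us @ [h i]) (map h us' @ [h j])"
      if "\<gamma>' < \<gamma>" "i \<in> UB" "j \<in> UB" "back_forth lang_star A' (Zf \<beta>2 \<gamma>') (as @ [base i]) (bs @ [base j])" for \<gamma>' i j
    proof -
      have "list_all2 (\<lambda>k k'. (base k, base k') \<in> set (zip (as @ [base i]) (bs @ [base j]))) us us'"
        using less.prems(5) by (rule list_all2_mono) (use less.prems(2) in auto)
      then have "list_all2 (\<lambda>k k'. (base k, base k') \<in> set (zip (as @ [base i]) (bs @ [base j]))) (us @ [i]) (us' @ [j])"
        unfolding list_all2_append[OF list_all2_lengthD[OF less.prems(5)]] using less.prems(2)
        by (auto intro!: list_all2_appendI)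
      from less.IH[OF that(1,4), of "us @ [i]" "us' @ [j]"] this show ?thesis
        using less.prems(2-4) that(2,3) by simp
    qed
    have at: "same_atoms lang_star A' (as @ [x]) (bs @ [y])"
      if "back_forth lang_star A' \<delta> (as @ [x]) (bs @ [y])" for \<delta> x y
      using back_forth_same_atoms[OF _ _ that] less.prems(2) V_ne by simp
    show ?thesis
      unfolding back_forth_pos[OF False]
    proof (intro allI impI conjI ballI)
      fix \<gamma>' c assume \<gamma>': "\<gamma>' < \<gamma>" and "c \<in> univ A"
      then obtain i where i: "i \<in> UB" "c = h i" using h_surj by blast
      then have "base i \<in> univ A'" by simp
      from back_forth_forth[OF less.prems(1) Zf_mono[OF \<gamma>'] this] obtain y
        where y: "y \<in> V" "back_forth lang_star A' (Zf \<beta>2 \<gamma>') (as @ [base i]) (bs @ [y])" by auto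
      then obtain j where "j \<in> UB" "y = base j" using base_same at by blast
      then show "\<exists>d\<in>univ A. back_forth L A \<gamma>' (map h us @ [c]) (map h us' @ [d])"
        using IH[OF \<gamma>' i(1)] y i(2) h_in by blast
    next
      fix \<gamma>' c assume \<gamma>': "\<gamma>' < \<gamma>" and "c \<in> univ A"
      then obtain i where i: "i \<in> UB" "c = h i" using h_surj by blast
      then have "base i \<in> univ A'" by simp
      from back_forth_back[OF less.prems(1) Zf_mono[OF \<gamma>'] this] obtain y
        where y: "y \<in> V" "back_forth lang_star A' (Zf \<beta>2 \<gamma>') (as @ [y]) (bs @ [base i])" by auto
      then obtain j where "j \<in> UB" "y = base j" using base_same' at by blast
      then show "\<exists>d\<in>univ A. back_forth L A \<gamma>' (map h us @ [d]) (map h us' @ [c])"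
        using IH[OF \<gamma>' _ i(1)] y i(2) h_in by blast
    qed
  qed
qed

section \<open>Closing tuples under components\<close>

definition cmp_list :: "nat list \<Rightarrow> (nat \<times> nat) list \<Rightarrow> nat list" where
  "cmp_list as ps = map (\<lambda>(i, j). comps (as ! i) ! j) ps"

definition comp_idx :: "nat list \<Rightarrow> (nat \<times> nat) list" where
  "comp_idx as = concat (map (\<lambda>i. map (Pair i) [0..<length (comps (as ! i))]) [0..<length as])"

text \<open>The index list is computed from one tuple and applied to both, so that the two
  extensions correspond position by position.\<close>

definition adjoin :: "nat list \<Rightarrow> (nat \<times> nat) list \<Rightarrow> nat list" where
  "adjoin as ps = as @ cmp_list as ps"

lemma set_comp_idx: "(i, j) \<in> set (comp_idx as) \<longleftrightarrow> i < length as \<and> j < length (comps (as ! i))"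
  unfolding comp_idx_def by (auto simp: image_iff)

lemma length_adjoin [simp]: "length (adjoin as ps) = length as + length ps"
  by (simp add: adjoin_def cmp_list_def)

lemma adjoin_pair:
  "length as = length bs \<Longrightarrow> i < length as \<Longrightarrow> (as ! i, bs ! i) \<in> set (zip (adjoin as ps) (adjoin bs ps))"
  unfolding adjoin_def by (auto simp: in_set_zip)

lemma adjoin_V: "set as \<subseteq> V \<Longrightarrow> set ps \<subseteq> set (comp_idx as) \<Longrightarrow> set (adjoin as ps) \<subseteq> V"
proof -
  assume as: "set as \<subseteq> V" and ps: "set ps \<subseteq> set (comp_idx as)"
  have "comps (as ! i) ! j \<in> V" if "(i, j) \<in> set ps" for i j
  proof -
    have ij: "i < length as" "j < length (comps (as ! i))" using that ps by (auto simp: set_comp_idx)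
    then have "as ! i \<in> V" using as nth_mem by blast
    from comps_in_V[OF this] show ?thesis using nth_mem[OF ij(2)] by blast
  qed
  then show ?thesis using as by (auto simp: adjoin_def cmp_list_def)
qed

text \<open>Components are played one at a time, each at the price of one successor; the relations
  for components leave only one possible answer.\<close>

lemma back_forth_adjoin:
  assumes as: "set as \<subseteq> V" and len: "length as = length bs"
  shows "back_forth lang_star A' ((succ_cord ^^ length qs) \<eta>) (adjoin as ps) (adjoin bs ps) \<Longrightarrow>
    set (ps @ qs) \<subseteq> set (comp_idx as) \<Longrightarrow> back_forth lang_star A' \<eta> (adjoin as (ps @ qs)) (adjoin bs (ps @ qs))"
proof (induction qs arbitrary: ps)
  case (Cons q qs)
  obtain i j where q: "q = (i, j)" by force
  then have ij: "i < length as" "j < length (comps (as ! i))" using Cons.prems(2) by (simp_all add: set_comp_idx)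
  let ?c = "comps (as ! i) ! j"
  have "as ! i \<in> V" using as nth_mem ij(1) by blast
  from comps_in_V[OF this] have "?c \<in> univ A'" using nth_mem[OF ij(2)] by auto
  moreover have "(succ_cord ^^ length qs) \<eta> < (succ_cord ^^ length (q # qs)) \<eta>" by simp
  ultimately obtain d where d: "back_forth lang_star A' ((succ_cord ^^ length qs) \<eta>) (adjoin as ps @ [?c]) (adjoin bs ps @ [d])"
    using back_forth_forth[OF Cons.prems(1)] by blast
  have len': "length (adjoin as ps @ [?c]) = length (adjoin bs ps @ [d])" using len by simp
  have at: "same_atoms lang_star A' (adjoin as ps @ [?c]) (adjoin bs ps @ [d])"
    using back_forth_same_atoms[OF _ len' d] V_ne by simp
  have z: "(as ! i, bs ! i) \<in> set (zip (adjoin as ps @ [?c]) (adjoin bs ps @ [d]))"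
    "(?c, d) \<in> set (zip (adjoin as ps @ [?c]) (adjoin bs ps @ [d]))"
    using adjoin_pair[OF len ij(1), of ps] len by auto
  have "comps (bs ! i) ! j = d" using same_atoms_comps[OF at len' z ij(2)] by simp
  then have "back_forth lang_star A' ((succ_cord ^^ length qs) \<eta>) (adjoin as (ps @ [q])) (adjoin bs (ps @ [q]))"
    using d q by (simp add: adjoin_def cmp_list_def)
  then show ?case using Cons.IH[of "ps @ [q]"] Cons.prems(2) by simp
qed simp

definition base_part :: "nat list \<Rightarrow> nat list" where
  "base_part xs = map (\<lambda>x. snd (prod_decode x)) (filter (\<lambda>x. ety x = 0) xs)"

lemma snd_prod_decode_base [simp]: "snd (prod_decode (base i)) = i"
  by (simp add: base_def)

lemma base_part_zip:
  assumes "list_all2 (\<lambda>x y. ety x = ety y \<and> x \<in> V \<and> y \<in> V) xs ys"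
  shows "list_all2 (\<lambda>i i'. (base i, base i') \<in> set (zip xs ys)) (base_part xs) (base_part ys) \<and>
    (\<forall>i i'. (base i, base i') \<in> set (zip xs ys) \<longrightarrow> (i, i') \<in> set (zip (base_part xs) (base_part ys)))"
  using assms
proof (induction xs ys rule: list_all2_induct)
  case (Cons x xs y ys)
  show ?case
  proof (cases "ety x = 0")
    case True
    then obtain i j where "x = base i" "y = base j"
      using Cons.hyps by (metis ety_base_cases)
    then show ?thesis using Cons.IH unfolding base_part_def by (auto elim!: list_all2_mono)
  next
    case False
    then have "x \<noteq> base i" for i by auto
    then show ?thesis using False Cons unfolding base_part_def by (auto elim!: list_all2_mono)
  qed
qed (simp add: base_part_def)

text \<open>The converse of the extension lemmas: a high enough level forces the correspondence
  between two tuples, closed under components, to preserve ranks and hence to be a good map.\<close>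

lemma good_zip_adjoin:
  assumes as: "set as \<subseteq> V" "set bs \<subseteq> V" and len: "length as = length bs"
    and bf: "back_forth lang_star A' \<delta> (adjoin as (comp_idx as)) (adjoin bs (comp_idx as))" and \<delta>: "\<beta>2 \<le> \<delta>"
  defines "xs \<equiv> adjoin as (comp_idx as)" and "ys \<equiv> adjoin bs (comp_idx as)"
  shows "good (set (zip xs ys))" "base_in (set (zip xs ys)) (base_part xs) (base_part ys)"
    "set xs \<subseteq> V" "set ys \<subseteq> V" "length xs = length ys"
    "list_all2 (\<lambda>i i'. (base i, base i') \<in> set (zip xs ys)) (base_part xs) (base_part ys)"
proof -
  show len': "length xs = length ys" using len by (simp add: xs_def ys_def)
  have at: "same_atoms lang_star A' xs ys"
    using back_forth_same_atoms[OF _ len'] bf V_ne unfolding xs_def ys_def by simp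
  have xV: "set xs \<subseteq> V" using adjoin_V as unfolding xs_def by blast
  have ab: "(as ! i, bs ! i) \<in> set (zip xs ys)" if "i < length as" for i
    using that len by (auto simp: adjoin_def in_set_zip nth_append xs_def ys_def intro!: exI[of _ i])
  \<comment> \<open>Indices computed from \<open>as\<close> are legitimate for \<open>bs\<close>,
    since corresponding elements have equal types and hence equally many components.\<close>
  have idx: "set (comp_idx as) \<subseteq> set (comp_idx bs)"
  proof
    fix q assume q: "q \<in> set (comp_idx as)"
    obtain i j where ij: "q = (i, j)" by force
    then have "i < length as" "j < length (comps (as ! i))" using q by (simp_all add: set_comp_idx)
    then show "q \<in> set (comp_idx bs)"
      using length_comps[OF same_atoms_typ[OF at len' ab]] len ij by (simp add: set_comp_idx)
  qed
  have yV: "set ys \<subseteq> V" using adjoin_V[OF as(2) idx] unfolding ys_def by blast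
  show "set xs \<subseteq> V" "set ys \<subseteq> V" by fact+
  have \<beta>: "\<beta>1 < \<delta>" using \<delta> unfolding \<beta>2_def by (meson less_succ_cord less_le_trans order_less_trans)
  have cl: "comps x ! j \<in> set xs" if x: "x \<in> set xs" and j: "j < length (comps x)" for x j
  proof -
    have top: "set (comps (as ! i)) \<subseteq> set xs" if "i < length as" for i
    proof
      fix y assume "y \<in> set (comps (as ! i))"
      then obtain j where "j < length (comps (as ! i))" "y = comps (as ! i) ! j" by (auto simp: in_set_conv_nth)
      then have "(i, j) \<in> set (comp_idx as)" "y = (\<lambda>(i, j). comps (as ! i) ! j) (i, j)"
        using that by (simp_all add: set_comp_idx)
      then show "y \<in> set xs" unfolding xs_def adjoin_def cmp_list_def by (auto intro!: image_eqI)
    qed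
    have "x \<in> set as \<or> (\<exists>i<length as. x \<in> set (comps (as ! i)))"
      using x unfolding xs_def adjoin_def cmp_list_def by (auto simp: set_comp_idx)
    then have "\<exists>i<length as. set (comps x) \<subseteq> set (comps (as ! i))"
      using comps_comps as(1) by (metis in_set_conv_nth nth_mem subset_iff order_refl)
    then show ?thesis using top j nth_mem by blast
  qed
  show "good (set (zip xs ys))"
    unfolding good_def
  proof (intro conjI allI impI)
    fix x x' assume xx: "(x, x') \<in> set (zip xs ys)"
    show "x \<in> V" "x' \<in> V" using xx xV yV by (meson set_zip_leftD set_zip_rightD subsetD)+
    show "ety x = ety x'" by (rule same_atoms_typ[OF at len' xx])
    show "rkE x = rkE x'"
      using rank_back_forth[OF _ \<beta> len' xV yV xx] bf unfolding xs_def ys_def by blast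
    show "(comps x ! j, comps x' ! j) \<in> set (zip xs ys)" if j: "j < length (comps x)" for j
    proof -
      have "comps x ! j \<in> set xs" using cl j set_zip_leftD[OF xx] by blast
      then obtain k where k: "k < length xs" "comps x ! j = xs ! k" by (metis in_set_conv_nth)
      then have "(comps x ! j, ys ! k) \<in> set (zip xs ys)" using len' by (auto simp: in_set_zip)
      then show ?thesis using same_atoms_comps[OF at len' xx _ j] by metis
    qed
  next
    fix x x' y y' assume "(x, x') \<in> set (zip xs ys)" "(y, y') \<in> set (zip xs ys)"
    then show "x = y \<longleftrightarrow> x' = y'" using same_atoms_zip_eq[OF at len'] by blast
  qed simp
  have "list_all2 (\<lambda>x y. ety x = ety y \<and> x \<in> V \<and> y \<in> V) xs ys"
    unfolding list_all2_iff
  proof (intro conjI ballI)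
    show "length xs = length ys" by fact
    fix z assume z: "z \<in> set (zip xs ys)"
    obtain x y where xy: "z = (x, y)" by force
    then have "(x, y) \<in> set (zip xs ys)" using z by simp
    from set_zip_leftD[OF this] set_zip_rightD[OF this] same_atoms_typ[OF at len' this]
    show "case z of (x, y) \<Rightarrow> ety x = ety y \<and> x \<in> V \<and> y \<in> V" using xV yV xy by auto
  qed
  note bp = base_part_zip[OF this]
  then show l: "list_all2 (\<lambda>i i'. (base i, base i') \<in> set (zip xs ys)) (base_part xs) (base_part ys)" by blast
  have "length (base_part xs) = length (base_part ys)" by (rule list_all2_lengthD[OF l])
  moreover have "set (base_part xs) \<subseteq> UB" if "set xs \<subseteq> V" for xs
    using that unfolding base_part_def by (auto elim!: ety_base_cases dest!: subsetD)
  ultimately show "base_in (set (zip xs ys)) (base_part xs) (base_part ys)"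
    using bp xV yV unfolding base_in_def by blast
qed

section \<open>Comparison of Scott ranks\<close>

lemma base_part_adjoin: "set as \<subseteq> V \<Longrightarrow> set (map h (base_part (adjoin as (comp_idx as)))) \<subseteq> univ A"
  using adjoin_V[of as "comp_idx as"] h_in unfolding base_part_def by (auto elim!: ety_base_cases dest!: subsetD)

text \<open>Playing all components leads to a good map whose base tuples are equivalent at level
  \<open>\<gamma>\<close> in \<open>A\<close>, hence in one orbit; \<open>same_orbit_star\<close>
  lifts this to \<open>A'\<close>. The iterated successor pays for the components.\<close>

theorem SR_tuple_star_le:
  assumes as: "set as \<subseteq> V" and SR: "SR_tuple L A (map h (base_part (adjoin as (comp_idx as)))) \<le> \<gamma>"
  shows "SR_tuple lang_star A' as \<le> (succ_cord ^^ length (comp_idx as)) (Zf \<beta>2 \<gamma>)"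
proof -
  let ?xs = "adjoin as (comp_idx as)"
  show ?thesis
    unfolding SR_tuple_le_iff[OF str_A', unfolded univ_A', OF as]
  proof (intro ballI impI)
    fix bs assume "bs \<in> tuples A' (length as)"
      and bf: "back_forth lang_star A' ((succ_cord ^^ length (comp_idx as)) (Zf \<beta>2 \<gamma>)) as bs"
    then have bs: "set bs \<subseteq> V" and len: "length as = length bs" by (auto simp: tuples_def)
    let ?ys = "adjoin bs (comp_idx as)"
    have bf': "back_forth lang_star A' (Zf \<beta>2 \<gamma>) ?xs ?ys"
      using back_forth_adjoin[OF as len, of "comp_idx as" "Zf \<beta>2 \<gamma>" "[]"] bf by (simp add: adjoin_def cmp_list_def)
    note g = good_zip_adjoin[OF as bs len bf' Zf_ge]
    have "back_forth L A \<gamma> (map h (base_part ?xs)) (map h (base_part ?ys))"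
      by (rule back_forth_unstar[OF bf' g(5,3,4,6)])
    moreover have "map h (base_part ?ys) \<in> tuples A (length (map h (base_part ?xs)))"
      using g(2) h_in unfolding base_in_def tuples_def by auto
    ultimately have "same_orbit L A (map h (base_part ?xs)) (map h (base_part ?ys))"
      using SR unfolding SR_tuple_le_iff[OF strA base_part_adjoin[OF as]] by blast
    moreover have "list_all2 (\<lambda>x y. (x, y) \<in> set (zip ?xs ?ys)) as bs"
      using len adjoin_pair[OF len] unfolding list_all2_conv_all_nth by simp
    ultimately show "same_orbit lang_star A' as bs" by (intro same_orbit_star[OF g(1,2)])
  qed
qed

text \<open>For a tuple of rank \<open>\<mu>\<close> the preceding bound can exceed
  \<open>\<mu>\<close>. Instead, equivalence at level \<open>\<mu>\<close> gives equivalence in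
  \<open>A\<close> at all \<open>\<gamma> < \<mu>\<close>, and therefore at the limit
  \<open>\<mu>\<close>.\<close>

theorem SR_tuple_star_le_limit:
  assumes as: "set as \<subseteq> V" and SR: "SR_tuple L A (map h (base_part (adjoin as (comp_idx as)))) \<le> \<mu>"
    and \<mu>: "\<mu> \<noteq> 0" "\<And>\<gamma>. \<gamma> < \<mu> \<Longrightarrow> succ_cord \<gamma> < \<mu>" "\<And>\<gamma>. \<gamma> < \<mu> \<Longrightarrow> Zf \<beta>2 \<gamma> < \<mu>"
  shows "SR_tuple lang_star A' as \<le> \<mu>"
proof -
  let ?xs = "adjoin as (comp_idx as)"
  have iter: "(succ_cord ^^ n) \<gamma> < \<mu>" if "\<gamma> < \<mu>" for n \<gamma> using that \<mu>(2) by (induction n) auto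
  show ?thesis
    unfolding SR_tuple_le_iff[OF str_A', unfolded univ_A', OF as]
  proof (intro ballI impI)
    fix bs assume "bs \<in> tuples A' (length as)" and bf: "back_forth lang_star A' \<mu> as bs"
    then have bs: "set bs \<subseteq> V" and len: "length as = length bs" by (auto simp: tuples_def)
    let ?ys = "adjoin bs (comp_idx as)"
    have bf': "back_forth lang_star A' (Zf \<beta>2 \<gamma>) ?xs ?ys" if "\<gamma> < \<mu>" for \<gamma>
    proof -
      have "back_forth lang_star A' ((succ_cord ^^ length (comp_idx as)) (Zf \<beta>2 \<gamma>)) as bs"
        using back_forth_mono[OF _ len bf] V_ne iter[OF \<mu>(3)[OF that]] by (simp add: less_imp_le)
      then show ?thesis
        using back_forth_adjoin[OF as len, of "comp_idx as" "Zf \<beta>2 \<gamma>" "[]"] by (simp add: adjoin_def cmp_list_def)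
    qed
    have "0 < \<mu>" using \<mu>(1) zero_cord_least[of \<mu>] by (simp add: order_less_le)
    note g = good_zip_adjoin[OF as bs len bf'[OF this] Zf_ge]
    have "back_forth L A \<gamma> (map h (base_part ?xs)) (map h (base_part ?ys))" if "\<gamma> < \<mu>" for \<gamma>
      by (rule back_forth_unstar[OF bf'[OF that] g(5,3,4,6)])
    moreover have len_b: "length (map h (base_part ?xs)) = length (map h (base_part ?ys))"
      using g(2) unfolding base_in_def by simp
    ultimately have "back_forth L A \<mu> (map h (base_part ?xs)) (map h (base_part ?ys))"
      by (intro back_forth_limit[OF ne _ \<mu>(1)]) (use \<mu>(2) in auto)
    moreover have "map h (base_part ?ys) \<in> tuples A (length (map h (base_part ?xs)))"
      using g(2) h_in unfolding base_in_def tuples_def by auto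
    ultimately have "same_orbit L A (map h (base_part ?xs)) (map h (base_part ?ys))"
      using SR unfolding SR_tuple_le_iff[OF strA base_part_adjoin[OF as]] by blast
    moreover have "list_all2 (\<lambda>x y. (x, y) \<in> set (zip ?xs ?ys)) as bs"
      using len adjoin_pair[OF len] unfolding list_all2_conv_all_nth by simp
    ultimately show "same_orbit lang_star A' as bs" by (intro same_orbit_star[OF g(1,2)])
  qed
qed

lemma base_preimage: "set as \<subseteq> univ A \<Longrightarrow> \<exists>us. set us \<subseteq> UB \<and> as = map h us"
proof (induction as)
  case (Cons c cs)
  then obtain us where us: "set us \<subseteq> UB" "cs = map h us" by auto
  obtain i where "i \<in> UB" "c = h i" using h_surj[of c] Cons.prems by auto
  then show ?case using us by (intro exI[of _ "i # us"]) simp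
qed simp

text \<open>Base elements have no components, so base tuples with the same atoms form a good map at
  once. The automorphism of \<open>A'\<close> is brought back to \<open>A\<close> through agreement
  at all levels.\<close>

theorem SR_tuple_le_star:
  assumes us: "set us \<subseteq> UB" and SR: "SR_tuple lang_star A' (map base us) \<le> \<gamma>"
  shows "SR_tuple L A (map h us) \<le> Zf \<beta>2 \<gamma>"
proof -
  have sub: "set (map h us) \<subseteq> univ A" "set (map base us) \<subseteq> V" using us h_in by auto
  show ?thesis
    unfolding SR_tuple_le_iff[OF strA sub(1)]
  proof (intro ballI impI)
    fix cs assume cs: "cs \<in> tuples A (length (map h us))" and bf: "back_forth L A (Zf \<beta>2 \<gamma>) (map h us) cs"
    obtain us' where us': "set us' \<subseteq> UB" "cs = map h us'"
      using cs base_preimage[of cs] by (auto simp: tuples_def)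
    have len: "length us = length us'" using cs us' by (simp add: tuples_def)
    let ?p = "set (zip (map base us) (map base us'))"
    have at: "same_atoms L A (map h us) (map h us')"
      using back_forth_same_atoms[OF ne _ bf] us' len by simp
    have "i = j \<longleftrightarrow> i' = j'" if "(i, i') \<in> set (zip us us')" "(j, j') \<in> set (zip us us')" for i i' j j'
    proof -
      have "(h i, h i') \<in> set (zip (map h us) (map h us'))" "(h j, h j') \<in> set (zip (map h us) (map h us'))"
        using that by (auto simp: zip_map_map)
      from same_atoms_zip_eq[OF at _ this] have "h i = h j \<longleftrightarrow> h i' = h j'" using len by simp
      moreover have "i \<in> UB" "j \<in> UB" "i' \<in> UB" "j' \<in> UB"
        using that us us' by (meson set_zip_leftD set_zip_rightD subsetD)+
      ultimately show ?thesis using h_inj by simp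
    qed
    moreover have "i \<in> UB" "i' \<in> UB" if "(i, i') \<in> set (zip us us')" for i i'
      using that us us' by (meson set_zip_leftD set_zip_rightD subsetD)+
    ultimately have g: "good ?p" unfolding good_def by (auto simp: zip_map_map)
    have b: "base_in ?p us us'" using us us' len unfolding base_in_def by (auto simp: zip_map_map)
    have ab: "list_all2 (\<lambda>x y. (x, y) \<in> ?p) (map base us) (map base us')"
      using len unfolding list_all2_conv_all_nth by (auto simp: in_set_zip intro!: exI)
    have "back_forth lang_star A' \<gamma> (map base us) (map base us')"
      by (rule back_forth_star[OF _ g b ab]) (use bf us' in simp)
    moreover have "map base us' \<in> tuples A' (length (map base us))"
      using us' len by (auto simp: tuples_def)
    ultimately have orb: "same_orbit lang_star A' (map base us) (map base us')"
      using SR SR_tuple_le_iff[OF str_A'] sub(2) by simp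
    have "back_forth L A \<delta> (map h us) (map h us')" for \<delta>
    proof (rule back_forth_unstar)
      show "back_forth lang_star A' (Zf \<beta>2 \<delta>) (map base us) (map base us')"
        by (rule same_orbit_back_forth[OF str_A' orb]) (use sub(2) in simp)
      show "list_all2 (\<lambda>i i'. (base i, base i') \<in> ?p) us us'"
        using ab by (simp add: list_all2_map1 list_all2_map2)
    qed (use us us' len in auto)
    then show "same_orbit L A (map h us) cs"
      using us' len h_in us by (intro back_forth_all_same_orbit[OF strA]) auto
  qed
qed

text \<open>Ranks below \<open>\<mu>\<close> are transferred in both directions, so
  \<open>SR L A = \<mu>\<close> excludes a smaller value for \<open>A'\<close>. For
  \<open>succ_cord \<mu>\<close> the lower bound holds because tuple ranks that all lie below
  \<open>\<mu>\<close> in \<open>A'\<close> would come back as ranks below \<open>\<mu>\<close> in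
  \<open>A\<close>.\<close>

theorem SR_star:
  assumes \<mu>: "\<mu> \<noteq> 0" "\<And>\<gamma>. \<gamma> < \<mu> \<Longrightarrow> succ_cord \<gamma> < \<mu>" "\<And>\<gamma>. \<gamma> < \<mu> \<Longrightarrow> Zf \<beta>2 \<gamma> < \<mu>"
  shows "SR L A < \<mu> \<Longrightarrow> SR lang_star A' < \<mu>"
    and "SR L A = \<mu> \<Longrightarrow> SR lang_star A' = \<mu>"
    and "SR L A = succ_cord \<mu> \<Longrightarrow> SR lang_star A' = succ_cord \<mu>"
proof -
  let ?b = "\<lambda>as. map h (base_part (adjoin as (comp_idx as)))"
  have iter: "(succ_cord ^^ n) \<gamma> < \<mu>" if "\<gamma> < \<mu>" for n \<gamma> using that \<mu>(2) by (induction n) auto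
  have up: "SR_tuple lang_star A' as < Zf \<beta>2 (succ_cord \<gamma>)"
    if "set as \<subseteq> V" "SR_tuple L A (?b as) \<le> \<gamma>" for as \<gamma>
    using le_less_trans[OF SR_tuple_star_le[OF that] Zf_upper[OF less_succ_cord]] .
  have less: "SR L A < \<mu>" if "SR lang_star A' < \<mu>"
  proof -
    have "SR_tuple L A as < succ_cord (Zf \<beta>2 (SR lang_star A'))" if "set as \<subseteq> univ A" for as
    proof -
      obtain us where us: "set us \<subseteq> UB" "as = map h us" using base_preimage \<open>set as \<subseteq> univ A\<close> by blast
      have "SR_tuple lang_star A' (map base us) \<le> SR lang_star A'"
        by (rule less_imp_le, rule SR_tuple_less_SR) (use us(1) in auto)
      from SR_tuple_le_star[OF us(1) this] show ?thesis using us(2) by (simp add: less_succ_cord_iff)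
    qed
    then have "SR L A \<le> succ_cord (Zf \<beta>2 (SR lang_star A'))" by (rule SR_le)
    then show ?thesis using \<mu>(2)[OF \<mu>(3)[OF that]] by simp
  qed
  show "SR lang_star A' < \<mu>" if "SR L A < \<mu>"
  proof -
    have "SR_tuple lang_star A' as < Zf \<beta>2 (succ_cord (SR L A))" if "set as \<subseteq> univ A'" for as
      using that SR_tuple_less_SR[OF base_part_adjoin] by (intro up) (auto simp: less_imp_le)
    then have "SR lang_star A' \<le> Zf \<beta>2 (succ_cord (SR L A))" by (rule SR_le)
    then show ?thesis using \<mu>(3)[OF \<mu>(2)[OF that]] by simp
  qed
  have le: "SR lang_star A' \<le> \<mu>" if "SR L A \<le> \<mu>"
  proof (rule SR_le)
    fix as assume as: "set as \<subseteq> univ A'"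
    then have "SR_tuple L A (?b as) < \<mu>"
      using SR_tuple_less_SR[OF base_part_adjoin] that by (metis less_le_trans univ_A')
    then show "SR_tuple lang_star A' as < \<mu>"
      using up[of as "SR_tuple L A (?b as)"] as \<mu>(2,3) by (metis order_refl order_less_trans univ_A')
  qed
  show "SR lang_star A' = \<mu>" if "SR L A = \<mu>"
    using le less that by (metis order_refl antisym_conv2 less_irrefl)
  show "SR lang_star A' = succ_cord \<mu>" if eq: "SR L A = succ_cord \<mu>"
  proof (rule antisym)
    show "SR lang_star A' \<le> succ_cord \<mu>"
    proof (rule SR_le)
      fix as assume as: "set as \<subseteq> univ A'"
      then have "SR_tuple L A (?b as) \<le> \<mu>"
        using SR_tuple_less_SR[OF base_part_adjoin, of as L] unfolding eq less_succ_cord_iff by simp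
      then show "SR_tuple lang_star A' as < succ_cord \<mu>"
        using as SR_tuple_star_le_limit[OF _ _ \<mu>] by (simp add: less_succ_cord_iff)
    qed
    show "succ_cord \<mu> \<le> SR lang_star A'"
      unfolding succ_cord_le_iff
    proof (rule ccontr)
      assume "\<not> \<mu> < SR lang_star A'"
      then have star: "SR lang_star A' \<le> \<mu>" by simp
      have "SR_tuple L A as < \<mu>" if "set as \<subseteq> univ A" for as
      proof -
        obtain us where us: "set us \<subseteq> UB" "as = map h us" using base_preimage \<open>set as \<subseteq> univ A\<close> by blast
        let ?\<gamma> = "SR_tuple lang_star A' (map base us)"
        have "?\<gamma> < \<mu>" using us(1) star SR_tuple_less_SR[of "map base us" A' lang_star]
          by (metis V_simps(1) image_subset_iff less_le_trans list.set_map subsetD univ_A')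
        then show ?thesis using SR_tuple_le_star[OF us(1) order_refl] us(2) \<mu>(3) by (meson le_less_trans)
      qed
      then have "SR L A \<le> \<mu>" by (rule SR_le)
      then show False unfolding eq succ_cord_le_iff by simp
    qed
  qed
qed

end

section \<open>Computable functions and decidable predicates\<close>

lemma eval_fun: "eval X p x y \<Longrightarrow> eval X p x z \<Longrightarrow> y = z"
proof (induction arbitrary: z rule: eval.induct)
  case (eval_pair p x y q y')
  from eval_pair.prems show ?case by cases (use eval_pair.IH in blast)
next
  case (eval_comp q x y p y')
  from eval_comp.prems show ?case by cases (use eval_comp.IH in blast)
next
  case (eval_prec_0 p a y q)
  from eval_prec_0.prems show ?case by cases (use eval_prec_0.IH in auto)
next
  case (eval_prec_Suc p q a n y y')
  from eval_prec_Suc.prems show ?case by cases (use eval_prec_Suc.IH in auto)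
next
  case (eval_mu p a n)
  from eval_mu.prems show ?case
  proof cases
    case eval_mu
    show ?thesis
    proof (rule linorder_cases[of n z])
      assume "n < z" then show ?thesis using eval_mu(2) \<open>\<And>z. eval X p (prod_encode (a, n)) z \<Longrightarrow> 0 = z\<close> by fastforce
    next
      assume "z < n" then show ?thesis using eval_mu(1) eval_mu.IH(2) by fastforce
    qed
  qed
qed (auto elim: eval.cases)

definition p1 :: "nat \<Rightarrow> nat" where "p1 x = fst (prod_decode x)"
definition p2 :: "nat \<Rightarrow> nat" where "p2 x = snd (prod_decode x)"

lemma p_simps [simp]: "p1 (prod_encode (x, y)) = x" "p2 (prod_encode (x, y)) = y" "prod_encode (p1 x, p2 x) = x"
  by (simp_all add: p1_def p2_def)

definition cf :: "(nat \<Rightarrow> nat) \<Rightarrow> bool" where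
  "cf f \<longleftrightarrow> (\<exists>p. \<forall>x. eval {} p x (f x))"

definition dec :: "(nat \<Rightarrow> bool) \<Rightarrow> bool" where
  "dec R \<longleftrightarrow> cf (\<lambda>x. if R x then 1 else 0)"

definition cfl :: "(nat \<Rightarrow> nat list) \<Rightarrow> bool" where
  "cfl F \<longleftrightarrow> cf (\<lambda>x. list_encode (F x))"

named_theorems cf_intros

lemma computable_set_iff: "computable_set Y \<longleftrightarrow> dec (\<lambda>x. x \<in> Y)"
  by (simp add: computable_set_def turing_le_def dec_def cf_def)

lemma cf_computable_fun_on: "cf f \<Longrightarrow> computable_fun_on D f"
  by (auto simp: computable_fun_on_def cf_def)

lemma cf_id [cf_intros]: "cf (\<lambda>x. x)"
  unfolding cf_def
proof (intro exI allI)
  fix x show "eval {} (PPair PFst PSnd) x x"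
    using eval_pair[OF eval_fst eval_snd, of "{}" x] by simp
qed

lemma cf_comp: "cf f \<Longrightarrow> cf g \<Longrightarrow> cf (\<lambda>x. f (g x))"
  unfolding cf_def using eval_comp by metis

lemma dec_comp: "dec R \<Longrightarrow> cf g \<Longrightarrow> dec (\<lambda>x. R (g x))"
  unfolding dec_def by (rule cf_comp)

lemma cf_pair [cf_intros]: "cf f \<Longrightarrow> cf g \<Longrightarrow> cf (\<lambda>x. prod_encode (f x, g x))"
  unfolding cf_def using eval_pair by metis

lemma cf_p1 [cf_intros]: "cf f \<Longrightarrow> cf (\<lambda>x. p1 (f x))"
  by (rule cf_comp) (unfold cf_def p1_def, auto intro: eval_fst)

lemma cf_p2 [cf_intros]: "cf f \<Longrightarrow> cf (\<lambda>x. p2 (f x))"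
  by (rule cf_comp) (unfold cf_def p2_def, auto intro: eval_snd)

lemma cf_Suc [cf_intros]: "cf f \<Longrightarrow> cf (\<lambda>x. Suc (f x))"
  by (rule cf_comp) (unfold cf_def, auto intro: eval_succ)

lemma cf_const [cf_intros]: "cf (\<lambda>x. c)"
proof (induction c)
  case 0 show ?case unfolding cf_def by (auto intro: eval_zero)
qed (rule cf_Suc)

lemma cf_rec [cf_intros]:
  assumes "cf b" "cf (\<lambda>z. G (p1 z) (p1 (p2 z)) (p2 (p2 z)))" "cf k"
  shows "cf (\<lambda>x. rec_nat (b x) (G x) (k x))"
proof -
  obtain p q where p: "\<And>x. eval {} p x (b x)" and q: "\<And>z. eval {} q z (G (p1 z) (p1 (p2 z)) (p2 (p2 z)))"
    using assms unfolding cf_def by blast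
  have "eval {} (PPrec p q) (prod_encode (x, n)) (rec_nat (b x) (G x) n)" for x n
  proof (induction n)
    case (Suc n)
    show ?case
      using eval_prec_Suc[OF Suc, of "rec_nat (b x) (G x) (Suc n)"] q[of "prod_encode (x, prod_encode (n, rec_nat (b x) (G x) n))"] by simp
  qed (auto intro: eval_prec_0 p)
  then have "cf (\<lambda>z. rec_nat (b (p1 z)) (G (p1 z)) (p2 z))"
    unfolding cf_def by (metis p_simps(3))
  from cf_comp[OF this cf_pair[OF cf_id assms(3)]] show ?thesis by simp
qed

lemma cf_if [cf_intros]:
  assumes "dec R" "cf f" "cf g" shows "cf (\<lambda>x. if R x then f x else g x)"
proof -
  have "cf (\<lambda>x. rec_nat (g x) (\<lambda>_ _. f x) (if R x then 1 else 0))"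
    by (intro cf_rec assms cf_comp[OF assms(2)] cf_p1 cf_id assms(1)[unfolded dec_def])
  moreover have "rec_nat a (\<lambda>_ _. b) (if c then 1 else 0) = (if c then b else a)" for a b :: nat and c
    by simp
  ultimately show ?thesis by simp
qed

lemma dec_const [cf_intros]: "dec (\<lambda>x. c)"
  unfolding dec_def by (rule cf_const)

lemma dec_not [cf_intros]: "dec R \<Longrightarrow> dec (\<lambda>x. \<not> R x)"
  unfolding dec_def[of "\<lambda>x. \<not> R x"] by (rule back_subst[of cf], rule cf_if[of R "\<lambda>_. 0" "\<lambda>_. 1"]) (auto intro: cf_const)

lemma dec_and [cf_intros]: "dec R \<Longrightarrow> dec S \<Longrightarrow> dec (\<lambda>x. R x \<and> S x)"
  unfolding dec_def[of "\<lambda>x. R x \<and> S x"]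
  by (rule back_subst[of cf], rule cf_if[of R "\<lambda>x. if S x then 1 else 0" "\<lambda>_. 0"]) (auto intro: cf_intros)

lemma dec_or [cf_intros]: "dec R \<Longrightarrow> dec S \<Longrightarrow> dec (\<lambda>x. R x \<or> S x)"
  using dec_not[OF dec_and[OF dec_not dec_not], of R S] by simp

lemma dec_imp [cf_intros]: "dec R \<Longrightarrow> dec S \<Longrightarrow> dec (\<lambda>x. R x \<longrightarrow> S x)"
  using dec_or[OF dec_not, of R S] by (simp only: imp_conv_disj)

lemma dec_iff [cf_intros]: "dec R \<Longrightarrow> dec S \<Longrightarrow> dec (\<lambda>x. R x \<longleftrightarrow> S x)"
  using dec_and[OF dec_imp dec_imp, of R S S R] by (simp only: iff_conv_conj_imp)

lemma cf_add [cf_intros]: assumes "cf f" "cf g" shows "cf (\<lambda>x. f x + g x)"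
proof -
  have "cf (\<lambda>x. rec_nat (f x) (\<lambda>_ y. Suc y) (g x))" by (intro cf_intros assms)
  moreover have "rec_nat m (\<lambda>_ y. Suc y) n = m + n" for m n by (induction n) auto
  ultimately show ?thesis by simp
qed

lemma cf_diff [cf_intros]: assumes "cf f" "cf g" shows "cf (\<lambda>x. f x - g x)"
proof -
  have "cf (\<lambda>x. rec_nat (f x) (\<lambda>_ y. rec_nat 0 (\<lambda>n _. n) y) (g x))" by (intro cf_intros assms)
  moreover have "rec_nat 0 (\<lambda>n _. n) m = m - 1" for m :: nat by (cases m) auto
  moreover have "rec_nat m (\<lambda>_ y. y - 1) n = m - n" for m n :: nat by (induction n) auto
  ultimately show ?thesis by simp
qed

lemma cf_mult [cf_intros]: assumes "cf f" "cf g" shows "cf (\<lambda>x. f x * g x)"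
proof -
  have "cf (\<lambda>x. rec_nat 0 (\<lambda>_ y. y + f x) (g x))" by (intro cf_intros cf_comp[OF assms(1)] assms)
  moreover have "rec_nat 0 (\<lambda>_ y. y + m) n = m * n" for m n :: nat by (induction n) auto
  ultimately show ?thesis by simp
qed

lemma cf_power [cf_intros]: assumes "cf f" "cf g" shows "cf (\<lambda>x. f x ^ g x)"
proof -
  have "cf (\<lambda>x. rec_nat 1 (\<lambda>_ y. y * f x) (g x))" by (intro cf_intros cf_comp[OF assms(1)] assms)
  moreover have "rec_nat 1 (\<lambda>_ y. y * m) n = m ^ n" for m n :: nat by (induction n) auto
  ultimately show ?thesis by simp
qed

lemma dec_le [cf_intros]: assumes "cf f" "cf g" shows "dec (\<lambda>x. f x \<le> g x)"
proof -
  have "cf (\<lambda>x. rec_nat 1 (\<lambda>_ _. 0) (f x - g x))" by (intro cf_intros assms)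
  moreover have "rec_nat 1 (\<lambda>_ _. 0) (m - n) = (if m \<le> n then 1 else (0::nat))" for m n :: nat
    by (cases "m - n") auto
  ultimately show ?thesis unfolding dec_def by (simp del: One_nat_def)
qed

lemma dec_less [cf_intros]: "cf f \<Longrightarrow> cf g \<Longrightarrow> dec (\<lambda>x. f x < g x)"
  using dec_le[OF cf_Suc, of f g] by (simp add: Suc_le_eq)

lemma dec_eq [cf_intros]: "cf f \<Longrightarrow> cf g \<Longrightarrow> dec (\<lambda>x. f x = g x)"
  using dec_and[OF dec_le dec_le, of f g g f] by (simp add: eq_iff)

lemma dec_ball [cf_intros]:
  assumes "cf k" "dec (\<lambda>z. R (p1 z) (p2 z))" shows "dec (\<lambda>x. \<forall>i<k x. R x i)"
proof -
  have "dec (\<lambda>z. R (p1 z) (p1 (p2 z)))"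
  proof -
    have "cf (\<lambda>z. prod_encode (p1 z, p1 (p2 z)))" by (intro cf_intros)
    from dec_comp[OF assms(2) this] show ?thesis by simp
  qed
  then have "cf (\<lambda>x. rec_nat 1 (\<lambda>i y. if R x i then y else 0) (k x))" by (intro cf_intros assms)
  moreover have "rec_nat 1 (\<lambda>i y. if R x i then y else 0) n = (if \<forall>i<n. R x i then 1 else (0::nat))" for x n
    by (induction n) (auto simp: less_Suc_eq)
  ultimately show ?thesis unfolding dec_def by (simp del: One_nat_def)
qed

lemma dec_bex [cf_intros]: "cf k \<Longrightarrow> dec (\<lambda>z. R (p1 z) (p2 z)) \<Longrightarrow> dec (\<lambda>x. \<exists>i<k x. R x i)"
  using dec_not[OF dec_ball[OF _ dec_not], of k R] by simp

lemma semidecidable_exists: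
  assumes "dec (\<lambda>z. R (p1 z) (p2 z))"
  shows "\<exists>p. \<forall>x. (\<exists>y. eval {} p x y) \<longleftrightarrow> (\<exists>n. R x n)"
proof -
  \<comment> \<open>\<open>PMu\<close> searches for the value 0, so the test is negated.\<close>
  have "cf (\<lambda>z. if R (p1 z) (p2 z) then 0 else 1)" by (intro cf_intros assms)
  then obtain q where q: "\<And>z. eval {} q z (if R (p1 z) (p2 z) then 0 else 1)" unfolding cf_def by blast
  have q': "eval {} q (prod_encode (x, n)) (if R x n then 0 else 1)" for x n
    using q[of "prod_encode (x, n)"] by simp
  show ?thesis
  proof (intro exI[of _ "PMu q"] allI iffI)
    fix x assume "\<exists>y. eval {} (PMu q) x y"
    then obtain n where "eval {} q (prod_encode (x, n)) 0" by (auto elim: eval.cases)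
    then show "\<exists>n. R x n" using eval_fun[OF q'] by (metis zero_neq_one)
  next
    fix x assume "\<exists>n. R x n"
    then have l: "R x (LEAST n. R x n)" by (rule LeastI_ex)
    have "eval {} (PMu q) x (LEAST n. R x n)"
    proof (rule eval_mu)
      show "eval {} q (prod_encode (x, LEAST n. R x n)) 0" using q'[of x "LEAST n. R x n"] l by simp
      show "\<forall>m<LEAST n. R x n. \<exists>y>0. eval {} q (prod_encode (x, m)) y"
        using q'[of x] not_less_Least[of _ "R x"] by (metis zero_less_one)
    qed
    then show "\<exists>y. eval {} (PMu q) x y" by blast
  qed
qed

section \<open>Computable operations on lists\<close>

lemma cfl_decode [cf_intros]: "cf f \<Longrightarrow> cfl (\<lambda>x. list_decode (f x))"
  by (simp add: cfl_def)

lemma cf_encode [cf_intros]: "cfl F \<Longrightarrow> cf (\<lambda>x. list_encode (F x))"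
  by (simp add: cfl_def)

lemma cfl_Nil [cf_intros]: "cfl (\<lambda>x. [])"
  by (simp add: cfl_def cf_const)

definition lhd :: "nat list \<Rightarrow> nat" where
  "lhd xs = (case xs of [] \<Rightarrow> 0 | x # _ \<Rightarrow> x)"

lemma lhd_simps [simp]: "lhd [] = 0" "lhd (x # xs) = x"
  by (simp_all add: lhd_def)

lemma lhd_drop: "i < length xs \<Longrightarrow> lhd (drop i xs) = xs ! i"
  by (simp add: Cons_nth_drop_Suc[symmetric])

text \<open>Makes the formulas for head and tail correct for the empty list: its code 0 has the
  truncated predecessor 0, which decodes to a pair of zeros.\<close>

lemma p12_0: "p1 0 = 0" "p2 0 = 0"
  by (simp_all add: p1_def p2_def prod_decode_def prod_decode_aux.simps)

lemma cf_lhd [cf_intros]: assumes "cfl F" shows "cf (\<lambda>x. lhd (F x))"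
proof -
  have "lhd (F x) = p1 (list_encode (F x) - 1)" for x
    by (cases "F x") (simp_all add: p12_0)
  moreover have "cf (\<lambda>x. p1 (list_encode (F x) - 1))" by (intro cf_intros assms)
  ultimately show ?thesis by simp
qed

lemma cfl_tl [cf_intros]: assumes "cfl F" shows "cfl (\<lambda>x. tl (F x))"
proof -
  have "list_encode (tl (F x)) = p2 (list_encode (F x) - 1)" for x
    by (cases "F x") (simp_all add: p12_0)
  moreover have "cf (\<lambda>x. p2 (list_encode (F x) - 1))" by (intro cf_intros assms)
  ultimately show ?thesis unfolding cfl_def[of "\<lambda>x. tl (F x)"] by simp
qed

lemma cfl_drop [cf_intros]: assumes "cf k" "cfl F" shows "cfl (\<lambda>x. drop (k x) (F x))"
proof -
  have "cf (\<lambda>x. rec_nat (list_encode (F x)) (\<lambda>_ y. list_encode (tl (list_decode y))) (k x))"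
    by (intro cf_intros assms)
  moreover have "rec_nat (list_encode xs) (\<lambda>_ y. list_encode (tl (list_decode y))) n = list_encode (drop n xs)" for xs n
    by (induction n) (simp_all add: drop_Suc tl_drop)
  ultimately show ?thesis by (simp add: cfl_def)
qed

lemma dec_list_eq [cf_intros]: "cfl F \<Longrightarrow> cfl G \<Longrightarrow> dec (\<lambda>x. F x = G x)"
  using dec_eq[of "\<lambda>x. list_encode (F x)" "\<lambda>x. list_encode (G x)"] by (simp add: cfl_def)

lemma length_le_list_encode: "length xs \<le> list_encode xs"
proof (induction xs)
  case (Cons x xs)
  then show ?case using le_prod_encode_2[of "list_encode xs" x] by simp
qed simp

text \<open>The code of a list bounds its length, so a recursion up to the code can count the
  nonempty tails.\<close>

lemma cf_length [cf_intros]: assumes "cfl F" shows "cf (\<lambda>x. length (F x))"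
proof -
  have "cf (\<lambda>x. rec_nat 0 (\<lambda>i y. if drop i (F x) = [] then y else Suc y) (list_encode (F x)))"
  proof -
    have "cfl (\<lambda>z. F (p1 z))"
      unfolding cfl_def by (rule cf_comp[of "\<lambda>x. list_encode (F x)"]) (intro cf_intros assms)+
    then show ?thesis by (intro cf_intros assms)
  qed
  moreover have "rec_nat 0 (\<lambda>i y. if drop i xs = [] then y else Suc y) n = min n (length xs)" for xs :: "nat list" and n
    by (induction n) auto
  ultimately show ?thesis using length_le_list_encode by (simp add: min_absorb2)
qed

lemma dec_list_ball [cf_intros]:
  assumes "cfl F" "dec (\<lambda>z. R (p1 z) (p2 z))" shows "dec (\<lambda>x. \<forall>y\<in>set (F x). R x y)"
proof -
  have F: "cfl (\<lambda>z. F (p1 z))"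
    unfolding cfl_def by (rule cf_comp[of "\<lambda>x. list_encode (F x)"]) (intro cf_intros assms)+
  have "dec (\<lambda>z. R (p1 z) (lhd (drop (p2 z) (F (p1 z)))))"
  proof -
    have "cf (\<lambda>z. prod_encode (p1 z, lhd (drop (p2 z) (F (p1 z)))))" by (intro cf_intros F)
    from dec_comp[OF assms(2) this] show ?thesis by simp
  qed
  then have "dec (\<lambda>x. \<forall>i<length (F x). R x (lhd (drop i (F x))))" by (intro cf_intros assms)
  moreover have "(\<forall>y\<in>set (F x). R x y) \<longleftrightarrow> (\<forall>i<length (F x). R x (lhd (drop i (F x))))" for x
    by (simp add: lhd_drop all_set_conv_all_nth)
  ultimately show ?thesis by simp
qed

lemma finite_dec: "finite Y \<Longrightarrow> dec (\<lambda>x. x \<in> Y)"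
proof (induction Y rule: finite_induct)
  case (insert y Y)
  have "dec (\<lambda>x. x = y \<or> x \<in> Y)" by (intro cf_intros insert.IH)
  then show ?case by simp
qed (simp add: dec_const)

section \<open>Infinitary conjunctive normal forms of arithmetical predicates\<close>

declare One_nat_def [simp del]

text \<open>A literal is a pair of a propositional variable and a sign.  A clause system is given by a
  function \<open>l\<close> whose value at \<open>(c, y)\<close> is the \<open>y\<close>-th literal of the \<open>c\<close>-th clause.\<close>

definition holds :: "nat set \<Rightarrow> nat \<Rightarrow> bool" where
  "holds M t \<longleftrightarrow> (p1 t \<in> M \<longleftrightarrow> p2 t \<noteq> 0)"

definition mdl :: "(nat \<Rightarrow> nat) \<Rightarrow> nat set \<Rightarrow> bool" where
  "mdl l M \<longleftrightarrow> (\<forall>c. \<exists>y. holds M (l (prod_encode (c, y))))"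

definition zpart :: "nat set \<Rightarrow> nat set" where
  "zpart M = {z. prod_encode (0, z) \<in> M}"

text \<open>A predicate of a set \<open>Z\<close> and a number \<open>x\<close> is arithmetical if some computable clause system
  defines it: the variables \<open>(0, z)\<close> stand for \<open>z \<in> Z\<close>, the variables \<open>(1, x)\<close> for the truth of the
  predicate, and the remaining ones are auxiliary.\<close>

definition arith :: "(nat set \<Rightarrow> nat \<Rightarrow> bool) \<Rightarrow> bool" where
  "arith P \<longleftrightarrow> (\<exists>l. cf l \<and> (\<forall>Z. \<exists>M. mdl l M \<and> zpart M = Z) \<and>
     (\<forall>M x. mdl l M \<longrightarrow> (prod_encode (1, x) \<in> M \<longleftrightarrow> P (zpart M) x)))"

named_theorems arith_intros

text \<open>The variables for \<open>Z\<close> are shared by the systems that are combined; all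
  others are moved apart by the tag \<open>k\<close>.\<close>

definition ren_var :: "nat \<Rightarrow> nat \<Rightarrow> nat" where
  "ren_var k v = (if p1 v = 0 then v else prod_encode (k, v))"

definition ren_lit :: "nat \<Rightarrow> nat \<Rightarrow> nat" where
  "ren_lit k t = prod_encode (ren_var k (p1 t), p2 t)"

definition pull :: "nat \<Rightarrow> nat set \<Rightarrow> nat set" where
  "pull k M = {v. ren_var k v \<in> M}"

lemma holds_ren_lit [simp]: "holds M (ren_lit k t) \<longleftrightarrow> holds (pull k M) t"
  by (simp add: holds_def ren_lit_def pull_def)

lemma holds_prod_encode [simp]: "holds M (prod_encode (v, s)) \<longleftrightarrow> (v \<in> M \<longleftrightarrow> s \<noteq> 0)"
  by (simp add: holds_def)

lemma zpart_pull [simp]: "zpart (pull k M) = zpart M"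
  by (simp add: zpart_def pull_def ren_var_def)

lemma cf_ren_lit: "cf f \<Longrightarrow> cf (\<lambda>x. ren_lit k (f x))"
proof -
  have "cf (\<lambda>t. prod_encode (if p1 (p1 t) = 0 then p1 t else prod_encode (k, p1 t), p2 t))" by (intro cf_intros)
  then have "cf (ren_lit k)" unfolding ren_lit_def[abs_def] ren_var_def .
  then show "cf f \<Longrightarrow> cf (\<lambda>x. ren_lit k (f x))" by (rule cf_comp)
qed

text \<open>Tseitin's transformation: the variables \<open>(2, (1, x))\<close> and \<open>(3, (1, x))\<close> stand for the truth
  values of the two given predicates, and the system \<open>l0\<close> links them to that of the new one.\<close>

lemma arith_combine:
  assumes P: "arith P" and Q: "arith Q" and l0: "cf l0"
    and link: "\<And>M. (\<And>x. prod_encode (2, prod_encode (1, x)) \<in> M \<longleftrightarrow> P (zpart M) x) \<Longrightarrow>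
      (\<And>x. prod_encode (3, prod_encode (1, x)) \<in> M \<longleftrightarrow> Q (zpart M) x) \<Longrightarrow>
      mdl l0 M \<longleftrightarrow> (\<forall>x. prod_encode (1, x) \<in> M \<longleftrightarrow> R (zpart M) x)"
  shows "arith R"
proof -
  obtain lp where lp: "cf lp" "\<And>Z. \<exists>M. mdl lp M \<and> zpart M = Z"
    "\<And>M x. mdl lp M \<Longrightarrow> prod_encode (1, x) \<in> M \<longleftrightarrow> P (zpart M) x" using P unfolding arith_def by blast
  obtain lq where lq: "cf lq" "\<And>Z. \<exists>M. mdl lq M \<and> zpart M = Z"
    "\<And>M x. mdl lq M \<Longrightarrow> prod_encode (1, x) \<in> M \<longleftrightarrow> Q (zpart M) x" using Q unfolding arith_def by blast
  define l where "l z = (if p1 (p1 z) = 0 then ren_lit 2 (lp (prod_encode (p2 (p1 z), p2 z)))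
    else if p1 (p1 z) = 1 then ren_lit 3 (lq (prod_encode (p2 (p1 z), p2 z)))
    else l0 (prod_encode (p2 (p1 z), p2 z)))" for z
  have "cf l" unfolding l_def
    by (intro cf_intros cf_ren_lit cf_comp[OF lp(1)] cf_comp[OF lq(1)] cf_comp[OF l0])
  have mdl: "mdl l M \<longleftrightarrow> mdl lp (pull 2 M) \<and> mdl lq (pull 3 M) \<and> mdl l0 M" for M
  proof
    assume l: "mdl l M"
    have "\<exists>y. holds (pull 2 M) (lp (prod_encode (c, y)))" for c
      using l[unfolded mdl_def, rule_format, of "prod_encode (0, c)"] by (simp add: l_def)
    moreover have "\<exists>y. holds (pull 3 M) (lq (prod_encode (c, y)))" for c
      using l[unfolded mdl_def, rule_format, of "prod_encode (1, c)"] by (simp add: l_def)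
    moreover have "\<exists>y. holds M (l0 (prod_encode (c, y)))" for c
      using l[unfolded mdl_def, rule_format, of "prod_encode (2, c)"] by (simp add: l_def)
    ultimately show "mdl lp (pull 2 M) \<and> mdl lq (pull 3 M) \<and> mdl l0 M" by (simp add: mdl_def)
  next
    assume a: "mdl lp (pull 2 M) \<and> mdl lq (pull 3 M) \<and> mdl l0 M"
    show "mdl l M"
      unfolding mdl_def
    proof
      fix c
      consider "p1 c = 0" | "p1 c = 1" | "p1 c \<noteq> 0" "p1 c \<noteq> 1" by blast
      then show "\<exists>y. holds M (l (prod_encode (c, y)))"
        using a by cases (simp_all add: mdl_def l_def)
    qed
  qed
  have pull: "prod_encode (1, x) \<in> pull k M \<longleftrightarrow> prod_encode (k, prod_encode (1, x)) \<in> M" for k x M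
    by (simp add: pull_def ren_var_def)
  have "\<exists>M. mdl l M \<and> zpart M = Z" for Z
  proof -
    obtain Mp where Mp: "mdl lp Mp" "zpart Mp = Z" using lp(2) by blast
    obtain Mq where Mq: "mdl lq Mq" "zpart Mq = Z" using lq(2) by blast
    define M where "M = {v. (p1 v = 0 \<and> p2 v \<in> Z) \<or> (p1 v = 1 \<and> R Z (p2 v)) \<or>
      (p1 v = 2 \<and> p2 v \<in> Mp) \<or> (p1 v = 3 \<and> p2 v \<in> Mq)}"
    have Z: "zpart M = Z" by (auto simp: zpart_def M_def)
    have "v \<in> pull 2 M \<longleftrightarrow> v \<in> Mp" "v \<in> pull 3 M \<longleftrightarrow> v \<in> Mq" for v
    proof -
      have "prod_encode (0, z) \<in> Mp \<longleftrightarrow> z \<in> Z" "prod_encode (0, z) \<in> Mq \<longleftrightarrow> z \<in> Z" for z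
        using Mp(2) Mq(2) unfolding zpart_def by blast+
      from this[of "p2 v"] show "v \<in> pull 2 M \<longleftrightarrow> v \<in> Mp" "v \<in> pull 3 M \<longleftrightarrow> v \<in> Mq"
        using p_simps(3)[of v] by (cases "p1 v = 0"; simp add: pull_def ren_var_def M_def)+
    qed
    then have "pull 2 M = Mp" "pull 3 M = Mq" by blast+
    moreover have "mdl l0 M"
    proof (subst link)
      show "prod_encode (2, prod_encode (1, x)) \<in> M \<longleftrightarrow> P (zpart M) x" for x
        using lp(3)[OF Mp(1)] Mp(2) Z by (simp add: M_def)
      show "prod_encode (3, prod_encode (1, x)) \<in> M \<longleftrightarrow> Q (zpart M) x" for x
        using lq(3)[OF Mq(1)] Mq(2) Z by (simp add: M_def)
      show "\<forall>x. prod_encode (1, x) \<in> M \<longleftrightarrow> R (zpart M) x" using Z by (simp add: M_def)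
    qed
    ultimately show ?thesis using Mp(1) Mq(1) Z mdl by metis
  qed
  moreover have "prod_encode (1, x) \<in> M \<longleftrightarrow> R (zpart M) x" if "mdl l M" for M x
  proof -
    have "mdl l0 M \<longleftrightarrow> (\<forall>x. prod_encode (1, x) \<in> M \<longleftrightarrow> R (zpart M) x)"
      using that lp(3)[of "pull 2 M"] lq(3)[of "pull 3 M"] unfolding mdl pull by (intro link) auto
    then show ?thesis using that mdl by blast
  qed
  ultimately show ?thesis using \<open>cf l\<close> unfolding arith_def by blast
qed

lemma arith_not [arith_intros]: assumes "arith P" shows "arith (\<lambda>Z x. \<not> P Z x)"
proof (rule arith_combine[OF assms assms])
  let ?v = "\<lambda>z. p1 (p1 z)"
  \<comment> \<open>A clause number codes \<open>x\<close> and a sign. Sign 0 gives the clause that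
    one of the old and the new predicate fails at \<open>x\<close>, any other sign the clause that
    one of them holds.\<close>
  let ?l = "\<lambda>z. if p2 z = 0 then prod_encode (prod_encode (1, ?v z), p2 (p1 z))
    else prod_encode (prod_encode (2, prod_encode (1, ?v z)), p2 (p1 z))"
  show "cf ?l" by (intro cf_intros)
  fix M assume *: "\<And>x. prod_encode (2, prod_encode (1, x)) \<in> M \<longleftrightarrow> P (zpart M) x"
  show "mdl ?l M \<longleftrightarrow> (\<forall>x. prod_encode (1, x) \<in> M \<longleftrightarrow> \<not> P (zpart M) x)"
  proof
    assume m: "mdl ?l M"
    have "\<exists>y. holds M (?l (prod_encode (prod_encode (x, i), y)))" for x i using m unfolding mdl_def by blast
    note m' = this
    show "\<forall>x. prod_encode (1, x) \<in> M \<longleftrightarrow> \<not> P (zpart M) x"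
    proof
      fix x show "prod_encode (1, x) \<in> M \<longleftrightarrow> \<not> P (zpart M) x"
        using m'[of x 0] m'[of x 1] by (cases "P (zpart M) x") (auto simp: * split: if_splits)
    qed
  next
    assume a: "\<forall>x. prod_encode (1, x) \<in> M \<longleftrightarrow> \<not> P (zpart M) x"
    have "holds M (?l (prod_encode (c, 0))) \<or> holds M (?l (prod_encode (c, 1)))" for c
      by (cases "p2 c = 0"; cases "P (zpart M) (p1 c)") (simp_all add: * a)
    then show "mdl ?l M" unfolding mdl_def by blast
  qed
qed

lemma arith_and [arith_intros]:
  assumes "arith P" "arith Q" shows "arith (\<lambda>Z x. P Z x \<and> Q Z x)"
proof (rule arith_combine[OF assms])
  let ?v = "\<lambda>z. p1 (p1 z)" let ?i = "\<lambda>z. p2 (p1 z)"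
  \<comment> \<open>The clauses 0 and 1 say that the conjunction implies each conjunct, selected by
    the tag \<open>2 + ?i z\<close>; the others give the converse.\<close>
  let ?l = "\<lambda>z. if ?i z \<ge> 2
    then (if p2 z = 0 then prod_encode (prod_encode (1, ?v z), 1) else
          if p2 z = 1 then prod_encode (prod_encode (2, prod_encode (1, ?v z)), 0)
          else prod_encode (prod_encode (3, prod_encode (1, ?v z)), 0))
    else (if p2 z = 0 then prod_encode (prod_encode (1, ?v z), 0)
          else prod_encode (prod_encode (2 + ?i z, prod_encode (1, ?v z)), 1))"
  show "cf ?l" by (intro cf_intros)
  fix M assume *: "\<And>x. prod_encode (2, prod_encode (1, x)) \<in> M \<longleftrightarrow> P (zpart M) x"
    "\<And>x. prod_encode (3, prod_encode (1, x)) \<in> M \<longleftrightarrow> Q (zpart M) x"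
  show "mdl ?l M \<longleftrightarrow> (\<forall>x. prod_encode (1, x) \<in> M \<longleftrightarrow> P (zpart M) x \<and> Q (zpart M) x)"
  proof
    assume m: "mdl ?l M"
    have "\<exists>y. holds M (?l (prod_encode (prod_encode (x, i), y)))" for x i using m unfolding mdl_def by blast
    note m' = this
    show "\<forall>x. prod_encode (1, x) \<in> M \<longleftrightarrow> P (zpart M) x \<and> Q (zpart M) x"
    proof
      fix x show "prod_encode (1, x) \<in> M \<longleftrightarrow> P (zpart M) x \<and> Q (zpart M) x"
        using m'[of x 0] m'[of x 1] m'[of x 2]
        by (cases "P (zpart M) x"; cases "Q (zpart M) x") (auto simp: * split: if_splits)
    qed
  next
    assume a: "\<forall>x. prod_encode (1, x) \<in> M \<longleftrightarrow> P (zpart M) x \<and> Q (zpart M) x"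
    have "holds M (?l (prod_encode (c, 0))) \<or> holds M (?l (prod_encode (c, 1))) \<or> holds M (?l (prod_encode (c, 2)))" for c
    proof (cases "p2 c \<ge> 2")
      case False
      then have "p2 c = 0 \<or> p2 c = 1" by auto
      then show ?thesis by (elim disjE) (simp_all add: * a)
    qed (simp add: * a)
    then show "mdl ?l M" unfolding mdl_def by blast
  qed
qed

lemma arith_ex [arith_intros]:
  assumes "arith (\<lambda>Z z. P Z (p1 z) (p2 z))" shows "arith (\<lambda>Z x. \<exists>n. P Z x n)"
proof (rule arith_combine[OF assms assms])
  let ?v = "\<lambda>z. p1 (p1 z)" let ?i = "\<lambda>z. p2 (p1 z)"
  \<comment> \<open>Clause 0 is genuinely infinite: it offers every instance as a literal. Clause
    \<open>n + 1\<close> says that the instance \<open>n\<close> implies the existential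
    statement.\<close>
  let ?l = "\<lambda>z. if ?i z = 0
    then (if p2 z = 0 then prod_encode (prod_encode (1, ?v z), 0)
          else prod_encode (prod_encode (2, prod_encode (1, prod_encode (?v z, p2 z - 1))), 1))
    else (if p2 z = 0 then prod_encode (prod_encode (1, ?v z), 1)
          else prod_encode (prod_encode (2, prod_encode (1, prod_encode (?v z, ?i z - 1))), 0))"
  show "cf ?l" by (intro cf_intros)
  fix M assume *: "\<And>x. prod_encode (2, prod_encode (1, x)) \<in> M \<longleftrightarrow> P (zpart M) (p1 x) (p2 x)"
  show "mdl ?l M \<longleftrightarrow> (\<forall>x. prod_encode (1, x) \<in> M \<longleftrightarrow> (\<exists>n. P (zpart M) x n))"
  proof
    assume m: "mdl ?l M"
    have m': "\<exists>y. holds M (?l (prod_encode (prod_encode (x, i), y)))" for x i using m unfolding mdl_def by blast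
    show "\<forall>x. prod_encode (1, x) \<in> M \<longleftrightarrow> (\<exists>n. P (zpart M) x n)"
    proof (intro allI iffI)
      fix x assume "prod_encode (1, x) \<in> M"
      then show "\<exists>n. P (zpart M) x n" using m'[of x 0] by (auto simp: * split: if_splits)
    next
      fix x assume "\<exists>n. P (zpart M) x n"
      then obtain n where "P (zpart M) x n" by blast
      then show "prod_encode (1, x) \<in> M" using m'[of x "Suc n"] by (auto simp: * split: if_splits)
    qed
  next
    assume a: "\<forall>x. prod_encode (1, x) \<in> M \<longleftrightarrow> (\<exists>n. P (zpart M) x n)"
    show "mdl ?l M"
      unfolding mdl_def
    proof
      fix c
      show "\<exists>y. holds M (?l (prod_encode (c, y)))"
      proof (cases "p2 c = 0 \<and> prod_encode (1, p1 c) \<in> M")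
        case True
        then obtain n where "P (zpart M) (p1 c) n" using a by blast
        then have "holds M (?l (prod_encode (c, Suc n)))" using True by (simp add: *)
        then show ?thesis by blast
      next
        case False
        then have "holds M (?l (prod_encode (c, 0))) \<or> holds M (?l (prod_encode (c, 1)))"
          using a by (auto simp: *)
        then show ?thesis by blast
      qed
    qed
  qed
qed

lemma arith_mem [arith_intros]: assumes "cf f" shows "arith (\<lambda>Z x. f x \<in> Z)"
proof -
  let ?v = "\<lambda>z. p1 (p1 z)" let ?i = "\<lambda>z. p2 (p1 z)"
  define l where "l z = (if p2 z = 0 then prod_encode (prod_encode (1, ?v z), ?i z)
    else prod_encode (prod_encode (0, f (?v z)), 1 - ?i z))" for z
  have cf: "cf l" unfolding l_def by (intro cf_intros cf_comp[OF assms])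
  have m: "mdl l M \<longleftrightarrow> (\<forall>x. prod_encode (1, x) \<in> M \<longleftrightarrow> f x \<in> zpart M)" for M
  proof
    assume m: "mdl l M"
    have "\<exists>y. holds M (l (prod_encode (prod_encode (x, i), y)))" for x i using m unfolding mdl_def by blast
    note m' = this
    show "\<forall>x. prod_encode (1, x) \<in> M \<longleftrightarrow> f x \<in> zpart M"
    proof
      fix x show "prod_encode (1, x) \<in> M \<longleftrightarrow> f x \<in> zpart M"
        using m'[of x 0] m'[of x 1] by (cases "f x \<in> zpart M") (auto simp: l_def zpart_def split: if_splits)
    qed
  next
    assume a: "\<forall>x. prod_encode (1, x) \<in> M \<longleftrightarrow> f x \<in> zpart M"
    have "holds M (l (prod_encode (c, 0))) \<or> holds M (l (prod_encode (c, 1)))" for c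
      by (cases "f (p1 c) \<in> zpart M"; cases "p2 c = 0") (simp_all add: l_def a, simp_all add: zpart_def)
    then show "mdl l M" unfolding mdl_def by blast
  qed
  have "\<exists>M. mdl l M \<and> zpart M = Z" for Z
  proof -
    let ?M = "{v. (p1 v = 0 \<and> p2 v \<in> Z) \<or> (p1 v = 1 \<and> f (p2 v) \<in> Z)}"
    have "zpart ?M = Z" by (auto simp: zpart_def)
    then show ?thesis unfolding m by (intro exI[of _ ?M]) simp
  qed
  then show ?thesis unfolding arith_def using cf m by blast
qed

lemma arith_dec: assumes "dec R" shows "arith (\<lambda>Z x. R x)"
proof -
  define l where "l z = prod_encode (prod_encode (1, p1 z), if R (p1 z) then 1 else 0)" for z
  have cf: "cf l" unfolding l_def by (intro cf_intros dec_comp[OF assms])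
  have m: "mdl l M \<longleftrightarrow> (\<forall>x. prod_encode (1, x) \<in> M \<longleftrightarrow> R x)" for M
    unfolding mdl_def l_def by auto
  have "\<exists>M. mdl l M \<and> zpart M = Z" for Z
    unfolding m by (intro exI[of _ "{v. (p1 v = 0 \<and> p2 v \<in> Z) \<or> (p1 v = 1 \<and> R (p2 v))}"]) (auto simp: zpart_def)
  then show ?thesis unfolding arith_def using cf m by blast
qed

lemma arith_or [arith_intros]: "arith P \<Longrightarrow> arith Q \<Longrightarrow> arith (\<lambda>Z x. P Z x \<or> Q Z x)"
  using arith_not[OF arith_and[OF arith_not arith_not], of P Q] by simp

lemma arith_imp [arith_intros]: "arith P \<Longrightarrow> arith Q \<Longrightarrow> arith (\<lambda>Z x. P Z x \<longrightarrow> Q Z x)"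
  using arith_or[OF arith_not, of P Q] by (simp only: imp_conv_disj)

lemma arith_iff [arith_intros]: "arith P \<Longrightarrow> arith Q \<Longrightarrow> arith (\<lambda>Z x. P Z x \<longleftrightarrow> Q Z x)"
  using arith_and[OF arith_imp arith_imp, of P Q Q P] by (simp only: iff_conv_conj_imp)

lemma arith_all [arith_intros]:
  "arith (\<lambda>Z z. P Z (p1 z) (p2 z)) \<Longrightarrow> arith (\<lambda>Z x. \<forall>n. P Z x n)"
  using arith_not[OF arith_ex[of "\<lambda>Z x n. \<not> P Z x n"]] arith_not[of "\<lambda>Z z. P Z (p1 z) (p2 z)"] by simp

text \<open>The new clause 0 asserts the predicate at 0. It cuts the models, which exist for every
  \<open>Z\<close>, down to those whose \<open>Z\<close> satisfies \<open>\<Phi>\<close>.\<close>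

lemma arith_sentence:
  assumes "arith (\<lambda>Z x. \<Phi> Z)"
  shows "\<exists>l. cf l \<and> (\<forall>M. mdl l M \<longrightarrow> \<Phi> (zpart M)) \<and> (\<forall>Z. \<Phi> Z \<longrightarrow> (\<exists>M. mdl l M \<and> zpart M = Z))"
proof -
  obtain l where l: "cf l" "\<And>Z. \<exists>M. mdl l M \<and> zpart M = Z"
    "\<And>M x. mdl l M \<Longrightarrow> prod_encode (1, x) \<in> M \<longleftrightarrow> \<Phi> (zpart M)" using assms unfolding arith_def by blast
  define l' where "l' z = (if p1 z = 0 then prod_encode (prod_encode (1, 0), 1)
    else l (prod_encode (p1 z - 1, p2 z)))" for z
  have "cf l'" unfolding l'_def by (intro cf_intros cf_comp[OF l(1)])
  moreover have "mdl l' M \<longleftrightarrow> prod_encode (1, 0) \<in> M \<and> mdl l M" for M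
  proof
    assume m: "mdl l' M"
    have "\<exists>y. holds M (l (prod_encode (c, y)))" for c
      using m[unfolded mdl_def, rule_format, of "Suc c"] by (simp add: l'_def)
    moreover have "prod_encode (1, 0) \<in> M" using m[unfolded mdl_def, rule_format, of 0] by (simp add: l'_def)
    ultimately show "prod_encode (1, 0) \<in> M \<and> mdl l M" by (simp add: mdl_def)
  qed (simp add: mdl_def l'_def)
  ultimately show ?thesis using l by (intro exI[of _ l']) metis
qed

section \<open>An arithmetical description of the facts of a hyperarithmetical structure\<close>

lemma eval_iffs:
  "eval X PZero x y \<longleftrightarrow> y = 0" "eval X PSucc x y \<longleftrightarrow> y = Suc x" "eval X PFst x y \<longleftrightarrow> y = p1 x"
  "eval X PSnd x y \<longleftrightarrow> y = p2 x" "eval X POracle x y \<longleftrightarrow> y = (if x \<in> X then 1 else 0)"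
  "eval X (PPair p q) x y \<longleftrightarrow> eval X p x (p1 y) \<and> eval X q x (p2 y)"
  "eval X (PComp p q) x y \<longleftrightarrow> (\<exists>u. eval X q x u \<and> eval X p u y)"
  "eval X (PPrec p q) (prod_encode (x, 0)) y \<longleftrightarrow> eval X p x y"
  "eval X (PPrec p q) (prod_encode (x, Suc n)) y \<longleftrightarrow>
    (\<exists>u. eval X (PPrec p q) (prod_encode (x, n)) u \<and> eval X q (prod_encode (x, prod_encode (n, u))) y)"
  "eval X (PMu p) x y \<longleftrightarrow> eval X p (prod_encode (x, y)) 0 \<and>
    (\<forall>m. m < y \<longrightarrow> (\<exists>u. 0 < u \<and> eval X p (prod_encode (x, m)) u))"
proof -
  show "eval X PZero x y \<longleftrightarrow> y = 0" "eval X PSucc x y \<longleftrightarrow> y = Suc x" "eval X PFst x y \<longleftrightarrow> y = p1 x"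
    "eval X PSnd x y \<longleftrightarrow> y = p2 x" "eval X POracle x y \<longleftrightarrow> y = (if x \<in> X then 1 else 0)"
    unfolding p1_def p2_def using eval_oracle[of X x] by (auto elim: eval.cases intro: eval.intros)
  show "eval X (PPair p q) x y \<longleftrightarrow> eval X p x (p1 y) \<and> eval X q x (p2 y)"
    using eval_pair[of X p x "p1 y" q "p2 y"] by (auto elim: eval.cases)
  show "eval X (PPrec p q) (prod_encode (x, Suc n)) y \<longleftrightarrow>
    (\<exists>u. eval X (PPrec p q) (prod_encode (x, n)) u \<and> eval X q (prod_encode (x, prod_encode (n, u))) y)"
  proof
    assume "eval X (PPrec p q) (prod_encode (x, Suc n)) y"
    then show "\<exists>u. eval X (PPrec p q) (prod_encode (x, n)) u \<and> eval X q (prod_encode (x, prod_encode (n, u))) y"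
      by cases auto
  qed (auto intro: eval.intros)
qed (auto elim: eval.cases intro: eval.intros)

lemma code_prog_inj: "code_prog p = code_prog q \<Longrightarrow> p = q"
  by (induction p arbitrary: q; case_tac q) auto

lemma phi_code [simp]: "phi X (code_prog p) x y \<longleftrightarrow> eval X p x y"
  unfolding phi_def using code_prog_inj by blast

definition is_prog :: "nat \<Rightarrow> bool" where
  "is_prog e \<longleftrightarrow> (\<exists>p. code_prog p = e)"

lemma phi_is_prog: "phi X e x y \<Longrightarrow> is_prog e"
  unfolding phi_def is_prog_def by blast

lemma is_prog_rec:
  "is_prog p \<longleftrightarrow> (p1 p < 5 \<and> p2 p = 0) \<or>
    ((p1 p = 5 \<or> p1 p = 6 \<or> p1 p = 7) \<and> is_prog (p1 (p2 p)) \<and> is_prog (p2 (p2 p))) \<or>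
    (p1 p = 8 \<and> is_prog (p2 p))" (is "_ \<longleftrightarrow> ?R")
proof
  assume "is_prog p"
  then obtain r where "code_prog r = p" unfolding is_prog_def by blast
  then show ?R unfolding is_prog_def by (cases r) auto
next
  assume R: ?R
  have a: "is_prog p" if "p1 p < 5" "p2 p = 0"
  proof -
    have "p1 p = 0 \<or> p1 p = 1 \<or> p1 p = 2 \<or> p1 p = 3 \<or> p1 p = 4" using that by auto
    then have "p \<in> {code_prog PZero, code_prog PSucc, code_prog PFst, code_prog PSnd, code_prog POracle}"
      using that(2) p_simps(3)[of p] by auto
    then show ?thesis unfolding is_prog_def by blast
  qed
  have b: "is_prog p" if c: "p1 p = 5 \<or> p1 p = 6 \<or> p1 p = 7" and d: "is_prog (p1 (p2 p))" "is_prog (p2 (p2 p))"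
  proof -
    obtain q r where "code_prog q = p1 (p2 p)" "code_prog r = p2 (p2 p)" using d unfolding is_prog_def by blast
    then have e: "prod_encode (p1 p, prod_encode (code_prog q, code_prog r)) = p" by simp
    have "code_prog (PPair q r) = p" if "p1 p = 5" using e that by simp
    moreover have "code_prog (PComp q r) = p" if "p1 p = 6" using e that by simp
    moreover have "code_prog (PPrec q r) = p" if "p1 p = 7" using e that by simp
    ultimately show ?thesis using c unfolding is_prog_def by blast
  qed
  have c: "is_prog p" if c: "p1 p = 8" and d: "is_prog (p2 p)"
  proof -
    obtain q where "code_prog q = p2 p" using d unfolding is_prog_def by blast
    then have e: "prod_encode (p1 p, code_prog q) = p" by simp
    have "code_prog (PMu q) = p" using e c by simp
    then show ?thesis unfolding is_prog_def by blast
  qed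
  from R show "is_prog p" by (elim disjE conjE) (rule a b c; simp)+
qed

lemma p2_le: "p2 x \<le> x" and p1_le: "p1 x \<le> x"
  using le_prod_encode_2[of "p2 x" "p1 x"] le_prod_encode_1[of "p1 x" "p2 x"] by simp_all

text \<open>Composite programs and terms carry a nonzero tag, so induction on codes reaches their
  parts.\<close>

lemma p2_less: "p1 x \<noteq> 0 \<Longrightarrow> p2 x < x"
proof -
  assume "p1 x \<noteq> 0"
  have "n \<le> triangle n" for n by (induction n) auto
  then have "p2 x \<le> triangle (p1 x + p2 x)" by (rule order_trans[OF le_add2])
  moreover have "prod_encode (p1 x, p2 x) = triangle (p1 x + p2 x) + p1 x"
    by (simp add: prod_encode_def del: p_simps)
  then have "x = triangle (p1 x + p2 x) + p1 x" unfolding p_simps(3) .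
  ultimately show ?thesis using \<open>p1 x \<noteq> 0\<close> by linarith
qed

text \<open>Intended meaning of the members of \<open>Z\<close>: program \<open>p\<close> with oracle \<open>H(b)\<close> (the empty set for
  \<open>b = 0\<close>) yields \<open>y\<close> at \<open>x\<close>; \<open>x \<in> H(b)\<close>; \<open>b\<close> is below the given notation; \<open>p\<close> codes a program;
  \<open>k\<close> elements of \<open>A\<close> are less than \<open>x\<close>; replacing variables by the elements with the numbers listed in
  \<open>xs\<close> turns the term (list of terms) \<open>t\<close> into \<open>t'\<close>; \<open>a\<close> is true at the elements numbered by \<open>xs\<close>.\<close>

abbreviation "zE Z b p x y \<equiv> prod_encode (0, prod_encode (b, prod_encode (p, prod_encode (x, y)))) \<in> (Z :: nat set)"
abbreviation "zY Z b x \<equiv> prod_encode (1, prod_encode (b, x)) \<in> (Z :: nat set)"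
abbreviation "zD Z b \<equiv> prod_encode (2, b) \<in> (Z :: nat set)"
abbreviation "zP Z p \<equiv> prod_encode (3, p) \<in> (Z :: nat set)"
abbreviation "zC Z x k \<equiv> prod_encode (4, prod_encode (x, k)) \<in> (Z :: nat set)"
abbreviation "zS Z xs t t' \<equiv> prod_encode (5, prod_encode (xs, prod_encode (t, t'))) \<in> (Z :: nat set)"
abbreviation "zL Z xs l l' \<equiv> prod_encode (6, prod_encode (xs, prod_encode (l, l'))) \<in> (Z :: nat set)"
abbreviation "zV Z a xs \<equiv> prod_encode (7, prod_encode (a, xs)) \<in> (Z :: nat set)"

definition th_prog :: "nat set \<Rightarrow> bool" where
  "th_prog Z \<longleftrightarrow> (\<forall>p. zP Z p \<longleftrightarrow> (p1 p < 5 \<and> p2 p = 0) \<or>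
    ((p1 p = 5 \<or> p1 p = 6 \<or> p1 p = 7) \<and> zP Z (p1 (p2 p)) \<and> zP Z (p2 (p2 p))) \<or>
    (p1 p = 8 \<and> zP Z (p2 p)))"

definition th_eval0 :: "nat set \<Rightarrow> bool" where
  "th_eval0 Z \<longleftrightarrow> (\<forall>b x y. (zE Z b (prod_encode (0, 0)) x y \<longleftrightarrow> y = 0) \<and>
    (zE Z b (prod_encode (1, 0)) x y \<longleftrightarrow> y = Suc x) \<and>
    (zE Z b (prod_encode (2, 0)) x y \<longleftrightarrow> y = p1 x) \<and>
    (zE Z b (prod_encode (3, 0)) x y \<longleftrightarrow> y = p2 x) \<and>
    (zE Z b (prod_encode (4, 0)) x y \<longleftrightarrow> (zY Z b x \<and> y = 1) \<or> (\<not> zY Z b x \<and> y = 0)))"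

text \<open>The guard matters: if \<open>q\<close> codes no program, neither does
  \<open>prod_encode (7, prod_encode (p, q))\<close>. Its intended graph is then empty, whereas the
  equation at 0 would give it the values of \<open>p\<close>.\<close>

definition th_eval1 :: "nat set \<Rightarrow> bool" where
  "th_eval1 Z \<longleftrightarrow> (\<forall>b p q x y. zP Z p \<and> zP Z q \<longrightarrow>
    (zE Z b (prod_encode (5, prod_encode (p, q))) x y \<longleftrightarrow> zE Z b p x (p1 y) \<and> zE Z b q x (p2 y)) \<and>
    (zE Z b (prod_encode (6, prod_encode (p, q))) x y \<longleftrightarrow> (\<exists>u. zE Z b q x u \<and> zE Z b p u y)) \<and>
    (zE Z b (prod_encode (7, prod_encode (p, q))) (prod_encode (x, 0)) y \<longleftrightarrow> zE Z b p x y) \<and>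
    (\<forall>n. zE Z b (prod_encode (7, prod_encode (p, q))) (prod_encode (x, Suc n)) y \<longleftrightarrow>
      (\<exists>u. zE Z b (prod_encode (7, prod_encode (p, q))) (prod_encode (x, n)) u \<and>
           zE Z b q (prod_encode (x, prod_encode (n, u))) y)) \<and>
    (zE Z b (prod_encode (8, p)) x y \<longleftrightarrow> zE Z b p (prod_encode (x, y)) 0 \<and>
      (\<forall>m. m < y \<longrightarrow> (\<exists>u. 0 < u \<and> zE Z b p (prod_encode (x, m)) u))))"

text \<open>The index 0 is no notation and stands for the empty oracle that limit notations refer
  to; \<open>c \<noteq> 0\<close> keeps \<open>2 ^ 0 = 1\<close>, the notation of zero, out of the
  successor clause. Well-foundedness of the notations is not arithmetical and is not expressed:
  \<open>zD\<close> only leads down from \<open>a0\<close>, and induction along \<open>H_set\<close>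
  supplies the rest.\<close>

definition th_H :: "nat \<Rightarrow> nat set \<Rightarrow> bool" where
  "th_H a0 Z \<longleftrightarrow> zD Z a0 \<and> (\<forall>x. \<not> zY Z 0 x \<and> \<not> zY Z 1 x) \<and>
    (\<forall>c. c \<noteq> 0 \<and> zD Z (2 ^ c) \<longrightarrow> zD Z c \<and> (\<forall>e. zY Z (2 ^ c) e \<longleftrightarrow> zP Z e \<and> (\<exists>y. zE Z c e e y))) \<and>
    (\<forall>e. zD Z (3 * 5 ^ e) \<longrightarrow> zP Z e \<and> (\<forall>n. \<exists>b. zE Z 0 e n b \<and> zD Z b) \<and>
      (\<forall>z. zY Z (3 * 5 ^ e) z \<longleftrightarrow> (\<exists>b. zE Z 0 e (p2 z) b \<and> zY Z b (p1 z))))"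

text \<open>The diagram sentence \<open>x = x\<close>, through which the theory learns whether
  \<open>x\<close> is an element.\<close>

abbreviation "name_eq x \<equiv> prod_encode (1, prod_encode (0, prod_encode (prod_encode (0, x), prod_encode (0, x))))"

definition th_cnt :: "nat \<Rightarrow> nat \<Rightarrow> nat set \<Rightarrow> bool" where
  "th_cnt a0 q0 Z \<longleftrightarrow> (\<forall>k. zC Z 0 k \<longleftrightarrow> k = 0) \<and>
    (\<forall>x k. zC Z (Suc x) k \<longleftrightarrow> (zE Z a0 q0 (name_eq x) 1 \<and> k \<noteq> 0 \<and> zC Z x (k - 1)) \<or>
      (\<not> zE Z a0 q0 (name_eq x) 1 \<and> zC Z x k))"

definition th_sub :: "nat \<Rightarrow> nat \<Rightarrow> nat set \<Rightarrow> bool" where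
  "th_sub a0 q0 Z \<longleftrightarrow>
    (\<forall>xs t t'. zS Z xs t t' \<longleftrightarrow>
      (p1 t = 0 \<and> p1 t' = 0 \<and> p2 t < length (list_decode xs) \<and> zE Z a0 q0 (name_eq (p2 t')) 1 \<and>
        zC Z (p2 t') (lhd (drop (p2 t) (list_decode xs)))) \<or>
      (p1 t = 1 \<and> p1 t' = 1 \<and> p1 (p2 t') = p1 (p2 t) \<and> zL Z xs (p2 (p2 t)) (p2 (p2 t')))) \<and>
    (\<forall>xs l l'. zL Z xs l l' \<longleftrightarrow> (l = 0 \<and> l' = 0) \<or>
      (l \<noteq> 0 \<and> l' \<noteq> 0 \<and> zS Z xs (p1 (l - 1)) (p1 (l' - 1)) \<and> zL Z xs (p2 (l - 1)) (p2 (l' - 1))))"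

definition th_val :: "nat \<Rightarrow> nat \<Rightarrow> nat set \<Rightarrow> bool" where
  "th_val a0 q0 Z \<longleftrightarrow> (\<forall>a xs. zV Z a xs \<longleftrightarrow>
    (p1 a = 0 \<and> (\<exists>t t'. zS Z xs (p1 (p2 a)) t \<and> zS Z xs (p2 (p2 a)) t' \<and>
      zE Z a0 q0 (prod_encode (1, prod_encode (0, prod_encode (t, t')))) 1)) \<or>
    (p1 a = 1 \<and> (\<exists>l. zL Z xs (p2 (p2 a)) l \<and>
      zE Z a0 q0 (prod_encode (1, prod_encode (1, prod_encode (p1 (p2 a), l)))) 1)))"

definition theta :: "nat \<Rightarrow> nat \<Rightarrow> nat set \<Rightarrow> bool" where
  "theta a0 q0 Z \<longleftrightarrow> th_prog Z \<and> th_eval0 Z \<and> th_eval1 Z \<and> th_H a0 Z \<and> th_cnt a0 q0 Z \<and>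
    th_sub a0 q0 Z \<and> th_val a0 q0 Z"

lemma arith_theta: "arith (\<lambda>Z x. theta a0 q0 Z)"
  unfolding theta_def
proof (intro arith_and)
  show "arith (\<lambda>Z x. th_prog Z)" unfolding th_prog_def by (intro arith_intros arith_dec cf_intros)
  show "arith (\<lambda>Z x. th_eval0 Z)" unfolding th_eval0_def by (intro arith_intros arith_dec cf_intros)
  show "arith (\<lambda>Z x. th_eval1 Z)" unfolding th_eval1_def by (intro arith_intros arith_dec cf_intros)
  show "arith (\<lambda>Z x. th_H a0 Z)" unfolding th_H_def by (intro arith_intros arith_dec cf_intros)
  show "arith (\<lambda>Z x. th_cnt a0 q0 Z)" unfolding th_cnt_def by (intro arith_intros arith_dec cf_intros)
  show "arith (\<lambda>Z x. th_sub a0 q0 Z)" unfolding th_sub_def by (intro arith_intros arith_dec cf_intros)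
  show "arith (\<lambda>Z x. th_val a0 q0 Z)" unfolding th_val_def by (intro arith_intros arith_dec cf_intros)
qed

section \<open>Uniqueness of the jump hierarchy\<close>

lemma H_set_0: "\<not> H_set 0 X"
  by (auto elim: H_set.cases)

lemma pow2_neq_lim: "(2::nat) ^ a \<noteq> 3 * 5 ^ e"
proof
  assume eq: "(2::nat) ^ a = 3 * 5 ^ e"
  have "odd (3 * 5 ^ e :: nat)" by simp
  then have "a = 0" unfolding eq[symmetric] by simp
  moreover have "3 * 5 ^ e \<ge> (3::nat)" by simp
  ultimately show False using eq by simp
qed

lemma H_set_1: "H_set 1 X \<longleftrightarrow> X = {}"
proof
  assume "H_set 1 X"
  then show "X = {}"
  proof cases
    case (H_succ a X)
    then have "a = 0" using power_inject_exp[of "2::nat" a 0] by auto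
    then show ?thesis using H_succ H_set_0 by blast
  next
    case (H_lim e f Y)
    then show ?thesis using pow2_neq_lim[of 0 e] by simp
  qed
qed (simp add: H_zero)

lemma H_set_succ:
  assumes "c \<noteq> 0" shows "H_set (2 ^ c) X \<longleftrightarrow> (\<exists>Y. H_set c Y \<and> X = jump Y)"
proof
  assume "H_set (2 ^ c) X"
  then show "\<exists>Y. H_set c Y \<and> X = jump Y"
  proof cases
    case H_zero
    then show ?thesis using assms power_inject_exp[of "2::nat" c 0] by simp
  next
    case (H_succ a X)
    then show ?thesis by auto
  next
    case (H_lim e f Y)
    then show ?thesis using pow2_neq_lim by metis
  qed
qed (auto intro: H_set.H_succ)

lemma H_set_lim:
  "H_set (3 * 5 ^ e) X \<longleftrightarrow> (\<exists>f Y. (\<forall>n. phi {} e n (f n)) \<and> (\<forall>n. H_set (f n) (Y n)) \<and>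
    X = {prod_encode (x, n) | x n. x \<in> Y n})"
proof
  assume "H_set (3 * 5 ^ e) X"
  then show "\<exists>f Y. (\<forall>n. phi {} e n (f n)) \<and> (\<forall>n. H_set (f n) (Y n)) \<and> X = {prod_encode (x, n) | x n. x \<in> Y n}"
  proof cases
    case H_zero
    then show ?thesis using pow2_neq_lim[of 0 e] by simp
  next
    case (H_succ a X)
    then show ?thesis using pow2_neq_lim by metis
  next
    case (H_lim e' f Y)
    then have "e' = e" by simp
    then show ?thesis using H_lim by blast
  qed
qed (auto intro: H_set.H_lim)

lemma phi_fun: "phi X e x y \<Longrightarrow> phi X e x z \<Longrightarrow> y = z"
  unfolding phi_def using eval_fun code_prog_inj by blast

lemma H_set_fun: "H_set a X \<Longrightarrow> H_set a Y \<Longrightarrow> X = Y"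
proof (induction arbitrary: Y rule: H_set.induct)
  case H_zero
  then show ?case using H_set_1 by simp
next
  case (H_succ a X)
  then have "a \<noteq> 0" using H_set_0 by metis
  then obtain W where "H_set a W" "Y = jump W" using H_succ.prems H_set_succ by blast
  then show ?case using H_succ.IH by simp
next
  case (H_lim e f W)
  obtain g V where g: "\<And>n. phi {} e n (g n)" "\<And>n. H_set (g n) (V n)"
    "Y = {prod_encode (x, n) | x n. x \<in> V n}" using H_lim.prems unfolding H_set_lim by blast
  have "W n = V n" for n
  proof -
    have "g n = f n" using phi_fun g(1) H_lim(1) by blast
    then show ?thesis using g(2)[of n] H_lim(2) by simp
  qed
  then show ?case using g(3) by simp
qed

text \<open>Total in \<open>b\<close>: where the hierarchy has no level the value is empty, which in
  particular makes index 0 the empty oracle.\<close>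

definition hier :: "nat \<Rightarrow> nat set" where
  "hier b = {x. \<exists>X. H_set b X \<and> x \<in> X}"

lemma hier_eq: "H_set b X \<Longrightarrow> hier b = X"
  unfolding hier_def using H_set_fun by blast

section \<open>Numbering the elements of the universe\<close>

definition cnt :: "nat set \<Rightarrow> nat \<Rightarrow> nat" where
  "cnt U x = card {y \<in> U. y < x}"

lemma cnt_0: "cnt U 0 = 0"
  by (simp add: cnt_def)

lemma cnt_Suc: "cnt U (Suc x) = (if x \<in> U then Suc (cnt U x) else cnt U x)"
proof -
  have "{y \<in> U. y < Suc x} = (if x \<in> U then insert x {y \<in> U. y < x} else {y \<in> U. y < x})"
    by (auto simp: less_Suc_eq)
  then show ?thesis by (simp add: cnt_def)
qed

lemma cnt_strict: "x \<in> U \<Longrightarrow> x < y \<Longrightarrow> cnt U x < cnt U y"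
proof -
  assume "x \<in> U" "x < y"
  then have "{z \<in> U. z < x} \<subset> {z \<in> U. z < y}" by auto
  then show ?thesis unfolding cnt_def by (intro psubset_card_mono) auto
qed

lemma inj_on_cnt: "inj_on (cnt U) U"
  by (rule inj_onI) (metis cnt_strict less_irrefl linorder_neqE_nat)

lemma cnt_below: "i < cnt U y \<Longrightarrow> i \<in> cnt U ` U"
proof (induction y)
  case (Suc y)
  then show ?case by (cases "i < cnt U y") (auto simp: cnt_Suc less_Suc_eq split: if_splits)
qed (simp add: cnt_0)

text \<open>The numbers given to the elements form an initial segment of the natural numbers, either
  finite or everything, and both are decidable however complicated \<open>U\<close> is. The argument
  is not uniform in \<open>U\<close>.\<close>

lemma dec_cnt_image: "dec (\<lambda>i. i \<in> cnt U ` U)"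
proof (cases "finite (cnt U ` U)")
  case False
  have "i \<in> cnt U ` U" for i
  proof -
    obtain j where "j \<in> cnt U ` U" "i < j" using False infinite_nat_iff_unbounded by blast
    then show ?thesis using cnt_below by blast
  qed
  then show ?thesis by (simp add: dec_const)
qed (rule finite_dec)

definition enum :: "nat set \<Rightarrow> nat \<Rightarrow> nat" where
  "enum U = inv_into U (cnt U)"

lemma bij_enum: "bij_betw (enum U) (cnt U ` U) U"
  unfolding enum_def by (rule bij_betw_inv_into) (simp add: bij_betw_def inj_on_cnt)

lemma cnt_eq_iff: "y \<in> U \<and> cnt U y = i \<longleftrightarrow> i \<in> cnt U ` U \<and> y = enum U i"
  unfolding enum_def using inj_on_cnt[of U] by (auto simp: inv_into_into f_inv_into_f)

definition sub_trm :: "(nat \<Rightarrow> nat) \<Rightarrow> nat set \<Rightarrow> nat list \<Rightarrow> trm \<Rightarrow> nat \<Rightarrow> bool" where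
  "sub_trm h B xs t c \<longleftrightarrow> (\<forall>i\<in>trm_vars t. i < length xs \<and> xs ! i \<in> B) \<and> c = code_trm (ren_trm (\<lambda>i. h (xs ! i)) t)"

lemma list_encode_eq_0 [simp]: "list_encode xs = 0 \<longleftrightarrow> xs = []"
  by (cases xs) auto

text \<open>The recursion that the substitution relation shares with its axiomatisation; it determines
  the relation by induction on the code of the term.\<close>

lemma sub_trm_rec:
  fixes h B
  defines "S \<equiv> \<lambda>xs c c'. \<exists>t. c = code_trm t \<and> sub_trm h B (list_decode xs) t c'"
    and "K \<equiv> \<lambda>xs l l'. \<exists>ts cs. l = list_encode (map code_trm ts) \<and> l' = list_encode cs \<and>
      list_all2 (sub_trm h B (list_decode xs)) ts cs"
  shows "S xs t t' \<longleftrightarrow>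
      (p1 t = 0 \<and> p1 t' = 0 \<and> p2 t < length (list_decode xs) \<and>
        lhd (drop (p2 t) (list_decode xs)) \<in> B \<and> p2 t' = h (lhd (drop (p2 t) (list_decode xs)))) \<or>
      (p1 t = 1 \<and> p1 t' = 1 \<and> p1 (p2 t') = p1 (p2 t) \<and> K xs (p2 (p2 t)) (p2 (p2 t')))" (is "_ \<longleftrightarrow> ?R1 \<or> ?R2")
    and "K xs l l' \<longleftrightarrow> (l = 0 \<and> l' = 0) \<or>
      (l \<noteq> 0 \<and> l' \<noteq> 0 \<and> S xs (p1 (l - 1)) (p1 (l' - 1)) \<and> K xs (p2 (l - 1)) (p2 (l' - 1)))"
proof -
  have fn: "sub_trm h B ys (Fun f ts) c \<longleftrightarrow>
    (\<exists>cs. list_all2 (sub_trm h B ys) ts cs \<and> c = prod_encode (1, prod_encode (f, list_encode cs)))" for ys f ts c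
  proof -
    have "list_all2 (sub_trm h B ys) ts cs \<longleftrightarrow> (\<forall>t\<in>set ts. \<forall>i\<in>trm_vars t. i < length ys \<and> ys ! i \<in> B) \<and>
      cs = map (\<lambda>t. code_trm (ren_trm (\<lambda>i. h (ys ! i)) t)) ts" for cs
      by (induction ts arbitrary: cs) (auto simp: list_all2_Cons1 sub_trm_def)
    then show ?thesis by (auto simp: sub_trm_def comp_def)
  qed
  show "S xs t t' \<longleftrightarrow> ?R1 \<or> ?R2"
  proof
    assume "S xs t t'"
    then obtain u where u: "t = code_trm u" "sub_trm h B (list_decode xs) u t'" unfolding S_def by blast
    show "?R1 \<or> ?R2"
    proof (cases u)
      case (Var i)
      then show ?thesis using u by (auto simp: sub_trm_def lhd_drop)
    next
      case (Fun f ts)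
      then obtain cs where "list_all2 (sub_trm h B (list_decode xs)) ts cs"
        "t' = prod_encode (1, prod_encode (f, list_encode cs))" using u fn by blast
      then show ?thesis unfolding K_def using u(1) Fun by auto
    qed
  next
    assume "?R1 \<or> ?R2"
    then show "S xs t t'"
    proof
      assume r: ?R1
      have "prod_encode (p1 t, p2 t) = t" "prod_encode (p1 t', p2 t') = t'" by simp_all
      moreover have "p1 t = 0" "p1 t' = 0" "p2 t' = h (list_decode xs ! p2 t)" using r lhd_drop by auto
      ultimately have "code_trm (Var (p2 t)) = t" "code_trm (Var (h (list_decode xs ! p2 t))) = t'" by simp_all
      moreover have "p2 t < length (list_decode xs) \<and> list_decode xs ! p2 t \<in> B" using r lhd_drop by metis
      ultimately have "sub_trm h B (list_decode xs) (Var (p2 t)) t'" unfolding sub_trm_def by simp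
      then show ?thesis unfolding S_def using \<open>code_trm (Var (p2 t)) = t\<close>[symmetric] by blast
    next
      assume r: ?R2
      then obtain ts cs where c: "p2 (p2 t) = list_encode (map code_trm ts)" "p2 (p2 t') = list_encode cs"
        "list_all2 (sub_trm h B (list_decode xs)) ts cs" unfolding K_def by blast
      have r': "p1 t = 1" "p1 t' = 1" "p1 (p2 t') = p1 (p2 t)" using r by blast+
      have "prod_encode (p1 t, prod_encode (p1 (p2 t), p2 (p2 t))) = t"
        "prod_encode (p1 t', prod_encode (p1 (p2 t'), p2 (p2 t'))) = t'" by simp_all
      then have e: "prod_encode (1, prod_encode (p1 (p2 t), list_encode (map code_trm ts))) = t"
        "prod_encode (1, prod_encode (p1 (p2 t), list_encode cs)) = t'" unfolding r' c by simp_all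
      have "sub_trm h B (list_decode xs) (Fun (p1 (p2 t)) ts) t'"
        unfolding fn using c(3) e(2) by blast
      moreover have "t = code_trm (Fun (p1 (p2 t)) ts)" using e(1) unfolding code_trm.simps by (rule sym)
      ultimately show ?thesis unfolding S_def by blast
    qed
  qed
  show "K xs l l' \<longleftrightarrow> (l = 0 \<and> l' = 0) \<or>
      (l \<noteq> 0 \<and> l' \<noteq> 0 \<and> S xs (p1 (l - 1)) (p1 (l' - 1)) \<and> K xs (p2 (l - 1)) (p2 (l' - 1)))" (is "_ \<longleftrightarrow> ?R")
  proof
    assume "K xs l l'"
    then obtain ts cs where c: "l = list_encode (map code_trm ts)" "l' = list_encode cs"
      "list_all2 (sub_trm h B (list_decode xs)) ts cs" unfolding K_def by blast
    show ?R
    proof (cases ts)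
      case Nil
      then show ?thesis using c by simp
    next
      case (Cons u ts')
      then obtain d cs' where "cs = d # cs'" "sub_trm h B (list_decode xs) u d"
        "list_all2 (sub_trm h B (list_decode xs)) ts' cs'" using c(3) by (auto simp: list_all2_Cons1)
      then show ?thesis unfolding S_def K_def using c Cons by auto
    qed
  next
    assume ?R
    then show "K xs l l'"
    proof (elim disjE conjE)
      assume "l = 0" "l' = 0"
      then show ?thesis unfolding K_def by (intro exI[of _ "[]"]) simp
    next
      assume l: "l \<noteq> 0" "l' \<noteq> 0" and s: "S xs (p1 (l - 1)) (p1 (l' - 1))" and k: "K xs (p2 (l - 1)) (p2 (l' - 1))"
      obtain u where u: "p1 (l - 1) = code_trm u" "sub_trm h B (list_decode xs) u (p1 (l' - 1))" using s unfolding S_def by blast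
      obtain ts cs where c: "p2 (l - 1) = list_encode (map code_trm ts)" "p2 (l' - 1) = list_encode cs"
        "list_all2 (sub_trm h B (list_decode xs)) ts cs" using k unfolding K_def by blast
      have "l = Suc (prod_encode (p1 (l - 1), p2 (l - 1)))" "l' = Suc (prod_encode (p1 (l' - 1), p2 (l' - 1)))" using l by simp_all
      then have "l = list_encode (map code_trm (u # ts))" "l' = list_encode (p1 (l' - 1) # cs)"
        unfolding u(1) c(1,2) by (simp_all only: list.map list_encode.simps)
      moreover have "list_all2 (sub_trm h B (list_decode xs)) (u # ts) (p1 (l' - 1) # cs)" using u(2) c(3) by simp
      ultimately show ?thesis unfolding K_def by blast
    qed
  qed
qed

lemma list_all2_sub_trm:
  "list_all2 (sub_trm h B ys) ts cs \<longleftrightarrow> (\<forall>t\<in>set ts. \<forall>i\<in>trm_vars t. i < length ys \<and> ys ! i \<in> B) \<and>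
     cs = map code_trm (map (ren_trm (\<lambda>i. h (ys ! i))) ts)"
  by (induction ts arbitrary: cs) (auto simp: list_all2_Cons1 sub_trm_def)

lemma atomic_diagram_pos:
  "prod_encode (1, code_atom b) \<in> atomic_diagram L A \<longleftrightarrow>
    L_atom L b \<and> atom_vars b \<subseteq> univ A \<and> sat_atom A b (\<lambda>a. a)"
  unfolding atomic_diagram_def by (auto dest: code_atom_inj)

lemma name_eq_diagram: "name_eq x \<in> atomic_diagram L A \<longleftrightarrow> x \<in> univ A"
  using atomic_diagram_pos[of "Eq (Var x) (Var x)" L A] by (auto intro: L_trm.intros)

section \<open>The intended model of the theory and its uniqueness on facts\<close>

locale hyp_reduction =
  fixes L :: lang and A :: struct and a0 :: nat and X0 :: "nat set" and q :: prog
  assumes H0: "H_set a0 X0"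
    and red: "\<And>x. eval X0 q x (if x \<in> atomic_diagram L A then 1 else 0)"
begin

abbreviation "U \<equiv> univ A"
abbreviation "B \<equiv> cnt U ` U"
abbreviation "hh \<equiv> enum U"
abbreviation "q0 \<equiv> code_prog q"

definition subS :: "nat \<Rightarrow> nat \<Rightarrow> nat \<Rightarrow> bool" where
  "subS xs c c' \<longleftrightarrow> (\<exists>t. c = code_trm t \<and> sub_trm hh B (list_decode xs) t c')"

definition subL :: "nat \<Rightarrow> nat \<Rightarrow> nat \<Rightarrow> bool" where
  "subL xs l l' \<longleftrightarrow> (\<exists>ts cs. l = list_encode (map code_trm ts) \<and> l' = list_encode cs \<and>
      list_all2 (sub_trm hh B (list_decode xs)) ts cs)"

lemma subS_rec: "subS xs t t' \<longleftrightarrow>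
      (p1 t = 0 \<and> p1 t' = 0 \<and> p2 t < length (list_decode xs) \<and> p2 t' \<in> U \<and>
        cnt U (p2 t') = lhd (drop (p2 t) (list_decode xs))) \<or>
      (p1 t = 1 \<and> p1 t' = 1 \<and> p1 (p2 t') = p1 (p2 t) \<and> subL xs (p2 (p2 t)) (p2 (p2 t')))"
  using sub_trm_rec(1)[where h = hh and B = B and xs = xs and t = t and t' = t'] cnt_eq_iff[of "p2 t'" U "lhd (drop (p2 t) (list_decode xs))"]
  unfolding subS_def subL_def by metis

lemma subL_rec: "subL xs l l' \<longleftrightarrow> (l = 0 \<and> l' = 0) \<or>
      (l \<noteq> 0 \<and> l' \<noteq> 0 \<and> subS xs (p1 (l - 1)) (p1 (l' - 1)) \<and> subL xs (p2 (l - 1)) (p2 (l' - 1)))"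
  using sub_trm_rec(2)[where h = hh and B = B and xs = xs and l = l and l' = l'] unfolding subS_def subL_def .

definition valn :: "nat \<Rightarrow> nat \<Rightarrow> bool" where
  "valn a xs \<longleftrightarrow>
    (p1 a = 0 \<and> (\<exists>t t'. subS xs (p1 (p2 a)) t \<and> subS xs (p2 (p2 a)) t' \<and>
      prod_encode (1, prod_encode (0, prod_encode (t, t'))) \<in> atomic_diagram L A)) \<or>
    (p1 a = 1 \<and> (\<exists>l. subL xs (p2 (p2 a)) l \<and>
      prod_encode (1, prod_encode (1, prod_encode (p1 (p2 a), l))) \<in> atomic_diagram L A))"

text \<open>\<open>valn\<close> speaks of codes and of the diagram, \<open>fact_holds\<close> of
  syntax and satisfaction. They agree because a code passes the substitution only if it codes a
  term, and the diagram contains only codes of \<open>L\<close>-atoms.\<close>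

lemma valn_iff:
  assumes xs: "set xs \<subseteq> B"
  shows "valn a (list_encode xs) \<longleftrightarrow> fact_holds L A hh a xs"
proof -
  let ?g = "\<lambda>i. hh (xs ! i)"
  have "valn a (list_encode xs) \<longleftrightarrow> (\<exists>b. a = code_atom b \<and> atom_vars b \<subseteq> {..<length xs} \<and>
    prod_encode (1, code_atom (ren_atom ?g b)) \<in> atomic_diagram L A)" (is "_ \<longleftrightarrow> ?R")
  proof
    assume "valn a (list_encode xs)"
    then consider t t' where "p1 a = 0" "subS (list_encode xs) (p1 (p2 a)) t" "subS (list_encode xs) (p2 (p2 a)) t'"
        "prod_encode (1, prod_encode (0, prod_encode (t, t'))) \<in> atomic_diagram L A"
      | l where "p1 a = 1" "subL (list_encode xs) (p2 (p2 a)) l"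
        "prod_encode (1, prod_encode (1, prod_encode (p1 (p2 a), l))) \<in> atomic_diagram L A"
      unfolding valn_def by blast
    then show ?R
    proof cases
      case 1
      obtain u where u: "p1 (p2 a) = code_trm u" "sub_trm hh B xs u t" using 1(2) unfolding subS_def by auto
      obtain u' where u': "p2 (p2 a) = code_trm u'" "sub_trm hh B xs u' t'" using 1(3) unfolding subS_def by auto
      have "prod_encode (p1 a, prod_encode (p1 (p2 a), p2 (p2 a))) = a" by simp
      then have "code_atom (Eq u u') = a" unfolding 1(1) u(1) u'(1) by simp
      moreover have "atom_vars (Eq u u') \<subseteq> {..<length xs}" using u(2) u'(2) by (auto simp: sub_trm_def)
      moreover have "prod_encode (1, code_atom (ren_atom ?g (Eq u u'))) \<in> atomic_diagram L A"
        using 1(4) u(2) u'(2) by (simp add: sub_trm_def)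
      ultimately show ?thesis by (intro exI[of _ "Eq u u'"] conjI) simp_all
    next
      case 2
      obtain ts cs where u: "p2 (p2 a) = list_encode (map code_trm ts)" "l = list_encode cs"
        "list_all2 (sub_trm hh B xs) ts cs" using 2(2) unfolding subL_def by auto
      have "prod_encode (p1 a, prod_encode (p1 (p2 a), p2 (p2 a))) = a" by simp
      then have "code_atom (Rel (p1 (p2 a)) ts) = a" unfolding 2(1) u(1) by simp
      moreover have "atom_vars (Rel (p1 (p2 a)) ts) \<subseteq> {..<length xs}" using u(3) by (auto simp: list_all2_sub_trm)
      moreover have "prod_encode (1, code_atom (ren_atom ?g (Rel (p1 (p2 a)) ts))) \<in> atomic_diagram L A"
        using 2(3) u(2,3) by (simp add: list_all2_sub_trm)
      ultimately show ?thesis by (intro exI[of _ "Rel (p1 (p2 a)) ts"] conjI) simp_all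
    qed
  next
    assume ?R
    then obtain b where b: "a = code_atom b" "atom_vars b \<subseteq> {..<length xs}"
      "prod_encode (1, code_atom (ren_atom ?g b)) \<in> atomic_diagram L A" by blast
    have nth: "i < length xs \<Longrightarrow> xs ! i \<in> B" for i using xs nth_mem by blast
    show "valn a (list_encode xs)"
    proof (cases b)
      case (Eq u u')
      have "sub_trm hh B xs u (code_trm (ren_trm ?g u))" "sub_trm hh B xs u' (code_trm (ren_trm ?g u'))"
        using b(2) Eq nth by (auto simp: sub_trm_def)
      then have "subS (list_encode xs) (code_trm u) (code_trm (ren_trm ?g u))"
        "subS (list_encode xs) (code_trm u') (code_trm (ren_trm ?g u'))" unfolding subS_def by auto
      then show ?thesis unfolding valn_def using b Eq by auto
    next
      case (Rel r ts)
      have "list_all2 (sub_trm hh B xs) ts (map code_trm (map (ren_trm ?g) ts))"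
        using b(2) Rel nth unfolding list_all2_sub_trm by auto
      then have "subL (list_encode xs) (list_encode (map code_trm ts)) (list_encode (map code_trm (map (ren_trm ?g) ts)))"
        unfolding subL_def by auto
      then show ?thesis unfolding valn_def using b Rel by auto
    qed
  qed
  also have "\<dots> \<longleftrightarrow> fact_holds L A hh a xs"
  proof -
    have "atom_vars (ren_atom ?g b) \<subseteq> U" if "atom_vars b \<subseteq> {..<length xs}" for b
    proof -
      have "?g i \<in> U" if "i < length xs" for i
        using bij_enum[of U] xs nth_mem[OF that] unfolding bij_betw_def by blast
      then show ?thesis using that by (auto simp: atom_vars_ren)
    qed
    then show ?thesis unfolding atomic_diagram_pos fact_holds_def L_atom_ren sat_atom_ren by blast
  qed
  finally show ?thesis .
qed

definition Zst :: "nat set" where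
  "Zst = {z. (p1 z = 0 \<and> phi (hier (p1 (p2 z))) (p1 (p2 (p2 z))) (p1 (p2 (p2 (p2 z)))) (p2 (p2 (p2 (p2 z))))) \<or>
    (p1 z = 1 \<and> p2 (p2 z) \<in> hier (p1 (p2 z))) \<or>
    (p1 z = 2 \<and> (\<exists>X. H_set (p2 z) X)) \<or>
    (p1 z = 3 \<and> is_prog (p2 z)) \<or>
    (p1 z = 4 \<and> cnt U (p1 (p2 z)) = p2 (p2 z)) \<or>
    (p1 z = 5 \<and> subS (p1 (p2 z)) (p1 (p2 (p2 z))) (p2 (p2 (p2 z)))) \<or>
    (p1 z = 6 \<and> subL (p1 (p2 z)) (p1 (p2 (p2 z))) (p2 (p2 (p2 z)))) \<or>
    (p1 z = 7 \<and> valn (p1 (p2 z)) (p2 (p2 z)))}"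

lemma Zst_simps:
  "zE Zst b p x y \<longleftrightarrow> phi (hier b) p x y" "zY Zst b x \<longleftrightarrow> x \<in> hier b" "zD Zst b \<longleftrightarrow> (\<exists>X. H_set b X)"
  "zP Zst p \<longleftrightarrow> is_prog p" "zC Zst x k \<longleftrightarrow> cnt U x = k" "zS Zst xs c c' \<longleftrightarrow> subS xs c c'"
  "zL Zst xs c c' \<longleftrightarrow> subL xs c c'" "zV Zst a xs \<longleftrightarrow> valn a xs"
  unfolding Zst_def by simp_all

lemma hier_a0: "hier a0 = X0"
  by (rule hier_eq[OF H0])

lemma red_iff: "eval X0 q x 1 \<longleftrightarrow> x \<in> atomic_diagram L A"
  using red[of x] eval_fun[OF red[of x], of 1] by (auto split: if_splits)

lemma theta_Zst: "theta a0 q0 Zst"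
  unfolding theta_def
proof (intro conjI)
  show "th_prog Zst" unfolding th_prog_def Zst_simps using is_prog_rec by blast
  have base: "prod_encode (0, 0) = code_prog PZero" "prod_encode (1, 0) = code_prog PSucc"
    "prod_encode (2, 0) = code_prog PFst" "prod_encode (3, 0) = code_prog PSnd"
    "prod_encode (4, 0) = code_prog POracle" by simp_all
  show "th_eval0 Zst" unfolding th_eval0_def Zst_simps base phi_code eval_iffs by auto
  show "th_eval1 Zst"
    unfolding th_eval1_def Zst_simps
  proof (intro allI impI, elim conjE)
    fix b p r x y assume "is_prog p" "is_prog r"
    then obtain P R where P: "p = code_prog P" "r = code_prog R" unfolding is_prog_def by blast
    have c: "prod_encode (5, prod_encode (code_prog P, code_prog R)) = code_prog (PPair P R)"
      "prod_encode (6, prod_encode (code_prog P, code_prog R)) = code_prog (PComp P R)"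
      "prod_encode (7, prod_encode (code_prog P, code_prog R)) = code_prog (PPrec P R)"
      "prod_encode (8, code_prog P) = code_prog (PMu P)" by simp_all
    show "(phi (hier b) (prod_encode (5, prod_encode (p, r))) x y \<longleftrightarrow> phi (hier b) p x (p1 y) \<and> phi (hier b) r x (p2 y)) \<and>
      (phi (hier b) (prod_encode (6, prod_encode (p, r))) x y \<longleftrightarrow> (\<exists>u. phi (hier b) r x u \<and> phi (hier b) p u y)) \<and>
      (phi (hier b) (prod_encode (7, prod_encode (p, r))) (prod_encode (x, 0)) y \<longleftrightarrow> phi (hier b) p x y) \<and>
      (\<forall>n. phi (hier b) (prod_encode (7, prod_encode (p, r))) (prod_encode (x, Suc n)) y \<longleftrightarrow>
        (\<exists>u. phi (hier b) (prod_encode (7, prod_encode (p, r))) (prod_encode (x, n)) u \<and>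
           phi (hier b) r (prod_encode (x, prod_encode (n, u))) y)) \<and>
      (phi (hier b) (prod_encode (8, p)) x y \<longleftrightarrow> phi (hier b) p (prod_encode (x, y)) 0 \<and>
        (\<forall>m. m < y \<longrightarrow> (\<exists>u. 0 < u \<and> phi (hier b) p (prod_encode (x, m)) u)))"
      unfolding P c phi_code by (intro conjI allI; rule eval_iffs)
  qed
  have h0: "hier 0 = {}" "hier 1 = {}" unfolding hier_def using H_set_0 H_set_1 by auto
  show "th_H a0 Zst"
    unfolding th_H_def Zst_simps
  proof (intro conjI allI impI)
    show "\<exists>X. H_set a0 X" using H0 by blast
    show "x \<notin> hier 0" "x \<notin> hier 1" for x using h0 by auto
  next
    fix c e assume c: "c \<noteq> 0 \<and> (\<exists>X. H_set (2 ^ c) X)"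
    then obtain X where X: "H_set c X" using H_set_succ by blast
    then show "\<exists>X. H_set c X" by blast
    have "hier (2 ^ c) = jump X" "hier c = X" using X hier_eq H_set.H_succ by auto
    then show "e \<in> hier (2 ^ c) \<longleftrightarrow> is_prog e \<and> (\<exists>y. phi (hier c) e e y)"
      using phi_is_prog by (auto simp: jump_def)
  next
    fix e assume "\<exists>X. H_set (3 * 5 ^ e) X"
    then obtain f Y where f: "\<And>n. phi {} e n (f n)" "\<And>n. H_set (f n) (Y n)" unfolding H_set_lim by blast
    show "is_prog e" using phi_is_prog f(1) by blast
    show "\<exists>b. phi (hier 0) e n b \<and> (\<exists>X. H_set b X)" for n using f h0 by auto
    fix z
    have "H_set (3 * 5 ^ e) {prod_encode (x, n) | x n. x \<in> Y n}" using f H_set.H_lim by blast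
    then have "hier (3 * 5 ^ e) = {prod_encode (x, n) | x n. x \<in> Y n}" by (rule hier_eq)
    then have "z \<in> hier (3 * 5 ^ e) \<longleftrightarrow> p1 z \<in> Y (p2 z)"
      using p_simps(3)[of z] by (auto, metis)
    moreover have "phi (hier 0) e n b \<longleftrightarrow> b = f n" for n b unfolding h0 using f(1) phi_fun by blast
    ultimately show "z \<in> hier (3 * 5 ^ e) \<longleftrightarrow> (\<exists>b. phi (hier 0) e (p2 z) b \<and> p1 z \<in> hier b)"
      using hier_eq[OF f(2)] by simp
  qed
  have diag: "phi (hier a0) q0 x 1 \<longleftrightarrow> x \<in> atomic_diagram L A" for x
    by (simp add: hier_a0 red_iff)
  show "th_cnt a0 q0 Zst"
    unfolding th_cnt_def Zst_simps diag name_eq_diagram by (auto simp: cnt_0 cnt_Suc)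
  show "th_sub a0 q0 Zst"
    unfolding th_sub_def Zst_simps diag name_eq_diagram using subS_rec subL_rec by blast
  show "th_val a0 q0 Zst"
    unfolding th_val_def Zst_simps diag using valn_def by blast
qed

text \<open>Determinacy follows the order of dependence: programs and substitution by induction on
  codes, evaluation by induction on programs, the levels leading to \<open>a0\<close> by induction
  along \<open>H_set\<close>. Elsewhere, as at indices outside the hierarchy, \<open>Z\<close> may
  deviate from \<open>Zst\<close>.\<close>

lemma theta_unique:
  assumes Z: "theta a0 q0 Z" shows "zV Z a xs \<longleftrightarrow> valn a xs"
proof -
  have Zs: "th_prog Z" "th_eval0 Z" "th_eval1 Z" "th_H a0 Z" "th_cnt a0 q0 Z" "th_sub a0 q0 Z" "th_val a0 q0 Z"
    using Z unfolding theta_def by blast+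
  have P: "zP Z p \<longleftrightarrow> is_prog p" for p
  proof (induction p rule: less_induct)
    case (less p)
    have "zP Z (p2 p) \<longleftrightarrow> is_prog (p2 p)" if "p1 p \<noteq> 0" using less p2_less[OF that] by blast
    moreover have "(zP Z (p1 (p2 p)) \<longleftrightarrow> is_prog (p1 (p2 p))) \<and> (zP Z (p2 (p2 p)) \<longleftrightarrow> is_prog (p2 (p2 p)))" if "p1 p \<noteq> 0"
      using less le_less_trans[OF p1_le p2_less[OF that]] le_less_trans[OF p2_le p2_less[OF that]] by blast
    ultimately show ?case
      unfolding Zs(1)[unfolded th_prog_def, rule_format, of p] is_prog_rec[of p]
      by (cases "p1 p = 0") simp_all
  qed
  have code: "zP Z (code_prog r)" for r unfolding P is_prog_def by blast
  note T = Zs(3)[unfolded th_eval1_def, THEN spec, THEN spec, THEN spec, THEN spec, THEN spec, THEN mp, OF conjI[OF code code]]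
  \<comment> \<open>The oracle is whatever \<open>Z\<close> says about \<open>b\<close>, so
    evaluation is settled before anything is known about the hierarchy.\<close>
  have E: "zE Z b (code_prog r) x y \<longleftrightarrow> eval {z. zY Z b z} r x y" for b r x y
  proof (induction r arbitrary: x y)
    case (PPair r s)
    show ?case unfolding code_prog.simps eval_iffs T[THEN conjunct1] PPair ..
  next
    case (PComp r s)
    show ?case unfolding code_prog.simps eval_iffs T[THEN conjunct2, THEN conjunct1] PComp ..
  next
    case (PPrec r s)
    have "zE Z b (code_prog (PPrec r s)) (prod_encode (u, n)) y \<longleftrightarrow> eval {z. zY Z b z} (PPrec r s) (prod_encode (u, n)) y" for u n y
    proof (induction n arbitrary: y)
      case 0
      show ?case unfolding code_prog.simps eval_iffs T[THEN conjunct2, THEN conjunct2, THEN conjunct1] PPrec ..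
    next
      case (Suc n)
      show ?case
        unfolding code_prog.simps eval_iffs Suc[unfolded code_prog.simps, symmetric] PPrec(2)[symmetric]
        by (rule T[THEN conjunct2, THEN conjunct2, THEN conjunct2, THEN conjunct1, THEN spec])
    qed
    from this[of "p1 x" "p2 x"] show ?case by simp
  next
    case (PMu r)
    show ?case
      unfolding code_prog.simps eval_iffs PMu[symmetric]
      by (rule T[THEN conjunct2, THEN conjunct2, THEN conjunct2, THEN conjunct2])
  qed (use Zs(2) in \<open>auto simp: th_eval0_def eval_iffs\<close>)
  have phiE: "zP Z e \<and> zE Z b e x y \<longleftrightarrow> phi {z. zY Z b z} e x y" for b e x y
    unfolding P using E by (auto simp: is_prog_def phi_def)
  have Y0: "{z. zY Z 0 z} = {}" "{z. zY Z 1 z} = {}" using Zs(4) unfolding th_H_def by auto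
  \<comment> \<open>Only indices in \<open>zD\<close> are constrained; the clauses of
    \<open>th_H\<close> hand \<open>zD\<close> on to the lower notations that the induction
    needs.\<close>
  have Hrec: "H_set b X \<Longrightarrow> zD Z b \<Longrightarrow> {z. zY Z b z} = X" for b X
  proof (induction rule: H_set.induct)
    case H_zero
    then show ?case using Y0 by simp
  next
    case (H_succ c X)
    have "c \<noteq> 0" using H_succ.hyps H_set_0 by metis
    then have "zD Z c" and y: "zY Z (2 ^ c) e \<longleftrightarrow> zP Z e \<and> (\<exists>y. zE Z c e e y)" for e
      using Zs(4) H_succ.prems unfolding th_H_def by blast+
    then have X: "{z. zY Z c z} = X" using H_succ.IH by blast
    have "zY Z (2 ^ c) e \<longleftrightarrow> e \<in> jump X" for e
      unfolding y jump_def mem_Collect_eq X[symmetric] phiE[symmetric] by blast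
    then show ?case by blast
  next
    case (H_lim e f Y)
    have l: "zP Z e" "\<exists>b. zE Z 0 e n b \<and> zD Z b" "zY Z (3 * 5 ^ e) z \<longleftrightarrow> (\<exists>b. zE Z 0 e (p2 z) b \<and> zY Z b (p1 z))" for n z
      using Zs(4) H_lim.prems unfolding th_H_def by blast+
    have e: "zE Z 0 e n b \<longleftrightarrow> b = f n" for n b
      using phiE[of e 0 n b] l(1) H_lim(1) phi_fun unfolding Y0 by blast
    then have "zD Z (f n)" for n using l(2)[of n] by simp
    then have "{z. zY Z (f n) z} = Y n" for n using H_lim(2) by blast
    then have "zY Z (f n) x \<longleftrightarrow> x \<in> Y n" for n x by blast
    then have y: "zY Z (3 * 5 ^ e) z \<longleftrightarrow> p1 z \<in> Y (p2 z)" for z unfolding l(3) e by simp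
    show ?case
    proof (intro set_eqI iffI)
      fix z assume "z \<in> {z. zY Z (3 * 5 ^ e) z}"
      then have "p1 z \<in> Y (p2 z)" using y by blast
      then show "z \<in> {prod_encode (x, n) | x n. x \<in> Y n}" using p_simps(3)[of z, symmetric] by blast
    next
      fix z assume "z \<in> {prod_encode (x, n) | x n. x \<in> Y n}"
      then obtain x n where "z = prod_encode (x, n)" "x \<in> Y n" by blast
      then have "p1 z \<in> Y (p2 z)" by simp
      then show "z \<in> {z. zY Z (3 * 5 ^ e) z}" using y by blast
    qed
  qed
  have "{z. zY Z a0 z} = X0" using Hrec[OF H0] Zs(4) unfolding th_H_def by blast
  then have diag: "zE Z a0 q0 x 1 \<longleftrightarrow> x \<in> atomic_diagram L A" for x unfolding E using red_iff by simp
  have C: "zC Z x k \<longleftrightarrow> cnt U x = k" for x k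
  proof (induction x arbitrary: k)
    case 0
    then show ?case using Zs(5) by (auto simp: th_cnt_def cnt_0)
  next
    case (Suc x)
    have "zC Z (Suc x) k \<longleftrightarrow> (x \<in> U \<and> k \<noteq> 0 \<and> zC Z x (k - 1)) \<or> (x \<notin> U \<and> zC Z x k)"
      using Zs(5) unfolding th_cnt_def diag name_eq_diagram by blast
    then show ?case unfolding Suc cnt_Suc by (cases k) auto
  qed
  have SL: "(\<forall>t'. zS Z xs n t' \<longleftrightarrow> subS xs n t') \<and> (\<forall>l'. zL Z xs n l' \<longleftrightarrow> subL xs n l')" for xs n
  proof (induction n rule: less_induct)
    case (less n)
    have L: "zL Z xs n l' \<longleftrightarrow> (n = 0 \<and> l' = 0) \<or>
      (n \<noteq> 0 \<and> l' \<noteq> 0 \<and> zS Z xs (p1 (n - 1)) (p1 (l' - 1)) \<and> zL Z xs (p2 (n - 1)) (p2 (l' - 1)))" for l'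
      by (rule Zs(6)[unfolded th_sub_def, THEN conjunct2, THEN spec, THEN spec, THEN spec])
    have "zL Z xs n l' \<longleftrightarrow> subL xs n l'" for l'
    proof (cases "n = 0")
      case True
      show ?thesis unfolding L[of l'] by (subst subL_rec) (use True in simp)
    next
      case False
      have "p1 (n - 1) < n" "p2 (n - 1) < n"
        using le_less_trans[OF p1_le, of "n - 1" n] le_less_trans[OF p2_le, of "n - 1" n] False by simp_all
      from less[OF this(1)] less[OF this(2)] show ?thesis
        unfolding L[of l'] by (subst subL_rec) (use False in simp)
    qed
    moreover have S: "zS Z xs n t' \<longleftrightarrow>
      (p1 n = 0 \<and> p1 t' = 0 \<and> p2 n < length (list_decode xs) \<and> p2 t' \<in> U \<and>
        cnt U (p2 t') = lhd (drop (p2 n) (list_decode xs))) \<or>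
      (p1 n = 1 \<and> p1 t' = 1 \<and> p1 (p2 t') = p1 (p2 n) \<and> zL Z xs (p2 (p2 n)) (p2 (p2 t')))" for t'
      by (rule Zs(6)[unfolded th_sub_def diag name_eq_diagram C, THEN conjunct1, THEN spec, THEN spec, THEN spec])
    have "zS Z xs n t' \<longleftrightarrow> subS xs n t'" for t'
    proof (cases "p1 n = 1")
      case True
      then have "p2 (p2 n) < n" by (intro le_less_trans[OF p2_le p2_less]) simp
      from less[OF this] show ?thesis unfolding S[of t'] by (subst subS_rec) (use True in simp)
    next
      case False
      show ?thesis unfolding S[of t'] by (subst subS_rec) (use False in simp)
    qed
    ultimately show ?case by blast
  qed
  have "zV Z a xs \<longleftrightarrow> (p1 a = 0 \<and> (\<exists>t t'. zS Z xs (p1 (p2 a)) t \<and> zS Z xs (p2 (p2 a)) t' \<and>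
      prod_encode (1, prod_encode (0, prod_encode (t, t'))) \<in> atomic_diagram L A)) \<or>
    (p1 a = 1 \<and> (\<exists>l. zL Z xs (p2 (p2 a)) l \<and>
      prod_encode (1, prod_encode (1, prod_encode (p1 (p2 a), l))) \<in> atomic_diagram L A))"
    by (rule Zs(7)[unfolded th_val_def diag, THEN spec, THEN spec])
  moreover have "zS Z xs n t' \<longleftrightarrow> subS xs n t'" "zL Z xs n t' \<longleftrightarrow> subL xs n t'" for n t' using SL by blast+
  ultimately show ?thesis unfolding valn_def by simp
qed

theorem fact_clauses:
  "\<exists>l. cf l \<and> (\<exists>M. mdl l M) \<and> (\<forall>M a xs. mdl l M \<longrightarrow> set xs \<subseteq> B \<longrightarrow>
     (prod_encode (0, prod_encode (7, prod_encode (a, list_encode xs))) \<in> M \<longleftrightarrow> fact_holds L A hh a xs))"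
proof -
  obtain l where l: "cf l" "\<And>M. mdl l M \<Longrightarrow> theta a0 q0 (zpart M)"
    "\<And>Z. theta a0 q0 Z \<Longrightarrow> \<exists>M. mdl l M \<and> zpart M = Z" using arith_sentence[OF arith_theta] by blast
  have "zV (zpart M) a (list_encode xs) \<longleftrightarrow> fact_holds L A hh a xs" if "mdl l M" "set xs \<subseteq> B" for M a xs
    using theta_unique[OF l(2)[OF that(1)]] valn_iff[OF that(2)] by blast
  then show ?thesis using l(1) l(3)[OF theta_Zst] unfolding zpart_def by blast
qed

end

section \<open>Ranks of well-founded relations\<close>

definition wf_rank :: "nat rel \<Rightarrow> nat \<Rightarrow> cord" where
  "wf_rank r = wfrec r (\<lambda>f x. strict_sup (f ` {y. (y, x) \<in> r}))"

lemma wf_rank_eq: "wf r \<Longrightarrow> wf_rank r x = strict_sup (wf_rank r ` {y. (y, x) \<in> r})"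
  unfolding wf_rank_def by (subst wfrec) (auto intro!: arg_cong[of _ _ strict_sup] simp: cut_apply image_def)

lemma wf_rank_less: "wf r \<Longrightarrow> (y, x) \<in> r \<Longrightarrow> wf_rank r y < wf_rank r x"
  by (subst wf_rank_eq[of r x]) (auto intro!: strict_sup_upper)

text \<open>In a transitive relation an element reached after several steps is itself a predecessor,
  so no rank is skipped. This is the source of the fatness of the trees.\<close>

lemma wf_rank_attained:
  assumes r: "wf r" "trans r" and \<gamma>: "\<gamma> < wf_rank r x"
  shows "\<exists>y. (y, x) \<in> r \<and> wf_rank r y = \<gamma>"
  using r(1) \<gamma>
proof (induction x rule: wf_induct_rule)
  case (less x)
  have "\<gamma> < strict_sup (wf_rank r ` {y. (y, x) \<in> r})" using less.prems unfolding wf_rank_eq[OF r(1), of x] .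
  then obtain y where y: "(y, x) \<in> r" "\<gamma> \<le> wf_rank r y" using less_strict_supD by blast
  show ?case
  proof (cases "\<gamma> = wf_rank r y")
    case False
    then have "\<gamma> < wf_rank r y" using y(2) by simp
    from less.IH[OF y(1) this] obtain z where z: "(z, y) \<in> r" "wf_rank r z = \<gamma>" by blast
    then show ?thesis using transD[OF r(2) z(1) y(1)] by blast
  qed (use y in blast)
qed

lemma seg_eq_strict_sup:
  assumes "Well_order r" "x \<in> Field r"
  shows "seg r x = strict_sup (seg r ` {y. (y, x) \<in> r \<and> y \<noteq> x})"
proof (rule antisym)
  show "seg r x \<le> strict_sup (seg r ` {y. (y, x) \<in> r \<and> y \<noteq> x})"
  proof (rule leI, rule notI)
    assume l: "strict_sup (seg r ` {y. (y, x) \<in> r \<and> y \<noteq> x}) < seg r x"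
    then have "strict_sup (seg r ` {y. (y, x) \<in> r \<and> y \<noteq> x}) < abs_cord r"
      using seg_less[OF assms] by (rule order_less_trans)
    then obtain y where y: "y \<in> Field r" "strict_sup (seg r ` {y. (y, x) \<in> r \<and> y \<noteq> x}) = seg r y"
      using seg_surj[OF assms(1)] by blast
    then have "(y, x) \<in> r \<and> y \<noteq> x" using seg_less_iff[OF assms(1) y(1) assms(2)] l by simp
    then have "seg r y < strict_sup (seg r ` {y. (y, x) \<in> r \<and> y \<noteq> x})" by (intro strict_sup_upper) auto
    then show False using y(2) by simp
  qed
  show "strict_sup (seg r ` {y. (y, x) \<in> r \<and> y \<noteq> x}) \<le> seg r x"
    by (rule strict_sup_least) (use seg_strict[OF assms(1)] in auto)
qed

text \<open>Least elements of subsets with two and three members already give totality and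
  transitivity, so only asymmetry and least elements have to be checked for the Kleene-Brouwer
  order.\<close>

lemma Well_order_least:
  fixes R :: "nat \<Rightarrow> nat \<Rightarrow> bool"
  assumes asym: "\<And>x y. R x y \<Longrightarrow> R y x \<Longrightarrow> False"
    and least: "\<And>Q. Q \<subseteq> F \<Longrightarrow> Q \<noteq> {} \<Longrightarrow> \<exists>m\<in>Q. \<forall>q\<in>Q. q = m \<or> R m q"
    and r: "r = {(x, y). x \<in> F \<and> y \<in> F \<and> (x = y \<or> R x y)}"
  shows "Well_order r" "Field r = F"
proof -
  show F: "Field r = F" unfolding r Field_def by auto
  have tr: "x = z \<or> R x z" if "x \<in> F" "y \<in> F" "z \<in> F" "R x y" "R y z" for x y z
    using least[of "{x, y, z}"] asym that by auto
  have tot: "x = y \<or> R x y \<or> R y x" if "x \<in> F" "y \<in> F" for x y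
    using least[of "{x, y}"] that by auto
  have "wf (r - Id)"
    unfolding wf_eq_minimal
  proof (intro allI impI)
    fix Q :: "nat set" and x assume x: "x \<in> Q"
    show "\<exists>z\<in>Q. \<forall>y. (y, z) \<in> r - Id \<longrightarrow> y \<notin> Q"
    proof (cases "Q \<inter> F = {}")
      case True
      then show ?thesis using x unfolding r by blast
    next
      case False
      then obtain m where m: "m \<in> Q \<inter> F" "\<forall>q\<in>Q \<inter> F. q = m \<or> R m q" using least[of "Q \<inter> F"] by auto
      show ?thesis
      proof (intro bexI[of _ m] allI impI notI)
        fix y assume y: "(y, m) \<in> r - Id" "y \<in> Q"
        then have "y \<in> Q \<inter> F" "y \<noteq> m" "R y m" unfolding r by auto
        then show False using m(2) asym by blast
      qed (use m in blast)
    qed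
  qed
  then show "Well_order r"
    unfolding well_order_on_def linear_order_on_def partial_order_on_def preorder_on_def F
    using tr tot asym unfolding r refl_on_def trans_def antisym_def total_on_def by blast
qed

section \<open>Trees of partial solutions\<close>

definition compat :: "nat \<Rightarrow> nat \<Rightarrow> bool" where
  "compat t t' \<longleftrightarrow> \<not> (p1 t = p1 t' \<and> (p2 t = 0) \<noteq> (p2 t' = 0))"

lemma holds_compat: "holds M t \<Longrightarrow> holds M t' \<Longrightarrow> compat t t'"
  unfolding holds_def compat_def by auto

definition path :: "(nat \<Rightarrow> nat) \<Rightarrow> nat \<Rightarrow> nat list" where
  "path g k = map g (rev [0..<k])"

lemma path_simps [simp]: "path g 0 = []" "path g (Suc k) = g k # path g k" "length (path g k) = k"
  by (simp_all add: path_def)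

lemma drop_path: "i \<le> k \<Longrightarrow> drop i (path g k) = path g (k - i)"
proof (induction k arbitrary: i)
  case (Suc k)
  then show ?case by (cases i) auto
qed simp

locale clauses =
  fixes l :: "nat \<Rightarrow> nat" and UB :: "nat set" and tr :: "nat \<Rightarrow> bool"
  assumes cf_l: "cf l" and dec_UB: "dec (\<lambda>i. i \<in> UB)" and model: "\<exists>M. mdl l M"
    and decides: "mdl l M \<Longrightarrow> set (list_decode (p2 n)) \<subseteq> UB \<Longrightarrow> prod_encode (0, prod_encode (7, n)) \<in> M \<longleftrightarrow> tr n"
begin

abbreviation "gv n \<equiv> prod_encode (0, prod_encode (7, n))"

text \<open>A list \<open>s\<close> is read from its end: the entry above a tail of length \<open>c\<close> selects, through \<open>f\<close>,
  a literal of the \<open>c\<close>-th clause.\<close>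

definition lit_at :: "(nat \<Rightarrow> nat) \<Rightarrow> nat list \<Rightarrow> nat \<Rightarrow> nat" where
  "lit_at f s i = l (prod_encode (length (drop (Suc i) s), f (lhd (drop i s))))"

text \<open>The pair \<open>prod_encode (gv n, b)\<close> acts as an additional literal: it asserts
  the fact \<open>n\<close> if \<open>b \<noteq> 0\<close> and denies it if
  \<open>b = 0\<close>.\<close>

definition Ok :: "(nat \<Rightarrow> nat) \<Rightarrow> nat \<Rightarrow> nat \<Rightarrow> nat list \<Rightarrow> bool" where
  "Ok f b n s \<longleftrightarrow> (\<forall>i<length s. compat (prod_encode (gv n, b)) (lit_at f s i) \<and>
     (\<forall>j<length s. compat (lit_at f s i) (lit_at f s j)))"

lemma Ok_Nil [simp]: "Ok f b n []"
  by (simp add: Ok_def)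

lemma Ok_tl: "Ok f b n (x # s) \<Longrightarrow> Ok f b n s"
proof -
  assume ok: "Ok f b n (x # s)"
  have eq: "lit_at f (x # s) (Suc i) = lit_at f s i" for i by (simp add: lit_at_def)
  show "Ok f b n s"
    unfolding Ok_def
  proof (intro allI impI conjI)
    fix i j assume i: "i < length s"
    show "compat (prod_encode (gv n, b)) (lit_at f s i)" using ok i eq unfolding Ok_def by (metis Suc_less_eq length_Cons)
    assume "j < length s"
    then show "compat (lit_at f s i) (lit_at f s j)" using ok i eq unfolding Ok_def by (metis Suc_less_eq length_Cons)
  qed
qed

lemma Ok_drop: "Ok f b n s \<Longrightarrow> Ok f b n (drop i s)"
proof (induction s arbitrary: i)
  case (Cons x s)
  then show ?case using Ok_tl[OF Cons.prems] by (cases i) auto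
qed simp

lemma Ok_holds:
  assumes "gv n \<in> M \<longleftrightarrow> b \<noteq> 0" "\<And>i. i < length s \<Longrightarrow> holds M (lit_at f s i)"
  shows "Ok f b n s"
  unfolding Ok_def using assms holds_compat[of M] by (metis holds_prod_encode)

lemma lit_at_path: "c < k \<Longrightarrow> lit_at f (path g k) (k - Suc c) = l (prod_encode (c, f (g c)))"
  unfolding lit_at_def by (simp add: drop_path Suc_diff_Suc)

text \<open>Pairwise compatible choices define a model: exactly the variables chosen positively are
  made true, together with \<open>gv n\<close> if \<open>b \<noteq> 0\<close>.\<close>

lemma path_model:
  assumes ok: "\<And>k. Ok f b n (path g k)"
  shows "\<exists>M. mdl l M \<and> (gv n \<in> M \<longleftrightarrow> b \<noteq> 0)"
proof -
  let ?t = "\<lambda>c. l (prod_encode (c, f (g c)))"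
  have c1: "compat (prod_encode (gv n, b)) (?t c)" for c
    using ok[of "Suc c", unfolded Ok_def, THEN spec[of _ 0]] lit_at_path[of c "Suc c" f g] by simp
  have c2: "compat (?t c) (?t d)" for c d
  proof -
    let ?k = "Suc (max c d)"
    have "c < ?k" "d < ?k" by auto
    then have "?k - Suc c < length (path g ?k)" "?k - Suc d < length (path g ?k)" by auto
    then have "compat (lit_at f (path g ?k) (?k - Suc c)) (lit_at f (path g ?k) (?k - Suc d))"
      using ok[of ?k] unfolding Ok_def by blast
    then show ?thesis using lit_at_path \<open>c < ?k\<close> \<open>d < ?k\<close> by metis
  qed
  define M where "M = {v. (v = gv n \<and> b \<noteq> 0) \<or> (\<exists>c. p1 (?t c) = v \<and> p2 (?t c) \<noteq> 0)}"
  have "holds M (?t c)" for c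
    unfolding holds_def
  proof
    assume "p1 (?t c) \<in> M"
    then consider "p1 (?t c) = gv n" "b \<noteq> 0" | d where "p1 (?t d) = p1 (?t c)" "p2 (?t d) \<noteq> 0"
      unfolding M_def by blast
    then show "p2 (?t c) \<noteq> 0"
    proof cases
      case 1
      then show ?thesis using c1[of c] unfolding compat_def by simp
    next
      case 2
      then show ?thesis using c2[of d c] unfolding compat_def by simp
    qed
  qed (auto simp: M_def)
  then have "mdl l M" unfolding mdl_def by blast
  moreover have "b \<noteq> 0" if "p1 (?t c) = gv n" "p2 (?t c) \<noteq> 0" for c
    using c1[of c] that unfolding compat_def by simp
  then have "gv n \<in> M \<longleftrightarrow> b \<noteq> 0" unfolding M_def by blast
  ultimately show ?thesis by blast
qed

lemma model_path:
  assumes M: "mdl l M" "gv n \<in> M \<longleftrightarrow> b \<noteq> 0"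
  shows "\<exists>g. (\<forall>k. Ok (\<lambda>x. x) b n (path g k)) \<and> (\<forall>c. holds M (l (prod_encode (c, g c))))"
proof -
  obtain g where g: "\<And>c. holds M (l (prod_encode (c, g c)))" using M(1) unfolding mdl_def by metis
  have "Ok (\<lambda>x. x) b n (path g k)" for k
  proof (rule Ok_holds[OF M(2)])
    fix i assume "i < length (path g k)"
    then have "i = k - Suc (k - Suc i)" "k - Suc i < k" by auto
    then show "holds M (lit_at (\<lambda>x. x) (path g k) i)" using lit_at_path[of "k - Suc i" k "\<lambda>x. x" g] g by metis
  qed
  then show ?thesis using g by blast
qed

text \<open>Nodes of the joint tree: entries \<open>(n, (y, y'))\<close> select literals for two would-be models that
  disagree on the variable \<open>gv n\<close>.  It has no infinite path.\<close>

definition inP :: "nat list \<Rightarrow> bool" where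
  "inP z \<longleftrightarrow> z = [] \<or> (set (list_decode (p2 (p1 (lhd z)))) \<subseteq> UB \<and> (\<forall>u\<in>set z. p1 u = p1 (lhd z)) \<and>
     Ok (\<lambda>u. p1 (p2 u)) 1 (p1 (lhd z)) z \<and> Ok (\<lambda>u. p2 (p2 u)) 0 (p1 (lhd z)) z)"

lemma inP_tl: "inP (x # z) \<Longrightarrow> inP z"
  unfolding inP_def by (cases z) (auto dest: Ok_tl)

text \<open>An infinite branch is about one and the same fact \<open>n\<close> and yields two
  models, one with \<open>gv n\<close> and one without, against \<open>decides\<close>.\<close>

lemma wf_inP: "wf {(x # z, z) | x z. inP (x # z)}" (is "wf ?r")
proof (rule ccontr)
  assume "\<not> wf ?r"
  then obtain Z where Z: "\<And>i. (Z (Suc i), Z i) \<in> ?r" unfolding wf_iff_no_infinite_down_chain by blast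
  then have "\<exists>x. Z (Suc i) = x # Z i \<and> inP (x # Z i)" for i by blast
  then obtain x where x: "\<And>i. Z (Suc i) = x i # Z i" "\<And>i. inP (x i # Z i)" by metis
  \<comment> \<open>A descending chain may start at any node; the entries of that node are put in
    front to obtain a branch from the root.\<close>
  define k0 where "k0 = length (Z 0)"
  define g where "g c = (if c < k0 then rev (Z 0) ! c else x (c - k0))" for c
  have p: "path g (k0 + i) = Z i" for i
  proof (induction i)
    case 0
    have "path g k0 = Z 0"
      unfolding path_def by (rule nth_equalityI) (auto simp: k0_def g_def rev_nth)
    then show ?case by simp
  next
    case (Suc i)
    then show ?case using x(1)[of i] by (simp add: g_def)
  qed
  define n where "n = p1 (x 0)"
  have lhd: "p1 (lhd (Z (Suc i))) = n" for i
  proof (induction i)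
    case 0
    show ?case using x(1)[of 0] by (simp add: n_def)
  next
    case (Suc i)
    have "lhd (Z (Suc i)) \<in> set (Z (Suc (Suc i)))" using x(1)[of i] x(1)[of "Suc i"] by simp
    then show ?case using x(1,2)[of "Suc i"] Suc unfolding inP_def by auto
  qed
  have in': "inP (Z (Suc i))" "Z (Suc i) \<noteq> []" for i using x by simp_all
  have ok: "Ok (\<lambda>u. p1 (p2 u)) 1 n (Z (Suc i)) \<and> Ok (\<lambda>u. p2 (p2 u)) 0 n (Z (Suc i))" for i
    using in'[of i] lhd[of i] unfolding inP_def by auto
  have nUB: "set (list_decode (p2 n)) \<subseteq> UB"
    using in'[of 0] lhd[of 0] unfolding inP_def by auto
  have "path g k = drop (Suc k0) (path g (k0 + Suc k))" for k using drop_path[of "Suc k0" "k0 + Suc k" g] by simp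
  then have "Ok (\<lambda>u. p1 (p2 u)) 1 n (path g k)" "Ok (\<lambda>u. p2 (p2 u)) 0 n (path g k)" for k
    using ok Ok_drop unfolding p by metis+
  then obtain M M' where "mdl l M" "gv n \<in> M" "mdl l M'" "gv n \<notin> M'"
    using path_model[of _ 1 n g] path_model[of _ 0 n g] by (metis zero_neq_one)
  then show False using decides nUB by blast
qed

text \<open>The Kleene-Brouwer order; positions are counted from the end of the list, where the root is.\<close>

definition kat :: "nat list \<Rightarrow> nat \<Rightarrow> nat" where
  "kat z k = lhd (drop (length z - Suc k) z)"

definition kb :: "nat list \<Rightarrow> nat list \<Rightarrow> bool" where
  "kb z z' \<longleftrightarrow> (\<exists>k<length z. k < Suc (length z') \<and> (\<forall>i<k. kat z i = kat z' i) \<and>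
     (k = length z' \<or> kat z k < kat z' k))"

lemma kat_append: "i < length u \<Longrightarrow> kat (w @ u) i = kat u i"
  by (simp add: kat_def)

lemma kat_Cons: "kat (w @ x # u) (length u) = x"
  by (simp add: kat_def)

lemma kb_asym: "kb z z' \<Longrightarrow> kb z' z \<Longrightarrow> False"
proof -
  assume "kb z z'" "kb z' z"
  then obtain k k' where k: "k < length z" "k \<le> length z'" "\<forall>i<k. kat z i = kat z' i" "k = length z' \<or> kat z k < kat z' k"
    and k': "k' < length z'" "k' \<le> length z" "\<forall>i<k'. kat z' i = kat z i" "k' = length z \<or> kat z' k' < kat z k'"
    unfolding kb_def by (auto simp: less_Suc_eq_le)
  consider "k < k'" | "k' < k" | "k = k'" by linarith
  then show False using k k' by cases auto
qed

lemma kb_extend: "w \<noteq> [] \<Longrightarrow> kb (w @ u) u"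
  unfolding kb_def by (rule exI[of _ "length u"]) (auto simp: kat_append)

lemma kb_branch: "x < y \<Longrightarrow> kb (w @ x # u) (w' @ y # u)"
  unfolding kb_def
proof (rule exI[of _ "length u"], intro conjI allI impI)
  fix i assume i: "i < length u"
  show "kat (w @ x # u) i = kat (w' @ y # u) i"
    using kat_append[OF i, of "w @ [x]"] kat_append[OF i, of "w' @ [y]"] by simp
qed (auto simp: kat_Cons)

text \<open>Induction over the well-founded joint tree, where extensions count as smaller. Among the
  members of \<open>Q\<close> that extend \<open>u\<close> properly, those with the least next entry
  come first, and all of them precede \<open>u\<close>.\<close>

lemma kb_least:
  "Q \<noteq> {} \<Longrightarrow> (\<And>q. q \<in> Q \<Longrightarrow> inP q \<and> (\<exists>w. q = w @ u)) \<Longrightarrow> \<exists>m\<in>Q. \<forall>q\<in>Q. q = m \<or> kb m q"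
  using wf_inP
proof (induction u arbitrary: Q rule: wf_induct_rule)
  case (less u)
  have step: "q = u \<or> (\<exists>w x. q = w @ x # u)" if q: "q \<in> Q" for q
  proof -
    obtain w where w: "q = w @ u" using less.prems(2)[OF q] by blast
    show ?thesis using w by (cases w rule: rev_cases) auto
  qed
  show ?case
  proof (cases "Q = {u}")
    case False
    let ?X = "{x. \<exists>w. w @ x # u \<in> Q}"
    have "?X \<noteq> {}" using False step less.prems(1) by blast
    then have x: "(LEAST x. x \<in> ?X) \<in> ?X" by (metis (no_types, lifting) LeastI_ex all_not_in_conv)
    define x where "x = (LEAST x. x \<in> ?X)"
    let ?Q = "{q \<in> Q. \<exists>w. q = w @ x # u}"
    have ne: "?Q \<noteq> {}" using x unfolding x_def by blast
    have inP_suffix: "inP (w @ v) \<Longrightarrow> inP v" for w v by (induction w) (auto dest: inP_tl)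
    have "inP (x # u)" using ne less.prems(2) inP_suffix by blast
    then have "(x # u, u) \<in> {(x # z, z) | x z. inP (x # z)}" by blast
    from less.IH[OF this ne] obtain m where m: "m \<in> ?Q" "\<forall>q\<in>?Q. q = m \<or> kb m q"
      using less.prems(2) by blast
    obtain w where w: "m = w @ x # u" using m(1) by blast
    have "q = m \<or> kb m q" if q: "q \<in> Q" for q
      using step[OF q]
    proof
      assume "q = u"
      then show ?thesis using kb_extend[of "w @ [x]" u] w by simp
    next
      assume "\<exists>w x. q = w @ x # u"
      then obtain w' y where y: "q = w' @ y # u" by blast
      then have "x \<le> y" unfolding x_def using q by (intro Least_le) blast
      then consider "x = y" | "x < y" by linarith
      then show ?thesis
      proof cases
        case 1
        then have "q \<in> ?Q" using q y by blast
        then show ?thesis using m(2) by blast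
      next
        case 2
        then show ?thesis using kb_branch w y by blast
      qed
    qed
    then show ?thesis using m(1) by blast
  qed simp
qed

definition W :: "nat rel" where
  "W = {(c, c'). c \<in> {c. inP (list_decode c)} \<and> c' \<in> {c. inP (list_decode c)} \<and>
     (c = c' \<or> kb (list_decode c) (list_decode c'))}"

lemma Well_order_W: "Well_order W" and Field_W: "Field W = {c. inP (list_decode c)}"
proof -
  have least: "\<exists>m\<in>Q. \<forall>q\<in>Q. q = m \<or> kb (list_decode m) (list_decode q)"
    if Q: "Q \<subseteq> {c. inP (list_decode c)}" "Q \<noteq> {}" for Q
  proof -
    obtain m where m: "m \<in> list_decode ` Q" "\<forall>q\<in>list_decode ` Q. q = m \<or> kb m q"
      using kb_least[of "list_decode ` Q" "[]"] Q by auto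
    then show ?thesis by (metis (no_types, lifting) image_iff list_decode_inverse)
  qed
  show "Well_order W" "Field W = {c. inP (list_decode c)}"
    by (rule Well_order_least[of "\<lambda>c c'. kb (list_decode c) (list_decode c')" "{c. inP (list_decode c)}" W, OF _ _ W_def];
      use kb_asym least in blast)+
qed

lemma zero_Field_W: "0 \<in> Field W"
  by (simp add: Field_W inP_def)

text \<open>The number 0 codes the empty list, which is the root, and extensions precede their
  tails.\<close>

lemma W_zero_top: "c \<in> Field W \<Longrightarrow> (c, 0) \<in> W"
proof -
  assume c: "c \<in> Field W"
  have "c = 0 \<or> kb (list_decode c) []"
    using kb_extend[of "list_decode c" "[]"] list_encode_inverse list_decode_inverse[of c]
    by (metis append_Nil2 list_encode.simps(1))
  moreover have "inP (list_decode c)" "inP []" using c zero_Field_W unfolding Field_W by simp_all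
  ultimately show "(c, 0) \<in> W" unfolding W_def by auto
qed

text \<open>An item \<open>(u, w)\<close> of the gadget of \<open>n\<close> consists of an element \<open>w\<close> of \<open>W\<close> and possibly
  (\<open>u = Suc c\<close>) a nonempty node \<open>c\<close> of the tree of \<open>n\<close>; without a node the greatest element \<open>0\<close> of
  \<open>W\<close> is excluded.  If \<open>n\<close> is true, then the tree has an infinite path, along which the node imposes
  no restriction; otherwise the node bounds the rank strictly below the type of \<open>W\<close> without its top.\<close>

definition D :: "nat \<Rightarrow> nat \<Rightarrow> bool" where
  "D n t \<longleftrightarrow> inP (list_decode (p2 t)) \<and>
     (if p1 t = 0 then p2 t \<noteq> 0 else list_decode (p1 t - 1) \<noteq> [] \<and> Ok (\<lambda>x. x) 1 n (list_decode (p1 t - 1)))"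

text \<open>Every step descends in \<open>W\<close>, which makes all trees well-founded. The node is
  extended by any positive number of entries at once, which makes the relation transitive. Items
  with a node and items without one are never mixed along a branch.\<close>

definition below :: "nat \<Rightarrow> nat \<Rightarrow> bool" where
  "below t' t \<longleftrightarrow> (p2 t' \<noteq> p2 t \<and> kb (list_decode (p2 t')) (list_decode (p2 t))) \<and>
     (if p1 t = 0 then p1 t' = 0 else p1 t' \<noteq> 0 \<and>
       (\<exists>i<length (list_decode (p1 t' - 1)). drop (Suc i) (list_decode (p1 t' - 1)) = list_decode (p1 t - 1)))"

definition G :: "nat \<Rightarrow> nat rel" where
  "G n = {(t', t). D n t' \<and> D n t \<and> below t' t}"

lemma G_W: "(t', t) \<in> G n \<Longrightarrow> (p2 t', p2 t) \<in> W \<and> p2 t' \<noteq> p2 t"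
  unfolding G_def below_def D_def W_def by auto

lemma wf_G: "wf (G n)"
proof (rule wf_subset)
  have "wf (W - Id)" using Well_order_W unfolding well_order_on_def by blast
  then show "wf (inv_image (W - Id) p2)" by (rule wf_inv_image)
  show "G n \<subseteq> inv_image (W - Id) p2" using G_W by (auto simp: inv_image_def)
qed

lemma W_strict: "(c, c') \<in> W \<and> c \<noteq> c' \<longleftrightarrow> inP (list_decode c) \<and> inP (list_decode c') \<and> c \<noteq> c' \<and> kb (list_decode c) (list_decode c')"
  unfolding W_def by auto

lemma W_strict_trans: "(a, b) \<in> W \<and> a \<noteq> b \<Longrightarrow> (b, c) \<in> W \<and> b \<noteq> c \<Longrightarrow> (a, c) \<in> W \<and> a \<noteq> c"
proof -
  assume "(a, b) \<in> W \<and> a \<noteq> b" "(b, c) \<in> W \<and> b \<noteq> c"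
  moreover have "trans W" "antisym W"
    using Well_order_W by (auto simp: well_order_on_def linear_order_on_def partial_order_on_def preorder_on_def)
  ultimately show ?thesis by (meson antisymD transD)
qed

lemma trans_G: "trans (G n)"
proof (rule transI)
  fix t1 t2 t3 assume 1: "(t1, t2) \<in> G n" and 2: "(t2, t3) \<in> G n"
  have w: "p2 t1 \<noteq> p2 t3 \<and> kb (list_decode (p2 t1)) (list_decode (p2 t3))"
    using W_strict_trans[OF G_W[OF 1] G_W[OF 2]] W_strict by blast
  have D: "D n t1" "D n t3" using 1 2 unfolding G_def by auto
  show "(t1, t3) \<in> G n"
  proof (cases "p1 t3 = 0")
    case True
    then have "p1 t1 = 0" using 1 2 unfolding G_def below_def by auto
    then show ?thesis using w D True unfolding G_def below_def by simp
  next
    case False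
    let ?s = "\<lambda>t. list_decode (p1 t - 1)"
    have nz: "p1 t2 \<noteq> 0" "p1 t1 \<noteq> 0" using 1 2 False unfolding G_def below_def by (auto split: if_splits)
    obtain i j where ij: "drop (Suc i) (?s t1) = ?s t2" "j < length (?s t2)" "drop (Suc j) (?s t2) = ?s t3" "i < length (?s t1)"
      using 1 2 False nz unfolding G_def below_def by auto
    then have "drop (Suc (Suc i + j)) (?s t1) = ?s t3" by (metis add_Suc_right drop_drop add.commute)
    moreover have "Suc i + j < length (?s t1)" using ij by (metis length_drop less_diff_conv add.commute)
    ultimately show ?thesis using w D False nz unfolding G_def below_def by auto
  qed
qed

text \<open>The second components of the entries are arbitrary: they provide infinitely many copies of
  every item.\<close>

definition valid :: "nat \<Rightarrow> nat list \<Rightarrow> nat list \<Rightarrow> bool" where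
  "valid a xs s \<longleftrightarrow> (\<forall>i<length s. D (prod_encode (a, list_encode xs)) (p1 (lhd (drop i s))) \<and>
     (Suc i < length s \<longrightarrow> below (p1 (lhd (drop i s))) (p1 (lhd (drop (Suc i) s)))))"

definition root_rank :: "nat \<Rightarrow> cord" where
  "root_rank n = strict_sup (wf_rank (G n) ` {t. D n t})"

definition rk :: "nat \<Rightarrow> nat list \<Rightarrow> nat list \<Rightarrow> cord" where
  "rk a xs s = (if s = [] then root_rank (prod_encode (a, list_encode xs))
     else wf_rank (G (prod_encode (a, list_encode xs))) (p1 (lhd s)))"

lemma valid_Cons_iff: "valid a xs (d # s) \<longleftrightarrow> D (prod_encode (a, list_encode xs)) (p1 d) \<and>
    (s \<noteq> [] \<longrightarrow> below (p1 d) (p1 (lhd s))) \<and> valid a xs s"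
proof -
  have "(\<forall>i<length (d # s). P i) \<longleftrightarrow> P 0 \<and> (\<forall>i<length s. P (Suc i))" for P
    using less_Suc_eq_0_disj by auto
  then show ?thesis unfolding valid_def by auto
qed

lemma valid_lhd: "valid a xs s \<Longrightarrow> s \<noteq> [] \<Longrightarrow> D (prod_encode (a, list_encode xs)) (p1 (lhd s))"
  by (cases s) (auto simp: valid_Cons_iff)

lemma rk_less: "valid a xs (d # s) \<Longrightarrow> rk a xs (d # s) < rk a xs s"
proof -
  assume v: "valid a xs (d # s)"
  let ?n = "prod_encode (a, list_encode xs)"
  show ?thesis
  proof (cases "s = []")
    case True
    then show ?thesis using v unfolding rk_def root_rank_def valid_Cons_iff
      by (auto intro!: strict_sup_upper)
  next
    case False
    then have "(p1 d, p1 (lhd s)) \<in> G ?n" using v valid_lhd[of a xs s] unfolding G_def valid_Cons_iff by auto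
    then show ?thesis using wf_rank_less[OF wf_G] False by (simp add: rk_def)
  qed
qed

lemma rk_inf:
  assumes v: "valid a xs s" and \<gamma>: "\<gamma> < rk a xs s"
  shows "infinite {d. valid a xs (d # s) \<and> rk a xs (d # s) = \<gamma>}"
proof -
  let ?n = "prod_encode (a, list_encode xs)"
  have "\<exists>t. D ?n t \<and> (s \<noteq> [] \<longrightarrow> below t (p1 (lhd s))) \<and> wf_rank (G ?n) t = \<gamma>"
  proof (cases "s = []")
    case True
    then have "\<gamma> < strict_sup (wf_rank (G ?n) ` {t. D ?n t})" using \<gamma> by (simp add: rk_def root_rank_def)
    from less_strict_supD[OF this] obtain t where t: "D ?n t" "\<gamma> \<le> wf_rank (G ?n) t" by blast
    show ?thesis
    proof (cases "\<gamma> = wf_rank (G ?n) t")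
      case False
      then have "\<gamma> < wf_rank (G ?n) t" using t(2) by simp
      from wf_rank_attained[OF wf_G trans_G this] obtain t' where "(t', t) \<in> G ?n" "wf_rank (G ?n) t' = \<gamma>" by blast
      then show ?thesis using True unfolding G_def by auto
    qed (use t True in blast)
  next
    case False
    then have "\<gamma> < wf_rank (G ?n) (p1 (lhd s))" using \<gamma> by (simp add: rk_def)
    from wf_rank_attained[OF wf_G trans_G this] obtain t where "(t, p1 (lhd s)) \<in> G ?n" "wf_rank (G ?n) t = \<gamma>" by blast
    then show ?thesis unfolding G_def by auto
  qed
  then obtain t where t: "D ?n t" "s \<noteq> [] \<longrightarrow> below t (p1 (lhd s))" "wf_rank (G ?n) t = \<gamma>" by blast
  have "range (\<lambda>k. prod_encode (t, k)) \<subseteq> {d. valid a xs (d # s) \<and> rk a xs (d # s) = \<gamma>}"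
    using t v by (auto simp: valid_Cons_iff rk_def)
  moreover have "infinite (range (\<lambda>k. prod_encode (t, k)))"
    by (rule range_inj_infinite) (auto intro: injI)
  ultimately show ?thesis using infinite_super by blast
qed

section \<open>Ranks of the roots of true and of false facts\<close>

definition \<beta> :: cord where "\<beta> = seg W 0"

lemma wf_rank_le_seg: "D n t \<Longrightarrow> wf_rank (G n) t \<le> seg W (p2 t)"
proof (induction t rule: wf_induct_rule[OF wf_G[of n]])
  case (1 t)
  show ?case
    unfolding wf_rank_eq[OF wf_G, of n t]
  proof (rule strict_sup_least)
    fix x assume "x \<in> wf_rank (G n) ` {t'. (t', t) \<in> G n}"
    then obtain t' where t': "(t', t) \<in> G n" "x = wf_rank (G n) t'" by blast
    then have "x \<le> seg W (p2 t')" using 1(1)[OF t'(1)] unfolding G_def by blast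
    also have "\<dots> < seg W (p2 t)" using seg_strict[OF Well_order_W] G_W[OF t'(1)] by blast
    finally show "x < seg W (p2 t)" .
  qed
qed

text \<open>If the items in \<open>J\<close> can follow every descent in \<open>W\<close>, then
  \<open>W\<close> is the only limit on their ranks. It is applied to the items without a node and
  to those on an infinite path.\<close>

lemma seg_le_wf_rank:
  assumes step: "\<And>t w. J t \<Longrightarrow> (w, p2 t) \<in> W \<Longrightarrow> w \<noteq> p2 t \<Longrightarrow> \<exists>t'. J t' \<and> p2 t' = w \<and> (t', t) \<in> G n"
    and t: "J t" "p2 t \<in> Field W"
  shows "seg W (p2 t) \<le> wf_rank (G n) t"
  using t
proof (induction t rule: wf_induct_rule[OF wf_G[of n]])
  case (1 t)
  show ?case
    unfolding seg_eq_strict_sup[OF Well_order_W 1(3)]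
  proof (rule strict_sup_least)
    fix x assume "x \<in> seg W ` {w. (w, p2 t) \<in> W \<and> w \<noteq> p2 t}"
    then obtain w where w: "(w, p2 t) \<in> W" "w \<noteq> p2 t" "x = seg W w" by blast
    obtain t' where t': "J t'" "p2 t' = w" "(t', t) \<in> G n" using step[OF 1(2) w(1,2)] by blast
    have "w \<in> Field W" using w(1) by (auto simp: Field_def)
    then have "x \<le> wf_rank (G n) t'" using 1(1)[OF t'(3,1)] t'(2) w(3) by simp
    also have "\<dots> < wf_rank (G n) t" by (rule wf_rank_less[OF wf_G t'(3)])
    finally show "x < wf_rank (G n) t" .
  qed
qed

lemma rank_plain:
  assumes "w \<in> Field W" "w \<noteq> 0"
  shows "D n (prod_encode (0, w))" "wf_rank (G n) (prod_encode (0, w)) = seg W w"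
proof -
  show D: "D n (prod_encode (0, w))" using assms by (simp add: D_def Field_W)
  have "seg W (p2 (prod_encode (0, w))) \<le> wf_rank (G n) (prod_encode (0, w))"
  proof (rule seg_le_wf_rank[of "\<lambda>t. p1 t = 0 \<and> D n t"])
    fix t v assume t: "p1 t = 0 \<and> D n t" "(v, p2 t) \<in> W" "v \<noteq> p2 t"
    have "v \<noteq> 0" using t W_zero_top[of "p2 t"] W_strict_trans[of v "p2 t" v]
      by (metis FieldI2)
    then have "D n (prod_encode (0, v))" using t(2) by (auto simp: D_def W_def)
    moreover have "below (prod_encode (0, v)) t" using t W_strict[of v "p2 t"] by (simp add: below_def)
    ultimately show "\<exists>t'. (p1 t' = 0 \<and> D n t') \<and> p2 t' = v \<and> (t', t) \<in> G n"
      using t(1) by (intro exI[of _ "prod_encode (0, v)"]) (simp add: G_def)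
  qed (use D assms in simp_all)
  then show "wf_rank (G n) (prod_encode (0, w)) = seg W w" using wf_rank_le_seg[OF D] by simp
qed

lemma seg_le_\<beta>: "w \<in> Field W \<Longrightarrow> seg W w \<le> \<beta>"
  unfolding \<beta>_def using seg_le_iff[OF Well_order_W _ zero_Field_W] W_zero_top by blast

lemma D_Field: "D n t \<Longrightarrow> p2 t \<in> Field W"
  by (simp add: D_def Field_W)

text \<open>Items without a node exist for every \<open>n\<close>. They lift each root to
  \<open>\<beta>\<close>, however low the tree of partial solutions may be.\<close>

lemma root_rank_ge: "\<beta> \<le> root_rank n"
  unfolding \<beta>_def seg_eq_strict_sup[OF Well_order_W zero_Field_W]
proof (rule strict_sup_least)
  fix x assume "x \<in> seg W ` {w. (w, 0) \<in> W \<and> w \<noteq> 0}"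
  then obtain w where w: "(w, 0) \<in> W" "w \<noteq> 0" "x = seg W w" by blast
  then have "w \<in> Field W" by (auto simp: Field_def)
  from rank_plain[OF this w(2)] show "x < root_rank n"
    unfolding root_rank_def using w(3) by (intro strict_sup_upper) (auto simp: image_iff intro!: exI)
qed

lemma root_rank_true:
  assumes n: "set (list_decode (p2 n)) \<subseteq> UB" and t: "tr n"
  shows "root_rank n = succ_cord \<beta>"
proof (rule antisym)
  have "wf_rank (G n) t < succ_cord \<beta>" if "D n t" for t
    using wf_rank_le_seg[OF that] seg_le_\<beta>[OF D_Field[OF that]] by (simp add: less_succ_cord_iff)
  then show "root_rank n \<le> succ_cord \<beta>" unfolding root_rank_def by (intro strict_sup_least) auto
  obtain M where M: "mdl l M" using model by blast
  then have "gv n \<in> M \<longleftrightarrow> (1::nat) \<noteq> 0" using decides n t by simp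
  then obtain g where g: "\<And>k. Ok (\<lambda>x. x) 1 n (path g k)" using model_path[OF M] by blast
  \<comment> \<open>A node on the infinite path, nonempty as \<open>D\<close> demands, together with
    an element of \<open>W\<close>. The path never ends, so the item with the top element 0 has rank
    \<open>\<beta>\<close> and lifts the root one step further.\<close>
  let ?it = "\<lambda>k w. prod_encode (Suc (list_encode (path g (Suc k))), w)"
  have D: "D n (?it k w)" if "w \<in> Field W" for k w using g[of "Suc k"] that by (simp add: D_def Field_W)
  have "seg W (p2 (?it 0 0)) \<le> wf_rank (G n) (?it 0 0)"
  proof (rule seg_le_wf_rank[of "\<lambda>t. p2 t \<in> Field W \<and> (\<exists>k w. t = ?it k w)"])
    fix t w assume t: "p2 t \<in> Field W \<and> (\<exists>k w. t = ?it k w)" and w: "(w, p2 t) \<in> W" "w \<noteq> p2 t"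
    obtain k v where k: "t = ?it k v" using t by blast
    have wF: "w \<in> Field W" using w(1) by (auto simp: Field_def)
    have "below (?it (Suc k) w) t"
      using w W_strict[of w v] unfolding k below_def by (auto intro!: exI[of _ 0])
    then have "(?it (Suc k) w, t) \<in> G n" using D[OF wF, of "Suc k"] D[of v k] t k unfolding G_def by simp
    then show "\<exists>t'. (p2 t' \<in> Field W \<and> (\<exists>k w. t' = ?it k w)) \<and> p2 t' = w \<and> (t', t) \<in> G n"
      using wF by (intro exI[of _ "?it (Suc k) w"] conjI exI[of _ "Suc k"] exI[of _ w]) simp_all
  qed (use zero_Field_W in auto)
  then have "\<beta> \<le> wf_rank (G n) (?it 0 0)" by (simp add: \<beta>_def)
  also have "\<dots> < root_rank n" unfolding root_rank_def using D[OF zero_Field_W, of 0] by (intro strict_sup_upper) auto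
  finally show "succ_cord \<beta> \<le> root_rank n" by (simp add: succ_cord_le_iff)
qed

text \<open>Adding the choices of a model, in which \<open>n\<close> fails, turns each partial
  solution asserting \<open>n\<close> into a node of the joint tree and preserves extensions. So an
  item with a node has at most the rank of that joint node in \<open>W\<close>, and this is below
  the top because the node is nonempty.\<close>

lemma root_rank_false:
  assumes n: "set (list_decode (p2 n)) \<subseteq> UB" and t: "\<not> tr n"
  shows "root_rank n = \<beta>"
proof (rule antisym[OF _ root_rank_ge])
  obtain M where M: "mdl l M" using model by blast
  then have gv: "gv n \<in> M \<longleftrightarrow> (0::nat) \<noteq> 0" using decides n t by simp
  obtain g where g: "\<And>c. holds M (l (prod_encode (c, g c)))" using model_path[OF M gv] by blast
  \<comment> \<open>The clause treated by an entry is numbered by the length of the tail below it,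
    hence the model's choice \<open>g (length s)\<close>.\<close>
  define m where "m = rec_list [] (\<lambda>x s r. prod_encode (n, prod_encode (x, g (length s))) # r)"
  have m [simp]: "m [] = []" "m (x # s) = prod_encode (n, prod_encode (x, g (length s))) # m s" for x s
    by (simp_all add: m_def)
  have len [simp]: "length (m s) = length s" for s by (induction s) auto
  have drop: "drop i (m s) = m (drop i s)" for i s by (induction s arbitrary: i) (auto simp: drop_Cons split: nat.splits)
  have lhd: "lhd (m s) = prod_encode (n, prod_encode (lhd s, g (length s - 1)))" if "s \<noteq> []" for s
    using that by (cases s) auto
  have P: "inP (m s)" if "Ok (\<lambda>x. x) 1 n s" for s
  proof (cases "s = []")
    case False
    have l1: "lit_at (\<lambda>u. p1 (p2 u)) (m s) i = lit_at (\<lambda>x. x) s i" if "i < length s" for i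
      using that lhd[of "drop i s"] by (simp add: lit_at_def drop)
    have l2: "lit_at (\<lambda>u. p2 (p2 u)) (m s) i = l (prod_encode (length s - Suc i, g (length s - Suc i)))" if "i < length s" for i
      using that lhd[of "drop i s"] by (simp add: lit_at_def drop Suc_eq_plus1)
    have "Ok (\<lambda>u. p1 (p2 u)) 1 n (m s)" using that l1 unfolding Ok_def by simp
    moreover have "Ok (\<lambda>u. p2 (p2 u)) 0 n (m s)" by (rule Ok_holds[OF gv]) (use l2 g in simp)
    moreover have "\<forall>u\<in>set (m s). p1 u = n" by (induction s) auto
    ultimately show ?thesis using lhd[OF False] n unfolding inP_def by simp
  qed (simp add: inP_def)
  have bound: "D n t \<Longrightarrow> p1 t \<noteq> 0 \<Longrightarrow> wf_rank (G n) t \<le> seg W (list_encode (m (list_decode (p1 t - 1))))" for t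
  proof (induction t rule: wf_induct_rule[OF wf_G[of n]])
    case (1 t)
    let ?s = "\<lambda>t. list_decode (p1 t - 1)"
    show ?case
      unfolding wf_rank_eq[OF wf_G, of n t]
    proof (rule strict_sup_least)
      fix x assume "x \<in> wf_rank (G n) ` {t'. (t', t) \<in> G n}"
      then obtain t' where t': "(t', t) \<in> G n" "x = wf_rank (G n) t'" by blast
      then have "below t' t" and D': "D n t'" unfolding G_def by blast+
      then have b: "p1 t' \<noteq> 0 \<and> (\<exists>i<length (?s t'). drop (Suc i) (?s t') = ?s t)"
        using 1(3) by (simp add: below_def)
      then have nz: "p1 t' \<noteq> 0" "D n t'" using D' by blast+
      obtain i where i: "drop (Suc i) (?s t') = ?s t" "i < length (?s t')" using b by blast
      have "m (?s t') = take (Suc i) (m (?s t')) @ m (?s t)"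
        unfolding i(1)[symmetric] drop[symmetric] by simp
      moreover have "take (Suc i) (m (?s t')) \<noteq> []" using i(2) len[of "?s t'"] by (metis length_0_conv less_nat_zero_code take_eq_Nil nat.distinct(1))
      ultimately have kb: "kb (m (?s t')) (m (?s t))" using kb_extend by metis
      have "Ok (\<lambda>x. x) 1 n (?s t')" "Ok (\<lambda>x. x) 1 n (?s t)" using nz 1(2,3) unfolding D_def by auto
      then have "(list_encode (m (?s t')), list_encode (m (?s t))) \<in> W" using P kb unfolding W_def by simp
      moreover have "m (?s t') \<noteq> m (?s t)" using kb kb_asym by metis
      ultimately have "seg W (list_encode (m (?s t'))) < seg W (list_encode (m (?s t)))"
        by (intro seg_strict[OF Well_order_W]) auto
      then show "x < seg W (list_encode (m (?s t)))" using 1(1)[OF t'(1) nz(2,1)] t'(2) by simp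
    qed
  qed
  have "wf_rank (G n) t < \<beta>" if D: "D n t" for t
  proof -
    have less: "seg W w < \<beta>" if "w \<in> Field W" "w \<noteq> 0" for w
      unfolding \<beta>_def using seg_strict[OF Well_order_W] W_zero_top that by blast
    show ?thesis
    proof (cases "p1 t = 0")
      case True
      then have "p2 t \<noteq> 0" using D unfolding D_def by simp
      then show ?thesis using wf_rank_le_seg[OF D] less[OF D_Field[OF D]] by simp
    next
      case False
      then have "list_decode (p1 t - 1) \<noteq> []" "Ok (\<lambda>x. x) 1 n (list_decode (p1 t - 1))" using D unfolding D_def by auto
      then have "list_encode (m (list_decode (p1 t - 1))) \<in> Field W" "list_encode (m (list_decode (p1 t - 1))) \<noteq> 0"
        using P len[of "list_decode (p1 t - 1)"] by (auto simp: Field_W) (metis len length_0_conv)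
      from less[OF this] show ?thesis using bound[OF D False] by simp
    qed
  qed
  then show "root_rank n \<le> \<beta>" unfolding root_rank_def by (intro strict_sup_least) auto
qed

end

section \<open>Computable ordinals\<close>

lemma computable_rel_iff: "computable_set (prod_encode ` r) \<longleftrightarrow> dec (\<lambda>z. (p1 z, p2 z) \<in> r)"
proof -
  have "z \<in> prod_encode ` r \<longleftrightarrow> (p1 z, p2 z) \<in> r" for z
    by (metis (no_types, lifting) image_iff p_simps prod.exhaust)
  then show ?thesis unfolding computable_set_iff by simp
qed

lemma dec_rel: "dec (\<lambda>z. (p1 z, p2 z) \<in> r) \<Longrightarrow> cf f \<Longrightarrow> cf g \<Longrightarrow> dec (\<lambda>z. (f z, g z) \<in> r)"
  using dec_comp[of "\<lambda>z. (p1 z, p2 z) \<in> r" "\<lambda>z. prod_encode (f z, g z)"] cf_pair by simp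

lemma computable_seg:
  assumes "Well_order r" "dec (\<lambda>z. (p1 z, p2 z) \<in> r)"
  shows "computable_ordinal (seg r x)"
proof -
  have "dec (\<lambda>z. (p1 z, p2 z) \<in> r \<and> (p1 z \<noteq> x \<and> (p1 z, x) \<in> r) \<and> (p2 z \<noteq> x \<and> (p2 z, x) \<in> r))"
    by (intro cf_intros dec_rel[OF assms(2)])
  then have "dec (\<lambda>z. (p1 z, p2 z) \<in> Restr r (underS r x))" by (simp add: underS_def)
  then show ?thesis unfolding computable_ordinal_def seg_def computable_rel_iff
    using Well_order_Restr[OF assms(1)] by blast
qed

lemma countable_computable_ordinals: "countable {\<alpha>. computable_ordinal \<alpha>}"
proof -
  have "inj code_prog" using code_prog_inj by (rule injI)
  then have "countable (UNIV :: prog set)" by (rule countableI)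
  moreover have "{\<alpha>. computable_ordinal \<alpha>} \<subseteq> range (\<lambda>p. abs_cord {(a, b). eval {} p (prod_encode (a, b)) 1})"
  proof
    fix \<alpha> assume "\<alpha> \<in> {\<alpha>. computable_ordinal \<alpha>}"
    then obtain r p where r: "\<alpha> = abs_cord r" "\<And>x. eval {} p x (if x \<in> prod_encode ` r then 1 else 0)"
      unfolding computable_ordinal_def computable_set_def turing_le_def by blast
    have "eval {} p x 1 \<longleftrightarrow> x \<in> prod_encode ` r" for x
      using r(2)[of x] eval_fun[OF r(2)[of x], of 1] by (auto split: if_splits)
    then have "r = {(a, b). eval {} p (prod_encode (a, b)) 1}" by auto
    then show "\<alpha> \<in> range (\<lambda>p. abs_cord {(a, b). eval {} p (prod_encode (a, b)) 1})" using r(1) by blast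
  qed
  ultimately show ?thesis by (meson countable_image countable_subset)
qed

text \<open>Segments of computable well-orders are computable, so computable ordinals are closed
  downwards; as they are countable, some ordinal is not computable and the \<open>LEAST\<close> in
  the definition is meaningful.\<close>

lemma less_omega1CK_iff: "\<alpha> < omega1CK \<longleftrightarrow> computable_ordinal \<alpha>"
proof
  assume "\<alpha> < omega1CK"
  then show "computable_ordinal \<alpha>" unfolding omega1CK_def using not_less_Least by blast
next
  assume c: "computable_ordinal \<alpha>"
  have "\<exists>\<alpha>. \<not> computable_ordinal \<alpha>"
    using countable_cords_bounded[OF countable_computable_ordinals] by (metis less_irrefl mem_Collect_eq)
  then have n: "\<not> computable_ordinal omega1CK" unfolding omega1CK_def by (rule LeastI_ex)
  obtain r where r: "Well_order r" "dec (\<lambda>z. (p1 z, p2 z) \<in> r)" "\<alpha> = abs_cord r"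
    using c unfolding computable_ordinal_def computable_rel_iff by blast
  show "\<alpha> < omega1CK"
  proof (rule ccontr)
    assume "\<not> \<alpha> < omega1CK"
    then consider "omega1CK = \<alpha>" | "omega1CK < abs_cord r" using r(3) by fastforce
    then show False
    proof cases
      case 2
      then obtain x where "omega1CK = seg r x" using seg_surj[OF r(1)] by blast
      then have "computable_ordinal omega1CK" using computable_seg[OF r(1,2), of x] by (simp only:)
      then show False using n by blast
    qed (use c n in simp)
  qed
qed

text \<open>The order \<open>q\<close> consists of \<open>s\<close>, followed by pairs of an element
  of \<open>r\<close> and a number in lexicographic order. It is decidable and its type bounds
  \<open>Zf \<beta> \<gamma>\<close>; an upper bound suffices because \<open>omega1CK\<close> is
  compared by size only.\<close>

lemma Zf_omega1CK:
  assumes "\<beta> < omega1CK" "\<gamma> < omega1CK" shows "Zf \<beta> \<gamma> < omega1CK"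
proof -
  obtain s where s: "Well_order s" "dec (\<lambda>z. (p1 z, p2 z) \<in> s)" "\<beta> = abs_cord s"
    using assms(1) unfolding less_omega1CK_iff computable_ordinal_def computable_rel_iff by blast
  obtain r where r: "Well_order r" "dec (\<lambda>z. (p1 z, p2 z) \<in> r)" "\<gamma> = abs_cord r"
    using assms(2) unfolding less_omega1CK_iff computable_ordinal_def computable_rel_iff by blast
  have refl: "x \<in> Field q \<longleftrightarrow> (x, x) \<in> q" if "Well_order q" for x and q :: "nat rel"
    using that by (auto simp: well_order_on_def linear_order_on_def partial_order_on_def preorder_on_def refl_on_def Field_def)
  define F where "F = {z. (p1 z = 0 \<and> p2 z \<in> Field s) \<or> (p1 z = 1 \<and> p1 (p2 z) \<in> Field r)}"
  define m where "m z = (if p1 z = 0 then (0 :: nat, seg s (p2 z), 0 :: nat)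
    else (1, seg r (p1 (p2 z)), p2 (p2 z)))" for z
  define q where "q = {(x, y). x \<in> F \<and> y \<in> F \<and> m x \<le> m y}"
  have inj: "inj_on m F"
  proof (rule inj_onI)
    fix x y assume x: "x \<in> F" and y: "y \<in> F" and eq: "m x = m y"
    show "x = y"
    proof (cases "p1 x = 0")
      case True
      then have "p1 y = 0" "seg s (p2 x) = seg s (p2 y)" using eq unfolding m_def by (auto split: if_splits)
      moreover have "p2 x \<in> Field s" "p2 y \<in> Field s" using x y True \<open>p1 y = 0\<close> unfolding F_def by auto
      ultimately have "p2 x = p2 y" using inj_on_seg[OF s(1)] by (auto dest: inj_onD)
      then show ?thesis using True \<open>p1 y = 0\<close> by (metis p_simps(3))
    next
      case False
      then have e: "p1 y \<noteq> 0" "seg r (p1 (p2 x)) = seg r (p1 (p2 y))" "p2 (p2 x) = p2 (p2 y)"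
        using eq unfolding m_def by (auto split: if_splits)
      moreover have f: "p1 x = 1" "p1 y = 1" "p1 (p2 x) \<in> Field r" "p1 (p2 y) \<in> Field r"
        using x y False e(1) unfolding F_def by auto
      ultimately have "p1 (p2 x) = p1 (p2 y)" using inj_on_seg[OF r(1)] by (auto dest: inj_onD)
      then show ?thesis using e(3) f(1,2) by (metis p_simps(3))
    qed
  qed
  note wo = Well_order_key[OF inj q_def]
  have "dec (\<lambda>z. z \<in> F)" unfolding F_def mem_Collect_eq refl[OF s(1)] refl[OF r(1)]
    by (intro cf_intros dec_rel[OF s(2)] dec_rel[OF r(2)])
  note decF = dec_comp[OF this]
  \<comment> \<open>The keys contain ordinals; restating their comparison through \<open>s\<close>
    and \<open>r\<close> makes \<open>q\<close> visibly decidable.\<close>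
  have "(x, y) \<in> q \<longleftrightarrow> x \<in> F \<and> y \<in> F \<and> ((p1 x = 0 \<and> p1 y \<noteq> 0) \<or> (p1 x = 0 \<and> p1 y = 0 \<and> (p2 x, p2 y) \<in> s) \<or>
      (p1 x \<noteq> 0 \<and> p1 y \<noteq> 0 \<and> ((p1 (p2 x) \<noteq> p1 (p2 y) \<and> (p1 (p2 x), p1 (p2 y)) \<in> r) \<or>
        (p1 (p2 x) = p1 (p2 y) \<and> p2 (p2 x) \<le> p2 (p2 y)))))" for x y
  proof (cases "x \<in> F \<and> y \<in> F")
    case True
    have s': "seg s (p2 x) \<le> seg s (p2 y) \<longleftrightarrow> (p2 x, p2 y) \<in> s" if "p1 x = 0" "p1 y = 0"
      using True that unfolding F_def by (intro seg_le_iff[OF s(1)]) auto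
    have r': "seg r (p1 (p2 x)) < seg r (p1 (p2 y)) \<longleftrightarrow> (p1 (p2 x), p1 (p2 y)) \<in> r \<and> p1 (p2 x) \<noteq> p1 (p2 y)"
      "seg r (p1 (p2 x)) \<le> seg r (p1 (p2 y)) \<longleftrightarrow> (p1 (p2 x), p1 (p2 y)) \<in> r"
      "(p1 (p2 x), p1 (p2 x)) \<in> r"
      if "p1 x \<noteq> 0" "p1 y \<noteq> 0"
      using True that unfolding F_def refl[OF r(1), symmetric]
      by (auto intro!: seg_le_iff[OF r(1)] simp: seg_less_iff[OF r(1)])
    show ?thesis using True s' r' unfolding q_def m_def
      by (cases "p1 x = 0"; cases "p1 y = 0"; cases "p1 (p2 x) = p1 (p2 y)") auto
  qed (auto simp: q_def)
  then have "dec (\<lambda>z. (p1 z, p2 z) \<in> q)"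
    by (simp only:) (intro cf_intros decF dec_rel[OF s(2)] dec_rel[OF r(2)])
  then have comp: "abs_cord q < omega1CK"
    unfolding less_omega1CK_iff computable_ordinal_def computable_rel_iff using wo(1) by blast
  \<comment> \<open>The ordinal that \<open>z\<close> is meant to reach. \<open>slow_le_seg\<close>
    shows that the position of \<open>z\<close> in \<open>q\<close> is at least as large.\<close>
  define t where "t z = (if p1 z = 0 then seg s (p2 z) else (succ_cord ^^ p2 (p2 z)) (Zf \<beta> (seg r (p1 (p2 z)))))" for z
  have q_iff: "(x, z) \<in> q \<longleftrightarrow> x \<in> F \<and> z \<in> F \<and> m x \<le> m z" for x z unfolding q_def by simp
  have t_le: "t z \<le> seg q z" if "z \<in> F" for z
  proof (rule slow_le_seg[OF wo(1)])
    show "z \<in> Field q" using that wo(2) by simp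
    fix z c assume z: "z \<in> Field q" and c: "\<And>y. (y, z) \<in> q \<Longrightarrow> y \<noteq> z \<Longrightarrow> t y < c"
    have zF: "z \<in> F" using z wo(2) by simp
    have c': "t y < c" if "y \<in> F" "m y < m z" for y
      using c[of y] that zF unfolding q_iff by (metis less_imp_le less_irrefl)
    show "t z \<le> c"
    proof (cases "p1 z = 0")
      case True
      then have zs: "p2 z \<in> Field s" using zF unfolding F_def by simp
      have "seg s (p2 z) \<le> c"
        unfolding seg_eq_strict_sup[OF s(1) zs]
      proof (rule strict_sup_least)
        fix x assume "x \<in> seg s ` {y. (y, p2 z) \<in> s \<and> y \<noteq> p2 z}"
        then obtain y where y: "(y, p2 z) \<in> s" "y \<noteq> p2 z" "x = seg s y" by blast
        have "t (prod_encode (0, y)) < c"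
          using y True seg_strict[OF s(1) y(1,2)] by (intro c') (auto simp: F_def m_def Field_def)
        then show "x < c" using y(3) by (simp add: t_def)
      qed
      then show ?thesis using True by (simp add: t_def)
    next
      case False
      then have zr: "p1 z = 1" "p1 (p2 z) \<in> Field r" using zF unfolding F_def by auto
      show ?thesis
      proof (cases "p2 (p2 z)")
        case 0
        have "Zf \<beta> (seg r (p1 (p2 z))) \<le> c"
        proof (rule Zf_least)
          show "\<beta> \<le> c" unfolding s(3)
          proof (rule strict_mono_abs_cord_le[OF s(1), of "seg s"])
            show "seg s x < c" if "x \<in> Field s" for x
            proof -
              have "t (prod_encode (0, x)) < c" using that zr by (intro c') (auto simp: F_def m_def)
              then show ?thesis by (simp add: t_def)
            qed
          qed (rule seg_strict[OF s(1)])
          fix \<gamma>' n assume \<gamma>': "\<gamma>' < seg r (p1 (p2 z))"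
          then have "\<gamma>' < abs_cord r" using seg_less[OF r(1) zr(2)] by (rule order_less_trans)
          then obtain x where x: "x \<in> Field r" "\<gamma>' = seg r x" using seg_surj[OF r(1)] by blast
          have "t (prod_encode (1, prod_encode (x, n))) < c" using x zr \<gamma>' by (intro c') (auto simp: F_def m_def)
          then show "(succ_cord ^^ n) (Zf \<beta> \<gamma>') < c" using x by (simp add: t_def)
        qed
        then show ?thesis using False 0 by (simp add: t_def)
      next
        case (Suc n)
        have "t (prod_encode (1, prod_encode (p1 (p2 z), n))) < c" using zr Suc by (intro c') (auto simp: F_def m_def)
        then show ?thesis using False Suc by (simp add: t_def succ_cord_le_iff)
      qed
    qed
  qed
  have t_less: "t z < abs_cord q" if "z \<in> F" for z
    using le_less_trans[OF t_le[OF that] seg_less[OF wo(1)]] that wo(2) by simp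
  have "Zf \<beta> \<gamma> \<le> abs_cord q"
  proof (rule Zf_least)
    show "\<beta> \<le> abs_cord q" unfolding s(3)
    proof (rule strict_mono_abs_cord_le[OF s(1), of "seg s"])
      show "seg s x < abs_cord q" if "x \<in> Field s" for x
        using t_less[of "prod_encode (0, x)"] that by (simp add: F_def t_def)
    qed (rule seg_strict[OF s(1)])
    fix \<gamma>' n assume "\<gamma>' < \<gamma>"
    then obtain x where x: "x \<in> Field r" "\<gamma>' = seg r x" using seg_surj[OF r(1)] r(3) by blast
    then show "(succ_cord ^^ n) (Zf \<beta> \<gamma>') < abs_cord q"
      using t_less[of "prod_encode (1, prod_encode (x, n))"] by (simp add: F_def t_def)
  qed
  then show ?thesis using comp by simp
qed

text \<open>The one-point order has positive type, so the successor of \<open>\<gamma>\<close> lies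
  below the value of \<open>Zf \<gamma>\<close> at that type.\<close>

lemma omega1CK_limit: "omega1CK \<noteq> 0" "\<gamma> < omega1CK \<Longrightarrow> succ_cord \<gamma> < omega1CK"
proof -
  let ?F = "{0 :: nat}"
  let ?r = "{(x, y). x \<in> ?F \<and> y \<in> ?F \<and> id x \<le> id y}"
  have "inj_on id ?F" by simp
  note wo = Well_order_key[OF this refl]
  have "dec (\<lambda>z. p1 z = 0 \<and> p2 z = 0)" by (intro cf_intros)
  then have "dec (\<lambda>z. (p1 z, p2 z) \<in> ?r)" by (rule back_subst[of dec]) auto
  then have 1: "abs_cord ?r < omega1CK"
    unfolding less_omega1CK_iff computable_ordinal_def computable_rel_iff using wo(1) by blast
  have "0 \<in> Field ?r" using wo(2) by blast
  then have 0: "0 < abs_cord ?r" using seg_less[OF wo(1)] zero_cord_least le_less_trans by blast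
  then show "omega1CK \<noteq> 0" using 1 by auto
  assume \<gamma>: "\<gamma> < omega1CK"
  have "succ_cord \<gamma> \<le> succ_cord (Zf \<gamma> 0)"
    unfolding succ_cord_le_iff less_succ_cord_iff by (rule Zf_ge)
  also have "\<dots> < Zf \<gamma> (abs_cord ?r)" using Zf_upper[OF 0, of 1 \<gamma>] by (simp add: One_nat_def)
  also have "\<dots> < omega1CK" by (rule Zf_omega1CK[OF \<gamma> 1])
  finally show "succ_cord \<gamma> < omega1CK" .
qed

section \<open>Decidability of the structure of gadget trees\<close>

lemma cf_ety: "cf f \<Longrightarrow> cf (\<lambda>x. ety (f x))"
proof -
  have "ety x = (if p1 x = 0 then 0 else Suc (prod_encode (p1 (p2 x),
    prod_encode (length (list_decode (p1 (p2 (p2 x)))), length (list_decode (p2 (p2 (p2 x))))))))" for x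
    by (simp add: ety_def p1_def p2_def split: prod.splits)
  moreover have "cf (\<lambda>x. if p1 x = 0 then 0 else Suc (prod_encode (p1 (p2 x),
    prod_encode (length (list_decode (p1 (p2 (p2 x)))), length (list_decode (p2 (p2 (p2 x))))))))"
    by (intro cf_intros)
  ultimately have "cf ety" by presburger
  then show "cf f \<Longrightarrow> cf (\<lambda>x. ety (f x))" by (rule cf_comp)
qed

lemma comps_nth_iff:
  "j < length (comps x) \<and> comps x ! j = y \<longleftrightarrow> p1 x \<noteq> 0 \<and>
    ((j < length (list_decode (p1 (p2 (p2 x)))) \<and> y = prod_encode (0, lhd (drop j (list_decode (p1 (p2 (p2 x))))))) \<or>
     (length (list_decode (p1 (p2 (p2 x)))) \<le> j \<and>
      j - length (list_decode (p1 (p2 (p2 x)))) < length (list_decode (p2 (p2 (p2 x)))) \<and>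
      y = prod_encode (1, prod_encode (p1 (p2 x), prod_encode (p1 (p2 (p2 x)),
        list_encode (drop (Suc (j - length (list_decode (p1 (p2 (p2 x)))))) (list_decode (p2 (p2 (p2 x))))))))))"
proof -
  have c: "comps x = (if p1 x = 0 then [] else map base (list_decode (p1 (p2 (p2 x)))) @
    map (\<lambda>i. nd (p1 (p2 x)) (list_decode (p1 (p2 (p2 x)))) (drop (Suc i) (list_decode (p2 (p2 (p2 x))))))
      [0..<length (list_decode (p2 (p2 (p2 x))))])"
    by (simp add: comps_def p1_def p2_def split: prod.splits)
  show ?thesis
  proof (cases "p1 x = 0 \<or> j < length (list_decode (p1 (p2 (p2 x))))")
    case True
    then show ?thesis unfolding c by (auto simp: nth_append base_def lhd_drop)
  next
    case False
    then show ?thesis unfolding c by (auto simp: nth_append nd_def)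
  qed
qed

lemma child_iff:
  "child x y \<longleftrightarrow> p1 x = 1 \<and> p1 y = 1 \<and> p1 (p2 x) = p1 (p2 y) \<and> p1 (p2 (p2 x)) = p1 (p2 (p2 y)) \<and>
    list_decode (p2 (p2 (p2 y))) \<noteq> [] \<and> list_decode (p2 (p2 (p2 x))) = drop 1 (list_decode (p2 (p2 (p2 y))))"
  (is "_ \<longleftrightarrow> ?R")
proof
  assume R: ?R
  let ?s = "list_decode (p2 (p2 (p2 y)))"
  have "prod_encode (p1 x, prod_encode (p1 (p2 x), prod_encode (p1 (p2 (p2 x)), p2 (p2 (p2 x))))) = x"
    "prod_encode (p1 y, prod_encode (p1 (p2 y), prod_encode (p1 (p2 (p2 y)), p2 (p2 (p2 y))))) = y" by simp_all
  moreover have "p2 (p2 (p2 x)) = list_encode (tl ?s)" using R by (metis One_nat_def drop0 drop_Suc list_decode_inverse)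
  moreover have "p2 (p2 (p2 y)) = list_encode (hd ?s # tl ?s)" using R by (metis hd_Cons_tl list_decode_inverse)
  ultimately have "x = nd (p1 (p2 y)) (list_decode (p1 (p2 (p2 y)))) (tl ?s)"
    "y = nd (p1 (p2 y)) (list_decode (p1 (p2 (p2 y)))) (hd ?s # tl ?s)"
    using R unfolding nd_def list_decode_inverse by metis+
  then show "child x y" unfolding child_def by blast
next
  assume "child x y"
  then show ?R unfolding child_def by (auto simp: nd_def One_nat_def)
qed

text \<open>A unary relation ignores the second entry, so all relations can be decided uniformly on
  lists of length two.\<close>

lemma rel_star_pair:
  "rel_star r [x, y] \<longleftrightarrow> (if p1 r = 0 then ety x = p2 r else if p1 r = 1 then
     p2 r < length (comps x) \<and> comps x ! p2 r = y else child x y)"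
  by (simp add: rel_star_def p1_def p2_def split: prod.splits)

lemma dec_rel_star:
  assumes "cf f" "cf g" "cf k" shows "dec (\<lambda>z. rel_star (f z) [g z, k z])"
  unfolding rel_star_pair comps_nth_iff child_iff if_bool_eq_conj
  by (intro cf_intros cf_ety assms)

lemma computable_lang_star: "computable_language lang_star"
proof -
  have "(\<lambda>r. if fst (prod_decode r) = 0 then 1 else 2) = (\<lambda>r. if p1 r = 0 then 1 else (2::nat))"
    by (simp add: p1_def)
  moreover have "cf (\<lambda>r. if p1 r = 0 then 1 else (2::nat))" by (intro cf_intros)
  ultimately have "computable_fun_on UNIV (rel_arity lang_star)"
    using cf_computable_fun_on by (simp add: lang_star_def)
  then show ?thesis
    using cf_computable_fun_on[OF cf_const] unfolding computable_language_def computable_set_iff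
    by (simp add: lang_star_def dec_const)
qed

lemma computable_struct_star:
  assumes str: "is_structure lang_star (struct_star UB valid)"
    and V: "dec (\<lambda>x. x \<in> univ_star UB valid)"
  shows "computable_structure lang_star (struct_star UB valid)"
proof -
  let ?A = "struct_star UB valid" and ?V = "univ_star UB valid"
  \<comment> \<open>Without function symbols, atoms are equations and relations between names;
    \<open>E\<close> and \<open>R\<close> recognise the codes of those whose names are
    elements.\<close>
  define E where "E c \<longleftrightarrow> p1 c = 0 \<and> p1 (p1 (p2 c)) = 0 \<and> p1 (p2 (p2 c)) = 0 \<and> p2 (p1 (p2 c)) \<in> ?V \<and> p2 (p2 (p2 c)) \<in> ?V" for c
  define R where "R c \<longleftrightarrow> p1 c = 1 \<and> length (list_decode (p2 (p2 c))) = (if p1 (p1 (p2 c)) = 0 then 1 else 2) \<and>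
    (\<forall>t\<in>set (list_decode (p2 (p2 c))). p1 t = 0 \<and> p2 t \<in> ?V)" for c
  \<comment> \<open>For a unary relation the second argument is read from an empty tail and is the
    harmless default 0.\<close>
  define r where "r c = rel_star (p1 (p2 c)) [p2 (lhd (list_decode (p2 (p2 c)))), p2 (lhd (drop 1 (list_decode (p2 (p2 c)))))]" for c
  have E_iff: "E c \<longleftrightarrow> (\<exists>x y. c = code_atom (Eq (Var x) (Var y)) \<and> x \<in> ?V \<and> y \<in> ?V)" for c
  proof
    assume e: "E c"
    have "prod_encode (p1 c, prod_encode (prod_encode (p1 (p1 (p2 c)), p2 (p1 (p2 c))), prod_encode (p1 (p2 (p2 c)), p2 (p2 (p2 c))))) = c"
      by simp
    then have "code_atom (Eq (Var (p2 (p1 (p2 c)))) (Var (p2 (p2 (p2 c))))) = c" using e unfolding E_def by simp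
    then show "\<exists>x y. c = code_atom (Eq (Var x) (Var y)) \<and> x \<in> ?V \<and> y \<in> ?V" using e unfolding E_def by metis
  qed (auto simp: E_def)
  have R_iff: "R c \<longleftrightarrow> (\<exists>u xs. c = code_atom (Rel u (map Var xs)) \<and> length xs = rel_arity lang_star u \<and> set xs \<subseteq> ?V)" for c
  proof
    assume e: "R c"
    let ?ts = "list_decode (p2 (p2 c))"
    have e0: "?ts = map (\<lambda>t. code_trm (Var (p2 t))) ?ts"
    proof (rule nth_equalityI)
      fix i assume i: "i < length ?ts"
      then have "p1 (?ts ! i) = 0" using e unfolding R_def by auto
      then have "?ts ! i = prod_encode (0, p2 (?ts ! i))" by (metis p_simps(3))
      then show "?ts ! i = map (\<lambda>t. code_trm (Var (p2 t))) ?ts ! i" using i by simp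
    qed simp
    have eq: "map code_trm (map Var (map p2 ?ts)) = map (\<lambda>t. code_trm (Var (p2 t))) ?ts" by simp
    have ts: "list_encode (map code_trm (map Var (map p2 ?ts))) = p2 (p2 c)"
      unfolding eq e0[symmetric] by (rule list_decode_inverse)
    have p: "p1 c = 1" using e unfolding R_def by blast
    have "code_atom (Rel (p1 (p2 c)) (map Var (map p2 ?ts))) = c"
      unfolding code_atom.simps ts p[symmetric] by simp
    then have "c = code_atom (Rel (p1 (p2 c)) (map Var (map p2 ?ts)))" by (rule sym)
    moreover have "length (map p2 ?ts) = rel_arity lang_star (p1 (p2 c))" "set (map p2 ?ts) \<subseteq> ?V"
      using e unfolding R_def by (auto simp: lang_star_def p1_def)
    ultimately show "\<exists>u xs. c = code_atom (Rel u (map Var xs)) \<and> length xs = rel_arity lang_star u \<and> set xs \<subseteq> ?V" by blast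
  next
    assume "\<exists>u xs. c = code_atom (Rel u (map Var xs)) \<and> length xs = rel_arity lang_star u \<and> set xs \<subseteq> ?V"
    then obtain u xs where c: "c = code_atom (Rel u (map Var xs))" and len: "length xs = rel_arity lang_star u"
      and sub: "set xs \<subseteq> ?V" by blast
    have "p1 t = 0 \<and> p2 t \<in> ?V" if t: "t \<in> set (map code_trm (map Var xs))" for t
    proof -
      obtain x where "x \<in> set xs" "t = prod_encode (0, x)" using t by auto
      then show ?thesis using subsetD[OF sub] by simp
    qed
    then show "R c" using c len unfolding R_def by (simp add: lang_star_def p1_def)
  qed
  have r_iff: "r (code_atom (Rel u (map Var xs))) \<longleftrightarrow> rel_star u xs" if len: "length xs = rel_arity lang_star u" for u xs
  proof (cases "p1 u = 0")
    case True
    then obtain x where "xs = [x]" using len by (auto simp: lang_star_def p1_def length_Suc_conv One_nat_def)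
    then show ?thesis using True by (cases "prod_decode u") (simp add: r_def rel_star_def p1_def)
  next
    case False
    then obtain x y where "xs = [x, y]" using len by (auto simp: lang_star_def p1_def length_Suc_conv numeral_2_eq_2)
    then show ?thesis by (simp add: r_def One_nat_def)
  qed
  have mem: "prod_encode (b, code_atom a) \<in> atomic_diagram lang_star ?A \<longleftrightarrow> (b = 0 \<or> b = 1) \<and>
    L_atom lang_star a \<and> atom_vars a \<subseteq> ?V \<and> (b = 1 \<longleftrightarrow> sat_atom ?A a (\<lambda>a. a))" for a b
    unfolding atomic_diagram_def by (auto dest: code_atom_inj simp: struct_star_def)
  have not_code: "p2 z \<in> range code_atom" if "z \<in> atomic_diagram lang_star ?A" for z
    using that unfolding atomic_diagram_def by auto
  have atomE: "\<exists>x y. a = Eq (Var x) (Var y) \<or> (\<exists>u xs. a = Rel u (map Var xs))" if "L_atom lang_star a" for a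
  proof (cases a)
    case (Rel u ts)
    then have "\<forall>t\<in>set ts. \<exists>x. t = Var x" using that by (simp add: L_trm_star)
    then have "\<exists>xs. ts = map Var xs"
    proof (induction ts)
      case (Cons t ts)
      then obtain x xs where "t = Var x" "ts = map Var xs" by auto
      then show ?case by (intro exI[of _ "x # xs"]) simp
    qed simp
    then show ?thesis using Rel by blast
  qed (use that in \<open>auto simp: L_trm_star\<close>)
  have rel_arity: "length xs = rel_arity lang_star u" if "L_atom lang_star (Rel u (map Var xs))" for u xs
    using that by simp
  have "z \<in> atomic_diagram lang_star ?A \<longleftrightarrow> (p1 z = 0 \<or> p1 z = 1) \<and>
    ((E (p2 z) \<and> (p1 z = 1 \<longleftrightarrow> p1 (p2 (p2 z)) = p2 (p2 (p2 z)))) \<or> (R (p2 z) \<and> (p1 z = 1 \<longleftrightarrow> r (p2 z))))" (is "_ \<longleftrightarrow> ?rhs") for z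
  proof -
    show ?thesis
    proof
      assume zA: "z \<in> atomic_diagram lang_star ?A"
      then obtain a where a: "p2 z = code_atom a" using not_code by blast
      have m: "(p1 z = 0 \<or> p1 z = 1) \<and> L_atom lang_star a \<and> atom_vars a \<subseteq> ?V \<and> (p1 z = 1 \<longleftrightarrow> sat_atom ?A a (\<lambda>a. a))"
      proof -
        have "prod_encode (p1 z, p2 z) \<in> atomic_diagram lang_star ?A" using zA by simp
        then show ?thesis unfolding a mem .
      qed
      from atomE[of a] m consider x y where "a = Eq (Var x) (Var y)" | u xs where "a = Rel u (map Var xs)" by blast
      then show ?rhs
      proof cases
        case 1
        then have "E (p2 z)" using m a E_iff by auto
        moreover have "p1 z = 1 \<longleftrightarrow> x = y" "p1 (p2 (p2 z)) = p2 (p2 (p2 z)) \<longleftrightarrow> x = y" using m a 1 by simp_all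
        ultimately show ?thesis using m by blast
      next
        case 2
        then have len: "length xs = rel_arity lang_star u" using m by simp
        then have "R (p2 z)" using m a 2 unfolding R_iff by auto
        moreover have "r (p2 z) \<longleftrightarrow> sat_atom ?A a (\<lambda>a. a)"
          using r_iff[OF len] a 2 by (simp add: struct_star_def comp_def)
        ultimately show ?thesis using m by blast
      qed
    next
      assume rhs: ?rhs
      have "\<exists>a. p2 z = code_atom a \<and> L_atom lang_star a \<and> atom_vars a \<subseteq> ?V \<and> (p1 z = 1 \<longleftrightarrow> sat_atom ?A a (\<lambda>a. a))"
      proof (cases "E (p2 z)")
        case True
        then obtain x y where xy: "p2 z = code_atom (Eq (Var x) (Var y))" "x \<in> ?V" "y \<in> ?V" using E_iff by blast
        have "\<not> R (p2 z)" using True unfolding E_def R_def by simp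
        then have "p1 z = 1 \<longleftrightarrow> x = y" using rhs xy(1) by simp
        then show ?thesis using xy by (intro exI[of _ "Eq (Var x) (Var y)"]) (simp add: L_trm_star)
      next
        case False
        then obtain u xs where u: "p2 z = code_atom (Rel u (map Var xs))" "length xs = rel_arity lang_star u" "set xs \<subseteq> ?V"
          using rhs R_iff by blast
        have rels_lang_star: "rels lang_star = UNIV" by (simp add: lang_star_def)
        have "p1 z = 1 \<longleftrightarrow> rel_star u xs" using rhs False r_iff[OF u(2)] u(1) by simp
        then show ?thesis using u
          by (intro exI[of _ "Rel u (map Var xs)"]) (auto simp: L_trm_star struct_star_def comp_def rels_lang_star)
      qed
      then obtain a where a: "p2 z = code_atom a" "L_atom lang_star a" "atom_vars a \<subseteq> ?V"
        "p1 z = 1 \<longleftrightarrow> sat_atom ?A a (\<lambda>a. a)" by blast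
      have "prod_encode (p1 z, p2 z) \<in> atomic_diagram lang_star ?A" unfolding a(1) mem using a(2-4) rhs by blast
      then show "z \<in> atomic_diagram lang_star ?A" by simp
    qed
  qed
  note iff = this
  have "dec (\<lambda>z. (p1 z = 0 \<or> p1 z = 1) \<and>
    ((E (p2 z) \<and> (p1 z = 1 \<longleftrightarrow> p1 (p2 (p2 z)) = p2 (p2 (p2 z)))) \<or> (R (p2 z) \<and> (p1 z = 1 \<longleftrightarrow> r (p2 z)))))"
    unfolding E_def R_def r_def by (intro cf_intros dec_rel_star dec_comp[OF V])
  then show ?thesis unfolding computable_structure_def computable_set_iff iff using str by blast
qed

context clauses
begin

lemma dec_Ok:
  assumes "cf f" "cf k" "cfl F" shows "dec (\<lambda>z. Ok f b (k z) (F z))"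
proof -
  have "dec (\<lambda>z. Ok f b (p1 z) (list_decode (p2 z)))"
    unfolding Ok_def compat_def lit_at_def
    by (intro cf_intros cf_comp[OF cf_l] cf_comp[OF assms(1)])
  from dec_comp[OF this, of "\<lambda>z. prod_encode (k z, list_encode (F z))"] show ?thesis
    using assms by (simp add: cf_pair cf_encode)
qed

lemma dec_inP: assumes "cf f" shows "dec (\<lambda>z. inP (list_decode (f z)))"
proof -
  have "dec (\<lambda>x. list_decode x = [] \<or> (\<forall>y\<in>set (list_decode (p2 (p1 (lhd (list_decode x))))). y \<in> UB) \<and>
     (\<forall>u\<in>set (list_decode x). p1 u = p1 (lhd (list_decode x))) \<and>
     Ok (\<lambda>u. p1 (p2 u)) 1 (p1 (lhd (list_decode x))) (list_decode x) \<and>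
     Ok (\<lambda>u. p2 (p2 u)) 0 (p1 (lhd (list_decode x))) (list_decode x))"
    by (intro cf_intros dec_Ok dec_comp[OF dec_UB])
  then have "dec (\<lambda>x. inP (list_decode x))" unfolding inP_def subset_eq by simp
  then show ?thesis using assms by (rule dec_comp)
qed

lemma dec_kb: assumes "cf f" "cf g" shows "dec (\<lambda>z. kb (list_decode (f z)) (list_decode (g z)))"
proof -
  have "dec (\<lambda>z. kb (list_decode (p1 z)) (list_decode (p2 z)))"
    unfolding kb_def kat_def by (intro cf_intros)
  from dec_comp[OF this cf_pair[OF assms]] show ?thesis by simp
qed

lemma dec_W: "dec (\<lambda>z. (p1 z, p2 z) \<in> W)"
proof -
  have "dec (\<lambda>z. (inP (list_decode (p1 z)) \<and> inP (list_decode (p2 z))) \<and>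
    (p1 z = p2 z \<or> kb (list_decode (p1 z)) (list_decode (p2 z))))"
    by (intro cf_intros dec_inP dec_kb)
  then show ?thesis by (simp add: W_def)
qed

lemma dec_D: assumes "cf f" "cf g" shows "dec (\<lambda>z. D (f z) (g z))"
proof -
  have "dec (\<lambda>z. D (p1 z) (p2 z))"
    unfolding D_def if_bool_eq_conj by (intro cf_intros dec_Ok dec_inP)
  from dec_comp[OF this cf_pair[OF assms]] show ?thesis by simp
qed

lemma dec_below: assumes "cf f" "cf g" shows "dec (\<lambda>z. below (f z) (g z))"
proof -
  have "dec (\<lambda>z. below (p1 z) (p2 z))"
    unfolding below_def if_bool_eq_conj by (intro cf_intros dec_kb)
  from dec_comp[OF this cf_pair[OF assms]] show ?thesis by simp
qed

lemma dec_univ_star: "dec (\<lambda>x. x \<in> univ_star UB valid)"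
proof -
  have iff: "x \<in> univ_star UB valid \<longleftrightarrow> (p1 x = 0 \<and> p2 x \<in> UB) \<or>
    (p1 x = 1 \<and> (\<forall>y\<in>set (list_decode (p1 (p2 (p2 x)))). y \<in> UB) \<and>
     valid (p1 (p2 x)) (list_decode (p1 (p2 (p2 x)))) (list_decode (p2 (p2 (p2 x)))))" (is "_ \<longleftrightarrow> ?R") for x
  proof
    assume "x \<in> univ_star UB valid"
    then show ?R unfolding univ_star_def by (auto simp: base_def nd_def)
  next
    assume ?R
    then show "x \<in> univ_star UB valid"
    proof
      assume a: "p1 x = 0 \<and> p2 x \<in> UB"
      then have "x = base (p2 x)" unfolding base_def by (metis p_simps(3))
      then show ?thesis using a unfolding univ_star_def by blast
    next
      assume a: "p1 x = 1 \<and> (\<forall>y\<in>set (list_decode (p1 (p2 (p2 x)))). y \<in> UB) \<and>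
        valid (p1 (p2 x)) (list_decode (p1 (p2 (p2 x)))) (list_decode (p2 (p2 (p2 x))))"
      have "prod_encode (p1 x, prod_encode (p1 (p2 x), prod_encode (p1 (p2 (p2 x)), p2 (p2 (p2 x))))) = x" by simp
      then have "x = nd (p1 (p2 x)) (list_decode (p1 (p2 (p2 x)))) (list_decode (p2 (p2 (p2 x))))"
        using a unfolding nd_def by simp
      then show ?thesis using a unfolding univ_star_def by blast
    qed
  qed
  show ?thesis unfolding iff valid_def
    by (intro cf_intros dec_D dec_below dec_comp[OF dec_UB])
qed

end

section \<open>Definability by computable infinitary formulas\<close>

primrec kprog :: "nat \<Rightarrow> prog" where
  "kprog 0 = PZero"
| "kprog (Suc k) = PComp PSucc (kprog k)"

text \<open>Fixes the first argument of \<open>P\<close>; the pair of the two projections is a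
  program for the identity. Together with \<open>ap\<close>, which computes the code of the result,
  this is the s-m-n theorem in the form used here.\<close>

definition appl :: "prog \<Rightarrow> nat \<Rightarrow> prog" where
  "appl P k = PComp P (PPair (kprog k) (PPair PFst PSnd))"

definition ap :: "nat \<Rightarrow> nat \<Rightarrow> nat" where
  "ap c k = prod_encode (6, prod_encode (c, prod_encode (5, prod_encode
     (rec_nat (prod_encode (0, 0)) (\<lambda>_ y. prod_encode (6, prod_encode (prod_encode (1, 0), y))) k,
      prod_encode (5, prod_encode (prod_encode (2, 0), prod_encode (3, 0)))))))"

lemma eval_kprog: "eval X (kprog k) x y \<longleftrightarrow> y = k"
  by (induction k arbitrary: y) (auto simp: eval_iffs)

lemma eval_appl: "eval X (appl P k) x y \<longleftrightarrow> eval X P (prod_encode (k, x)) y"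
proof -
  have "u = prod_encode (k, x)" if "k = p1 u" "p1 (p2 u) = p1 x" "p2 (p2 u) = p2 x" for u
    using that by (metis p_simps(3))
  then show ?thesis unfolding appl_def eval_iffs eval_kprog by (metis p_simps)
qed

lemma code_appl: "code_prog (appl P k) = ap (code_prog P) k"
proof -
  have "code_prog (kprog k) = rec_nat (prod_encode (0, 0)) (\<lambda>_ y. prod_encode (6, prod_encode (prod_encode (1, 0), y))) k"
    by (induction k) simp_all
  then show ?thesis by (simp add: appl_def ap_def)
qed

lemma cf_ap: "cf f \<Longrightarrow> cf g \<Longrightarrow> cf (\<lambda>z. ap (f z) (g z))"
  unfolding ap_def by (intro cf_intros)

lemma kprog_inj: "kprog k = kprog k' \<Longrightarrow> k = k'"
  by (induction k arbitrary: k') (case_tac k', simp_all)+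

lemma ap_inj: "ap (code_prog P) k = ap (code_prog P) k' \<Longrightarrow> k = k'"
  unfolding code_appl[symmetric] by (drule code_prog_inj) (auto simp: appl_def dest: kprog_inj)

lemma ce_set_code: "ce_set (code_prog p) = {x. \<exists>y. eval {} p x y}"
  by (simp add: ce_set_def)

text \<open>Allows the formulas of a conjunction to be recovered from the indices that a c.e. set
  lists.\<close>

lemma fm_index_fun: "fm_index k \<phi> \<Longrightarrow> fm_index k \<psi> \<Longrightarrow> \<phi> = \<psi>"
proof (induction arbitrary: \<psi> rule: fm_index.induct)
  case (fm_index_Atom a)
  from fm_index_Atom show ?case by cases (auto dest: code_atom_inj)
next
  case (fm_index_Neg i \<phi>)
  from fm_index_Neg.prems show ?case by cases (use fm_index_Neg.IH in auto)
next
  case (fm_index_Ex i \<phi> x)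
  from fm_index_Ex.prems show ?case by cases (use fm_index_Ex.IH in auto)
next
  case (fm_index_All i \<phi> x)
  from fm_index_All.prems show ?case by cases (use fm_index_All.IH in auto)
next
  case (fm_index_Conj e F)
  from fm_index_Conj.prems show ?case
  proof cases
    case (fm_index_Conj e' F')
    then have "F ` ce_set e = F' ` ce_set e" using \<open>\<forall>i\<in>ce_set e. _\<close> by (intro image_cong) auto
    then show ?thesis using fm_index_Conj by simp
  qed auto
next
  case (fm_index_Disj e F)
  from fm_index_Disj.prems show ?case
  proof cases
    case (fm_index_Disj e' F')
    then have "F ` ce_set e = F' ` ce_set e" using \<open>\<forall>i\<in>ce_set e. _\<close> by (intro image_cong) auto
    then show ?thesis using fm_index_Disj by simp
  qed auto
qed

lemma rcset_acset: "countable S \<Longrightarrow> rcset (acset S) = S"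
  by (simp add: acset_inverse)

lemma finite_Conj_index:
  assumes fin: "finite \<Phi>" and ix: "\<And>\<phi>. \<phi> \<in> \<Phi> \<Longrightarrow> \<exists>k. fm_index k \<phi>"
  shows "\<exists>k. fm_index k (Conj (acset \<Phi>))"
proof -
  obtain ix where ix: "\<And>\<phi>. \<phi> \<in> \<Phi> \<Longrightarrow> fm_index (ix \<phi>) \<phi>" using ix by metis
  have "dec (\<lambda>z. p1 z \<in> ix ` \<Phi>)" by (rule dec_comp[OF finite_dec]) (use fin in \<open>auto intro: cf_intros\<close>)
  from semidecidable_exists[of "\<lambda>x _. x \<in> ix ` \<Phi>", OF this]
  obtain p where p: "\<And>x. (\<exists>y. eval {} p x y) \<longleftrightarrow> x \<in> ix ` \<Phi>" by auto
  define F where "F k = (SOME \<phi>. fm_index k \<phi>)" for k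
  have F: "F (ix \<phi>) = \<phi>" if "\<phi> \<in> \<Phi>" for \<phi>
    unfolding F_def using ix[OF that] fm_index_fun by (metis someI)
  have ce: "ce_set (code_prog p) = ix ` \<Phi>" unfolding ce_set_code using p by blast
  have "\<forall>k\<in>ce_set (code_prog p). fm_index k (F k)" unfolding ce using F ix by simp
  from fm_index_Conj[OF this] have "fm_index (prod_encode (4, code_prog p)) (Conj (acset (F ` ix ` \<Phi>)))" unfolding ce .
  moreover have "F ` ix ` \<Phi> = \<Phi>" using F by (force simp: image_iff)
  ultimately show ?thesis by auto
qed

context gadget
begin

section \<open>Formulas for ranks and for facts\<close>

lemma child_attained:
  assumes y: "y \<in> V" and \<gamma>: "\<gamma> < rkE y" shows "\<exists>c\<in>V. child y c \<and> rkE c = \<gamma>"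
  using y
proof (cases rule: V_cases)
  case (1 i)
  then show ?thesis using \<gamma> zero_cord_least[of \<gamma>] by simp
next
  case (2 a xs s)
  then have "infinite {d. valid a xs (d # s) \<and> rk a xs (d # s) = \<gamma>}" using rk_inf \<gamma> by simp
  then obtain d where "valid a xs (d # s)" "rk a xs (d # s) = \<gamma>" using infinite_imp_nonempty by blast
  then show ?thesis using 2 unfolding child_def by (intro bexI[of _ "nd a xs (d # s)"]) auto
qed

text \<open>This recursion along \<open>r\<close> is what \<open>rank_formula\<close> writes out: a
  conjunction over the smaller elements of existential statements about children.\<close>

lemma seg_le_rkE_iff:
  assumes wo: "Well_order r" and w: "w \<in> Field r" and y: "y \<in> V"
  shows "seg r w \<le> rkE y \<longleftrightarrow> (\<forall>m. (m, w) \<in> r \<and> m \<noteq> w \<longrightarrow> (\<exists>c\<in>V. child y c \<and> seg r m \<le> rkE c))"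
proof
  assume le: "seg r w \<le> rkE y"
  show "\<forall>m. (m, w) \<in> r \<and> m \<noteq> w \<longrightarrow> (\<exists>c\<in>V. child y c \<and> seg r m \<le> rkE c)"
  proof (intro allI impI)
    fix m assume "(m, w) \<in> r \<and> m \<noteq> w"
    then have "seg r m < rkE y" using seg_strict[OF wo] le by (blast intro: less_le_trans)
    from child_attained[OF y this] show "\<exists>c\<in>V. child y c \<and> seg r m \<le> rkE c" by force
  qed
next
  assume a: "\<forall>m. (m, w) \<in> r \<and> m \<noteq> w \<longrightarrow> (\<exists>c\<in>V. child y c \<and> seg r m \<le> rkE c)"
  show "seg r w \<le> rkE y"
    unfolding seg_eq_strict_sup[OF wo w]
  proof (rule strict_sup_least)
    fix x assume "x \<in> seg r ` {m. (m, w) \<in> r \<and> m \<noteq> w}"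
    then obtain c where "c \<in> V" "child y c" "x \<le> rkE c" using a by blast
    then show "x < rkE y" using child_rkE le_less_trans by blast
  qed
qed

lemma rel_star_child: "rel_star (prod_encode (2, 0)) [x, y] \<longleftrightarrow> child x y"
  by (simp add: rel_star_def)

text \<open>The index of the conjunction for \<open>w\<close> is computed from that for smaller elements.  As the
  members of the c.e. set are indices only, no universal program is needed: the program enumerating
  them receives its own code as a parameter.\<close>

lemma rank_formula:
  assumes wo: "Well_order r" and dec_r: "dec (\<lambda>z. (p1 z, p2 z) \<in> r)" and ij: "i \<noteq> j" and w: "w \<in> Field r"
  shows "\<exists>\<phi>. (\<exists>k. fm_index k \<phi>) \<and> L_fm lang_star \<phi> \<and> free_vars \<phi> \<subseteq> {i, j} \<and>
    (\<forall>v. v i \<in> V \<longrightarrow> v j \<in> V \<longrightarrow> (sat A' \<phi> v \<longleftrightarrow> child (v i) (v j) \<and> seg r w \<le> rkE (v j)))"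
proof -
  \<comment> \<open>Two variables suffice: a child of the element at \<open>X (1 - b)\<close> is
    bound to \<open>X b\<close>, whose old value is no longer needed inside, so the roles alternate
    with the level.\<close>
  define X where "X b = (if b = 0 then i else j)" for b :: nat
  \<comment> \<open>Every formula contains this child atom, so that it already restricts the
    quantifier one level up to children.\<close>
  define atm where "atm b = Rel (prod_encode (2, 0)) [Var (X b), Var (X (1 - b))]" for b
  define iat where "iat b = (if b = 0 then prod_encode (0, code_atom (atm 0)) else prod_encode (0, code_atom (atm 1)))" for b :: nat
  \<comment> \<open>\<open>u\<close> consists of the parameters (own code, element \<open>w\<close>,
    parity \<open>b\<close>) and a candidate index; \<open>m\<close> is the witness of the search.
    The index belonging to \<open>m\<close> refers to the same program with parameters
    \<open>m\<close> and \<open>1 - b\<close>.\<close>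
  define Q where "Q u m \<longleftrightarrow> p2 u = iat (p2 (p2 (p1 u))) \<or>
    (((m, p1 (p2 (p1 u))) \<in> r \<and> m \<noteq> p1 (p2 (p1 u))) \<and> p2 u = prod_encode (2, prod_encode (X (p2 (p2 (p1 u))),
      prod_encode (4, ap (p1 (p1 u)) (prod_encode (p1 (p1 u), prod_encode (m, 1 - p2 (p2 (p1 u)))))))))" for u m
  have "dec (\<lambda>z. Q (p1 z) (p2 z))"
    unfolding Q_def iat_def X_def by (intro cf_intros cf_ap dec_rel[OF dec_r])
  then obtain P where P: "\<And>u. (\<exists>y. eval {} P u y) \<longleftrightarrow> (\<exists>m. Q u m)" using semidecidable_exists by blast
  define e where "e w b = ap (code_prog P) (prod_encode (code_prog P, prod_encode (w, b)))" for w b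
  define ex where "ex b m = prod_encode (2, prod_encode (X b, prod_encode (4, e m (1 - b))))" for b m
  \<comment> \<open>Formulas are chosen by their index alone, so the index has to determine the
    element \<open>m\<close> it belongs to.\<close>
  have ex_inj: "ex b m = ex b m' \<Longrightarrow> m = m'" for b m m'
    unfolding ex_def e_def by (auto dest: ap_inj)
  have ce: "ce_set (e w b) = {iat b} \<union> {ex b m | m. (m, w) \<in> r \<and> m \<noteq> w}" for w b
  proof -
    have "ce_set (e w b) = {x. \<exists>m. Q (prod_encode (prod_encode (code_prog P, prod_encode (w, b)), x)) m}"
      unfolding e_def code_appl[symmetric] ce_set_code eval_appl P ..
    also have "\<dots> = {iat b} \<union> {ex b m | m. (m, w) \<in> r \<and> m \<noteq> w}"
      unfolding Q_def ex_def e_def by auto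
    finally show ?thesis .
  qed
  define good where "good \<phi> b w \<longleftrightarrow> L_fm lang_star \<phi> \<and> free_vars \<phi> \<subseteq> {i, j} \<and>
    (\<forall>v. v (X b) \<in> V \<longrightarrow> v (X (1 - b)) \<in> V \<longrightarrow>
      (sat A' \<phi> v \<longleftrightarrow> child (v (X b)) (v (X (1 - b))) \<and> seg r w \<le> rkE (v (X (1 - b)))))" for \<phi> b w
  have X_neq: "X b \<noteq> X (1 - b)" "X (1 - (1 - b)) = X b" if "b \<le> 1" for b
    using that ij by (auto simp: X_def)
  have wf: "wf (r - Id)" using wo unfolding well_order_on_def by blast
  have main: "\<exists>\<phi>. fm_index (prod_encode (4, e w b)) \<phi> \<and> good \<phi> b w" if "w \<in> Field r" "b \<le> 1" for w b
    using wf that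
  proof (induction w arbitrary: b rule: wf_induct_rule)
    case (less w)
    let ?K = "\<lambda>x \<phi>. fm_index x \<phi> \<and> (\<exists>m \<psi>. x = ex b m \<and> (m, w) \<in> r \<and> m \<noteq> w \<and> \<phi> = Ex (X b) \<psi> \<and> good \<psi> (1 - b) m)"
    define F where "F x = (if x = iat b then Atom (atm b) else (SOME \<phi>. ?K x \<phi>))" for x
    have iat_ex: "iat b \<noteq> ex b m" for m by (simp add: iat_def ex_def)
    have K: "?K (ex b m) (F (ex b m))" if m: "(m, w) \<in> r" "m \<noteq> w" for m
    proof -
      have "m \<in> Field r" using m by (auto simp: Field_def)
      then obtain \<psi> where \<psi>: "fm_index (prod_encode (4, e m (1 - b))) \<psi>" "good \<psi> (1 - b) m"
        using less.IH[of m "1 - b"] m by auto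
      have "?K (ex b m) (Ex (X b) \<psi>)" using fm_index_Ex[OF \<psi>(1), of "X b"] \<psi>(2) m unfolding ex_def by blast
      then have "?K (ex b m) (SOME \<phi>. ?K (ex b m) \<phi>)" by (rule someI)
      moreover have "F (ex b m) = (SOME \<phi>. ?K (ex b m) \<phi>)" using iat_ex[of m] by (simp add: F_def)
      ultimately show ?thesis by simp
    qed
    have Fi: "F (iat b) = Atom (atm b)" by (simp add: F_def)
    have ib: "fm_index (iat b) (Atom (atm b))"
    proof -
      have "b = 0 \<or> b = 1" using \<open>b \<le> 1\<close> by auto
      then show ?thesis unfolding iat_def using fm_index_Atom by auto
    qed
    have idx: "\<forall>x\<in>ce_set (e w b). fm_index x (F x)" unfolding ce using K ib Fi by auto
    let ?\<phi> = "Conj (acset (F ` ce_set (e w b)))"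
    have rc: "rcset (acset (F ` ce_set (e w b))) = F ` ce_set (e w b)" by (rule rcset_acset) simp
    have Xij: "X b \<in> {i, j}" for b by (simp add: X_def)
    have sub: "L_fm lang_star (F x) \<and> free_vars (F x) \<subseteq> {i, j}" if x: "x \<in> ce_set (e w b)" for x
    proof (cases "x = iat b")
      case True
      have "L_fm lang_star (Atom (atm b))" unfolding atm_def
        by (intro L_fm_Atom) (simp add: lang_star_def L_trm_Var)
      moreover have "free_vars (Atom (atm b)) \<subseteq> {i, j}" using Xij by (simp add: atm_def)
      ultimately show ?thesis using True Fi by simp
    next
      case False
      then obtain m where "x = ex b m" "(m, w) \<in> r" "m \<noteq> w" using x unfolding ce by blast
      then obtain m' \<psi> where "F x = Ex (X b) \<psi>" "good \<psi> (1 - b) m'" using K by blast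
      then show ?thesis unfolding good_def by (auto intro: L_fm_Ex)
    qed
    have "good ?\<phi> b w"
      unfolding good_def
    proof (intro conjI allI impI)
      show "L_fm lang_star ?\<phi>" by (rule L_fm_Conj) (use sub rc in auto)
      show "free_vars ?\<phi> \<subseteq> {i, j}" using sub rc by (auto simp del: insert_iff)
      fix v assume v: "v (X b) \<in> V" "v (X (1 - b)) \<in> V"
      have "sat A' ?\<phi> v \<longleftrightarrow> (\<forall>x\<in>ce_set (e w b). sat A' (F x) v)" using rc by simp
      also have "\<dots> \<longleftrightarrow> sat A' (Atom (atm b)) v \<and> (\<forall>m. (m, w) \<in> r \<and> m \<noteq> w \<longrightarrow> sat A' (F (ex b m)) v)"
        unfolding ce using Fi by auto
      also have "sat A' (Atom (atm b)) v \<longleftrightarrow> child (v (X b)) (v (X (1 - b)))"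
        by (simp add: atm_def struct_star_def rel_star_child)
      also have "(\<forall>m. (m, w) \<in> r \<and> m \<noteq> w \<longrightarrow> sat A' (F (ex b m)) v) \<longleftrightarrow>
        (\<forall>m. (m, w) \<in> r \<and> m \<noteq> w \<longrightarrow> (\<exists>c\<in>V. child (v (X (1 - b))) c \<and> seg r m \<le> rkE c))"
      proof (rule all_cong)
        fix m assume m: "(m, w) \<in> r \<and> m \<noteq> w"
        from K[of m] m obtain m' \<psi> where k: "ex b m = ex b m'" "F (ex b m) = Ex (X b) \<psi>" "good \<psi> (1 - b) m'" by blast
        have "m' = m" using ex_inj[OF k(1)] by simp
        have g: "sat A' \<psi> (v(X b := c)) \<longleftrightarrow> child (v (X (1 - b))) c \<and> seg r m \<le> rkE c" if "c \<in> V" for c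
          using k(3) v that X_neq[OF \<open>b \<le> 1\<close>] unfolding good_def \<open>m' = m\<close> by simp
        show "sat A' (F (ex b m)) v \<longleftrightarrow> (\<exists>c\<in>V. child (v (X (1 - b))) c \<and> seg r m \<le> rkE c)"
          unfolding k(2) sat.simps univ_A' using g by blast
      qed
      also have "\<dots> \<longleftrightarrow> seg r w \<le> rkE (v (X (1 - b)))"
        using seg_le_rkE_iff[OF wo \<open>w \<in> Field r\<close> v(2)] by blast
      finally show "sat A' ?\<phi> v \<longleftrightarrow> child (v (X b)) (v (X (1 - b))) \<and> seg r w \<le> rkE (v (X (1 - b)))" .
    qed
    then show ?case using fm_index_Conj[OF idx] by blast
  qed
  obtain \<phi> where "fm_index (prod_encode (4, e w 0)) \<phi>" "good \<phi> 0 w" using main[OF w, of 0] by auto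
  then show ?thesis unfolding good_def X_def by auto
qed

text \<open>A root has rank \<open>\<beta>0\<close> or its successor, so a fact is true iff its root
  has a child of rank at least \<open>\<beta>0\<close>. The root itself is described by its type and
  its components, without parameters.\<close>

lemma fact_definable:
  assumes wo: "Well_order r" and dec_r: "dec (\<lambda>z. (p1 z, p2 z) \<in> r)"
    and t: "t \<in> Field r" "seg r t = \<beta>0" and \<beta>1: "\<beta>1 = succ_cord \<beta>0"
    and a: "L_atom L a" "atom_vars a \<subseteq> {..<n}"
  shows "ci_definable lang_star A' n {map base xs | xs. length xs = n \<and> set xs \<subseteq> UB \<and> sat_atom A a (\<lambda>i. h (xs ! i))}"
proof -
  obtain \<psi> where \<psi>: "\<exists>k. fm_index k \<psi>" "L_fm lang_star \<psi>" "free_vars \<psi> \<subseteq> {n, Suc n}"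
    "\<And>v. v n \<in> V \<Longrightarrow> v (Suc n) \<in> V \<Longrightarrow> sat A' \<psi> v \<longleftrightarrow> child (v n) (v (Suc n)) \<and> \<beta>0 \<le> rkE (v (Suc n))"
    using rank_formula[OF wo dec_r _ t(1), of n "Suc n"] t(2) by auto
  \<comment> \<open>The type of a root, as the branch has length 0. The root and its child are the
    variables \<open>n\<close> and \<open>Suc n\<close>, just after those of the tuple.\<close>
  let ?T = "Suc (prod_encode (code_atom a, prod_encode (n, 0)))"
  let ?at = "Atom (Rel (prod_encode (0, ?T)) [Var n])"
  let ?ac = "\<lambda>k. Atom (Rel (prod_encode (1, k)) [Var n, Var k])"
  let ?\<Phi> = "insert ?at (insert \<psi> (?ac ` {..<n}))"
  let ?\<phi> = "Ex n (Ex (Suc n) (Conj (acset ?\<Phi>)))"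
  have rc: "rcset (acset ?\<Phi>) = ?\<Phi>" by (rule rcset_acset) (simp add: countable_finite)
  have "\<exists>k. fm_index k \<phi>" if "\<phi> \<in> ?\<Phi>" for \<phi> using that \<psi>(1) fm_index_Atom by auto
  then obtain k where "fm_index k (Conj (acset ?\<Phi>))" using finite_Conj_index[of ?\<Phi>] by auto
  then have idx: "\<exists>k. fm_index k ?\<phi>" using fm_index_Ex by blast
  have "L_fm lang_star \<phi>" if "\<phi> \<in> ?\<Phi>" for \<phi>
    using that \<psi>(2) by (auto intro!: L_fm_Atom simp: lang_star_def L_trm_Var)
  then have L: "L_fm lang_star ?\<phi>" using rc by (intro L_fm_Ex L_fm_Conj) simp
  have "free_vars (Conj (acset ?\<Phi>)) \<subseteq> insert n (insert (Suc n) {..<n})" using \<psi>(3) rc by auto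
  then have fv: "free_vars ?\<phi> \<subseteq> {..<n}" by auto
  have sat: "sat_at A' ?\<phi> ys \<longleftrightarrow> (\<exists>g\<in>V. \<exists>y\<in>V. ety g = ?T \<and>
      (child g y \<and> \<beta>0 \<le> rkE y) \<and> (\<forall>k<n. k < length (comps g) \<and> comps g ! k = ys ! k))"
    if len: "length ys = n" for ys
  proof -
    have "sat A' (Conj (acset ?\<Phi>)) ((vl ys)(n := g, Suc n := y)) \<longleftrightarrow> ety g = ?T \<and>
      (child g y \<and> \<beta>0 \<le> rkE y) \<and> (\<forall>k<n. k < length (comps g) \<and> comps g ! k = ys ! k)" if "g \<in> V" "y \<in> V" for g y
    proof -
      have "sat A' ?at ((vl ys)(n := g, Suc n := y)) \<longleftrightarrow> ety g = ?T"
        by (simp add: struct_star_def rel_star_def)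
      moreover have "sat A' \<psi> ((vl ys)(n := g, Suc n := y)) \<longleftrightarrow> child g y \<and> \<beta>0 \<le> rkE y"
        using \<psi>(4)[of "(vl ys)(n := g, Suc n := y)"] that by simp
      moreover have "sat A' (?ac k) ((vl ys)(n := g, Suc n := y)) \<longleftrightarrow> k < length (comps g) \<and> comps g ! k = ys ! k" if "k < n" for k
        using that len by (simp add: struct_star_def rel_star_def)
      ultimately show ?thesis using rc by auto
    qed
    note eq = this
    have "sat_at A' (Ex m (Ex m' \<chi>)) ys \<longleftrightarrow> (\<exists>g\<in>V. \<exists>y\<in>V. sat A' \<chi> ((vl ys)(m := g, m' := y)))" for m m' \<chi>
      by (simp add: sat_at_def)
    then show ?thesis using eq by (simp only: cong: bex_cong)
  qed
  have main: "sat_at A' ?\<phi> ys \<longleftrightarrow> (\<exists>xs. ys = map base xs \<and> length xs = n \<and> set xs \<subseteq> UB \<and> sat_atom A a (\<lambda>i. h (xs ! i)))"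
    if len: "length ys = n" for ys
  proof
    assume "sat_at A' ?\<phi> ys"
    then obtain g y where g: "g \<in> V" "y \<in> V" "ety g = ?T" "child g y" "\<beta>0 \<le> rkE y"
      "\<And>k. k < n \<Longrightarrow> k < length (comps g) \<and> comps g ! k = ys ! k" using sat[OF len] by blast
    have "ety (nd (code_atom a) (replicate n 0) []) = ety g" using g(3) by simp
    then obtain xs where xs: "set xs \<subseteq> UB" "g = nd (code_atom a) xs []" "length xs = n"
      using ety_nd_cases[OF g(1)] by (metis length_0_conv length_replicate list.size(3))
    have "ys = map base xs"
      by (rule nth_equalityI) (use g(6) xs len in \<open>auto simp: nth_append\<close>)
    moreover have "\<beta>0 < rkE g" using child_rkE[OF g(4,2)] g(5) by simp
    then have "fact_holds L A h (code_atom a) xs" using rk_Nil[OF xs(1)] xs(2) by (auto split: if_splits)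
    then have "sat_atom A a (\<lambda>i. h (xs ! i))" unfolding fact_holds_def by (auto dest: code_atom_inj)
    ultimately show "\<exists>xs. ys = map base xs \<and> length xs = n \<and> set xs \<subseteq> UB \<and> sat_atom A a (\<lambda>i. h (xs ! i))"
      using xs by blast
  next
    assume "\<exists>xs. ys = map base xs \<and> length xs = n \<and> set xs \<subseteq> UB \<and> sat_atom A a (\<lambda>i. h (xs ! i))"
    then obtain xs where xs: "ys = map base xs" "length xs = n" "set xs \<subseteq> UB" "sat_atom A a (\<lambda>i. h (xs ! i))" by blast
    let ?g = "nd (code_atom a) xs []"
    have gV: "?g \<in> V" using xs by simp
    have "fact_holds L A h (code_atom a) xs" unfolding fact_holds_def using a xs by auto
    then have "\<beta>0 < rkE ?g" using rk_Nil[OF xs(3)] \<beta>01 by simp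
    from child_attained[OF gV this] obtain y where "y \<in> V" "child ?g y" "rkE y = \<beta>0" by blast
    then show "sat_at A' ?\<phi> ys" unfolding sat[OF len] using gV xs(1,2)
      by (intro bexI[of _ ?g] bexI[of _ y]) (auto simp: nth_append)
  qed
  have "{map base xs | xs. length xs = n \<and> set xs \<subseteq> UB \<and> sat_atom A a (\<lambda>i. h (xs ! i))} =
    {ys \<in> tuples A' n. sat_at A' ?\<phi> ys}"
  proof (intro set_eqI iffI)
    fix ys assume "ys \<in> {map base xs | xs. length xs = n \<and> set xs \<subseteq> UB \<and> sat_atom A a (\<lambda>i. h (xs ! i))}"
    then obtain xs where xs: "ys = map base xs" "length xs = n" "set xs \<subseteq> UB" "sat_atom A a (\<lambda>i. h (xs ! i))" by blast
    then have "length ys = n" "set ys \<subseteq> V" by auto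
    then show "ys \<in> {ys \<in> tuples A' n. sat_at A' ?\<phi> ys}" using main[of ys] xs unfolding tuples_def by auto
  next
    fix ys assume "ys \<in> {ys \<in> tuples A' n. sat_at A' ?\<phi> ys}"
    then have "length ys = n" "sat_at A' ?\<phi> ys" unfolding tuples_def by blast+
    then show "ys \<in> {map base xs | xs. length xs = n \<and> set xs \<subseteq> UB \<and> sat_atom A a (\<lambda>i. h (xs ! i))}"
      using main[of ys] by blast
  qed
  then show ?thesis unfolding ci_definable_def computable_infinitary_def using L idx fv by blast
qed

lemma base_definable: "ci_definable lang_star A' 1 {[base i] | i. i \<in> UB}"
proof -
  let ?\<phi> = "Atom (Rel (prod_encode (0, 0)) [Var 0])"
  have "{[base i] | i. i \<in> UB} = {ys \<in> tuples A' 1. sat_at A' ?\<phi> ys}"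
  proof (intro set_eqI iffI)
    fix ys assume "ys \<in> {[base i] | i. i \<in> UB}"
    then show "ys \<in> {ys \<in> tuples A' 1. sat_at A' ?\<phi> ys}"
      by (auto simp: tuples_def sat_at_def struct_star_def rel_star_def One_nat_def)
  next
    fix ys assume "ys \<in> {ys \<in> tuples A' 1. sat_at A' ?\<phi> ys}"
    then obtain y where "ys = [y]" "y \<in> V" "ety y = 0"
      by (auto simp: tuples_def sat_at_def length_Suc_conv One_nat_def) (auto simp: struct_star_def rel_star_def)
    then show "ys \<in> {[base i] | i. i \<in> UB}" using ety_base_cases by blast
  qed
  moreover have "L_fm lang_star ?\<phi>" by (intro L_fm_Atom) (simp add: lang_star_def L_trm_Var)
  ultimately show ?thesis unfolding ci_definable_def computable_infinitary_def
    using fm_index_Atom[of "Rel (prod_encode (0, 0)) [Var 0]"] by (intro exI[of _ ?\<phi>]) auto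
qed

theorem copy_definable:
  assumes wo: "Well_order r" and dec_r: "dec (\<lambda>z. (p1 z, p2 z) \<in> r)"
    and t: "t \<in> Field r" "seg r t = \<beta>0" and \<beta>1: "\<beta>1 = succ_cord \<beta>0"
  shows "ci_definable_copy L A lang_star A'"
proof -
  define k where "k x = base (inv_into UB h x)" for x
  define g where "g y = h (snd (prod_decode y))" for y
  define B where "B = \<lparr>univ = base ` UB, rel_in = (\<lambda>r ys. rel_in A r (map g ys)),
    fun_in = (\<lambda>f ys. k (fun_in A f (map g ys)))\<rparr>"
  have g [simp]: "g (base i) = h i" for i by (simp add: g_def)
  have k: "x \<in> univ A \<Longrightarrow> k x \<in> base ` UB \<and> g (k x) = x" for x
    using h unfolding k_def bij_betw_def by (auto simp: inv_into_into f_inv_into_f)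
  have kh: "i \<in> UB \<Longrightarrow> k (h i) = base i" for i
    using h unfolding k_def bij_betw_def by (simp add: inv_into_f_f)
  have gk: "set xs \<subseteq> univ A \<Longrightarrow> map g (map k xs) = xs" for xs
    using k by (simp add: map_idI subset_eq)
  have tupB: "ys \<in> tuples B n \<longleftrightarrow> (\<exists>xs. ys = map base xs \<and> length xs = n \<and> set xs \<subseteq> UB)" for ys n
  proof
    assume "ys \<in> tuples B n"
    then have y: "set ys \<subseteq> base ` UB" "length ys = n" by (auto simp: tuples_def B_def)
    then have "ys = map base (map (\<lambda>y. snd (prod_decode y)) ys)" "set (map (\<lambda>y. snd (prod_decode y)) ys) \<subseteq> UB"
      by (auto simp: comp_def intro!: map_idI[symmetric])
    then show "\<exists>xs. ys = map base xs \<and> length xs = n \<and> set xs \<subseteq> UB" using y(2) length_map by metis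
  next
    assume "\<exists>xs. ys = map base xs \<and> length xs = n \<and> set xs \<subseteq> UB"
    then obtain xs where xs: "ys = map base xs" "length xs = n" "set xs \<subseteq> UB" by blast
    then have "set ys \<subseteq> base ` UB" unfolding xs(1) set_map by (intro image_mono)
    then show "ys \<in> tuples B n" using xs(1,2) by (simp add: tuples_def B_def)
  qed
  have hset: "set xs \<subseteq> UB \<Longrightarrow> h ` set xs \<subseteq> univ A" for xs using h_in by blast
  have gtup: "map g ys \<in> tuples A n" if ys: "ys \<in> tuples B n" for ys n
  proof -
    obtain xs where xs: "ys = map base xs" "length xs = n" "set xs \<subseteq> UB" using ys unfolding tupB by blast
    then show ?thesis using hset[OF xs(3)] by (simp add: tuples_def comp_def)
  qed
  have strB: "is_structure L B"
    unfolding is_structure_def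
  proof (intro conjI ballI)
    show "univ B \<noteq> {}" using UB_ne by (simp add: B_def)
    fix f ys assume "f \<in> funs L" "ys \<in> tuples B (fun_arity L f)"
    then have "fun_in A f (map g ys) \<in> univ A" using strA gtup unfolding is_structure_def by blast
    then show "fun_in B f ys \<in> univ B" using k by (simp add: B_def)
  qed
  have iso: "isomorphism L A B k"
    unfolding isomorphism_def
  proof (intro conjI ballI)
    have "inj_on k (univ A)" using k by (metis inj_onI)
    moreover have "k ` univ A = base ` UB" using k kh h_in by (auto simp: image_iff) (metis)
    ultimately show "bij_betw k (univ A) (univ B)" by (simp add: bij_betw_def B_def)
    fix q xs assume "xs \<in> tuples A (rel_arity L q)"
    then show "rel_in A q xs = rel_in B q (map k xs)" using gk[of xs] by (simp add: B_def tuples_def del: map_map)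
  next
    fix q xs assume "xs \<in> tuples A (fun_arity L q)"
    then show "k (fun_in A q xs) = fun_in B q (map k xs)" using gk[of xs] by (simp add: B_def tuples_def del: map_map)
  qed
  have "tuples B 1 = {[base i] | i. i \<in> UB}"
  proof (intro set_eqI iffI)
    fix ys assume "ys \<in> tuples B 1"
    then show "ys \<in> {[base i] | i. i \<in> UB}" unfolding tupB by (auto simp: length_Suc_conv One_nat_def)
  next
    fix ys assume "ys \<in> {[base i] | i. i \<in> UB}"
    then obtain i where "ys = [base i]" "i \<in> UB" by blast
    then show "ys \<in> tuples B 1" unfolding tupB by (intro exI[of _ "[i]"]) simp
  qed
  then have D1: "ci_definable lang_star A' 1 (tuples B 1)" using base_definable by simp
  have D2: "ci_definable lang_star A' (rel_arity L q) {ys \<in> tuples B (rel_arity L q). rel_in B q ys}" if "q \<in> rels L" for q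
  proof -
    let ?n = "rel_arity L q"
    have "L_atom L (Rel q (map Var [0..<?n]))" "atom_vars (Rel q (map Var [0..<?n])) \<subseteq> {..<?n}"
      using that by (auto intro: L_trm_Var)
    note d = fact_definable[OF wo dec_r t \<beta>1 this]
    have "{ys \<in> tuples B ?n. rel_in B q ys} =
      {map base xs | xs. length xs = ?n \<and> set xs \<subseteq> UB \<and> sat_atom A (Rel q (map Var [0..<?n])) (\<lambda>i. h (xs ! i))}"
    proof -
      have "map (\<lambda>i. h (xs ! i)) [0..<?n] = map h xs" if "length xs = ?n" for xs
        using that by (intro nth_equalityI) auto
      then show ?thesis unfolding tupB by (auto simp: B_def comp_def cong: conj_cong)
    qed
    then show ?thesis using d by simp
  qed
  have D3: "ci_definable lang_star A' (Suc (fun_arity L f)) {ys @ [fun_in B f ys] | ys. ys \<in> tuples B (fun_arity L f)}"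
    if "f \<in> funs L" for f
  proof -
    \<comment> \<open>The graph of a function is the truth set of an equation whose right side is
      the variable following the arguments.\<close>
    let ?n = "fun_arity L f" let ?a = "Eq (Fun f (map Var [0..<?n])) (Var ?n)"
    have "L_atom L ?a" "atom_vars ?a \<subseteq> {..<Suc ?n}"
      using that by (auto intro!: L_trm_Var L_trm_Fun)
    note d = fact_definable[OF wo dec_r t \<beta>1 this]
    have sat: "sat_atom A ?a (\<lambda>i. h ((xs @ [x]) ! i)) \<longleftrightarrow> fun_in A f (map h xs) = h x" if "length xs = ?n" for xs x
    proof -
      have "map (\<lambda>i. h ((xs @ [x]) ! i)) [0..<?n] = map h xs"
        using that by (intro nth_equalityI) (auto simp: nth_append)
      then show ?thesis using that by (simp add: comp_def nth_append)
    qed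
    have fin: "fun_in A f (map h xs) \<in> univ A" if "length xs = ?n" "set xs \<subseteq> UB" for xs
    proof -
      have "map h xs \<in> tuples A ?n" using hset[OF that(2)] that(1) by (simp add: tuples_def)
      then show ?thesis using strA \<open>f \<in> funs L\<close> unfolding is_structure_def by blast
    qed
    have "{ys @ [fun_in B f ys] | ys. ys \<in> tuples B ?n} =
      {map base xs | xs. length xs = Suc ?n \<and> set xs \<subseteq> UB \<and> sat_atom A ?a (\<lambda>i. h (xs ! i))}" (is "?l = ?r")
    proof (intro set_eqI iffI)
      fix z assume "z \<in> ?l"
      then obtain xs where xs: "z = map base xs @ [fun_in B f (map base xs)]" "length xs = ?n" "set xs \<subseteq> UB"
        unfolding tupB by blast
      have e: "fun_in B f (map base xs) = k (fun_in A f (map h xs))" by (simp add: B_def comp_def)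
      obtain x where x: "x \<in> UB" "k (fun_in A f (map h xs)) = base x" using k[OF fin[OF xs(2,3)]] by blast
      have "h x = fun_in A f (map h xs)" using k[OF fin[OF xs(2,3)]] x(2) by simp
      then have "sat_atom A ?a (\<lambda>i. h ((xs @ [x]) ! i))" using sat[OF xs(2)] by simp
      then show "z \<in> ?r" using xs x e by (intro CollectI exI[of _ "xs @ [x]"]) simp
    next
      fix z assume "z \<in> ?r"
      then obtain us where us: "z = map base us" "length us = Suc ?n" "set us \<subseteq> UB" "sat_atom A ?a (\<lambda>i. h (us ! i))" by blast
      then obtain xs x where ux: "us = xs @ [x]" "length xs = ?n" by (metis append_butlast_last_id length_butlast diff_Suc_1 list.size(3) nat.distinct(1))
      then have "fun_in A f (map h xs) = h x" using us(4) sat by simp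
      then have "fun_in B f (map base xs) = base x" using kh us(3) ux by (simp add: B_def comp_def)
      then show "z \<in> ?l" using us(1,3) ux unfolding tupB by (intro CollectI exI[of _ "map base xs"]) auto
    qed
    then show ?thesis using d by simp
  qed
  have "univ B \<subseteq> univ A'" by (auto simp: B_def)
  then show ?thesis unfolding ci_definable_copy_def using strB iso D1 D2 D3 by blast
qed

end

theorem theorem2p1:
  fixes L :: lang and A :: struct
  assumes "computable_language L"
    and "hyperarithmetical_structure L A"
  shows "\<exists>L' A'. computable_language L' \<and> computable_structure L' A' \<and>
    ci_definable_copy L A L' A' \<and>
    (SR L A < omega1CK \<longrightarrow> SR L' A' < omega1CK) \<and>
    (SR L A = omega1CK \<longrightarrow> SR L' A' = omega1CK) \<and>
    (SR L A = succ_cord omega1CK \<longrightarrow> SR L' A' = succ_cord omega1CK)"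
proof -
  have str: "is_structure L A" using assms(2) unfolding hyperarithmetical_structure_def by blast
  obtain a0 X0 q where H: "H_set a0 X0" "\<And>x. eval X0 q x (if x \<in> atomic_diagram L A then 1 else 0)"
    using assms(2) unfolding hyperarithmetical_structure_def hyperarithmetical_set_def turing_le_def by blast
  interpret hyp_reduction L A a0 X0 q by standard (use H in auto)
  obtain l where l: "cf l" "\<exists>M. mdl l M" "\<And>M a xs. mdl l M \<Longrightarrow> set xs \<subseteq> B \<Longrightarrow>
     (prod_encode (0, prod_encode (7, prod_encode (a, list_encode xs))) \<in> M \<longleftrightarrow> fact_holds L A hh a xs)"
    using fact_clauses by blast
  interpret clauses l B "\<lambda>n. fact_holds L A hh (p1 n) (list_decode (p2 n))"
  proof
    show "prod_encode (0, prod_encode (7, n)) \<in> M \<longleftrightarrow> fact_holds L A hh (p1 n) (list_decode (p2 n))"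
      if "mdl l M" "set (list_decode (p2 n)) \<subseteq> B" for M n
      using l(3)[OF that, of "p1 n"] by simp
  qed (use l dec_cnt_image in auto)
  interpret gadget L A hh B valid rk \<beta> "succ_cord \<beta>"
  proof
    show "valid a xs []" for a xs by (simp add: valid_def)
    show "valid a xs s" if "valid a xs (d # s)" for a xs d s using that by (simp add: valid_Cons_iff)
    show "rk a xs [] = (if fact_holds L A hh a xs then succ_cord \<beta> else \<beta>)" if "set xs \<subseteq> B" for a xs
      using root_rank_true[of "prod_encode (a, list_encode xs)"] root_rank_false[of "prod_encode (a, list_encode xs)"] that
      by (simp add: rk_def)
  qed (use str bij_enum rk_less rk_inf in auto)
  \<comment> \<open>Decidability of \<open>W\<close> enters the Scott ranks here:
    \<open>\<beta>\<close> is the type of a segment of \<open>W\<close>, so the shift starts at a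
    computable ordinal.\<close>
  have "\<beta> < omega1CK" unfolding \<beta>_def less_omega1CK_iff by (rule computable_seg[OF Well_order_W dec_W])
  then have "\<beta>2 < omega1CK" unfolding \<beta>2_def by (intro omega1CK_limit(2))
  note SR = SR_star[OF omega1CK_limit Zf_omega1CK[OF this]]
  have "computable_structure lang_star (struct_star B valid)"
    by (rule computable_struct_star[OF str_A' dec_univ_star])
  moreover have "ci_definable_copy L A lang_star (struct_star B valid)"
    by (rule copy_definable[OF Well_order_W dec_W zero_Field_W]) (simp_all add: \<beta>_def)
  ultimately show ?thesis using computable_lang_star SR by blast
qed

end
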